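(* Let $G\rightrightarrows M$ be a Lie groupoid. There is a one-to-one correspondence between $2$-term representations up to homotopy of $G$ (on graded vector bundles $E\oplus C[1]\to M$) and VB-groupoids over $G$ equipped with (right-)horizontal lifts. Explicitly: the map sending a VB-groupoid $\Gamma$ (with side bundle $E$ and core $C$) equipped with a horizontal lift $h$ to the $4$-tuple $(\partial,\Delta^C,\Delta^E,\Omega)$ given by $$\partial c=\tilde t(c),\quad \Delta^C_gc=h_g(\tilde t(c))\cdot c\cdot\tilde 0_{g^{-1}},\quad \Delta^E_ge=\tilde t(h_g(e)),$$ $$\Omega_{g_1,g_2}e=\big(h_{g_1g_2}(e)-h_{g_1}(\Delta^E_{g_2}e)\cdot h_{g_2}(e)\big)\cdot\tilde 0_{(g_1g_2)^{-1}}$$ is well-defined as a map to $2$-term representations up to homotopy, and it is inverted by the semidirect product construction.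
   Context: Lie groupoids: $G\rightrightarrows M$ has source $s$, target $t$, units $1_x$; $g_1g_2$ is defined iff $s(g_1)=t(g_2)$; $G^{(p)}$ is the manifold of composable $p$-tuples. VB-groupoid over $G$: Lie groupoids $\Gamma\rightrightarrows E$ (structure maps $\tilde s,\tilde t,\tilde m,\tilde 1$) and $G\rightrightarrows M$, and vector bundles $\tilde q:\Gamma\to G$ (zero section $\tilde 0$), $q:E\to M$, with $q\tilde s=s\tilde q$, $q\tilde t=t\tilde q$, such that (1) $(\tilde s,s)$ and (2) $(\tilde t,t)$ are vector bundle morphisms, (3) $(\tilde q,q)$ is a Lie groupoid morphism, (4) $(\gamma_1+\gamma_3)(\gamma_2+\gamma_4)=\gamma_1\gamma_2+\gamma_3\gamma_4$ whenever $(\gamma_1,\gamma_2),(\gamma_3,\gamma_4)$ are composable, $\tilde q(\gamma_1)=\tilde q(\gamma_3)$, $\tilde q(\gamma_2)=\tilde q(\gamma_4)$. Core: $C_x=\{c\in\Gamma_{1_x}:\tilde s(c)=0\}$. Horizontal lift: a vector bundle morphism $h:s^*E\to\Gamma$ over $\mathrm{id}_G$, $h_g:E_{s(g)}\to\Gamma_g$, with $\tilde s(h_g(e))=e$, $h_{1_x}(e)=\tilde 1_e$. Then $(c,g,e)\mapsto c\cdot\tilde 0_g+h_g(e)$ is an isomorphism $t^*C\oplus s^*E\cong\Gamma$ of vector bundles over $G$. Representations up to homotopy: $2$-term representations up to homotopy of $G$ on $E\oplus C[1]$ ($E$ in degree $0$, $C$ in degree $1$) are identified with $4$-tuples $(\partial,\Delta^C,\Delta^E,\Omega)$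 where $\partial:C\to E$ is a vector bundle map; $\Delta^C,\Delta^E$ are unital quasi-actions, i.e. smooth assignments of linear maps $\Delta^C_g:C_{s(g)}\to C_{t(g)}$, $\Delta^E_g:E_{s(g)}\to E_{t(g)}$ with $\Delta_{1_x}=\mathrm{id}$; $\Omega$ is a smooth assignment of linear maps $\Omega_{g_1,g_2}:E_{s(g_2)}\to C_{t(g_1)}$, $(g_1,g_2)\in G^{(2)}$, that is normalized (vanishes if some $g_i$ is a unit); and for all composable $g_i$: $\Delta^E_{g_1}\partial=\partial\Delta^C_{g_1}$; $\Delta^C_{g_1}\Delta^C_{g_2}-\Delta^C_{g_1g_2}+\Omega_{g_1,g_2}\partial=0$; $\Delta^E_{g_1}\Delta^E_{g_2}-\Delta^E_{g_1g_2}+\partial\Omega_{g_1,g_2}=0$; $\Delta^C_{g_1}\Omega_{g_2,g_3}-\Omega_{g_1g_2,g_3}+\Omega_{g_1,g_2g_3}-\Omega_{g_1,g_2}\Delta^E_{g_3}=0$. Semidirect product: given such a $4$-tuple, $\Gamma=t^*C\oplus s^*E=\{(c,g,e):c\in C_{t(g)},e\in E_{s(g)}\}$, with $\tilde s(c,g,e)=e$, $\tilde t(c,g,e)=\partial c+\Delta^E_ge$, $(c_1,g_1,e_1)\cdot(c_2,g_2,e_2)=(c_1+\Delta^C_{g_1}c_2-\Omega_{g_1,g_2}e_2,\,g_1g_2,\,e_2)$, units $\tilde 1_e=(0,1_x,e)$, inverse $(c,g,e)^{-1}=(-\Delta^C_{g^{-1}}c+\Omega_{g^{-1},g}e,\,g^{-1},\,\partial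 c+\Delta^E_ge)$, equipped with the horizontal lift $h_g(e)=(0,g,e)$. Here VB-groupoids with horizontal lifts are considered up to the tautological identification: $(\Gamma,h)$ is identified with another such pair via isomorphisms of VB-groupoids covering the identity of $G$, inducing the identity on $E$ and $C$ and matching the horizontal lifts (in particular with $t^*C\oplus s^*E$ via the decomposition determined by $h$). *)

theory Defs
  imports "HOL-Analysis.Analysis"
begin

section \<open>Smooth maps and smooth manifolds\<close>

primrec Ck_on :: "nat \<Rightarrow> 'a::real_normed_vector set \<Rightarrow> ('a \<Rightarrow> 'b::real_normed_vector) \<Rightarrow> bool" where
  "Ck_on 0 S f \<longleftrightarrow> continuous_on S f"
| "Ck_on (Suc k) S f \<longleftrightarrow>
     (\<forall>x\<in>S. f differentiable (at x)) \<and> (\<forall>v. Ck_on k S (\<lambda>x. frechet_derivative f (at x) v))"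

text \<open>
  Smoothness on an arbitrary subset of a Euclidean space means local extendability to a smooth map
  on an open set. On embedded submanifolds (in particular on relatively open subsets of linear
  subspaces) this is the usual notion.
\<close>

definition smooth_in :: "'a::euclidean_space set \<Rightarrow> ('a \<Rightarrow> 'b::euclidean_space) \<Rightarrow> bool" where
  "smooth_in A f \<longleftrightarrow>
     (\<forall>a\<in>A. \<exists>W f'. open W \<and> a \<in> W \<and> (\<forall>k. Ck_on k W f') \<and> (\<forall>x\<in>A \<inter> W. f' x = f x))"

text \<open>
  A type of class \<open>euclidean_space\<close> has positive dimension, so the model space of a chart is
  a linear subspace of the type \<open>'v\<close> rather than the whole type. Thus discrete manifolds (such as
  the unit space of a Lie group) and bundles of rank zero are included; the dimension is a locally
  constant function, as is the rank of a vector bundle below.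
\<close>

record ('p, 'v) mfd =
  mtop :: "'p topology"
  matlas :: "('p set \<times> ('p \<Rightarrow> 'v)) set"

abbreviation mcar :: "('p, 'v) mfd \<Rightarrow> 'p set" where
  "mcar X \<equiv> topspace (mtop X)"

definition models :: "'v::euclidean_space set \<Rightarrow> 'p set \<Rightarrow> ('p \<Rightarrow> 'v) \<Rightarrow> bool" where
  "models L U \<phi> \<longleftrightarrow> subspace L \<and> openin (top_of_set L) (\<phi> ` U)"

definition is_chart :: "'p topology \<Rightarrow> 'p set \<Rightarrow> ('p \<Rightarrow> 'v::euclidean_space) \<Rightarrow> bool" where
  "is_chart T U \<phi> \<longleftrightarrow>
     openin T U \<and> (\<exists>L. models L U \<phi>) \<and>
     homeomorphic_map (subtopology T U) (top_of_set (\<phi> ` U)) \<phi>"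

locale manifold =
  fixes X :: "('p, 'v::euclidean_space) mfd"
  assumes hausdorff: "Hausdorff_space (mtop X)"
    and second_countable: "second_countable (mtop X)"
    and charts: "(U, \<phi>) \<in> matlas X \<Longrightarrow> is_chart (mtop X) U \<phi>"
    and charts_cover: "(\<Union>(U, \<phi>)\<in>matlas X. U) = mcar X"
    and charts_compatible:
      "(U, \<phi>) \<in> matlas X \<Longrightarrow> (V, \<psi>) \<in> matlas X \<Longrightarrow>
        smooth_in (\<phi> ` (U \<inter> V)) (\<psi> \<circ> inv_into U \<phi>)"

text \<open>
  Smoothness of a map defined on a subset \<open>S\<close> of a manifold. It is only used for open subsets and
  for embedded submanifolds such as fibre products inside products.
\<close>

definition smooth_map_on ::
    "('p, 'v::euclidean_space) mfd \<Rightarrow> ('q, 'w::euclidean_space) mfd \<Rightarrow> 'p set \<Rightarrow> ('p \<Rightarrow> 'q) \<Rightarrow> bool" where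
  "smooth_map_on X Y S f \<longleftrightarrow>
     S \<subseteq> mcar X \<and> continuous_map (subtopology (mtop X) S) (mtop Y) f \<and>
     (\<forall>(U, \<phi>)\<in>matlas X. \<forall>(V, \<psi>)\<in>matlas Y.
        smooth_in (\<phi> ` {p \<in> S \<inter> U. f p \<in> V}) (\<psi> \<circ> f \<circ> inv_into U \<phi>))"

abbreviation smooth_map ::
    "('p, 'v::euclidean_space) mfd \<Rightarrow> ('q, 'w::euclidean_space) mfd \<Rightarrow> ('p \<Rightarrow> 'q) \<Rightarrow> bool" where
  "smooth_map X Y f \<equiv> smooth_map_on X Y (mcar X) f"

definition diffeomorphism ::
    "('p, 'v::euclidean_space) mfd \<Rightarrow> ('q, 'w::euclidean_space) mfd \<Rightarrow> ('p \<Rightarrow> 'q) \<Rightarrow> bool" where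
  "diffeomorphism X Y f \<longleftrightarrow>
     bij_betw f (mcar X) (mcar Y) \<and> smooth_map X Y f \<and> smooth_map Y X (inv_into (mcar X) f)"

text \<open>
  The linear map \<open>D\<close> is determined by the coordinate expression of \<open>f\<close> only on the model space
  \<open>L\<close>, where it is the differential of \<open>f\<close> at \<open>p\<close>.
\<close>

definition submersion ::
    "('p, 'v::euclidean_space) mfd \<Rightarrow> ('q, 'w::euclidean_space) mfd \<Rightarrow> ('p \<Rightarrow> 'q) \<Rightarrow> bool" where
  "submersion X Y f \<longleftrightarrow>
     smooth_map X Y f \<and>
     (\<forall>p\<in>mcar X. \<exists>(U, \<phi>)\<in>matlas X. \<exists>(V, \<psi>)\<in>matlas Y. p \<in> U \<and> f p \<in> V \<and>
        (\<exists>L L' D. models L U \<phi> \<and> models L' V \<psi> \<and>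
           ((\<psi> \<circ> f \<circ> inv_into U \<phi>) has_derivative D) (at (\<phi> p) within \<phi> ` {q \<in> U. f q \<in> V}) \<and>
           D ` L = L'))"

definition euclid_mfd :: "('v::euclidean_space, 'v) mfd" where
  "euclid_mfd = \<lparr>mtop = euclidean, matlas = {(UNIV, id)}\<rparr>"

definition prod_mfd :: "('p, 'v) mfd \<Rightarrow> ('q, 'w) mfd \<Rightarrow> ('p \<times> 'q, 'v \<times> 'w) mfd" where
  "prod_mfd X Y =
     \<lparr>mtop = prod_topology (mtop X) (mtop Y),
      matlas = {(U \<times> V, map_prod \<phi> \<psi>) | U \<phi> V \<psi>. (U, \<phi>) \<in> matlas X \<and> (V, \<psi>) \<in> matlas Y}\<rparr>"

text \<open>
  The structure induced on a subset, with its maximal atlas. It is a manifold exactly if \<open>S\<close> is an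
  embedded submanifold.
\<close>

definition sub_mfd :: "('p, 'v::euclidean_space) mfd \<Rightarrow> 'p set \<Rightarrow> ('p, 'v) mfd" where
  "sub_mfd X S =
     \<lparr>mtop = subtopology (mtop X) S,
      matlas = {(U, \<phi>). is_chart (subtopology (mtop X) S) U \<phi> \<and>
                  smooth_map_on X euclid_mfd U \<phi> \<and>
                  smooth_map_on euclid_mfd X (\<phi> ` U) (inv_into U \<phi>)}\<rparr>"


section \<open>Vector bundles\<close>

record ('p, 'v, 'b) vb =
  tot :: "('p, 'v) mfd"
  prj :: "'p \<Rightarrow> 'b"
  vadd :: "'p \<Rightarrow> 'p \<Rightarrow> 'p"
  vscl :: "real \<Rightarrow> 'p \<Rightarrow> 'p"
  vzero :: "'b \<Rightarrow> 'p"

definition fibre :: "('p, 'v, 'b, 'z) vb_scheme \<Rightarrow> 'b \<Rightarrow> 'p set" where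
  "fibre E x = {p \<in> mcar (tot E). prj E p = x}"

definition vsub :: "('p, 'v, 'b, 'z) vb_scheme \<Rightarrow> 'p \<Rightarrow> 'p \<Rightarrow> 'p" where
  "vsub E p q = vadd E p (vscl E (- 1) q)"

text \<open>
  A local trivialization over \<open>U\<close> is given by its second component \<open>\<Phi>\<close>, whose values lie in a
  linear subspace \<open>F\<close> of the model type of the total space.
\<close>

definition trivialization ::
    "('b, 'w::euclidean_space) mfd \<Rightarrow> ('p, 'v::euclidean_space, 'b, 'z) vb_scheme \<Rightarrow>
     'b set \<Rightarrow> 'v set \<Rightarrow> ('p \<Rightarrow> 'v) \<Rightarrow> bool" where
  "trivialization B E U F \<Phi> \<longleftrightarrow>
     openin (mtop B) U \<and> subspace F \<and>
     (\<forall>x\<in>U. bij_betw \<Phi> (fibre E x) F \<and>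
        (\<forall>p\<in>fibre E x. \<forall>q\<in>fibre E x. \<Phi> (vadd E p q) = \<Phi> p + \<Phi> q) \<and>
        (\<forall>a. \<forall>p\<in>fibre E x. \<Phi> (vscl E a p) = a *\<^sub>R \<Phi> p)) \<and>
     smooth_map_on (tot E) euclid_mfd {p \<in> mcar (tot E). prj E p \<in> U} \<Phi> \<and>
     smooth_map_on (prod_mfd B euclid_mfd) (tot E) (U \<times> F) (\<lambda>(x, v). inv_into (fibre E x) \<Phi> v)"

locale vector_bundle =
  fixes B :: "('b, 'w::euclidean_space) mfd"
    and E :: "('p, 'v::euclidean_space, 'b, 'z) vb_scheme"
  assumes base_manifold: "manifold B"
    and total_manifold: "manifold (tot E)"
    and prj_smooth: "smooth_map (tot E) B (prj E)"
    and zero_closed: "x \<in> mcar B \<Longrightarrow> vzero E x \<in> fibre E x"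
    and add_closed: "x \<in> mcar B \<Longrightarrow> p \<in> fibre E x \<Longrightarrow> q \<in> fibre E x \<Longrightarrow> vadd E p q \<in> fibre E x"
    and scale_closed: "x \<in> mcar B \<Longrightarrow> p \<in> fibre E x \<Longrightarrow> vscl E a p \<in> fibre E x"
    and add_assoc: "x \<in> mcar B \<Longrightarrow> p \<in> fibre E x \<Longrightarrow> q \<in> fibre E x \<Longrightarrow> r \<in> fibre E x \<Longrightarrow>
      vadd E (vadd E p q) r = vadd E p (vadd E q r)"
    and add_commute: "x \<in> mcar B \<Longrightarrow> p \<in> fibre E x \<Longrightarrow> q \<in> fibre E x \<Longrightarrow> vadd E p q = vadd E q p"
    and add_zero: "x \<in> mcar B \<Longrightarrow> p \<in> fibre E x \<Longrightarrow> vadd E p (vzero E x) = p"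
    and add_neg: "x \<in> mcar B \<Longrightarrow> p \<in> fibre E x \<Longrightarrow> vsub E p p = vzero E x"
    and scale_add_right: "x \<in> mcar B \<Longrightarrow> p \<in> fibre E x \<Longrightarrow> q \<in> fibre E x \<Longrightarrow>
      vscl E a (vadd E p q) = vadd E (vscl E a p) (vscl E a q)"
    and scale_add_left: "x \<in> mcar B \<Longrightarrow> p \<in> fibre E x \<Longrightarrow>
      vscl E (a + b) p = vadd E (vscl E a p) (vscl E b p)"
    and scale_scale: "x \<in> mcar B \<Longrightarrow> p \<in> fibre E x \<Longrightarrow> vscl E a (vscl E b p) = vscl E (a * b) p"
    and scale_one: "x \<in> mcar B \<Longrightarrow> p \<in> fibre E x \<Longrightarrow> vscl E 1 p = p"
    and locally_trivial: "x \<in> mcar B \<Longrightarrow> \<exists>U F \<Phi>. x \<in> U \<and> trivialization B E U F \<Phi>"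

definition fibre_linear ::
    "('p, 'v, 'b, 'y) vb_scheme \<Rightarrow> 'b \<Rightarrow> ('q, 'w, 'c, 'z) vb_scheme \<Rightarrow> 'c \<Rightarrow> ('p \<Rightarrow> 'q) \<Rightarrow> bool" where
  "fibre_linear E x E' x' f \<longleftrightarrow>
     (\<forall>p\<in>fibre E x. f p \<in> fibre E' x') \<and>
     (\<forall>p\<in>fibre E x. \<forall>q\<in>fibre E x. f (vadd E p q) = vadd E' (f p) (f q)) \<and>
     (\<forall>a. \<forall>p\<in>fibre E x. f (vscl E a p) = vscl E' a (f p))"

definition vb_morphism ::
    "('b, 'bv::euclidean_space) mfd \<Rightarrow> ('p, 'v::euclidean_space, 'b, 'y) vb_scheme \<Rightarrow>
     ('c, 'cv::euclidean_space) mfd \<Rightarrow> ('q, 'w::euclidean_space, 'c, 'z) vb_scheme \<Rightarrow>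
     ('p \<Rightarrow> 'q) \<Rightarrow> ('b \<Rightarrow> 'c) \<Rightarrow> bool" where
  "vb_morphism B E B' E' f f\<^sub>0 \<longleftrightarrow>
     smooth_map B B' f\<^sub>0 \<and> smooth_map (tot E) (tot E') f \<and>
     (\<forall>x\<in>mcar B. fibre_linear E x E' (f\<^sub>0 x) f)"


section \<open>Lie groupoids\<close>

record ('g, 'gv, 'm, 'mv) lgpd =
  arr :: "('g, 'gv) mfd"
  obj :: "('m, 'mv) mfd"
  src :: "'g \<Rightarrow> 'm"
  tgt :: "'g \<Rightarrow> 'm"
  mul :: "'g \<Rightarrow> 'g \<Rightarrow> 'g"
  unt :: "'m \<Rightarrow> 'g"
  ginv :: "'g \<Rightarrow> 'g"

abbreviation Arr :: "('g, 'gv, 'm, 'mv) lgpd \<Rightarrow> 'g set" where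
  "Arr G \<equiv> mcar (arr G)"

abbreviation Obj :: "('g, 'gv, 'm, 'mv) lgpd \<Rightarrow> 'm set" where
  "Obj G \<equiv> mcar (obj G)"

definition composable :: "('g, 'gv, 'm, 'mv) lgpd \<Rightarrow> ('g \<times> 'g) set" where
  "composable G = {(g\<^sub>1, g\<^sub>2). g\<^sub>1 \<in> Arr G \<and> g\<^sub>2 \<in> Arr G \<and> src G g\<^sub>1 = tgt G g\<^sub>2}"

locale lie_groupoid =
  fixes G :: "('g, 'gv::euclidean_space, 'm, 'mv::euclidean_space) lgpd"
  assumes arr_manifold: "manifold (arr G)"
    and obj_manifold: "manifold (obj G)"
    and src_submersion: "submersion (arr G) (obj G) (src G)"
    and tgt_submersion: "submersion (arr G) (obj G) (tgt G)"
    and mul_smooth: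
      "smooth_map_on (prod_mfd (arr G) (arr G)) (arr G) (composable G) (\<lambda>(g\<^sub>1, g\<^sub>2). mul G g\<^sub>1 g\<^sub>2)"
    and unt_smooth: "smooth_map (obj G) (arr G) (unt G)"
    and inv_smooth: "smooth_map (arr G) (arr G) (ginv G)"
    and src_mul: "(g\<^sub>1, g\<^sub>2) \<in> composable G \<Longrightarrow> src G (mul G g\<^sub>1 g\<^sub>2) = src G g\<^sub>2"
    and tgt_mul: "(g\<^sub>1, g\<^sub>2) \<in> composable G \<Longrightarrow> tgt G (mul G g\<^sub>1 g\<^sub>2) = tgt G g\<^sub>1"
    and mul_assoc: "(g\<^sub>1, g\<^sub>2) \<in> composable G \<Longrightarrow> (g\<^sub>2, g\<^sub>3) \<in> composable G \<Longrightarrow>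
      mul G (mul G g\<^sub>1 g\<^sub>2) g\<^sub>3 = mul G g\<^sub>1 (mul G g\<^sub>2 g\<^sub>3)"
    and src_unt: "x \<in> Obj G \<Longrightarrow> src G (unt G x) = x"
    and tgt_unt: "x \<in> Obj G \<Longrightarrow> tgt G (unt G x) = x"
    and mul_unt_left: "g \<in> Arr G \<Longrightarrow> mul G (unt G (tgt G g)) g = g"
    and mul_unt_right: "g \<in> Arr G \<Longrightarrow> mul G g (unt G (src G g)) = g"
    and src_inv: "g \<in> Arr G \<Longrightarrow> src G (ginv G g) = tgt G g"
    and tgt_inv: "g \<in> Arr G \<Longrightarrow> tgt G (ginv G g) = src G g"
    and inv_left: "g \<in> Arr G \<Longrightarrow> mul G (ginv G g) g = unt G (src G g)"
    and inv_right: "g \<in> Arr G \<Longrightarrow> mul G g (ginv G g) = unt G (tgt G g)"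

definition lgpd_morphism ::
    "('k, 'kv::euclidean_space, 'e, 'ev::euclidean_space) lgpd \<Rightarrow>
     ('g, 'gv::euclidean_space, 'm, 'mv::euclidean_space) lgpd \<Rightarrow>
     ('k \<Rightarrow> 'g) \<Rightarrow> ('e \<Rightarrow> 'm) \<Rightarrow> bool" where
  "lgpd_morphism H G f f\<^sub>0 \<longleftrightarrow>
     smooth_map (arr H) (arr G) f \<and> smooth_map (obj H) (obj G) f\<^sub>0 \<and>
     (\<forall>k\<in>Arr H. src G (f k) = f\<^sub>0 (src H k) \<and> tgt G (f k) = f\<^sub>0 (tgt H k)) \<and>
     (\<forall>(k\<^sub>1, k\<^sub>2)\<in>composable H. f (mul H k\<^sub>1 k\<^sub>2) = mul G (f k\<^sub>1) (f k\<^sub>2)) \<and>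
     (\<forall>x\<in>Obj H. f (unt H x) = unt G (f\<^sub>0 x))"


section \<open>VB-groupoids\<close>

record ('k, 'kv, 'g, 'e) vbg = "('k, 'kv, 'g) vb" +
  tsrc :: "'k \<Rightarrow> 'e"
  ttgt :: "'k \<Rightarrow> 'e"
  tmul :: "'k \<Rightarrow> 'k \<Rightarrow> 'k"
  tunt :: "'e \<Rightarrow> 'k"
  tinv :: "'k \<Rightarrow> 'k"

definition total_lgpd ::
    "('e, 'ev, 'm) vb \<Rightarrow> ('k, 'kv, 'g, 'e, 'z) vbg_scheme \<Rightarrow> ('k, 'kv, 'e, 'ev) lgpd" where
  "total_lgpd E \<Gamma> =
     \<lparr>arr = tot \<Gamma>, obj = tot E, src = tsrc \<Gamma>, tgt = ttgt \<Gamma>, mul = tmul \<Gamma>, unt = tunt \<Gamma>,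
      ginv = tinv \<Gamma>\<rparr>"

locale vb_groupoid =
  fixes G :: "('g, 'gv::euclidean_space, 'm, 'mv::euclidean_space) lgpd"
    and E :: "('e, 'ev::euclidean_space, 'm) vb"
    and \<Gamma> :: "('k, 'kv::euclidean_space, 'g, 'e, 'z) vbg_scheme"
  assumes base_groupoid: "lie_groupoid G"
    and total_groupoid: "lie_groupoid (total_lgpd E \<Gamma>)"
    and side_bundle: "vector_bundle (obj G) E"
    and total_bundle: "vector_bundle (arr G) \<Gamma>"
    and src_morphism: "vb_morphism (arr G) \<Gamma> (obj G) E (tsrc \<Gamma>) (src G)"
    and tgt_morphism: "vb_morphism (arr G) \<Gamma> (obj G) E (ttgt \<Gamma>) (tgt G)"
    and prj_morphism: "lgpd_morphism (total_lgpd E \<Gamma>) G (prj \<Gamma>) (prj E)"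
    and interchange:
      "(\<gamma>\<^sub>1, \<gamma>\<^sub>2) \<in> composable (total_lgpd E \<Gamma>) \<Longrightarrow> (\<gamma>\<^sub>3, \<gamma>\<^sub>4) \<in> composable (total_lgpd E \<Gamma>) \<Longrightarrow>
       prj \<Gamma> \<gamma>\<^sub>1 = prj \<Gamma> \<gamma>\<^sub>3 \<Longrightarrow> prj \<Gamma> \<gamma>\<^sub>2 = prj \<Gamma> \<gamma>\<^sub>4 \<Longrightarrow>
       tmul \<Gamma> (vadd \<Gamma> \<gamma>\<^sub>1 \<gamma>\<^sub>3) (vadd \<Gamma> \<gamma>\<^sub>2 \<gamma>\<^sub>4) = vadd \<Gamma> (tmul \<Gamma> \<gamma>\<^sub>1 \<gamma>\<^sub>2) (tmul \<Gamma> \<gamma>\<^sub>3 \<gamma>\<^sub>4)"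

definition core_fibre ::
    "('g, 'gv, 'm, 'mv) lgpd \<Rightarrow> ('e, 'ev, 'm) vb \<Rightarrow> ('k, 'kv, 'g, 'e, 'z) vbg_scheme \<Rightarrow> 'm \<Rightarrow> 'k set" where
  "core_fibre G E \<Gamma> x = {c \<in> fibre \<Gamma> (unt G x). tsrc \<Gamma> c = vzero E x}"

text \<open>
  The vector bundle \<open>C\<close> is fixed in advance, so that \<open>C\<close> being the core of \<open>\<Gamma>\<close> is an
  isomorphism \<open>\<kappa>\<close> of vector bundles from \<open>C\<close> onto the core of \<open>\<Gamma>\<close>, the latter being a
  submanifold of \<open>\<Gamma>\<close>. If \<open>C\<close> is the core itself, \<open>\<kappa>\<close> is the inclusion.
\<close>

definition core_identification ::
    "('g, 'gv::euclidean_space, 'm, 'mv::euclidean_space) lgpd \<Rightarrow> ('e, 'ev::euclidean_space, 'm) vb \<Rightarrow>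
     ('c, 'cv::euclidean_space, 'm) vb \<Rightarrow> ('k, 'kv::euclidean_space, 'g, 'e, 'z) vbg_scheme \<Rightarrow>
     ('c \<Rightarrow> 'k) \<Rightarrow> bool" where
  "core_identification G E C \<Gamma> \<kappa> \<longleftrightarrow>
     vb_morphism (obj G) C (arr G) \<Gamma> \<kappa> (unt G) \<and>
     (\<forall>x\<in>Obj G. bij_betw \<kappa> (fibre C x) (core_fibre G E \<Gamma> x)) \<and>
     smooth_map_on (tot \<Gamma>) (tot C) (\<Union>x\<in>Obj G. core_fibre G E \<Gamma> x) (inv_into (mcar (tot C)) \<kappa>)"

definition horizontal_lift ::
    "('g, 'gv::euclidean_space, 'm, 'mv::euclidean_space) lgpd \<Rightarrow> ('e, 'ev::euclidean_space, 'm) vb \<Rightarrow>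
     ('k, 'kv::euclidean_space, 'g, 'e, 'z) vbg_scheme \<Rightarrow> ('g \<Rightarrow> 'e \<Rightarrow> 'k) \<Rightarrow> bool" where
  "horizontal_lift G E \<Gamma> h \<longleftrightarrow>
     smooth_map_on (prod_mfd (arr G) (tot E)) (tot \<Gamma>)
       {(g, e). g \<in> Arr G \<and> e \<in> fibre E (src G g)} (\<lambda>(g, e). h g e) \<and>
     (\<forall>g\<in>Arr G. fibre_linear E (src G g) \<Gamma> g (h g)) \<and>
     (\<forall>g\<in>Arr G. \<forall>e\<in>fibre E (src G g). tsrc \<Gamma> (h g e) = e) \<and>
     (\<forall>x\<in>Obj G. \<forall>e\<in>fibre E x. h (unt G x) e = tunt \<Gamma> e)"

record ('k, 'kv, 'g, 'e, 'c) vbgh = "('k, 'kv, 'g, 'e) vbg" +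
  cemb :: "'c \<Rightarrow> 'k"
  hlift :: "'g \<Rightarrow> 'e \<Rightarrow> 'k"

definition vb_groupoid_hl ::
    "('g, 'gv::euclidean_space, 'm, 'mv::euclidean_space) lgpd \<Rightarrow> ('e, 'ev::euclidean_space, 'm) vb \<Rightarrow>
     ('c, 'cv::euclidean_space, 'm) vb \<Rightarrow> ('k, 'kv::euclidean_space, 'g, 'e, 'c) vbgh \<Rightarrow> bool" where
  "vb_groupoid_hl G E C \<Gamma> \<longleftrightarrow>
     vb_groupoid G E \<Gamma> \<and> vector_bundle (obj G) C \<and>
     core_identification G E C \<Gamma> (cemb \<Gamma>) \<and> horizontal_lift G E \<Gamma> (hlift \<Gamma>)"

text \<open>
  Isomorphisms of VB-groupoids covering the identity of \<open>G\<close>, inducing the identity on \<open>E\<close> and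
  on \<open>C\<close> and matching the horizontal lifts.
\<close>

definition vbgh_iso ::
    "('g, 'gv::euclidean_space, 'm, 'mv::euclidean_space) lgpd \<Rightarrow> ('e, 'ev::euclidean_space, 'm) vb \<Rightarrow>
     ('c, 'cv::euclidean_space, 'm) vb \<Rightarrow> ('k, 'kv::euclidean_space, 'g, 'e, 'c) vbgh \<Rightarrow>
     ('l, 'lv::euclidean_space, 'g, 'e, 'c) vbgh \<Rightarrow> ('k \<Rightarrow> 'l) \<Rightarrow> bool" where
  "vbgh_iso G E C \<Gamma> \<Gamma>' f \<longleftrightarrow>
     diffeomorphism (tot \<Gamma>) (tot \<Gamma>') f \<and>
     vb_morphism (arr G) \<Gamma> (arr G) \<Gamma>' f id \<and>
     lgpd_morphism (total_lgpd E \<Gamma>) (total_lgpd E \<Gamma>') f id \<and>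
     (\<forall>c\<in>mcar (tot C). f (cemb \<Gamma> c) = cemb \<Gamma>' c) \<and>
     (\<forall>g\<in>Arr G. \<forall>e\<in>fibre E (src G g). f (hlift \<Gamma> g e) = hlift \<Gamma>' g e)"

definition VBGH ::
    "('g, 'gv::euclidean_space, 'm, 'mv::euclidean_space) lgpd \<Rightarrow> ('e, 'ev::euclidean_space, 'm) vb \<Rightarrow>
     ('c, 'cv::euclidean_space, 'm) vb \<Rightarrow> ('k, 'kv::euclidean_space, 'g, 'e, 'c) vbgh set" where
  "VBGH G E C = {\<Gamma>. vb_groupoid_hl G E C \<Gamma>}"

definition vbgh_iso_rel ::
    "('g, 'gv::euclidean_space, 'm, 'mv::euclidean_space) lgpd \<Rightarrow> ('e, 'ev::euclidean_space, 'm) vb \<Rightarrow>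
     ('c, 'cv::euclidean_space, 'm) vb \<Rightarrow> ('k, 'kv::euclidean_space, 'g, 'e, 'c) vbgh rel" where
  "vbgh_iso_rel G E C =
     {(\<Gamma>, \<Gamma>'). \<Gamma> \<in> VBGH G E C \<and> \<Gamma>' \<in> VBGH G E C \<and> (\<exists>f. vbgh_iso G E C \<Gamma> \<Gamma>' f)}"

text \<open>The map \<open>t\<^sup>*C \<oplus> s\<^sup>*E \<rightarrow> \<Gamma>\<close> determined by the horizontal lift.\<close>

definition decomposition :: "('k, 'kv, 'g, 'e, 'c) vbgh \<Rightarrow> 'c \<times> 'g \<times> 'e \<Rightarrow> 'k" where
  "decomposition \<Gamma> = (\<lambda>(c, g, e). vadd \<Gamma> (tmul \<Gamma> (cemb \<Gamma> c) (vzero \<Gamma> g)) (hlift \<Gamma> g e))"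


section \<open>Representations up to homotopy\<close>

record ('c, 'g, 'e) rep2 =
  bd :: "'c \<Rightarrow> 'e"
  dC :: "'g \<Rightarrow> 'c \<Rightarrow> 'c"
  dE :: "'g \<Rightarrow> 'e \<Rightarrow> 'e"
  Om :: "'g \<Rightarrow> 'g \<Rightarrow> 'e \<Rightarrow> 'c"

definition quasi_action ::
    "('g, 'gv::euclidean_space, 'm, 'mv::euclidean_space) lgpd \<Rightarrow> ('e, 'ev::euclidean_space, 'm) vb \<Rightarrow>
     ('g \<Rightarrow> 'e \<Rightarrow> 'e) \<Rightarrow> bool" where
  "quasi_action G E \<Delta> \<longleftrightarrow>
     (\<forall>g\<in>Arr G. fibre_linear E (src G g) E (tgt G g) (\<Delta> g)) \<and>
     smooth_map_on (prod_mfd (arr G) (tot E)) (tot E)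
       {(g, e). g \<in> Arr G \<and> e \<in> fibre E (src G g)} (\<lambda>(g, e). \<Delta> g e)"

definition unital ::
    "('g, 'gv, 'm, 'mv) lgpd \<Rightarrow> ('e, 'ev, 'm) vb \<Rightarrow> ('g \<Rightarrow> 'e \<Rightarrow> 'e) \<Rightarrow> bool" where
  "unital G E \<Delta> \<longleftrightarrow> (\<forall>x\<in>Obj G. \<forall>e\<in>fibre E x. \<Delta> (unt G x) e = e)"

text \<open>
  The last assumption makes the components of a 4-tuple take the value \<open>undefined\<close> off their
  domains, so that two 4-tuples are equal iff they agree where they are meaningful.
\<close>

locale rep_up_to_homotopy =
  fixes G :: "('g, 'gv::euclidean_space, 'm, 'mv::euclidean_space) lgpd"
    and E :: "('e, 'ev::euclidean_space, 'm) vb"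
    and C :: "('c, 'cv::euclidean_space, 'm) vb"
    and R :: "('c, 'g, 'e) rep2"
  assumes base_groupoid: "lie_groupoid G"
    and E_bundle: "vector_bundle (obj G) E"
    and C_bundle: "vector_bundle (obj G) C"
    and bd_morphism: "vb_morphism (obj G) C (obj G) E (bd R) id"
    and dC_quasi_action: "quasi_action G C (dC R)"
    and dC_unital: "unital G C (dC R)"
    and dE_quasi_action: "quasi_action G E (dE R)"
    and dE_unital: "unital G E (dE R)"
    and Om_linear: "(g\<^sub>1, g\<^sub>2) \<in> composable G \<Longrightarrow>
      fibre_linear E (src G g\<^sub>2) C (tgt G g\<^sub>1) (Om R g\<^sub>1 g\<^sub>2)"
    and Om_smooth: "smooth_map_on (prod_mfd (prod_mfd (arr G) (arr G)) (tot E)) (tot C)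
      {((g\<^sub>1, g\<^sub>2), e). (g\<^sub>1, g\<^sub>2) \<in> composable G \<and> e \<in> fibre E (src G g\<^sub>2)}
      (\<lambda>((g\<^sub>1, g\<^sub>2), e). Om R g\<^sub>1 g\<^sub>2 e)"
    and Om_normalized: "(g\<^sub>1, g\<^sub>2) \<in> composable G \<Longrightarrow> g\<^sub>1 \<in> unt G ` Obj G \<or> g\<^sub>2 \<in> unt G ` Obj G \<Longrightarrow>
      e \<in> fibre E (src G g\<^sub>2) \<Longrightarrow> Om R g\<^sub>1 g\<^sub>2 e = vzero C (tgt G g\<^sub>1)"
    and dE_bd: "g \<in> Arr G \<Longrightarrow> c \<in> fibre C (src G g) \<Longrightarrow> dE R g (bd R c) = bd R (dC R g c)"
    and dC_dC: "(g\<^sub>1, g\<^sub>2) \<in> composable G \<Longrightarrow> c \<in> fibre C (src G g\<^sub>2) \<Longrightarrow>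
      vadd C (vsub C (dC R g\<^sub>1 (dC R g\<^sub>2 c)) (dC R (mul G g\<^sub>1 g\<^sub>2) c)) (Om R g\<^sub>1 g\<^sub>2 (bd R c))
        = vzero C (tgt G g\<^sub>1)"
    and dE_dE: "(g\<^sub>1, g\<^sub>2) \<in> composable G \<Longrightarrow> e \<in> fibre E (src G g\<^sub>2) \<Longrightarrow>
      vadd E (vsub E (dE R g\<^sub>1 (dE R g\<^sub>2 e)) (dE R (mul G g\<^sub>1 g\<^sub>2) e)) (bd R (Om R g\<^sub>1 g\<^sub>2 e))
        = vzero E (tgt G g\<^sub>1)"
    and Om_cocycle: "(g\<^sub>1, g\<^sub>2) \<in> composable G \<Longrightarrow> (g\<^sub>2, g\<^sub>3) \<in> composable G \<Longrightarrow>
      e \<in> fibre E (src G g\<^sub>3) \<Longrightarrow>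
      vsub C (vadd C (vsub C (dC R g\<^sub>1 (Om R g\<^sub>2 g\<^sub>3 e)) (Om R (mul G g\<^sub>1 g\<^sub>2) g\<^sub>3 e))
          (Om R g\<^sub>1 (mul G g\<^sub>2 g\<^sub>3) e))
        (Om R g\<^sub>1 g\<^sub>2 (dE R g\<^sub>3 e)) = vzero C (tgt G g\<^sub>1)"
    and off_domain:
      "c \<notin> mcar (tot C) \<Longrightarrow> bd R c = undefined"
      "\<not> (g \<in> Arr G \<and> c \<in> fibre C (src G g)) \<Longrightarrow> dC R g c = undefined"
      "\<not> (g \<in> Arr G \<and> e \<in> fibre E (src G g)) \<Longrightarrow> dE R g e = undefined"
      "\<not> ((g\<^sub>1, g\<^sub>2) \<in> composable G \<and> e \<in> fibre E (src G g\<^sub>2)) \<Longrightarrow> Om R g\<^sub>1 g\<^sub>2 e = undefined"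

definition RUTH ::
    "('g, 'gv::euclidean_space, 'm, 'mv::euclidean_space) lgpd \<Rightarrow> ('e, 'ev::euclidean_space, 'm) vb \<Rightarrow>
     ('c, 'cv::euclidean_space, 'm) vb \<Rightarrow> ('c, 'g, 'e) rep2 set" where
  "RUTH G E C = {R. rep_up_to_homotopy G E C R}"


section \<open>From VB-groupoids to representations up to homotopy and back\<close>

text \<open>
  The expressions for \<open>\<Delta>\<^sup>C\<close> and \<open>\<Omega>\<close> in \<open>\<Gamma>\<close> take values in the core;
  \<open>inv_into (mcar (tot C)) (cemb \<Gamma>)\<close> turns them into elements of \<open>C\<close>.
\<close>

definition to_rep2 ::
    "('g, 'gv, 'm, 'mv) lgpd \<Rightarrow> ('e, 'ev, 'm) vb \<Rightarrow> ('c, 'cv, 'm) vb \<Rightarrow>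
     ('k, 'kv, 'g, 'e, 'c) vbgh \<Rightarrow> ('c, 'g, 'e) rep2" where
  "to_rep2 G E C \<Gamma> =
    (let core = inv_into (mcar (tot C)) (cemb \<Gamma>);
         \<Delta>E = (\<lambda>g e. ttgt \<Gamma> (hlift \<Gamma> g e))
     in \<lparr>bd = (\<lambda>c. if c \<in> mcar (tot C) then ttgt \<Gamma> (cemb \<Gamma> c) else undefined),
         dC = (\<lambda>g c. if g \<in> Arr G \<and> c \<in> fibre C (src G g)
                 then core (tmul \<Gamma> (tmul \<Gamma> (hlift \<Gamma> g (ttgt \<Gamma> (cemb \<Gamma> c))) (cemb \<Gamma> c))
                                  (vzero \<Gamma> (ginv G g)))
                 else undefined),
         dE = (\<lambda>g e. if g \<in> Arr G \<and> e \<in> fibre E (src G g) then \<Delta>E g e else undefined),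
         Om = (\<lambda>g\<^sub>1 g\<^sub>2 e. if (g\<^sub>1, g\<^sub>2) \<in> composable G \<and> e \<in> fibre E (src G g\<^sub>2)
                 then core (tmul \<Gamma>
                   (vsub \<Gamma> (hlift \<Gamma> (mul G g\<^sub>1 g\<^sub>2) e) (tmul \<Gamma> (hlift \<Gamma> g\<^sub>1 (\<Delta>E g\<^sub>2 e)) (hlift \<Gamma> g\<^sub>2 e)))
                   (vzero \<Gamma> (ginv G (mul G g\<^sub>1 g\<^sub>2))))
                 else undefined)\<rparr>)"

text \<open>The total space is \<open>t\<^sup>*C \<oplus> s\<^sup>*E\<close>, a submanifold of \<open>C \<times> G \<times> E\<close>.\<close>

definition semidirect ::
    "('g, 'gv::euclidean_space, 'm, 'mv::euclidean_space) lgpd \<Rightarrow> ('e, 'ev::euclidean_space, 'm) vb \<Rightarrow>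
     ('c, 'cv::euclidean_space, 'm) vb \<Rightarrow> ('c, 'g, 'e) rep2 \<Rightarrow>
     ('c \<times> 'g \<times> 'e, 'cv \<times> 'gv \<times> 'ev, 'g, 'e, 'c) vbgh" where
  "semidirect G E C R =
     \<lparr>tot = sub_mfd (prod_mfd (tot C) (prod_mfd (arr G) (tot E)))
              {(c, g, e). g \<in> Arr G \<and> c \<in> fibre C (tgt G g) \<and> e \<in> fibre E (src G g)},
      prj = (\<lambda>(c, g, e). g),
      vadd = (\<lambda>(c\<^sub>1, g, e\<^sub>1) (c\<^sub>2, _, e\<^sub>2). (vadd C c\<^sub>1 c\<^sub>2, g, vadd E e\<^sub>1 e\<^sub>2)),
      vscl = (\<lambda>a (c, g, e). (vscl C a c, g, vscl E a e)),
      vzero = (\<lambda>g. (vzero C (tgt G g), g, vzero E (src G g))),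
      tsrc = (\<lambda>(c, g, e). e),
      ttgt = (\<lambda>(c, g, e). vadd E (bd R c) (dE R g e)),
      tmul = (\<lambda>(c\<^sub>1, g\<^sub>1, e\<^sub>1) (c\<^sub>2, g\<^sub>2, e\<^sub>2).
                (vsub C (vadd C c\<^sub>1 (dC R g\<^sub>1 c\<^sub>2)) (Om R g\<^sub>1 g\<^sub>2 e\<^sub>2), mul G g\<^sub>1 g\<^sub>2, e\<^sub>2)),
      tunt = (\<lambda>e. (vzero C (prj E e), unt G (prj E e), e)),
      tinv = (\<lambda>(c, g, e).
                (vadd C (vscl C (- 1) (dC R (ginv G g) c)) (Om R (ginv G g) g e), ginv G g,
                 vadd E (bd R c) (dE R g e))),
      cemb = (\<lambda>c. (c, unt G (prj C c), vzero E (prj C c))),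
      hlift = (\<lambda>g e. (vzero C (tgt G g), g, e))\<rparr>"

end

theory Submission
  imports Defs
begin

text \<open>
  A horizontal lift \<open>h\<close> writes every \<open>\<gamma> \<in> \<Gamma>\<close> over \<open>g\<close> uniquely as \<open>c \<cdot> 0\<^sub>g + h\<^sub>g(e)\<close>, with
  \<open>e\<close> the source of \<open>\<gamma>\<close> and \<open>c = (\<gamma> - h\<^sub>g(e)) \<cdot> 0\<close> over the inverse of \<open>g\<close>. By the interchange
  law the multiplication of \<open>\<Gamma>\<close> becomes, in these terms, that of the semidirect product. The
  equations of a representation up to homotopy then say that the target is invariant under
  multiplication from the right and that the multiplication is associative. Linearity over the reals,
  as opposed to additivity, comes from continuity.

  Conversely, the groupoid axioms of the semidirect product are identities in the fibres. Its source
  map is a submersion because curves can be lifted along it to first order, which characterizes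
  submersions without the implicit function theorem.
\<close>

section \<open>Functions of class \<open>C\<^sup>k\<close>\<close>

text \<open>No tangent spaces are available, and the induced atlas on the total space of the
  semidirect product consists of all compatible charts, so a differential is awkward to compute
  there. Two curves that agree to first order at time 0 take the place of a tangent vector. The
  target of the semidirect product is its source after the inversion, so that one explicit lifting
  argument serves both maps.

  Fibres are bare sets with operations; equations between their elements are decided after a linear
  injection into a Euclidean space. Equations between elements of \<open>C\<close> are decided in
  \<open>\<Gamma>\<close>, after the injective right translation \<open>kz\<close> by a zero vector.
  Undoing this translation is what the factors \<open>0\<close> over inverse arrows in the formulas
  for \<open>\<Delta>\<^sup>C\<close> and \<open>\<Omega>\<close> achieve.

  Associativity enters through a single identity in the core, of which the equations for
  \<open>\<Delta>\<^sup>C\<close> and for \<open>\<Omega>\<close> are two specializations. The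
  bijection is one between 4-tuples and isomorphism classes, and rests on the fact that
  \<open>\<Gamma>\<close> is isomorphic to the semidirect product of its own 4-tuple, so that the
  4-tuple is a complete invariant.\<close>

lemma Ck_on_subset: "Ck_on k S f \<Longrightarrow> T \<subseteq> S \<Longrightarrow> Ck_on k T f"
proof (induction k arbitrary: f)
  case 0
  then show ?case by (auto intro: continuous_on_subset)
qed auto

text \<open>On an open set the derivative at a point depends only on nearby values inside the set,
  so the recursion defining \<open>Ck_on\<close> passes from \<open>f\<close> to \<open>g\<close> at
  every order.\<close>

lemma Ck_on_cong_imp:
  assumes "open S" "\<And>x. x \<in> S \<Longrightarrow> f x = g x" "Ck_on k S f"
  shows "Ck_on k S g"
  using assms(2,3)
proof (induction k arbitrary: f g)
  case 0
  then show ?case by (metis Ck_on.simps(1) continuous_on_cong)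
next
  case (Suc k)
  have d: "g differentiable (at x)" if "x \<in> S" for x
  proof -
    have "(f has_derivative frechet_derivative f (at x)) (at x)"
      using Suc.prems(2) that by (simp add: frechet_derivative_works)
    then have "(g has_derivative frechet_derivative f (at x)) (at x)"
      using assms(1) that Suc.prems(1) by (rule has_derivative_transform_within_open)
    then show ?thesis by (auto simp: differentiable_def)
  qed
  have e: "frechet_derivative f (at x) = frechet_derivative g (at x)" if "x \<in> S" for x
    using Suc.prems that assms(1) by (intro frechet_derivative_transform_within_open) auto
  have "Ck_on k S (\<lambda>x. frechet_derivative g (at x) v)" for v
    by (rule Suc.IH[of "\<lambda>x. frechet_derivative f (at x) v"]) (use Suc.prems(2) e in auto)
  with d show ?case by simp
qed

text \<open>\<open>frechet_derivative\<close> is defined by choice. Uniqueness of derivatives allows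
  any explicit formula \<open>f'\<close> in its place, which is how all the closure rules below
  proceed.\<close>

lemma Ck_on_SucI:
  assumes "open S" "\<And>x. x \<in> S \<Longrightarrow> (f has_derivative f' x) (at x)"
    and "\<And>v. Ck_on k S (\<lambda>x. f' x v)"
  shows "Ck_on (Suc k) S f"
proof -
  have "Ck_on k S (\<lambda>x. frechet_derivative f (at x) v)" for v
    by (rule Ck_on_cong_imp[OF assms(1) _ assms(3)[of v]]) (simp add: frechet_derivative_at[OF assms(2), symmetric])
  with assms(2) show ?thesis
    by (auto intro: differentiableI)
qed

lemma Ck_on_SucD:
  assumes "Ck_on (Suc k) S f"
  shows "\<And>x. x \<in> S \<Longrightarrow> (f has_derivative frechet_derivative f (at x)) (at x)"
    and "\<And>v. Ck_on k S (\<lambda>x. frechet_derivative f (at x) v)"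
  proof -
  fix x assume "x \<in> S"
  then show "(f has_derivative frechet_derivative f (at x)) (at x)"
    using assms iffD1[OF frechet_derivative_works, of f "at x"] by simp
next
  show "Ck_on k S (\<lambda>x. frechet_derivative f (at x) v)" for v
    using assms by simp
qed

lemma Ck_on_Suc_imp: "Ck_on (Suc k) S f \<Longrightarrow> Ck_on k S f"
proof (induction k arbitrary: f)
  case 0
  then show ?case
    by (auto intro!: continuous_at_imp_continuous_on differentiable_imp_continuous_within)
next
  case (Suc k)
  have "\<forall>x\<in>S. f differentiable at x"
    using Suc.prems by simp
  moreover have "Ck_on k S (\<lambda>x. frechet_derivative f (at x) v)" for v
    by (rule Suc.IH) (use Suc.prems in \<open>subst (asm) (1) Ck_on.simps, blast\<close>)
  ultimately show ?case by simp
qed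

lemma Ck_on_const: "open S \<Longrightarrow> Ck_on k S (\<lambda>x. c)"
proof (induction k arbitrary: c)
  case (Suc k)
  show ?case
    by (rule Ck_on_SucI[where f' = "\<lambda>x v. 0"]) (auto intro: Suc)
qed simp

lemma Ck_on_linear:
  assumes "open S" "bounded_linear f"
  shows "Ck_on k S f"
proof (cases k)
  case 0
  then show ?thesis
    using assms linear_continuous_on by auto
next
  case (Suc n)
  then show ?thesis
    using Ck_on_SucI[where f = f and f' = "\<lambda>x. f", OF assms(1) bounded_linear_imp_has_derivative[OF assms(2)]
        Ck_on_const[OF assms(1)]] by blast
qed

lemma Ck_on_linear_compose:
  assumes "open S" "bounded_linear L" "Ck_on k S f"
  shows "Ck_on k S (\<lambda>x. L (f x))"
  using assms(3)
proof (induction k arbitrary: f)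
  case 0
  then show ?case
    using assms(2) by (auto intro: bounded_linear.continuous_on)
next
  case (Suc k)
  show ?case
    by (rule Ck_on_SucI[where f' = "\<lambda>x v. L (frechet_derivative f (at x) v)"])
      (auto intro!: assms(1) bounded_linear.has_derivative[OF assms(2)] Suc.IH Ck_on_SucD[OF Suc.prems])
qed

lemma Ck_on_add:
  assumes "open S" "Ck_on k S f" "Ck_on k S g"
  shows "Ck_on k S (\<lambda>x. f x + g x)"
  using assms(2,3)
proof (induction k arbitrary: f g)
  case 0
  then show ?case by (auto intro: continuous_on_add)
next
  case (Suc k)
  show ?case
    by (rule Ck_on_SucI[where f' = "\<lambda>x v. frechet_derivative f (at x) v + frechet_derivative g (at x) v"])
      (intro assms(1) has_derivative_add Suc.IH Ck_on_SucD[OF Suc.prems(1)] Ck_on_SucD[OF Suc.prems(2)] | assumption)+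
qed

lemma Ck_on_sum:
  assumes "open S" "\<And>i. i \<in> I \<Longrightarrow> Ck_on k S (f i)"
  shows "Ck_on k S (\<lambda>x. \<Sum>i\<in>I. f i x)"
  using assms(2)
  by (induction I rule: infinite_finite_induct) (auto intro!: Ck_on_add assms(1) Ck_on_const)

lemma Ck_on_bilinear:
  assumes "open S" "bounded_bilinear b" "Ck_on k S f" "Ck_on k S g"
  shows "Ck_on k S (\<lambda>x. b (f x) (g x))"
  using assms(3,4)
proof (induction k arbitrary: f g)
  case 0
  then show ?case
    using assms(2) by (auto intro: bounded_bilinear.continuous_on)
next
  case (Suc k)
  show ?case
    by (rule Ck_on_SucI[where f' = "\<lambda>x v. b (f x) (frechet_derivative g (at x) v) +
          b (frechet_derivative f (at x) v) (g x)"])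
      (intro assms(1) bounded_bilinear.FDERIV[OF assms(2)] Suc.IH Ck_on_add
          Ck_on_SucD[OF Suc.prems(1)] Ck_on_SucD[OF Suc.prems(2)]
          Ck_on_Suc_imp[OF Suc.prems(1)] Ck_on_Suc_imp[OF Suc.prems(2)] | assumption)+
qed

lemma Ck_on_Pair:
  assumes "open S" "Ck_on k S f" "Ck_on k S g"
  shows "Ck_on k S (\<lambda>x. (f x, g x))"
  using assms(2,3)
proof (induction k arbitrary: f g)
  case 0
  then show ?case by (auto intro: continuous_on_Pair)
next
  case (Suc k)
  show ?case
    by (rule Ck_on_SucI[where f' = "\<lambda>x v. (frechet_derivative f (at x) v, frechet_derivative g (at x) v)"])
      (intro assms(1) has_derivative_Pair Suc.IH Ck_on_SucD[OF Suc.prems(1)] Ck_on_SucD[OF Suc.prems(2)] | assumption)+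
qed

text \<open>The chain rule yields \<open>g' (f x) (f' x v)\<close>, in which the direction varies
  with \<open>x\<close>, whereas \<open>Ck_on\<close> only controls derivatives in a fixed
  direction. Expanding the direction in the basis of the Euclidean space in the middle gives a
  finite sum of products, and the induction hypothesis applies to the derivative of \<open>g\<close>
  along each basis vector.\<close>

lemma Ck_on_compose:
  fixes f :: "'a::real_normed_vector \<Rightarrow> 'b::euclidean_space"
  assumes "open S" "open T" "f ` S \<subseteq> T" "Ck_on k S f" "Ck_on k T g"
  shows "Ck_on k S (\<lambda>x. g (f x))"
  using assms(4,5)
proof (induction k arbitrary: g)
  case 0
  then show ?case
    using assms(3) by (auto intro: continuous_on_compose2)
next
  case (Suc k)
  define g' where "g' = (\<lambda>x. frechet_derivative g (at x))"
  define f' where "f' = (\<lambda>x. frechet_derivative f (at x))"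
  have lin: "linear (g' y)" if "y \<in> T" for y
    using Suc.prems(2) that by (auto simp: g'_def intro: linear_frechet_derivative)
  have eq: "g' (f x) (f' x v) = (\<Sum>i\<in>Basis. (f' x v \<bullet> i) *\<^sub>R g' (f x) i)" if "x \<in> S" for x v
  proof -
    have "g' (f x) (f' x v) = g' (f x) (\<Sum>i\<in>Basis. (f' x v \<bullet> i) *\<^sub>R i)"
      by (simp add: euclidean_representation)
    also have "\<dots> = (\<Sum>i\<in>Basis. (f' x v \<bullet> i) *\<^sub>R g' (f x) i)"
      using lin[of "f x"] assms(3) that by (subst linear_sum) (auto simp: linear_scale)
    finally show ?thesis .
  qed
  have der: "((\<lambda>x. g (f x)) has_derivative (\<lambda>v. g' (f x) (f' x v))) (at x)" if "x \<in> S" for x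
    using has_derivative_compose[OF Ck_on_SucD(1)[OF Suc.prems(1) that], of g "g' (f x)"]
      Ck_on_SucD(1)[OF Suc.prems(2), of "f x"] assms(3) that by (auto simp: g'_def f'_def)
  have "Ck_on k S (\<lambda>x. g' (f x) i)" for i
    using Suc.prems by (intro Suc.IH Ck_on_Suc_imp[OF Suc.prems(1)]) (auto simp: g'_def)
  moreover have "Ck_on k S (\<lambda>x. f' x v \<bullet> i)" for v i
    using Suc.prems(1) assms(1)
    by (intro Ck_on_linear_compose[where L = "\<lambda>x. x \<bullet> i"]) (auto simp: f'_def bounded_linear_inner_left)
  ultimately have sm: "Ck_on k S (\<lambda>x. \<Sum>i\<in>Basis. (f' x v \<bullet> i) *\<^sub>R g' (f x) i)" for v
    by (intro Ck_on_sum Ck_on_bilinear[of S scaleR] assms(1) bounded_bilinear_scaleR)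
  have "Ck_on k S (\<lambda>x. g' (f x) (f' x v))" for v
    by (rule Ck_on_cong_imp[OF assms(1) _ sm[of v]]) (simp add: eq)
  from Ck_on_SucI[OF assms(1) der this] show ?case .
qed

section \<open>Smooth functions on arbitrary subsets\<close>

lemma smooth_inE:
  assumes "smooth_in A f" "a \<in> A"
  obtains W f' where "open W" "a \<in> W" "\<forall>k. Ck_on k W f'" "\<forall>x\<in>A \<inter> W. f' x = f x"
proof -
  from assms have "\<exists>W f'. open W \<and> a \<in> W \<and> (\<forall>k. Ck_on k W f') \<and> (\<forall>x\<in>A \<inter> W. f' x = f x)"
    by (simp add: smooth_in_def)
  then obtain W f' where W: "open W" "a \<in> W" "\<forall>k. Ck_on k W f'" "\<forall>x\<in>A \<inter> W. f' x = f x"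
    by (elim exE conjE)
  show thesis
    by (rule that[OF W])
qed

lemma smooth_inI:
  assumes "\<And>a. a \<in> A \<Longrightarrow> \<exists>W f'. open W \<and> a \<in> W \<and> (\<forall>k. Ck_on k W f') \<and> (\<forall>x\<in>A \<inter> W. f' x = f x)"
  shows "smooth_in A f"
  using assms by (simp add: smooth_in_def)

lemma smooth_in_subset: "smooth_in A f \<Longrightarrow> B \<subseteq> A \<Longrightarrow> smooth_in B f"
proof (rule smooth_inI)
  fix a assume f: "smooth_in A f" and B: "B \<subseteq> A" "a \<in> B"
  from B have "a \<in> A" by blast
  from smooth_inE[OF f this] obtain W f' where W: "open W" "a \<in> W" "\<forall>k. Ck_on k W f'" "\<forall>x\<in>A \<inter> W. f' x = f x" .
  with B show "\<exists>W f'. open W \<and> a \<in> W \<and> (\<forall>k. Ck_on k W f') \<and> (\<forall>x\<in>B \<inter> W. f' x = f x)"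
    by (intro exI[of _ W] exI[of _ f']) auto
qed

lemma smooth_in_cong: "(\<And>x. x \<in> A \<Longrightarrow> f x = g x) \<Longrightarrow> smooth_in A f \<longleftrightarrow> smooth_in A g"
  unfolding smooth_in_def by simp

text \<open>Extensions are only demanded near each point, so one found for
  \<open>A \<inter> N\<close> serves \<open>A\<close> once its domain is cut down to
  \<open>N\<close>.\<close>

lemma smooth_in_local:
  assumes "\<And>a. a \<in> A \<Longrightarrow> \<exists>N. open N \<and> a \<in> N \<and> smooth_in (A \<inter> N) f"
  shows "smooth_in A f"
proof (rule smooth_inI)
  fix a assume a: "a \<in> A"
  then obtain N where N: "open N" "a \<in> N" "smooth_in (A \<inter> N) f"
    using assms by blast
  from N(3) IntI[OF a N(2)] obtain W f' where W: "open W" "a \<in> W" "\<forall>k. Ck_on k W f'" "\<forall>x\<in>A \<inter> N \<inter> W. f' x = f x"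
    by (rule smooth_inE)
  have "Ck_on k (W \<inter> N) f'" for k
    using W(3) Ck_on_subset by blast
  then show "\<exists>W f'. open W \<and> a \<in> W \<and> (\<forall>k. Ck_on k W f') \<and> (\<forall>x\<in>A \<inter> W. f' x = f x)"
    using N W by (intro exI[of _ "W \<inter> N"] exI[of _ f']) auto
qed

lemma smooth_in_if_Ck: "(\<And>k. Ck_on k UNIV f) \<Longrightarrow> smooth_in A f"
  by (intro smooth_inI exI[of _ UNIV] exI[of _ f]) auto

lemma smooth_in_linear: "bounded_linear f \<Longrightarrow> smooth_in A f"
  by (simp add: smooth_in_if_Ck Ck_on_linear)

lemma smooth_in_const: "smooth_in A (\<lambda>x. c)"
  by (simp add: smooth_in_if_Ck Ck_on_const)

lemma smooth_in_continuous: "smooth_in A f \<Longrightarrow> continuous_on A f"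
proof (clarsimp simp: continuous_on_eq_continuous_within)
  fix a assume f: "smooth_in A f" and a: "a \<in> A"
  then obtain W f' where W: "open W" "a \<in> W" "\<forall>k. Ck_on k W f'" "\<forall>x\<in>A \<inter> W. f' x = f x"
    by (rule smooth_inE)
  have "continuous_on W f'"
    using W(3) by (metis Ck_on.simps(1))
  then have "continuous (at a within A) f'"
    using W(1,2) by (simp add: continuous_on_eq_continuous_at continuous_at_imp_continuous_at_within)
  moreover obtain d where "d > 0" "ball a d \<subseteq> W"
    using W(1,2) openE by blast
  moreover have "f' x = f x" if "x \<in> A" "dist x a < d" for x
    using that W(4) \<open>ball a d \<subseteq> W\<close> by (simp add: dist_commute subset_iff)
  ultimately show "continuous (at a within A) f"
    using continuous_transform_within[of a A f' d f] a \<open>d > 0\<close> by blast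
qed

lemma smooth_in_compose:
  assumes "smooth_in A f" "smooth_in B g" "f ` A \<subseteq> B"
  shows "smooth_in A (\<lambda>x. g (f x))"
proof (rule smooth_inI)
  fix a assume a: "a \<in> A"
  then obtain W f' where W: "open W" "a \<in> W" "\<forall>k. Ck_on k W f'" "\<forall>x\<in>A \<inter> W. f' x = f x"
    by (rule smooth_inE[OF assms(1)])
  obtain V g' where V: "open V" "f a \<in> V" "\<forall>k. Ck_on k V g'" "\<forall>x\<in>B \<inter> V. g' x = g x"
    by (rule smooth_inE[OF assms(2), of "f a"]) (use assms(3) a in auto)
  have "continuous_on W f'"
    using W(3) by (metis Ck_on.simps(1))
  \<comment> \<open>The two local extensions compose on the part of \<open>W\<close> that
    \<open>f'\<close> sends into \<open>V\<close>; continuity of \<open>f'\<close> makes it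
    open.\<close>
  then have o: "open (W \<inter> f' -` V)"
    using W(1) V(1) by (simp add: continuous_on_open_vimage Int_commute)
  have "Ck_on k (W \<inter> f' -` V) (\<lambda>x. g' (f' x))" for k
    by (rule Ck_on_compose[OF o V(1) _ Ck_on_subset[OF W(3)[rule_format]] V(3)[rule_format]]) auto
  moreover have "g' (f' x) = g (f x)" if "x \<in> A" "x \<in> W \<inter> f' -` V" for x
    using that W(4) V(4) assms(3) by auto
  ultimately show "\<exists>W f'. open W \<and> a \<in> W \<and> (\<forall>k. Ck_on k W f') \<and> (\<forall>x\<in>A \<inter> W. f' x = g (f x))"
    using o W a V by (intro exI[of _ "W \<inter> f' -` V"] exI[of _ "\<lambda>x. g' (f' x)"]) auto
qed

lemma smooth_in_Pair:
  assumes "smooth_in A f" "smooth_in A g"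
  shows "smooth_in A (\<lambda>x. (f x, g x))"
proof (rule smooth_inI)
  fix a assume a: "a \<in> A"
  then obtain W f' where W: "open W" "a \<in> W" "\<forall>k. Ck_on k W f'" "\<forall>x\<in>A \<inter> W. f' x = f x"
    by (rule smooth_inE[OF assms(1)])
  obtain V g' where V: "open V" "a \<in> V" "\<forall>k. Ck_on k V g'" "\<forall>x\<in>A \<inter> V. g' x = g x"
    by (rule smooth_inE[OF assms(2) a])
  have "Ck_on k (W \<inter> V) (\<lambda>x. (f' x, g' x))" for k
    using W V by (intro Ck_on_Pair open_Int Ck_on_subset[OF W(3)[rule_format]] Ck_on_subset[OF V(3)[rule_format]]) auto
  with W V show "\<exists>W f'. open W \<and> a \<in> W \<and> (\<forall>k. Ck_on k W f') \<and> (\<forall>x\<in>A \<inter> W. f' x = (f x, g x))"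
    by (intro exI[of _ "W \<inter> V"] exI[of _ "\<lambda>x. (f' x, g' x)"]) auto
qed

lemma smooth_in_add:
  assumes "smooth_in A f" "smooth_in A g"
  shows "smooth_in A (\<lambda>x. f x + g x)"
  using smooth_in_compose[OF smooth_in_Pair[OF assms] smooth_in_linear[of "\<lambda>p. fst p + snd p"]]
  by (auto intro: bounded_linear_add bounded_linear_fst bounded_linear_snd)

section \<open>Charts and smooth maps\<close>

definition charted :: "('p, 'v::euclidean_space) mfd \<Rightarrow> bool" where
  "charted X \<longleftrightarrow> (\<forall>(U, \<phi>)\<in>matlas X. is_chart (mtop X) U \<phi>)"

lemma chartedD: "charted X \<Longrightarrow> (U, \<phi>) \<in> matlas X \<Longrightarrow> is_chart (mtop X) U \<phi>"
  unfolding charted_def by blast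

lemma manifold_charted: "manifold X \<Longrightarrow> charted X"
  unfolding charted_def using manifold.charts by blast

text \<open>The last fact is the one that gluing relies on: a chart sends open sets to relatively
  open subsets of its image, the image itself being open only in a linear subspace of the model
  type.\<close>

lemma is_chartD:
  assumes "is_chart T U \<phi>"
  shows "openin T U" "U \<subseteq> topspace T" "inj_on \<phi> U"
    and "continuous_map (subtopology T U) euclidean \<phi>"
    and "continuous_map (top_of_set (\<phi> ` U)) T (inv_into U \<phi>)"
    and "openin T N \<Longrightarrow> openin (top_of_set (\<phi> ` U)) (\<phi> ` (U \<inter> N))"
proof -
  have hom: "homeomorphic_map (subtopology T U) (top_of_set (\<phi> ` U)) \<phi>" and o: "openin T U"
    using assms by (auto simp: is_chart_def)
  show "openin T U" by fact
  then show U: "U \<subseteq> topspace T" by (rule openin_subset)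
  then have ts: "topspace (subtopology T U) = U" by auto
  with hom show inj: "inj_on \<phi> U"
    by (auto simp: homeomorphic_map_def)
  have hc: "continuous_map (subtopology T U) (top_of_set (\<phi> ` U)) \<phi>"
    using hom by (rule homeomorphic_imp_continuous_map)
  then show "continuous_map (subtopology T U) euclidean \<phi>"
    by (simp add: continuous_map_in_subtopology)
  obtain g where g: "homeomorphic_maps (subtopology T U) (top_of_set (\<phi> ` U)) \<phi> g"
    using hom by (auto simp: homeomorphic_map_maps)
  have "g y = inv_into U \<phi> y" if "y \<in> \<phi> ` U" for y
    using that g ts inj by (auto simp: homeomorphic_maps_def)
  moreover have "continuous_map (top_of_set (\<phi> ` U)) T g"
    using g by (auto simp: homeomorphic_maps_def continuous_map_in_subtopology)
  ultimately show "continuous_map (top_of_set (\<phi> ` U)) T (inv_into U \<phi>)"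
    by (auto intro: continuous_map_eq)
  show "openin (top_of_set (\<phi> ` U)) (\<phi> ` (U \<inter> N))" if "openin T N"
    using homeomorphic_imp_open_map[OF hom] that
    by (auto simp: open_map_def openin_subtopology_Int2)
qed

lemma smooth_map_onD:
  assumes "smooth_map_on X Y S f"
  shows "S \<subseteq> mcar X" "continuous_map (subtopology (mtop X) S) (mtop Y) f"
    and "(U, \<phi>) \<in> matlas X \<Longrightarrow> (V, \<psi>) \<in> matlas Y \<Longrightarrow>
      smooth_in (\<phi> ` {p \<in> S \<inter> U. f p \<in> V}) (\<psi> \<circ> f \<circ> inv_into U \<phi>)"
  using assms unfolding smooth_map_on_def by auto

lemma smooth_map_on_in: "smooth_map_on X Y S f \<Longrightarrow> p \<in> S \<Longrightarrow> f p \<in> mcar Y"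
  using smooth_map_onD(1,2)[of X Y S f] by (auto simp: continuous_map_def Pi_def)

lemma smooth_map_on_preimage_open:
  assumes "smooth_map_on X Y S f" "openin (mtop Y) V"
  obtains N where "openin (mtop X) N" "{p \<in> S. f p \<in> V} = S \<inter> N"
proof -
  have "openin (subtopology (mtop X) S) {p \<in> topspace (subtopology (mtop X) S). f p \<in> V}"
    using smooth_map_onD(2)[OF assms(1)] assms(2) by (rule openin_continuous_map_preimage)
  moreover have "topspace (subtopology (mtop X) S) = S"
    using smooth_map_onD(1)[OF assms(1)] by auto
  ultimately show thesis
    using that by (auto simp: openin_subtopology Int_commute)
qed

text \<open>A neighbourhood \<open>N\<close> in the manifold is the trace of an open set
  \<open>W\<close> of the model type under the chart, by the homeomorphism property and injectivity.
  Smoothness of the coordinate expression near each point therefore suffices.\<close>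

lemma smooth_map_onI:
  assumes "charted X" "S \<subseteq> mcar X" "continuous_map (subtopology (mtop X) S) (mtop Y) f"
    and "\<And>U \<phi> V \<psi> p. (U, \<phi>) \<in> matlas X \<Longrightarrow> (V, \<psi>) \<in> matlas Y \<Longrightarrow> p \<in> S \<Longrightarrow> p \<in> U \<Longrightarrow> f p \<in> V \<Longrightarrow>
      \<exists>N. openin (mtop X) N \<and> p \<in> N \<and>
        smooth_in (\<phi> ` ({p \<in> S \<inter> U. f p \<in> V} \<inter> N)) (\<psi> \<circ> f \<circ> inv_into U \<phi>)"
  shows "smooth_map_on X Y S f"
proof -
  have "smooth_in (\<phi> ` {p \<in> S \<inter> U. f p \<in> V}) (\<psi> \<circ> f \<circ> inv_into U \<phi>)"
    if ch: "(U, \<phi>) \<in> matlas X" "(V, \<psi>) \<in> matlas Y" for U \<phi> V \<psi>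
  proof (rule smooth_in_local, clarify)
    fix p assume p: "p \<in> S" "p \<in> U" "f p \<in> V"
    then obtain N where N: "openin (mtop X) N" "p \<in> N"
      "smooth_in (\<phi> ` ({p \<in> S \<inter> U. f p \<in> V} \<inter> N)) (\<psi> \<circ> f \<circ> inv_into U \<phi>)"
      using assms(4)[OF ch] by blast
    note c = is_chartD[OF chartedD[OF assms(1) ch(1)]]
    obtain W where W: "open W" "\<phi> ` (U \<inter> N) = \<phi> ` U \<inter> W"
      using c(6)[OF N(1)] by (auto simp: openin_open)
    have "\<phi> ` {p \<in> S \<inter> U. f p \<in> V} \<inter> W \<subseteq> \<phi> ` ({p \<in> S \<inter> U. f p \<in> V} \<inter> N)"
    proof clarify
      fix q assume q: "q \<in> S" "q \<in> U" "f q \<in> V" "\<phi> q \<in> W"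
      then have "\<phi> q \<in> \<phi> ` (U \<inter> N)" using W(2) by blast
      then have "q \<in> N" using c(3) q(2) by (auto dest: inj_onD)
      with q show "\<phi> q \<in> \<phi> ` ({p \<in> S \<inter> U. f p \<in> V} \<inter> N)" by blast
    qed
    then show "\<exists>N. open N \<and> \<phi> p \<in> N \<and> smooth_in (\<phi> ` {p \<in> S \<inter> U. f p \<in> V} \<inter> N) (\<psi> \<circ> f \<circ> inv_into U \<phi>)"
      using W N p by (intro exI[of _ W]) (auto intro: smooth_in_subset)
  qed
  with assms(2,3) show ?thesis
    unfolding smooth_map_on_def by blast
qed

lemma smooth_map_on_cong:
  assumes "\<And>x. x \<in> S \<Longrightarrow> f x = g x" "smooth_map_on X Y S f" "charted X"
  shows "smooth_map_on X Y S g"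
  unfolding smooth_map_on_def
proof (intro conjI ballI, goal_cases)
  case 1
  show ?case using assms(2) by (rule smooth_map_onD)
next
  case 2
  show ?case
    using smooth_map_onD(2)[OF assms(2)] by (rule continuous_map_eq) (auto intro: assms(1))
next
  case (3 a)
  obtain U \<phi> where a: "a = (U, \<phi>)" by (cases a)
  have *: "smooth_in (\<phi> ` {p \<in> S \<inter> U. g p \<in> V}) (\<psi> \<circ> g \<circ> inv_into U \<phi>)"
    if V: "(V, \<psi>) \<in> matlas Y" for V \<psi>
  proof -
    have "smooth_in (\<phi> ` {p \<in> S \<inter> U. f p \<in> V}) (\<psi> \<circ> f \<circ> inv_into U \<phi>)"
      using smooth_map_onD(3)[OF assms(2)] 3 V a by blast
    moreover have "{p \<in> S \<inter> U. f p \<in> V} = {p \<in> S \<inter> U. g p \<in> V}"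
      using assms(1) by auto
    ultimately have "smooth_in (\<phi> ` {p \<in> S \<inter> U. g p \<in> V}) (\<psi> \<circ> f \<circ> inv_into U \<phi>)"
      by simp
    then show ?thesis
      by (rule iffD1[OF smooth_in_cong, rotated])
        (use assms(1) is_chartD(3)[OF chartedD[OF assms(3)]] 3 a in auto)
  qed
  then show ?case using a by auto
qed

lemma smooth_map_on_subset:
  assumes "smooth_map_on X Y S f" "T \<subseteq> S"
  shows "smooth_map_on X Y T f"
  unfolding smooth_map_on_def
proof (intro conjI ballI)
  show "T \<subseteq> mcar X" using assms smooth_map_onD(1) by blast
  show "continuous_map (subtopology (mtop X) T) (mtop Y) f"
    using smooth_map_onD(2)[OF assms(1)] assms(2) by (rule continuous_map_from_subtopology_mono)
  fix a assume a: "a \<in> matlas X"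
  show "case a of (U, \<phi>) \<Rightarrow> \<forall>(V, \<psi>)\<in>matlas Y. smooth_in (\<phi> ` {p \<in> T \<inter> U. f p \<in> V}) (\<psi> \<circ> f \<circ> inv_into U \<phi>)"
    using smooth_map_onD(3)[OF assms(1)] a assms(2) by (auto intro!: smooth_in_subset[OF smooth_map_onD(3)[OF assms(1)]])
qed

text \<open>A chart of the middle manifold exists around \<open>f p\<close> because the atlas of
  \<open>Y\<close> covers; after the source is shrunk to the preimage of its domain, the two
  coordinate expressions compose.\<close>

lemma smooth_map_on_compose:
  assumes X: "charted X" and Y: "charted Y" "(\<Union>(V, \<psi>)\<in>matlas Y. V) = mcar Y"
    and f: "smooth_map_on X Y S f" and g: "smooth_map_on Y Z T g" and sub: "f ` S \<subseteq> T"
  shows "smooth_map_on X Z S (\<lambda>p. g (f p))"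
proof (rule smooth_map_onI[OF X])
  show "S \<subseteq> mcar X" using f by (rule smooth_map_onD)
  have "continuous_map (subtopology (mtop X) S) (subtopology (mtop Y) T) f"
    using smooth_map_onD(1,2)[OF f] sub by (auto simp: continuous_map_in_subtopology)
  from continuous_map_compose[OF this smooth_map_onD(2)[OF g]]
  show "continuous_map (subtopology (mtop X) S) (mtop Z) (\<lambda>p. g (f p))"
    by (simp add: o_def)
  fix U \<phi> W \<xi> p
  assume U: "(U, \<phi>) \<in> matlas X" and W: "(W, \<xi>) \<in> matlas Z" and p: "p \<in> S" "p \<in> U" "g (f p) \<in> W"
  obtain V \<psi> where V: "(V, \<psi>) \<in> matlas Y" "f p \<in> V"
    using smooth_map_on_in[OF f p(1)] Y(2) by blast
  note cU = is_chartD[OF chartedD[OF X U]] and cV = is_chartD[OF chartedD[OF Y(1) V(1)]]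
  obtain N where N: "openin (mtop X) N" "{p \<in> S. f p \<in> V} = S \<inter> N"
    using smooth_map_on_preimage_open[OF f cV(1)] .
  define A where "A = \<phi> ` ({p \<in> S \<inter> U. g (f p) \<in> W} \<inter> N)"
  have fV: "f q \<in> V" if "q \<in> S" "q \<in> N" for q
    using that N(2) by blast
  have 1: "smooth_in A (\<psi> \<circ> f \<circ> inv_into U \<phi>)"
    using smooth_map_onD(3)[OF f U V(1)] by (rule smooth_in_subset) (auto simp: A_def fV)
  have "(\<psi> \<circ> f \<circ> inv_into U \<phi>) ` A \<subseteq> \<psi> ` {p \<in> T \<inter> V. g p \<in> W}"
    using sub cU(3) by (auto simp: A_def fV)
  from smooth_in_compose[OF 1 smooth_map_onD(3)[OF g V(1) W] this]
  have "smooth_in A (\<lambda>x. (\<xi> \<circ> g \<circ> inv_into V \<psi>) ((\<psi> \<circ> f \<circ> inv_into U \<phi>) x))" .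
  then have "smooth_in A (\<xi> \<circ> (\<lambda>p. g (f p)) \<circ> inv_into U \<phi>)"
    by (rule iffD1[OF smooth_in_cong, rotated]) (use cU(3) cV(3) in \<open>auto simp: A_def fV\<close>)
  then show "\<exists>N. openin (mtop X) N \<and> p \<in> N \<and>
      smooth_in (\<phi> ` ({p \<in> S \<inter> U. g (f p) \<in> W} \<inter> N)) (\<xi> \<circ> (\<lambda>p. g (f p)) \<circ> inv_into U \<phi>)"
    using N p V(2) unfolding A_def by blast
qed

lemma smooth_compose:
  assumes "manifold X" "manifold Y" "smooth_map_on Y Z T g" "smooth_map_on X Y S f" "f ` S \<subseteq> T"
  shows "smooth_map_on X Z S (\<lambda>p. g (f p))"
  using smooth_map_on_compose[OF manifold_charted[OF assms(1)] manifold_charted[OF assms(2)]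
      manifold.charts_cover[OF assms(2)] assms(4,3,5)] .

text \<open>The gluing property. Continuity is a clause of its own in \<open>smooth_map_on\<close>
  and is checked point by point, since the pieces are traces on \<open>S\<close> of open sets of
  \<open>X\<close>.\<close>

lemma smooth_map_on_local:
  assumes X: "charted X" and loc: "\<And>p. p \<in> S \<Longrightarrow> \<exists>N. openin (mtop X) N \<and> p \<in> N \<and> smooth_map_on X Y (S \<inter> N) f"
  shows "smooth_map_on X Y S f"
proof (rule smooth_map_onI[OF X])
  show S: "S \<subseteq> mcar X"
    using loc openin_subset by blast
  show "continuous_map (subtopology (mtop X) S) (mtop Y) f"
    unfolding continuous_map_eq_topcontinuous_at
  proof
    fix p assume "p \<in> topspace (subtopology (mtop X) S)"
    then have p: "p \<in> S" by simp
    obtain N where N: "openin (mtop X) N" "p \<in> N" "smooth_map_on X Y (S \<inter> N) f"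
      using loc[OF p] by blast
    have "\<exists>U. openin (subtopology (mtop X) S) U \<and> p \<in> U \<and> (\<forall>y\<in>U. f y \<in> V)"
      if V: "openin (mtop Y) V" "f p \<in> V" for V
    proof -
      obtain N' where N': "openin (mtop X) N'" "{p \<in> S \<inter> N. f p \<in> V} = (S \<inter> N) \<inter> N'"
        using smooth_map_on_preimage_open[OF N(3) V(1)] .
      have "openin (subtopology (mtop X) S) (S \<inter> (N \<inter> N'))"
        using N(1) N'(1) by (simp add: openin_subtopology_Int2 openin_Int)
      moreover have "p \<in> S \<inter> (N \<inter> N')" "\<forall>y\<in>S \<inter> (N \<inter> N'). f y \<in> V"
        using N'(2) p N(2) V(2) by blast+
      ultimately show ?thesis by blast
    qed
    moreover have "f q \<in> mcar Y" if "q \<in> S" for q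
      using loc[OF that] smooth_map_on_in that by (metis IntI)
    ultimately show "topcontinuous_at (subtopology (mtop X) S) (mtop Y) f p"
      using p S by (auto simp: topcontinuous_at_def)
  qed
  fix U \<phi> V \<psi> p
  assume U: "(U, \<phi>) \<in> matlas X" and V: "(V, \<psi>) \<in> matlas Y" and p: "p \<in> S" "p \<in> U" "f p \<in> V"
  obtain N where N: "openin (mtop X) N" "p \<in> N" "smooth_map_on X Y (S \<inter> N) f"
    using loc[OF p(1)] by blast
  have "{p \<in> S \<inter> U. f p \<in> V} \<inter> N = {p \<in> S \<inter> N \<inter> U. f p \<in> V}" by auto
  then show "\<exists>N. openin (mtop X) N \<and> p \<in> N \<and>
      smooth_in (\<phi> ` ({p \<in> S \<inter> U. f p \<in> V} \<inter> N)) (\<psi> \<circ> f \<circ> inv_into U \<phi>)"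
    using N smooth_map_onD(3)[OF N(3) U V] by auto
qed

section \<open>Euclidean spaces as manifolds\<close>

lemma euclid_mfd_simps [simp]:
  "mtop (euclid_mfd :: ('v::euclidean_space, 'v) mfd) = euclidean"
  "matlas (euclid_mfd :: ('v::euclidean_space, 'v) mfd) = {(UNIV, id)}"
  by (simp_all add: euclid_mfd_def)

lemma smooth_map_on_to_euclid:
  "smooth_map_on X (euclid_mfd :: ('w::euclidean_space, 'w) mfd) S f \<longleftrightarrow>
     S \<subseteq> mcar X \<and> continuous_map (subtopology (mtop X) S) euclidean f \<and>
     (\<forall>(U, \<phi>)\<in>matlas X. smooth_in (\<phi> ` (S \<inter> U)) (f \<circ> inv_into U \<phi>))"
  by (simp add: smooth_map_on_def Int_def)

lemma smooth_map_on_from_euclid: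
  "smooth_map_on (euclid_mfd :: ('w::euclidean_space, 'w) mfd) Y A f \<longleftrightarrow>
     continuous_map (top_of_set A) (mtop Y) f \<and> (\<forall>(V, \<psi>)\<in>matlas Y. smooth_in {a \<in> A. f a \<in> V} (\<psi> \<circ> f))"
  by (simp add: smooth_map_on_def)

lemma smooth_map_on_euclid_euclid:
  "smooth_map_on (euclid_mfd :: ('w::euclidean_space, 'w) mfd) (euclid_mfd :: ('v::euclidean_space, 'v) mfd) A f
    \<longleftrightarrow> smooth_in A f"
  using smooth_in_continuous by (auto simp: smooth_map_on_from_euclid)

lemma manifold_euclid: "manifold (euclid_mfd :: ('w::euclidean_space, 'w) mfd)"
proof
  show "Hausdorff_space (mtop (euclid_mfd :: ('w::euclidean_space, 'w) mfd))"
    by simp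
  obtain B :: "'w set set" where B: "countable B" "topological_basis B"
    using ex_countable_basis by blast
  have "\<exists>V\<in>B. x \<in> V \<and> V \<subseteq> U" if "open U" "x \<in> U" for U x
    using topological_basisE[OF B(2) that] by metis
  then show "second_countable (mtop (euclid_mfd :: ('w::euclidean_space, 'w) mfd))"
    unfolding second_countable_def using B(1) topological_basis_open[OF B(2)]
    by (intro exI[of _ B]) simp
  show "is_chart (mtop (euclid_mfd :: ('w::euclidean_space, 'w) mfd)) U \<phi>"
    if "(U, \<phi>) \<in> matlas euclid_mfd" for U and \<phi> :: "'w \<Rightarrow> 'w"
    using that by (auto simp: is_chart_def models_def intro!: exI[of _ UNIV])
  show "(\<Union>(U, \<phi>)\<in>matlas (euclid_mfd :: ('w::euclidean_space, 'w) mfd). U) = mcar euclid_mfd"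
    by simp
  show "smooth_in (\<phi> ` (U \<inter> V)) (\<psi> \<circ> inv_into U \<phi>)"
    if "(U, \<phi>) \<in> matlas euclid_mfd" "(V, \<psi>) \<in> matlas euclid_mfd" for U V and \<phi> \<psi> :: "'w \<Rightarrow> 'w"
    using that by (auto intro!: smooth_in_linear simp: id_def o_def bounded_linear_ident)
qed

context manifold begin

text \<open>Together with \<open>chart_inv_smooth\<close> this makes charts smooth maps to and from
  \<open>euclid_mfd\<close>, so that smoothness can be assembled by composition instead of in
  coordinates.\<close>

lemma chart_smooth: "(U, \<phi>) \<in> matlas X \<Longrightarrow> smooth_map_on X euclid_mfd U \<phi>"
  using is_chartD[OF charts] charts_compatible
  by (fastforce simp: smooth_map_on_to_euclid Int_commute)

lemma chart_inv_smooth: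
  assumes U: "(U, \<phi>) \<in> matlas X"
  shows "smooth_map_on euclid_mfd X (\<phi> ` U) (inv_into U \<phi>)"
proof -
  note c = is_chartD[OF charts[OF U]]
  have "{a \<in> \<phi> ` U. inv_into U \<phi> a \<in> V} = \<phi> ` (U \<inter> V)" for V
    using c(3) by auto
  then show ?thesis
    using c(5) charts_compatible[OF U] by (auto simp: smooth_map_on_from_euclid)
qed

lemma chart_at: "p \<in> mcar X \<Longrightarrow> \<exists>U \<phi>. (U, \<phi>) \<in> matlas X \<and> p \<in> U"
  using charts_cover by blast

lemma smooth_ident: "S \<subseteq> mcar X \<Longrightarrow> smooth_map_on X X S (\<lambda>x. x)"
proof -
  have "smooth_in (\<phi> ` {p \<in> mcar X \<inter> U. p \<in> V}) (\<psi> \<circ> (\<lambda>x. x) \<circ> inv_into U \<phi>)"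
    if "(U, \<phi>) \<in> matlas X" "(V, \<psi>) \<in> matlas X" for U V \<phi> \<psi>
  proof -
    have "{p \<in> mcar X \<inter> U. p \<in> V} = U \<inter> V"
      using is_chartD(2)[OF charts] that by blast
    then show ?thesis
      using charts_compatible[OF that] by (simp add: o_def)
  qed
  then have "smooth_map_on X X (mcar X) (\<lambda>x. x)"
    unfolding smooth_map_on_def by (auto intro: continuous_map_from_subtopology)
  then show "S \<subseteq> mcar X \<Longrightarrow> smooth_map_on X X S (\<lambda>x. x)"
    by (rule smooth_map_on_subset)
qed

end

lemma smooth_const:
  assumes "S \<subseteq> mcar X" "c \<in> mcar Y"
  shows "smooth_map_on X Y S (\<lambda>x. c)"
  using assms by (auto simp: smooth_map_on_def o_def smooth_in_const)

section \<open>Products\<close>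

lemma prod_mfd_simps [simp]:
  "mtop (prod_mfd X Y) = prod_topology (mtop X) (mtop Y)"
  by (simp add: prod_mfd_def)

lemma matlas_prodI:
  "(U, \<phi>) \<in> matlas X \<Longrightarrow> (V, \<psi>) \<in> matlas Y \<Longrightarrow> (U \<times> V, map_prod \<phi> \<psi>) \<in> matlas (prod_mfd X Y)"
  unfolding prod_mfd_def by auto

lemma matlas_prodE:
  assumes "(W, \<xi>) \<in> matlas (prod_mfd X Y)"
  obtains U \<phi> V \<psi> where "(U, \<phi>) \<in> matlas X" "(V, \<psi>) \<in> matlas Y" "W = U \<times> V" "\<xi> = map_prod \<phi> \<psi>"
  using assms unfolding prod_mfd_def by auto

lemma smooth_Pair:
  assumes f: "smooth_map_on X Y S f" and g: "smooth_map_on X Z S g"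
  shows "smooth_map_on X (prod_mfd Y Z) S (\<lambda>x. (f x, g x))"
proof -
  have c: "continuous_map (subtopology (mtop X) S) (prod_topology (mtop Y) (mtop Z)) (\<lambda>x. (f x, g x))"
    using smooth_map_onD(2)[OF f] smooth_map_onD(2)[OF g] by (simp add: continuous_map_pairedI)
  have "smooth_in (\<phi> ` {p \<in> S \<inter> U. (f p, g p) \<in> V}) (\<psi> \<circ> (\<lambda>x. (f x, g x)) \<circ> inv_into U \<phi>)"
    if "(U, \<phi>) \<in> matlas X" "(V, \<psi>) \<in> matlas (prod_mfd Y Z)" for U V \<phi> \<psi>
    using that(2)
  proof (cases rule: matlas_prodE)
    case (1 V1 \<psi>1 V2 \<psi>2)
    have "smooth_in (\<phi> ` {p \<in> S \<inter> U. (f p, g p) \<in> V}) (\<psi>1 \<circ> f \<circ> inv_into U \<phi>)"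
      "smooth_in (\<phi> ` {p \<in> S \<inter> U. (f p, g p) \<in> V}) (\<psi>2 \<circ> g \<circ> inv_into U \<phi>)"
      by (rule smooth_in_subset[OF smooth_map_onD(3)[OF f that(1) 1(1)]]
          smooth_in_subset[OF smooth_map_onD(3)[OF g that(1) 1(2)]]; use 1 in auto)+
    from smooth_in_Pair[OF this] show ?thesis
      using 1 by (simp add: o_def)
  qed
  with c smooth_map_onD(1)[OF f] show ?thesis
    unfolding smooth_map_on_def by auto
qed

lemma inv_into_map_prod:
  assumes "inj_on \<phi> U" "inj_on \<psi> V" "a \<in> \<phi> ` U" "b \<in> \<psi> ` V"
  shows "inv_into (U \<times> V) (map_prod \<phi> \<psi>) (a, b) = (inv_into U \<phi> a, inv_into V \<psi> b)"
  using assms by (intro inv_into_f_eq) (auto simp: map_prod_inj_on inv_into_into f_inv_into_f)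

lemma is_chart_prod:
  assumes X: "is_chart T U \<phi>" and Y: "is_chart T' V \<psi>"
  shows "is_chart (prod_topology T T') (U \<times> V) (map_prod \<phi> \<psi>)"
proof -
  obtain L L' where L: "models L U \<phi>" "models L' V \<psi>"
    using X Y by (auto simp: is_chart_def)
  have im: "map_prod \<phi> \<psi> ` (U \<times> V) = (\<phi> ` U) \<times> (\<psi> ` V)"
    by (rule map_prod_surj_on) auto
  have "models (L \<times> L') (U \<times> V) (map_prod \<phi> \<psi>)"
    using L by (auto simp: models_def im subspace_Times openin_Times)
  moreover have "homeomorphic_map (subtopology (prod_topology T T') (U \<times> V)) (top_of_set (map_prod \<phi> \<psi> ` (U \<times> V))) (map_prod \<phi> \<psi>)"
  proof -
    obtain f' where f': "homeomorphic_maps (subtopology T U) (top_of_set (\<phi> ` U)) \<phi> f'"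
      using X by (auto simp: is_chart_def homeomorphic_map_maps)
    obtain g' where g': "homeomorphic_maps (subtopology T' V) (top_of_set (\<psi> ` V)) \<psi> g'"
      using Y by (auto simp: is_chart_def homeomorphic_map_maps)
    have "homeomorphic_maps (prod_topology (subtopology T U) (subtopology T' V))
        (prod_topology (top_of_set (\<phi> ` U)) (top_of_set (\<psi> ` V)))
        (\<lambda>(x, y). (\<phi> x, \<psi> y)) (\<lambda>(x, y). (f' x, g' y))"
      unfolding homeomorphic_maps_prod using f' g' by blast
    moreover have "prod_topology (top_of_set (\<phi> ` U)) (top_of_set (\<psi> ` V)) = top_of_set ((\<phi> ` U) \<times> (\<psi> ` V))"
      by (simp add: prod_topology_subtopology_eu)
    moreover have "(\<lambda>(x, y). (\<phi> x, \<psi> y)) = map_prod \<phi> \<psi>" by auto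
    ultimately show ?thesis
      by (auto simp: homeomorphic_map_maps im subtopology_Times)
  qed
  ultimately show ?thesis
    using X Y unfolding is_chart_def by (auto simp: openin_prod_Times_iff)
qed

lemma second_countable_prod_topology:
  assumes "second_countable T" "second_countable T'"
  shows "second_countable (prod_topology T T')"
proof -
  obtain B where B: "countable B" "\<And>V. V \<in> B \<Longrightarrow> openin T V"
    "\<And>U x. openin T U \<Longrightarrow> x \<in> U \<Longrightarrow> \<exists>V\<in>B. x \<in> V \<and> V \<subseteq> U"
    using assms(1) unfolding second_countable_def by metis
  obtain B' where B': "countable B'" "\<And>V. V \<in> B' \<Longrightarrow> openin T' V"
    "\<And>U x. openin T' U \<Longrightarrow> x \<in> U \<Longrightarrow> \<exists>V\<in>B'. x \<in> V \<and> V \<subseteq> U"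
    using assms(2) unfolding second_countable_def by metis
  have ex: "\<exists>V\<in>(\<lambda>(V, V'). V \<times> V') ` (B \<times> B'). p \<in> V \<and> V \<subseteq> U"
    if U: "openin (prod_topology T T') U" "p \<in> U" for U p
  proof -
    obtain x y where p: "p = (x, y)" by (cases p)
    obtain W W' where W: "openin T W" "openin T' W'" "x \<in> W" "y \<in> W'" "W \<times> W' \<subseteq> U"
      using U(1)[unfolded openin_prod_topology_alt, rule_format, of x y] U(2) p by auto
    obtain V where V: "V \<in> B" "x \<in> V" "V \<subseteq> W" using B(3)[OF W(1,3)] by blast
    obtain V' where V': "V' \<in> B'" "y \<in> V'" "V' \<subseteq> W'" using B'(3)[OF W(2,4)] by blast
    have "V \<times> V' \<in> (\<lambda>(V, V'). V \<times> V') ` (B \<times> B')" using V(1) V'(1) by auto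
    moreover have "p \<in> V \<times> V'" "V \<times> V' \<subseteq> U" using V V' W(5) p by auto
    ultimately show ?thesis by blast
  qed
  show ?thesis
    unfolding second_countable_def
    by (intro exI[of _ "(\<lambda>(V, V'). V \<times> V') ` (B \<times> B')"] conjI ballI allI impI)
      (use B(1,2) B'(1,2) ex in \<open>auto simp: openin_prod_Times_iff\<close>)
qed

lemma smooth_in_fst: "smooth_in A fst" and smooth_in_snd: "smooth_in A snd"
  by (simp_all add: smooth_in_linear bounded_linear_fst bounded_linear_snd)

text \<open>The three claims are proved together because a transition map of product charts is the
  pair of coordinate expressions of the two projections: compatibility of the product atlas is an
  instance of their smoothness.\<close>

lemma
  assumes X: "manifold X" and Y: "manifold Y"
  shows manifold_prod: "manifold (prod_mfd X Y)"
    and smooth_fst: "S \<subseteq> mcar X \<times> mcar Y \<Longrightarrow> smooth_map_on (prod_mfd X Y) X S fst"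
    and smooth_snd: "S \<subseteq> mcar X \<times> mcar Y \<Longrightarrow> smooth_map_on (prod_mfd X Y) Y S snd"
proof -
  interpret X: manifold X by fact
  interpret Y: manifold Y by fact
  have fst: "smooth_in (\<xi> ` {p \<in> (mcar X \<times> mcar Y) \<inter> W. fst p \<in> U'}) (\<phi>' \<circ> fst \<circ> inv_into W \<xi>)"
    if W: "(W, \<xi>) \<in> matlas (prod_mfd X Y)" and U': "(U', \<phi>') \<in> matlas X" for W \<xi> U' \<phi>'
    using W
  proof (cases rule: matlas_prodE)
    case (1 U \<phi> V \<psi>)
    note cU = is_chartD[OF X.charts[OF 1(1)]] and cV = is_chartD[OF Y.charts[OF 1(2)]]
    have "smooth_in (\<phi> ` (U \<inter> U') \<times> UNIV) (\<lambda>x. (\<phi>' \<circ> inv_into U \<phi>) (fst x))"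
      by (rule smooth_in_compose[OF smooth_in_fst X.charts_compatible[OF 1(1) U']]) auto
    then have "smooth_in (\<xi> ` {p \<in> (mcar X \<times> mcar Y) \<inter> W. fst p \<in> U'}) (\<lambda>x. (\<phi>' \<circ> inv_into U \<phi>) (fst x))"
      by (rule smooth_in_subset) (auto simp: 1)
    then show ?thesis
      by (rule iffD1[OF smooth_in_cong, rotated]) (use cU cV in \<open>auto simp: 1 inv_into_map_prod\<close>)
  qed
  have snd: "smooth_in (\<xi> ` {p \<in> (mcar X \<times> mcar Y) \<inter> W. snd p \<in> V'}) (\<psi>' \<circ> snd \<circ> inv_into W \<xi>)"
    if W: "(W, \<xi>) \<in> matlas (prod_mfd X Y)" and V': "(V', \<psi>') \<in> matlas Y" for W \<xi> V' \<psi>'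
    using W
  proof (cases rule: matlas_prodE)
    case (1 U \<phi> V \<psi>)
    note cU = is_chartD[OF X.charts[OF 1(1)]] and cV = is_chartD[OF Y.charts[OF 1(2)]]
    have "smooth_in (UNIV \<times> \<psi> ` (V \<inter> V')) (\<lambda>x. (\<psi>' \<circ> inv_into V \<psi>) (snd x))"
      by (rule smooth_in_compose[OF smooth_in_snd Y.charts_compatible[OF 1(2) V']]) auto
    then have "smooth_in (\<xi> ` {p \<in> (mcar X \<times> mcar Y) \<inter> W. snd p \<in> V'}) (\<lambda>x. (\<psi>' \<circ> inv_into V \<psi>) (snd x))"
      by (rule smooth_in_subset) (auto simp: 1)
    then show ?thesis
      by (rule iffD1[OF smooth_in_cong, rotated]) (use cU cV in \<open>auto simp: 1 inv_into_map_prod\<close>)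
  qed
  have sfst: "smooth_map_on (prod_mfd X Y) X (mcar X \<times> mcar Y) fst"
    unfolding smooth_map_on_def using fst
    by (auto intro: continuous_map_from_subtopology continuous_map_fst)
  have ssnd: "smooth_map_on (prod_mfd X Y) Y (mcar X \<times> mcar Y) snd"
    unfolding smooth_map_on_def using snd
    by (auto intro: continuous_map_from_subtopology continuous_map_snd)
  show "S \<subseteq> mcar X \<times> mcar Y \<Longrightarrow> smooth_map_on (prod_mfd X Y) X S fst"
    using sfst by (rule smooth_map_on_subset)
  show "S \<subseteq> mcar X \<times> mcar Y \<Longrightarrow> smooth_map_on (prod_mfd X Y) Y S snd"
    using ssnd by (rule smooth_map_on_subset)
  show "manifold (prod_mfd X Y)"
  proof
    show "Hausdorff_space (mtop (prod_mfd X Y))"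
      using X.hausdorff Y.hausdorff by (simp add: Hausdorff_space_prod_topology)
    show "second_countable (mtop (prod_mfd X Y))"
      using X.second_countable Y.second_countable by (simp add: second_countable_prod_topology)
    show "is_chart (mtop (prod_mfd X Y)) W \<xi>" if "(W, \<xi>) \<in> matlas (prod_mfd X Y)" for W \<xi>
      using that by (elim matlas_prodE) (auto intro!: is_chart_prod X.charts Y.charts)
    show "(\<Union>(U, \<phi>)\<in>matlas (prod_mfd X Y). U) = mcar (prod_mfd X Y)"
    proof
      show "(\<Union>(U, \<phi>)\<in>matlas (prod_mfd X Y). U) \<subseteq> mcar (prod_mfd X Y)"
        using is_chartD(2)[OF X.charts] is_chartD(2)[OF Y.charts] by (fastforce elim!: matlas_prodE)
      show "mcar (prod_mfd X Y) \<subseteq> (\<Union>(U, \<phi>)\<in>matlas (prod_mfd X Y). U)"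
      proof
        fix p assume "p \<in> mcar (prod_mfd X Y)"
        then obtain x y where p: "p = (x, y)" "x \<in> mcar X" "y \<in> mcar Y" by (cases p) auto
        then obtain U \<phi> V \<psi> where "(U, \<phi>) \<in> matlas X" "x \<in> U" "(V, \<psi>) \<in> matlas Y" "y \<in> V"
          using X.chart_at Y.chart_at by meson
        then show "p \<in> (\<Union>(U, \<phi>)\<in>matlas (prod_mfd X Y). U)"
          using p(1) by (intro UN_I[OF matlas_prodI[of U \<phi> X V \<psi> Y]]) auto
      qed
    qed
    show "smooth_in (\<xi> ` (W \<inter> W')) (\<xi>' \<circ> inv_into W \<xi>)"
      if W: "(W, \<xi>) \<in> matlas (prod_mfd X Y)" and W': "(W', \<xi>') \<in> matlas (prod_mfd X Y)" for W \<xi> W' \<xi>'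
      using W'
    proof (cases rule: matlas_prodE)
      case (1 U' \<phi>' V' \<psi>')
      have sub: "W \<subseteq> mcar X \<times> mcar Y"
        using W
      proof (cases rule: matlas_prodE)
        case (1 U \<phi> V \<psi>)
        then show ?thesis
          using is_chartD(2)[OF X.charts[OF 1(1)]] is_chartD(2)[OF Y.charts[OF 1(2)]] by auto
      qed
      have "smooth_in (\<xi> ` (W \<inter> W')) (\<phi>' \<circ> fst \<circ> inv_into W \<xi>)"
        "smooth_in (\<xi> ` (W \<inter> W')) (\<psi>' \<circ> snd \<circ> inv_into W \<xi>)"
        by (rule smooth_in_subset[OF fst[OF W 1(1)]] smooth_in_subset[OF snd[OF W 1(2)]]; use sub 1(3) in auto)+
      from smooth_in_Pair[OF this] show ?thesis
        by (simp add: 1 o_def map_prod_def case_prod_beta)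
    qed
  qed
qed

section \<open>Induced structures on subsets\<close>

lemma mtop_sub_mfd [simp]: "mtop (sub_mfd X S) = subtopology (mtop X) S"
  by (simp add: sub_mfd_def)

lemma matlas_sub_mfd:
  "(U, \<phi>) \<in> matlas (sub_mfd X S) \<longleftrightarrow> is_chart (subtopology (mtop X) S) U \<phi> \<and>
     smooth_map_on X euclid_mfd U \<phi> \<and> smooth_map_on euclid_mfd X (\<phi> ` U) (inv_into U \<phi>)"
  by (simp add: sub_mfd_def)

text \<open>A chart of the induced structure is, by definition of the atlas, smooth as a map from a
  subset of \<open>X\<close>. Composed with \<open>f\<close> it gives the coordinate expression in
  question.\<close>

lemma smooth_into_sub_mfd:
  assumes Y: "manifold Y" and X: "manifold X" and f: "smooth_map_on Y X T f" "f ` T \<subseteq> S"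
  shows "smooth_map_on Y (sub_mfd X S) T f"
proof -
  have "smooth_in (\<phi> ` {p \<in> T \<inter> U. f p \<in> V}) (\<psi> \<circ> f \<circ> inv_into U \<phi>)"
    if U: "(U, \<phi>) \<in> matlas Y" and V: "(V, \<psi>) \<in> matlas (sub_mfd X S)" for U \<phi> V \<psi>
  proof -
    have "smooth_map_on Y euclid_mfd {p \<in> T. f p \<in> V} (\<lambda>p. \<psi> (f p))"
      by (rule smooth_compose[OF Y X _ smooth_map_on_subset[OF f(1)], where T = V])
        (use V in \<open>auto simp: matlas_sub_mfd\<close>)
    then have "smooth_in (\<phi> ` ({p \<in> T. f p \<in> V} \<inter> U)) ((\<lambda>p. \<psi> (f p)) \<circ> inv_into U \<phi>)"
      using U by (auto simp: smooth_map_on_to_euclid)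
    moreover have "{p \<in> T. f p \<in> V} \<inter> U = {p \<in> T \<inter> U. f p \<in> V}" by auto
    ultimately show ?thesis by (simp add: o_def)
  qed
  then show ?thesis
    using smooth_map_onD(1,2)[OF f(1)] f(2)
    by (auto simp: smooth_map_on_def continuous_map_in_subtopology)
qed

text \<open>Here the other half of the induced atlas enters: the inverses of its charts are smooth
  into \<open>X\<close>.\<close>

lemma smooth_sub_incl:
  assumes "manifold X" "T \<subseteq> S" "T \<subseteq> mcar X"
  shows "smooth_map_on (sub_mfd X S) X T (\<lambda>x. x)"
proof (rule smooth_map_on_subset)
  have "smooth_in (\<phi> ` {p \<in> mcar X \<inter> S \<inter> U. p \<in> V}) (\<psi> \<circ> (\<lambda>x. x) \<circ> inv_into U \<phi>)"
    if U: "(U, \<phi>) \<in> matlas (sub_mfd X S)" and V: "(V, \<psi>) \<in> matlas X" for U \<phi> V \<psi>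
  proof -
    have c: "is_chart (subtopology (mtop X) S) U \<phi>" and s: "smooth_map_on euclid_mfd X (\<phi> ` U) (inv_into U \<phi>)"
      using U by (auto simp: matlas_sub_mfd)
    have "smooth_in {a \<in> \<phi> ` U. inv_into U \<phi> a \<in> V} (\<psi> \<circ> inv_into U \<phi>)"
      using s V by (auto simp: smooth_map_on_from_euclid)
    then have "smooth_in (\<phi> ` {p \<in> mcar X \<inter> S \<inter> U. p \<in> V}) (\<psi> \<circ> inv_into U \<phi>)"
      by (rule smooth_in_subset) (use is_chartD(3)[OF c] in auto)
    then show ?thesis by (simp add: o_def)
  qed
  then show "smooth_map_on (sub_mfd X S) X (mcar X \<inter> S) (\<lambda>x. x)"
    by (auto simp: smooth_map_on_def subtopology_subtopology intro: continuous_map_from_subtopology)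
qed (use assms in auto)

text \<open>Compatibility is automatic, a transition map being the inverse of one chart, smooth into
  \<open>X\<close>, followed by another chart, smooth from \<open>X\<close>. The content of
  embeddedness is that such charts cover \<open>S\<close>.\<close>

lemma manifold_sub_mfd:
  assumes X: "manifold X" and S: "S \<subseteq> mcar X"
    and cover: "\<And>p. p \<in> S \<Longrightarrow> \<exists>U \<phi>. p \<in> U \<and> (U, \<phi>) \<in> matlas (sub_mfd X S)"
  shows "manifold (sub_mfd X S)"
proof
  show "Hausdorff_space (mtop (sub_mfd X S))" "second_countable (mtop (sub_mfd X S))"
    using manifold.hausdorff[OF X] manifold.second_countable[OF X]
    by (simp_all add: Hausdorff_space_subtopology second_countable_subtopology)
  show c: "is_chart (mtop (sub_mfd X S)) U \<phi>" if "(U, \<phi>) \<in> matlas (sub_mfd X S)" for U \<phi>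
    using that by (simp add: matlas_sub_mfd)
  show "(\<Union>(U, \<phi>)\<in>matlas (sub_mfd X S). U) = mcar (sub_mfd X S)"
  proof
    show "(\<Union>(U, \<phi>)\<in>matlas (sub_mfd X S). U) \<subseteq> mcar (sub_mfd X S)"
      using is_chartD(2)[OF c] by blast
    show "mcar (sub_mfd X S) \<subseteq> (\<Union>(U, \<phi>)\<in>matlas (sub_mfd X S). U)"
    proof
      fix p assume "p \<in> mcar (sub_mfd X S)"
      then have "p \<in> S" by simp
      then obtain U \<phi> where "p \<in> U" "(U, \<phi>) \<in> matlas (sub_mfd X S)"
        using cover by blast
      then show "p \<in> (\<Union>(U, \<phi>)\<in>matlas (sub_mfd X S). U)"
        by (intro UN_I[of "(U, \<phi>)"]) auto
    qed
  qed
  show "smooth_in (\<phi> ` (U \<inter> V)) (\<psi> \<circ> inv_into U \<phi>)"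
    if U: "(U, \<phi>) \<in> matlas (sub_mfd X S)" and V: "(V, \<psi>) \<in> matlas (sub_mfd X S)" for U \<phi> V \<psi>
  proof -
    have "smooth_map_on euclid_mfd euclid_mfd (\<phi> ` (U \<inter> V)) (\<lambda>x. \<psi> (inv_into U \<phi> x))"
      by (rule smooth_compose[OF manifold_euclid X, where T = V])
        (use U V is_chartD(3)[OF c[OF U]] in \<open>auto simp: matlas_sub_mfd intro: smooth_map_on_subset\<close>)
    then show ?thesis
      by (simp add: smooth_map_on_euclid_euclid o_def)
  qed
qed

section \<open>Curves up to first order\<close>

text \<open>Coordinate expressions are differentiable only within a chart image, which may lie in a
  proper subspace, so the chain rule is applied along the times at which the curve is in
  \<open>A\<close>.\<close>

lemma has_vector_derivative_along_curve:
  fixes c :: "real \<Rightarrow> 'a::real_normed_vector" and f :: "'a \<Rightarrow> 'b::real_normed_vector"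
  assumes f: "(f has_derivative D) (at (c 0) within A)" and c: "(c has_vector_derivative u) (at 0)"
    and A: "eventually (\<lambda>t. c t \<in> A) (at 0)"
  shows "((\<lambda>t. f (c t)) has_vector_derivative D u) (at 0)"
proof -
  obtain N where N: "open N" "0 \<in> N" "\<And>t. t \<in> N \<Longrightarrow> t \<noteq> 0 \<Longrightarrow> c t \<in> A"
    using A unfolding eventually_at_topological by blast
  \<comment> \<open>The curve is known to lie in \<open>A\<close> only at nonzero times close to 0;
    deleting 0 leaves the filter at 0 unchanged.\<close>
  define S where "S = N - {0}"
  have eq: "at 0 within S = at 0"
    using N(1,2) by (intro at_within_nhd[of 0 N]) (auto simp: S_def)
  have "(c has_derivative (\<lambda>t. t *\<^sub>R u)) (at 0 within S)"
    using c by (simp add: has_vector_derivative_def has_derivative_at_withinI)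
  moreover have "(f has_derivative D) (at (c 0) within c ` S)"
    using f by (rule has_derivative_subset) (use N(3) in \<open>auto simp: S_def\<close>)
  ultimately have "((\<lambda>t. f (c t)) has_derivative (\<lambda>t. D (t *\<^sub>R u))) (at 0 within S)"
    by (rule has_derivative_in_compose)
  moreover have "D (t *\<^sub>R u) = t *\<^sub>R D u" for t
    using f by (meson has_derivative_bounded_linear bounded_linear.linear linear_scale)
  ultimately show ?thesis
    by (simp add: eq has_vector_derivative_def)
qed

text \<open>The difference quotients lie in \<open>L\<close>, which is closed because the dimension
  is finite.\<close>

lemma velocity_in_subspace:
  fixes c :: "real \<Rightarrow> 'a::euclidean_space"
  assumes "subspace L" "eventually (\<lambda>t. c t \<in> L) (at 0)" "c 0 \<in> L" "(c has_vector_derivative v) (at 0)"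
  shows "v \<in> L"
proof -
  have "((\<lambda>t. (c t - c 0) /\<^sub>R t) \<longlongrightarrow> v) (at 0)"
  proof -
    have "((\<lambda>t. (1 / norm t) *\<^sub>R (c t - (c 0 + t *\<^sub>R v))) \<longlongrightarrow> 0) (at 0)"
      using assms(4) by (simp add: has_vector_derivative_def has_derivative_within)
    then have "((\<lambda>t. norm ((1 / norm t) *\<^sub>R (c t - (c 0 + t *\<^sub>R v)))) \<longlongrightarrow> 0) (at 0)"
      by (rule tendsto_norm_zero)
    moreover have "norm ((1 / norm t) *\<^sub>R (c t - (c 0 + t *\<^sub>R v))) = norm ((c t - c 0) /\<^sub>R t - v)" if "t \<noteq> 0" for t
    proof -
      have "(c t - c 0) /\<^sub>R t - v = (1 / t) *\<^sub>R (c t - (c 0 + t *\<^sub>R v))"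
        using that by (simp add: algebra_simps divide_inverse)
      then show ?thesis by simp
    qed
    then have "eventually (\<lambda>t. norm ((1 / norm t) *\<^sub>R (c t - (c 0 + t *\<^sub>R v))) = norm ((c t - c 0) /\<^sub>R t - v)) (at 0)"
      by (simp add: eventually_at_filter)
    ultimately have "((\<lambda>t. norm ((c t - c 0) /\<^sub>R t - v)) \<longlongrightarrow> 0) (at 0)"
      by (rule Lim_transform_eventually)
    then show ?thesis
      by (rule Lim_null[THEN iffD2, OF tendsto_norm_zero_cancel])
  qed
  moreover have "eventually (\<lambda>t. (c t - c 0) /\<^sub>R t \<in> L) (at 0)"
    using assms(2) by eventually_elim (use assms(1,3) in \<open>auto intro: subspace_scale subspace_diff\<close>)
  ultimately show ?thesis
    by (intro Lim_in_closed_set[OF closed_subspace[OF assms(1)]]) auto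
qed

text \<open>Contact of first order at time 0. The curves are arbitrary functions near 0,
  differentiable only at 0, and \<open>tangent Y \<gamma> \<gamma>\<close> expresses just this
  differentiability. One chart witnesses the relation; \<open>tangent_image_chart\<close> passes to
  others.\<close>

definition tangent :: "('q, 'w::euclidean_space) mfd \<Rightarrow> (real \<Rightarrow> 'q) \<Rightarrow> (real \<Rightarrow> 'q) \<Rightarrow> bool" where
  "tangent Y \<gamma> \<delta> \<longleftrightarrow> \<gamma> 0 = \<delta> 0 \<and>
     (\<exists>V \<psi> v. (V, \<psi>) \<in> matlas Y \<and> \<gamma> 0 \<in> V \<and> eventually (\<lambda>t. \<gamma> t \<in> V \<and> \<delta> t \<in> V) (at 0) \<and>
        ((\<lambda>t. \<psi> (\<gamma> t)) has_vector_derivative v) (at 0) \<and> ((\<lambda>t. \<psi> (\<delta> t)) has_vector_derivative v) (at 0))"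

lemma tangentE:
  assumes "tangent Y \<gamma> \<delta>"
  obtains V \<psi> v where "(V, \<psi>) \<in> matlas Y" "\<gamma> 0 \<in> V" "\<delta> 0 = \<gamma> 0" "eventually (\<lambda>t. \<gamma> t \<in> V) (at 0)"
    "eventually (\<lambda>t. \<delta> t \<in> V) (at 0)"
    "((\<lambda>t. \<psi> (\<gamma> t)) has_vector_derivative v) (at 0)" "((\<lambda>t. \<psi> (\<delta> t)) has_vector_derivative v) (at 0)"
proof -
  obtain V \<psi> v where *: "\<gamma> 0 = \<delta> 0" "(V, \<psi>) \<in> matlas Y" "\<gamma> 0 \<in> V" "eventually (\<lambda>t. \<gamma> t \<in> V \<and> \<delta> t \<in> V) (at 0)"
    "((\<lambda>t. \<psi> (\<gamma> t)) has_vector_derivative v) (at 0)" "((\<lambda>t. \<psi> (\<delta> t)) has_vector_derivative v) (at 0)"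
    using assms unfolding tangent_def by (elim conjE exE)
  show thesis
    by (rule that[OF *(2,3) *(1)[symmetric] _ _ *(5,6)]) (use *(4) in \<open>auto elim: eventually_mono\<close>)
qed

lemma tangentI:
  assumes "(V, \<psi>) \<in> matlas Y" "\<gamma> 0 \<in> V" "\<delta> 0 = \<gamma> 0" "eventually (\<lambda>t. \<gamma> t \<in> V) (at 0)"
    "eventually (\<lambda>t. \<delta> t \<in> V) (at 0)"
    "((\<lambda>t. \<psi> (\<gamma> t)) has_vector_derivative v) (at 0)" "((\<lambda>t. \<psi> (\<delta> t)) has_vector_derivative v) (at 0)"
  shows "tangent Y \<gamma> \<delta>"
  unfolding tangent_def using assms
  by (intro conjI exI[of _ V] exI[of _ \<psi>] exI[of _ v]) (simp_all add: eventually_conj_iff)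

lemma tangent_sym: "tangent Y \<gamma> \<delta> \<Longrightarrow> tangent Y \<delta> \<gamma>"
  by (erule tangentE) (rule tangentI, simp_all)

lemma tangent_left: "tangent Y \<gamma> \<delta> \<Longrightarrow> tangent Y \<gamma> \<gamma>"
  by (erule tangentE) (rule tangentI, simp_all)

lemma has_vector_derivative_cong_at:
  assumes "eventually (\<lambda>t. f t = g t) (at 0)" "f 0 = g 0" "(f has_vector_derivative v) (at 0)"
  shows "(g has_vector_derivative v) (at (0::real))"
proof -
  obtain N where N: "open N" "0 \<in> N" "\<And>t. t \<in> N \<Longrightarrow> t \<noteq> 0 \<Longrightarrow> f t = g t"
    using assms(1) unfolding eventually_at_topological by blast
  have "f t = g t" if "t \<in> N" for t
    using N(3) that assms(2) by (cases "t = 0") auto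
  with assms(3) N(1,2) show ?thesis
    by (rule has_vector_derivative_transform_within_open)
qed

lemma tangent_cong:
  assumes "tangent Y \<gamma> \<delta>" "eventually (\<lambda>t. \<delta> t = \<delta>' t) (at 0)" "\<delta> 0 = \<delta>' 0"
  shows "tangent Y \<gamma> \<delta>'"
  using assms(1)
proof (rule tangentE)
  fix V \<psi> v
  assume *: "(V, \<psi>) \<in> matlas Y" "\<gamma> 0 \<in> V" "\<delta> 0 = \<gamma> 0" "eventually (\<lambda>t. \<gamma> t \<in> V) (at 0)"
    "eventually (\<lambda>t. \<delta> t \<in> V) (at 0)"
    "((\<lambda>t. \<psi> (\<gamma> t)) has_vector_derivative v) (at 0)" "((\<lambda>t. \<psi> (\<delta> t)) has_vector_derivative v) (at 0)"
  have "eventually (\<lambda>t. \<gamma> t \<in> V \<and> \<delta>' t \<in> V) (at 0)"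
    using *(4,5) assms(2) by eventually_elim auto
  moreover have "((\<lambda>t. \<psi> (\<delta>' t)) has_vector_derivative v) (at 0)"
    by (rule has_vector_derivative_cong_at[OF _ _ *(7)])
      (use assms(2,3) in \<open>auto elim: eventually_mono\<close>)
  ultimately show ?thesis
    using * assms(3) by (intro tangentI[OF *(1,2) _ *(4) _ *(6)]) (auto elim: eventually_mono)
qed

text \<open>Differentiability at 0 in a chart gives continuity at 0, although no continuity is
  assumed at other times.\<close>

lemma tangent_eventually:
  assumes Y: "manifold Y" and t: "tangent Y \<gamma> \<delta>" and N: "openin (mtop Y) N" "\<gamma> 0 \<in> N"
  shows "eventually (\<lambda>t. \<gamma> t \<in> N) (at 0)"
proof -
  from t obtain V \<psi> v where *: "(V, \<psi>) \<in> matlas Y" "\<gamma> 0 \<in> V" "eventually (\<lambda>t. \<gamma> t \<in> V) (at 0)"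
    "((\<lambda>t. \<psi> (\<gamma> t)) has_vector_derivative v) (at 0)"
    by (elim tangentE)
  note c = is_chartD[OF manifold.charts[OF Y *(1)]]
  obtain W where W: "open W" "\<psi> ` (V \<inter> N) = \<psi> ` V \<inter> W"
    using c(6)[OF N(1)] by (auto simp: openin_open)
  have "continuous (at 0) (\<lambda>t. \<psi> (\<gamma> t))"
    using *(4) by (rule has_vector_derivative_continuous)
  moreover have "\<psi> (\<gamma> 0) \<in> W" using W(2) *(2) N(2) by blast
  ultimately have "eventually (\<lambda>t. \<psi> (\<gamma> t) \<in> W) (at 0)"
    using W(1) by (auto simp: continuous_within dest: topological_tendstoD)
  with *(3) show ?thesis
  proof eventually_elim
    case (elim t)
    then have "\<psi> (\<gamma> t) \<in> \<psi> ` (V \<inter> N)" using W(2) by blast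
    then show ?case using c(3) elim(1) by (auto dest: inj_onD)
  qed
qed

text \<open>Both curves are fed to one local extension \<open>F\<close> of the coordinate expression
  of \<open>g\<close>, so their images acquire the same velocity, the derivative of \<open>F\<close>
  applied to \<open>v\<close>. The chart of the target is prescribed; taken for the identity map,
  the statement moves velocities from one chart to another.\<close>

lemma tangent_image_chart:
  assumes Y: "manifold Y" and g: "smooth_map_on Y Z T g" and t: "tangent Y \<gamma> \<delta>"
    and T: "\<gamma> 0 \<in> T" "eventually (\<lambda>t. \<gamma> t \<in> T) (at 0)" "eventually (\<lambda>t. \<delta> t \<in> T) (at 0)"
    and W: "(W, \<xi>) \<in> matlas Z" "openin (mtop Z) W" "g (\<gamma> 0) \<in> W"
  obtains w where "eventually (\<lambda>t. g (\<gamma> t) \<in> W) (at 0)" "eventually (\<lambda>t. g (\<delta> t) \<in> W) (at 0)"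
    "((\<lambda>t. \<xi> (g (\<gamma> t))) has_vector_derivative w) (at 0)"
    "((\<lambda>t. \<xi> (g (\<delta> t))) has_vector_derivative w) (at 0)"
proof -
  from t obtain V \<psi> v where V: "(V, \<psi>) \<in> matlas Y" "\<gamma> 0 \<in> V" "\<delta> 0 = \<gamma> 0" "eventually (\<lambda>t. \<gamma> t \<in> V) (at 0)"
    "eventually (\<lambda>t. \<delta> t \<in> V) (at 0)"
    "((\<lambda>t. \<psi> (\<gamma> t)) has_vector_derivative v) (at 0)" "((\<lambda>t. \<psi> (\<delta> t)) has_vector_derivative v) (at 0)"
    by (rule tangentE)
  note c = is_chartD[OF manifold.charts[OF Y V(1)]]
  obtain N where N: "openin (mtop Y) N" "{p \<in> T. g p \<in> W} = T \<inter> N"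
    using smooth_map_on_preimage_open[OF g W(2)] .
  have N0: "\<gamma> 0 \<in> N" using T(1) W(3) N(2) by blast
  define A where "A = \<psi> ` {p \<in> T \<inter> V. g p \<in> W}"
  have "\<psi> (\<gamma> 0) \<in> A" using T(1) V(2) W(3) by (auto simp: A_def)
  from smooth_map_onD(3)[OF g V(1) W(1), folded A_def] this
  obtain P F where P: "open P" "\<psi> (\<gamma> 0) \<in> P" "\<forall>k. Ck_on k P F" "\<forall>x\<in>A \<inter> P. F x = (\<xi> \<circ> g \<circ> inv_into V \<psi>) x"
    by (rule smooth_inE)
  have dF: "(F has_derivative frechet_derivative F (at (\<psi> (\<gamma> 0)))) (at (\<psi> (\<gamma> 0)))"
    using Ck_on_SucD(1)[OF P(3)[rule_format, of "Suc 0"] P(2)] .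
  have key: "eventually (\<lambda>t. g (\<beta> t) \<in> W) (at 0) \<and>
      ((\<lambda>t. \<xi> (g (\<beta> t))) has_vector_derivative frechet_derivative F (at (\<psi> (\<gamma> 0))) v) (at 0)"
    if \<beta>: "\<beta> 0 = \<gamma> 0" "eventually (\<lambda>t. \<beta> t \<in> V) (at 0)" "eventually (\<lambda>t. \<beta> t \<in> T) (at 0)"
      "((\<lambda>t. \<psi> (\<beta> t)) has_vector_derivative v) (at 0)" "tangent Y \<beta> \<beta>" for \<beta>
  proof
    have "eventually (\<lambda>t. \<beta> t \<in> N) (at 0)"
      using tangent_eventually[OF Y \<beta>(5) N(1)] N0 \<beta>(1) by simp
    with \<beta>(3) show ev: "eventually (\<lambda>t. g (\<beta> t) \<in> W) (at 0)"
      by eventually_elim (use N(2) in blast)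
    have "eventually (\<lambda>t. \<psi> (\<beta> t) \<in> P) (at 0)"
      using has_vector_derivative_continuous[OF \<beta>(4)] P(1,2) \<beta>(1)
      by (auto simp: continuous_within dest: topological_tendstoD)
    with \<beta>(2,3) ev have "eventually (\<lambda>t. F (\<psi> (\<beta> t)) = \<xi> (g (\<beta> t))) (at 0)"
      by eventually_elim (use P(4) c(3) in \<open>auto simp: A_def\<close>)
    moreover have "F (\<psi> (\<beta> 0)) = \<xi> (g (\<beta> 0))"
      using P(2,4) \<open>\<psi> (\<gamma> 0) \<in> A\<close> c(3) V(2) \<beta>(1) by auto
    moreover have "((\<lambda>t. F (\<psi> (\<beta> t))) has_vector_derivative frechet_derivative F (at (\<psi> (\<gamma> 0))) v) (at 0)"
      by (rule has_vector_derivative_along_curve[where A = UNIV]) (use dF \<beta> in auto)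
    ultimately show "((\<lambda>t. \<xi> (g (\<beta> t))) has_vector_derivative frechet_derivative F (at (\<psi> (\<gamma> 0))) v) (at 0)"
      by (rule has_vector_derivative_cong_at)
  qed
  show thesis
    using that key[of \<gamma>] key[of \<delta>] V T tangent_left[OF t] tangent_left[OF tangent_sym[OF t]] by blast
qed

lemma tangent_image:
  assumes Y: "manifold Y" and Z: "manifold Z" and g: "smooth_map_on Y Z T g" and t: "tangent Y \<gamma> \<delta>"
    and T: "\<gamma> 0 \<in> T" "eventually (\<lambda>t. \<gamma> t \<in> T) (at 0)" "eventually (\<lambda>t. \<delta> t \<in> T) (at 0)"
  shows "tangent Z (\<lambda>t. g (\<gamma> t)) (\<lambda>t. g (\<delta> t))"
proof -
  obtain W \<xi> where W: "(W, \<xi>) \<in> matlas Z" "g (\<gamma> 0) \<in> W"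
    using manifold.chart_at[OF Z smooth_map_on_in[OF g T(1)]] by blast
  have "\<gamma> 0 = \<delta> 0" using t by (simp add: tangent_def)
  obtain w where "eventually (\<lambda>t. g (\<gamma> t) \<in> W) (at 0)" "eventually (\<lambda>t. g (\<delta> t) \<in> W) (at 0)"
    "((\<lambda>t. \<xi> (g (\<gamma> t))) has_vector_derivative w) (at 0)"
    "((\<lambda>t. \<xi> (g (\<delta> t))) has_vector_derivative w) (at 0)"
    using tangent_image_chart[OF Y g t T W(1) is_chartD(1)[OF manifold.charts[OF Z W(1)]] W(2)] .
  with W \<open>\<gamma> 0 = \<delta> 0\<close> show ?thesis
    by (intro tangentI[OF W(1)]) simp_all
qed

lemma tangent_Pair:
  assumes "tangent X \<gamma> \<gamma>'" "tangent Y \<delta> \<delta>'"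
  shows "tangent (prod_mfd X Y) (\<lambda>t. (\<gamma> t, \<delta> t)) (\<lambda>t. (\<gamma>' t, \<delta>' t))"
proof -
  from assms(1) obtain V \<psi> v where V: "(V, \<psi>) \<in> matlas X" "\<gamma> 0 \<in> V" "\<gamma>' 0 = \<gamma> 0" "eventually (\<lambda>t. \<gamma> t \<in> V) (at 0)"
    "eventually (\<lambda>t. \<gamma>' t \<in> V) (at 0)"
    "((\<lambda>t. \<psi> (\<gamma> t)) has_vector_derivative v) (at 0)" "((\<lambda>t. \<psi> (\<gamma>' t)) has_vector_derivative v) (at 0)"
    by (rule tangentE)
  from assms(2) obtain W \<xi> w where W: "(W, \<xi>) \<in> matlas Y" "\<delta> 0 \<in> W" "\<delta>' 0 = \<delta> 0" "eventually (\<lambda>t. \<delta> t \<in> W) (at 0)"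
    "eventually (\<lambda>t. \<delta>' t \<in> W) (at 0)"
    "((\<lambda>t. \<xi> (\<delta> t)) has_vector_derivative w) (at 0)" "((\<lambda>t. \<xi> (\<delta>' t)) has_vector_derivative w) (at 0)"
    by (rule tangentE)
  have "eventually (\<lambda>t. (\<gamma> t, \<delta> t) \<in> V \<times> W) (at 0)" "eventually (\<lambda>t. (\<gamma>' t, \<delta>' t) \<in> V \<times> W) (at 0)"
    using V(4) W(4) V(5) W(5) by (eventually_elim, auto)+
  moreover have "((\<lambda>t. map_prod \<psi> \<xi> (\<gamma> t, \<delta> t)) has_vector_derivative (v, w)) (at 0)"
    "((\<lambda>t. map_prod \<psi> \<xi> (\<gamma>' t, \<delta>' t)) has_vector_derivative (v, w)) (at 0)"
    using V(6,7) W(6,7) by (simp_all add: has_vector_derivative_Pair)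
  ultimately show ?thesis
    using V(2,3) W(2,3) by (intro tangentI[OF matlas_prodI[OF V(1) W(1)]]) simp_all
qed

text \<open>Straight lines in a chart realize every vector \<open>u\<close> of the model space as a
  velocity. They remain in the chart for small times because its image is relatively open in
  \<open>L\<close>.\<close>

lemma line_curve:
  assumes X: "manifold X" and U: "(U, \<phi>) \<in> matlas X" "p \<in> U" and L: "models L U \<phi>" "u \<in> L"
    and \<delta>_def: "\<delta> = (\<lambda>t. inv_into U \<phi> (\<phi> p + t *\<^sub>R u))"
  shows "\<delta> 0 = p" "tangent X \<delta> \<delta>" "eventually (\<lambda>t. \<phi> p + t *\<^sub>R u \<in> \<phi> ` U) (at 0)"
    "eventually (\<lambda>t. \<phi> (\<delta> t) = \<phi> p + t *\<^sub>R u) (at 0)"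
    "((\<lambda>t. \<phi> p + t *\<^sub>R u) has_vector_derivative u) (at 0)"
    "((\<lambda>t. \<phi> (\<delta> t)) has_vector_derivative u) (at 0)"
    "eventually (\<lambda>t. \<delta> t \<in> U) (at 0)"
proof -
  note c = is_chartD[OF manifold.charts[OF X U(1)]]
  show d0: "\<delta> 0 = p" using c(3) U(2) by (simp add: \<delta>_def)
  obtain P where P: "open P" "\<phi> ` U = L \<inter> P"
    using L(1) by (auto simp: models_def openin_open)
  show der: "((\<lambda>t. \<phi> p + t *\<^sub>R u) has_vector_derivative u) (at 0)"
    by (auto intro!: derivative_eq_intros)
  have "((\<lambda>t. \<phi> p + t *\<^sub>R u) \<longlongrightarrow> \<phi> p) (at 0)"
    using has_vector_derivative_continuous[OF der] by (simp add: continuous_within)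
  moreover have "\<phi> p \<in> P" using P(2) U(2) by blast
  ultimately have "eventually (\<lambda>t. \<phi> p + t *\<^sub>R u \<in> P) (at 0)"
    using P(1) topological_tendstoD by blast
  moreover have "\<phi> p + t *\<^sub>R u \<in> L" for t
    using P(2) U(2) L by (intro subspace_add subspace_scale) (auto simp: models_def)
  ultimately show ev: "eventually (\<lambda>t. \<phi> p + t *\<^sub>R u \<in> \<phi> ` U) (at 0)"
    using P(2) by (auto elim: eventually_mono)
  then show e: "eventually (\<lambda>t. \<phi> (\<delta> t) = \<phi> p + t *\<^sub>R u) (at 0)"
    by eventually_elim (simp add: \<delta>_def f_inv_into_f)
  from ev show U': "eventually (\<lambda>t. \<delta> t \<in> U) (at 0)"
    by eventually_elim (simp add: \<delta>_def inv_into_into)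
  show d: "((\<lambda>t. \<phi> (\<delta> t)) has_vector_derivative u) (at 0)"
    by (rule has_vector_derivative_cong_at[OF _ _ der]) (use e d0 in \<open>auto elim: eventually_mono\<close>)
  show "tangent X \<delta> \<delta>"
    using U(2) d0 by (intro tangentI[OF U(1) _ _ U' U' d d]) simp_all
qed

section \<open>Submersions\<close>

text \<open>The velocity \<open>v\<close> of \<open>\<gamma>\<close> lies in the model space
  \<open>L'\<close>, so surjectivity of \<open>D\<close> yields \<open>u\<close> in \<open>L\<close>
  with \<open>D u = v\<close>. The line with velocity \<open>u\<close> is the lift; it covers
  \<open>\<gamma>\<close> only to first order.\<close>

lemma submersion_lift:
  assumes X: "manifold X" and Y: "manifold Y" and f: "submersion X Y f" and p: "p \<in> mcar X"
    and \<gamma>: "tangent Y \<gamma> \<gamma>" "\<gamma> 0 = f p"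
  obtains \<delta> where "\<delta> 0 = p" "tangent X \<delta> \<delta>" "tangent Y (\<lambda>t. f (\<delta> t)) \<gamma>"
proof -
  have sm: "smooth_map X Y f" using f by (simp add: submersion_def)
  obtain U \<phi> V \<psi> L L' D where U: "(U, \<phi>) \<in> matlas X" "p \<in> U" and V: "(V, \<psi>) \<in> matlas Y" "f p \<in> V"
    and L: "models L U \<phi>" "models L' V \<psi>" "D ` L = L'"
    and D: "((\<psi> \<circ> f \<circ> inv_into U \<phi>) has_derivative D) (at (\<phi> p) within \<phi> ` {q \<in> U. f q \<in> V})"
    using f p unfolding submersion_def by fast
  note cU = is_chartD[OF manifold.charts[OF X U(1)]] and cV = is_chartD[OF manifold.charts[OF Y V(1)]]
  have id: "smooth_map_on Y Y (mcar Y) (\<lambda>y. y)"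
    using manifold.smooth_ident[OF Y] by simp
  have inY: "eventually (\<lambda>t. \<gamma> t \<in> mcar Y) (at 0)" "\<gamma> 0 \<in> mcar Y"
    using tangent_eventually[OF Y \<gamma>(1), of "mcar Y"] smooth_map_on_in[OF sm p] \<gamma>(2) by auto
  obtain v where v: "eventually (\<lambda>t. \<gamma> t \<in> V) (at 0)" "((\<lambda>t. \<psi> (\<gamma> t)) has_vector_derivative v) (at 0)"
    by (rule tangent_image_chart[OF Y id \<gamma>(1) inY(2,1,1) V(1) cV(1)]) (use V(2) \<gamma>(2) in auto)
  have "v \<in> L'"
    by (rule velocity_in_subspace[OF _ _ _ v(2)])
      (use L(2) v(1) V(2) \<gamma>(2) in \<open>auto simp: models_def elim!: eventually_mono dest!: openin_imp_subset\<close>)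
  then obtain u where u: "u \<in> L" "D u = v" using L(3) by blast
  define \<delta> where "\<delta> = (\<lambda>t. inv_into U \<phi> (\<phi> p + t *\<^sub>R u))"
  note lc = line_curve[OF X U L(1) u(1) \<delta>_def]
  have inX: "eventually (\<lambda>t. \<delta> t \<in> mcar X) (at 0)" "\<delta> 0 \<in> mcar X"
    using lc(7) cU(2) p lc(1) by (auto elim!: eventually_mono)
  obtain w where "eventually (\<lambda>t. f (\<delta> t) \<in> V) (at 0)"
    by (rule tangent_image_chart[OF X sm lc(2) inX(2,1,1) V(1) cV(1)]) (use V(2) lc(1) in auto)
  with lc(7) have "eventually (\<lambda>t. \<delta> t \<in> {q \<in> U. f q \<in> V}) (at 0)"
    by eventually_elim auto
  then have A: "eventually (\<lambda>t. \<phi> (\<delta> t) \<in> \<phi> ` {q \<in> U. f q \<in> V}) (at 0)"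
    by eventually_elim auto
  from has_vector_derivative_along_curve[OF _ lc(6) A, of "\<psi> \<circ> f \<circ> inv_into U \<phi>" D]
  have "((\<lambda>t. (\<psi> \<circ> f \<circ> inv_into U \<phi>) (\<phi> (\<delta> t))) has_vector_derivative v) (at 0)"
    using D lc(1) u(2) by simp
  then have "((\<lambda>t. \<psi> (f (\<delta> t))) has_vector_derivative v) (at 0)"
    by (rule has_vector_derivative_cong_at[rotated 2])
      (use lc(7,1) cU(3) U(2) u(2) in \<open>auto elim: eventually_mono\<close>)
  then have "tangent Y (\<lambda>t. f (\<delta> t)) \<gamma>"
    using V(2) lc(1) \<gamma>(2) \<open>eventually (\<lambda>t. f (\<delta> t) \<in> V) (at 0)\<close> v by (intro tangentI[OF V(1)]) simp_all
  with lc(1,2) show thesis by (rule that)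
qed

text \<open>Any charts around \<open>p\<close> and \<open>f p\<close> will do. Lines through
  \<open>p\<close> show that \<open>D\<close> maps \<open>L\<close> into \<open>L'\<close>; lifting
  lines through \<open>f p\<close> and comparing velocities in the chosen charts shows that every
  vector of \<open>L'\<close> is reached.\<close>

lemma submersionI:
  assumes X: "manifold X" and Y: "manifold Y" and sm: "smooth_map X Y f"
    and lift: "\<And>p \<gamma>. p \<in> mcar X \<Longrightarrow> tangent Y \<gamma> \<gamma> \<Longrightarrow> \<gamma> 0 = f p \<Longrightarrow>
      \<exists>\<delta>. \<delta> 0 = p \<and> tangent X \<delta> \<delta> \<and> tangent Y (\<lambda>t. f (\<delta> t)) \<gamma>"
  shows "submersion X Y f"
  unfolding submersion_def
proof (intro conjI ballI sm)
  fix p assume p: "p \<in> mcar X"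
  obtain U \<phi> where U: "(U, \<phi>) \<in> matlas X" "p \<in> U" using manifold.chart_at[OF X p] by blast
  obtain V \<psi> where V: "(V, \<psi>) \<in> matlas Y" "f p \<in> V"
    using manifold.chart_at[OF Y smooth_map_on_in[OF sm p]] by blast
  note cU = is_chartD[OF manifold.charts[OF X U(1)]] and cV = is_chartD[OF manifold.charts[OF Y V(1)]]
  obtain L where L: "models L U \<phi>" using manifold.charts[OF X U(1)] by (auto simp: is_chart_def)
  obtain L' where L': "models L' V \<psi>" using manifold.charts[OF Y V(1)] by (auto simp: is_chart_def)
  define A where "A = \<phi> ` {q \<in> U. f q \<in> V}"
  have A: "A = \<phi> ` {q \<in> mcar X \<inter> U. f q \<in> V}" and pA: "\<phi> p \<in> A"
    using cU(2) U V by (auto simp: A_def)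
  from smooth_map_onD(3)[OF sm U(1) V(1), folded A] pA
  obtain P F where P: "open P" "\<phi> p \<in> P" "\<forall>k. Ck_on k P F" "\<forall>x\<in>A \<inter> P. F x = (\<psi> \<circ> f \<circ> inv_into U \<phi>) x"
    by (rule smooth_inE)
  \<comment> \<open>\<open>F\<close> is some local extension of the coordinate expression. The
    values of \<open>D\<close> outside \<open>L\<close> depend on the choice of \<open>F\<close>,
    but \<open>D\<close> is only evaluated on \<open>L\<close>.\<close>
  define D where "D = frechet_derivative F (at (\<phi> p))"
  have "(F has_derivative D) (at (\<phi> p))"
    using Ck_on_SucD(1)[OF P(3)[rule_format, of "Suc 0"] P(2)] by (simp add: D_def)
  then have dF: "(F has_derivative D) (at (\<phi> p) within A)"
    by (rule has_derivative_at_withinI)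
  obtain d where d: "d > 0" "ball (\<phi> p) d \<subseteq> P" using P(1,2) openE by blast
  have D: "((\<psi> \<circ> f \<circ> inv_into U \<phi>) has_derivative D) (at (\<phi> p) within A)"
    by (rule has_derivative_transform_within[OF dF d(1) pA]) (use P(4) d(2) in \<open>auto simp: dist_commute subset_iff\<close>)
  have along: "((\<lambda>t. \<psi> (f (\<delta> t))) has_vector_derivative D u) (at 0)"
    if \<delta>: "\<delta> 0 = p" "eventually (\<lambda>t. \<delta> t \<in> U) (at 0)" "eventually (\<lambda>t. f (\<delta> t) \<in> V) (at 0)"
      "((\<lambda>t. \<phi> (\<delta> t)) has_vector_derivative u) (at 0)" for \<delta> u
  proof -
    have "eventually (\<lambda>t. \<phi> (\<delta> t) \<in> A) (at 0)"
      using \<delta>(2,3) by eventually_elim (auto simp: A_def)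
    from has_vector_derivative_along_curve[OF _ \<delta>(4) this, of "\<psi> \<circ> f \<circ> inv_into U \<phi>" D]
    have "((\<lambda>t. (\<psi> \<circ> f \<circ> inv_into U \<phi>) (\<phi> (\<delta> t))) has_vector_derivative D u) (at 0)"
      using D \<delta>(1) by simp
    then show ?thesis
      by (rule has_vector_derivative_cong_at[rotated 2])
        (use \<delta> cU(3) U(2) in \<open>auto elim: eventually_mono\<close>)
  qed
  have inX: "eventually (\<lambda>t. \<delta> t \<in> mcar X) (at 0)" "\<delta> 0 \<in> mcar X" if "tangent X \<delta> \<delta>" "\<delta> 0 = p" for \<delta>
    using tangent_eventually[OF X that(1), of "mcar X"] p that(2) by auto
  have sub: "subspace L" "subspace L'" "\<phi> ` U \<subseteq> L" "\<psi> ` V \<subseteq> L'"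
    using L L' by (auto simp: models_def dest: openin_imp_subset)
  have "D ` L = L'"
  proof safe
    fix u assume u: "u \<in> L"
    define \<delta> where "\<delta> = (\<lambda>t. inv_into U \<phi> (\<phi> p + t *\<^sub>R u))"
    note lc = line_curve[OF X U L(1) u \<delta>_def]
    obtain w where w: "eventually (\<lambda>t. f (\<delta> t) \<in> V) (at 0)"
      by (rule tangent_image_chart[OF X sm lc(2) inX(2,1,1)[OF lc(2,1)] V(1) cV(1)]) (use V(2) lc(1) in auto)
    show "D u \<in> L'"
      by (rule velocity_in_subspace[OF sub(2) _ _ along[OF lc(1,7) w lc(6)]])
        (use w sub(4) V(2) lc(1) in \<open>auto elim!: eventually_mono\<close>)
  next
    fix v assume v: "v \<in> L'"
    define \<gamma> where "\<gamma> = (\<lambda>t. inv_into V \<psi> (\<psi> (f p) + t *\<^sub>R v))"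
    note lc = line_curve[OF Y V L'(1) v \<gamma>_def]
    obtain \<delta> where \<delta>: "\<delta> 0 = p" "tangent X \<delta> \<delta>" "tangent Y (\<lambda>t. f (\<delta> t)) \<gamma>"
      using lift[OF p lc(2,1)] by blast
    \<comment> \<open>\<open>tangent\<close> provides a velocity in some chart; smoothness of the
      identity moves it to the charts chosen here.\<close>
    have idX: "smooth_map_on X X (mcar X) (\<lambda>y. y)" and idY: "smooth_map_on Y Y (mcar Y) (\<lambda>y. y)"
      using manifold.smooth_ident[OF X] manifold.smooth_ident[OF Y] by simp_all
    obtain u where u: "eventually (\<lambda>t. \<delta> t \<in> U) (at 0)" "((\<lambda>t. \<phi> (\<delta> t)) has_vector_derivative u) (at 0)"
      by (rule tangent_image_chart[OF X idX \<delta>(2) inX(2,1,1)[OF \<delta>(2,1)] U(1) cU(1)]) (use U(2) \<delta>(1) in auto)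
    have inY: "eventually (\<lambda>t. f (\<delta> t) \<in> mcar Y) (at 0)" "eventually (\<lambda>t. \<gamma> t \<in> mcar Y) (at 0)" "f (\<delta> 0) \<in> mcar Y"
      subgoal using inX(1)[OF \<delta>(2,1)] by eventually_elim (rule smooth_map_on_in[OF sm])
      subgoal using lc(7) by eventually_elim (use cV(2) in blast)
      subgoal using smooth_map_on_in[OF sm p] \<delta>(1) by simp
      done
    obtain w where w: "eventually (\<lambda>t. f (\<delta> t) \<in> V) (at 0)"
      "((\<lambda>t. \<psi> (f (\<delta> t))) has_vector_derivative w) (at 0)" "((\<lambda>t. \<psi> (\<gamma> t)) has_vector_derivative w) (at 0)"
      by (rule tangent_image_chart[OF Y idY \<delta>(3) inY(3,1,2) V(1) cV(1)]) (use V(2) \<delta>(1) in auto)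
    have "w = v" using w(3) lc(6) vector_derivative_unique_at by blast
    moreover have "D u = w"
      using along[OF \<delta>(1) u(1) w(1) u(2)] w(2) vector_derivative_unique_at by blast
    moreover have "u \<in> L"
      by (rule velocity_in_subspace[OF sub(1) _ _ u(2)])
        (use u(1) sub(3) U(2) \<delta>(1) in \<open>auto elim!: eventually_mono\<close>)
    ultimately show "v \<in> D ` L" by blast
  qed
  then show "\<exists>(U, \<phi>)\<in>matlas X. \<exists>(V, \<psi>)\<in>matlas Y. p \<in> U \<and> f p \<in> V \<and>
        (\<exists>L L' D. models L U \<phi> \<and> models L' V \<psi> \<and>
           ((\<psi> \<circ> f \<circ> inv_into U \<phi>) has_derivative D) (at (\<phi> p) within \<phi> ` {q \<in> U. f q \<in> V}) \<and> D ` L = L')"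
    using L L' D U V unfolding A_def
    by (intro bexI[of _ "(U, \<phi>)"] bexI[of _ "(V, \<psi>)"]) auto
qed

section \<open>Smooth maps built from smooth maps\<close>

text \<open>An equality of structures and not only a diffeomorphism, both atlases consisting of the
  identity alone. Maps into a product of Euclidean spaces thus fall under
  \<open>smooth_Pair\<close>.\<close>

lemma prod_euclid_mfd: "prod_mfd euclid_mfd euclid_mfd = euclid_mfd"
  by (simp add: prod_mfd_def euclid_mfd_def map_prod.id)

lemma smooth_fst_comp:
  assumes "manifold X" "manifold Y" "manifold Z" "smooth_map_on X (prod_mfd Y Z) S f"
  shows "smooth_map_on X Y S (\<lambda>x. fst (f x))"
  by (rule smooth_compose[OF assms(1) manifold_prod[OF assms(2,3)] smooth_fst[OF assms(2,3) order_refl] assms(4)])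
    (use smooth_map_on_in[OF assms(4)] in \<open>auto simp del: mem_Sigma_iff simp: image_subset_iff\<close>)

lemma smooth_snd_comp:
  assumes "manifold X" "manifold Y" "manifold Z" "smooth_map_on X (prod_mfd Y Z) S f"
  shows "smooth_map_on X Z S (\<lambda>x. snd (f x))"
  by (rule smooth_compose[OF assms(1) manifold_prod[OF assms(2,3)] smooth_snd[OF assms(2,3) order_refl] assms(4)])
    (use smooth_map_on_in[OF assms(4)] in \<open>auto simp del: mem_Sigma_iff simp: image_subset_iff\<close>)

lemma smooth_compose2:
  assumes "manifold X" "manifold Y" "manifold Z" "smooth_map_on (prod_mfd Y Z) W T (\<lambda>(y, z). h y z)"
    and "smooth_map_on X Y S f" "smooth_map_on X Z S g" "\<And>x. x \<in> S \<Longrightarrow> (f x, g x) \<in> T"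
  shows "smooth_map_on X W S (\<lambda>x. h (f x) (g x))"
  using smooth_compose[OF assms(1) manifold_prod[OF assms(2,3)] assms(4) smooth_Pair[OF assms(5,6)]] assms(7)
  by auto

lemma smooth_map_to_euclidD:
  "smooth_map_on X euclid_mfd S f \<Longrightarrow> (U, \<phi>) \<in> matlas X \<Longrightarrow> smooth_in (\<phi> ` (S \<inter> U)) (f \<circ> inv_into U \<phi>)"
  unfolding smooth_map_on_to_euclid by blast

lemma smooth_euclid_add:
  assumes "smooth_map_on X euclid_mfd S f" "smooth_map_on X euclid_mfd S g"
  shows "smooth_map_on X euclid_mfd S (\<lambda>x. f x + g x)"
proof -
  have "smooth_in (\<phi> ` (S \<inter> U)) ((\<lambda>x. f x + g x) \<circ> inv_into U \<phi>)" if "(U, \<phi>) \<in> matlas X" for U \<phi>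
    using smooth_in_add[OF smooth_map_to_euclidD[OF assms(1) that] smooth_map_to_euclidD[OF assms(2) that]]
    by (simp add: o_def)
  then show ?thesis
    using assms by (auto simp: smooth_map_on_to_euclid intro: continuous_map_add)
qed

lemma smooth_euclid_scaleR:
  assumes "smooth_map_on X euclid_mfd S f"
  shows "smooth_map_on X euclid_mfd S (\<lambda>x. a *\<^sub>R f x)"
proof -
  have "smooth_in (\<phi> ` (S \<inter> U)) ((\<lambda>x. a *\<^sub>R f x) \<circ> inv_into U \<phi>)" if "(U, \<phi>) \<in> matlas X" for U \<phi>
    using smooth_in_compose[OF smooth_map_to_euclidD[OF assms that] smooth_in_linear[of "\<lambda>x. a *\<^sub>R x"], of UNIV]
    by (simp add: o_def bounded_linear_scaleR_right)
  moreover have "continuous_map (subtopology (mtop X) S) euclidean ((\<lambda>x. a *\<^sub>R x) \<circ> f)"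
    by (rule continuous_map_compose[where X' = euclidean])
      (use assms in \<open>auto simp: smooth_map_on_to_euclid intro!: continuous_intros\<close>)
  then have "continuous_map (subtopology (mtop X) S) euclidean (\<lambda>x. a *\<^sub>R f x)"
    by (simp add: o_def)
  ultimately show ?thesis
    using assms by (auto simp: smooth_map_on_to_euclid)
qed

section \<open>Fibres of vector bundles\<close>

text \<open>A linear injection of a fibre into the model space, which reduces identities between elements
  of a fibre to identities between vectors.\<close>

definition crd :: "('p, 'v::euclidean_space, 'b, 'z) vb_scheme \<Rightarrow> 'b \<Rightarrow> 'p \<Rightarrow> 'v" where
  "crd E x = (SOME \<Phi>. inj_on \<Phi> (fibre E x) \<and>
     (\<forall>p\<in>fibre E x. \<forall>q\<in>fibre E x. \<Phi> (vadd E p q) = \<Phi> p + \<Phi> q) \<and>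
     (\<forall>a. \<forall>p\<in>fibre E x. \<Phi> (vscl E a p) = a *\<^sub>R \<Phi> p))"

lemma trivializationD:
  assumes "trivialization B E U F \<Phi>"
  shows "openin (mtop B) U" "subspace F"
    and "x \<in> U \<Longrightarrow> bij_betw \<Phi> (fibre E x) F"
    and "x \<in> U \<Longrightarrow> p \<in> fibre E x \<Longrightarrow> q \<in> fibre E x \<Longrightarrow> \<Phi> (vadd E p q) = \<Phi> p + \<Phi> q"
    and "x \<in> U \<Longrightarrow> p \<in> fibre E x \<Longrightarrow> \<Phi> (vscl E a p) = a *\<^sub>R \<Phi> p"
    and "smooth_map_on (tot E) euclid_mfd {p \<in> mcar (tot E). prj E p \<in> U} \<Phi>"
    and "smooth_map_on (prod_mfd B euclid_mfd) (tot E) (U \<times> F) (\<lambda>(x, v). inv_into (fibre E x) \<Phi> v)"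
  using assms unfolding trivialization_def by blast+

context vector_bundle
begin

lemma fibreD: "p \<in> fibre E x \<Longrightarrow> x \<in> mcar B" "p \<in> fibre E x \<Longrightarrow> p \<in> mcar (tot E)" "p \<in> fibre E x \<Longrightarrow> prj E p = x"
  using smooth_map_on_in[OF prj_smooth] by (auto simp: fibre_def)

lemma fibreI: "p \<in> mcar (tot E) \<Longrightarrow> p \<in> fibre E (prj E p)"
  by (simp add: fibre_def)

lemma
  shows vadd_in: "p \<in> fibre E x \<Longrightarrow> q \<in> fibre E x \<Longrightarrow> vadd E p q \<in> fibre E x"
    and vscl_in: "p \<in> fibre E x \<Longrightarrow> vscl E a p \<in> fibre E x"
    and vsub_in: "p \<in> fibre E x \<Longrightarrow> q \<in> fibre E x \<Longrightarrow> vsub E p q \<in> fibre E x"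
  unfolding vsub_def by (meson add_closed scale_closed fibreD)+

lemma crd_props:
  assumes "x \<in> mcar B"
  shows "inj_on (crd E x) (fibre E x) \<and>
     (\<forall>p\<in>fibre E x. \<forall>q\<in>fibre E x. crd E x (vadd E p q) = crd E x p + crd E x q) \<and>
     (\<forall>a. \<forall>p\<in>fibre E x. crd E x (vscl E a p) = a *\<^sub>R crd E x p)"
proof -
  obtain U F \<Phi> where U: "x \<in> U" "trivialization B E U F \<Phi>"
    using locally_trivial[OF assms] by blast
  note t = trivializationD[OF U(2)]
  show ?thesis
    unfolding crd_def
    by (rule someI[where x = \<Phi>]) (use t(4,5)[OF U(1)] bij_betw_imp_inj_on[OF t(3)[OF U(1)]] in blast)
qed

lemma
  shows crd_inj: "p \<in> fibre E x \<Longrightarrow> q \<in> fibre E x \<Longrightarrow> crd E x p = crd E x q \<Longrightarrow> p = q"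
    and crd_add [simp]: "p \<in> fibre E x \<Longrightarrow> q \<in> fibre E x \<Longrightarrow> crd E x (vadd E p q) = crd E x p + crd E x q"
    and crd_scl [simp]: "p \<in> fibre E x \<Longrightarrow> crd E x (vscl E a p) = a *\<^sub>R crd E x p"
  using crd_props[OF fibreD(1)] by (blast dest: inj_onD)+

lemma crd_sub [simp]: "p \<in> fibre E x \<Longrightarrow> q \<in> fibre E x \<Longrightarrow> crd E x (vsub E p q) = crd E x p - crd E x q"
  by (simp add: vsub_def vscl_in)

lemma crd_zero [simp]: "x \<in> mcar B \<Longrightarrow> crd E x (vzero E x) = 0"
  using add_zero[of x "vzero E x"] crd_add[of "vzero E x" x "vzero E x"] zero_closed[of x] by simp

lemma vzero_unique: "p \<in> fibre E x \<Longrightarrow> vadd E p p = p \<Longrightarrow> p = vzero E x"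
  by (rule crd_inj) (use zero_closed fibreD crd_add[of p x p] in auto)

lemma vscl_0: "p \<in> fibre E x \<Longrightarrow> vscl E 0 p = vzero E x"
  by (rule crd_inj) (use zero_closed fibreD vscl_in in auto)

lemma vscl_vzero: "x \<in> mcar B \<Longrightarrow> vscl E a (vzero E x) = vzero E x"
  by (rule crd_inj) (use zero_closed vscl_in in auto)

lemma vadd_vzero_left: "p \<in> fibre E x \<Longrightarrow> vadd E (vzero E x) p = p"
  by (rule crd_inj) (use zero_closed fibreD vadd_in in auto)

lemma vadd_vzero_right: "p \<in> fibre E x \<Longrightarrow> vadd E p (vzero E x) = p"
  by (rule crd_inj) (use zero_closed fibreD vadd_in in auto)

lemma vsub_vadd_cancel: "p \<in> fibre E x \<Longrightarrow> q \<in> fibre E x \<Longrightarrow> vadd E (vsub E p q) q = p"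
  by (rule crd_inj) (use vsub_in vadd_in in auto)

lemma vsub_eq_vzero: "p \<in> fibre E x \<Longrightarrow> q \<in> fibre E x \<Longrightarrow> vsub E p q = vzero E x \<longleftrightarrow> p = q"
  using crd_inj[of p x q] crd_sub[of p x q] crd_zero[of x] fibreD(1)[of p x] add_neg[of x p]
  by (metis eq_iff_diff_eq_0)

lemma prj_smooth_comp:
  assumes "manifold X" "smooth_map_on X (tot E) S f"
  shows "smooth_map_on X B S (\<lambda>x. prj E (f x))"
  by (rule smooth_compose[OF assms(1) total_manifold prj_smooth assms(2)])
    (use smooth_map_on_in[OF assms(2)] in auto)

text \<open>Reduces smoothness of \<open>h\<close> to pieces of \<open>S\<close> over which the base
  point map \<open>b\<close> stays in one trivializing open set. The fibre operations are all
  treated in this way.\<close>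

lemma smooth_local_triv:
  assumes X: "manifold X" and b: "smooth_map_on X B S b"
    and loc: "\<And>U F \<Phi> T. trivialization B E U F \<Phi> \<Longrightarrow> T \<subseteq> S \<Longrightarrow> (\<And>x. x \<in> T \<Longrightarrow> b x \<in> U) \<Longrightarrow> smooth_map_on X Y T h"
  shows "smooth_map_on X Y S h"
proof (rule smooth_map_on_local[OF manifold_charted[OF X]])
  fix p assume p: "p \<in> S"
  obtain U F \<Phi> where U: "b p \<in> U" "trivialization B E U F \<Phi>"
    using locally_trivial smooth_map_on_in[OF b p] by blast
  obtain N where N: "openin (mtop X) N" "{q \<in> S. b q \<in> U} = S \<inter> N"
    using smooth_map_on_preimage_open[OF b trivializationD(1)[OF U(2)]] .
  have "smooth_map_on X Y (S \<inter> N) h"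
    by (rule loc[OF U(2)]) (use N(2) in blast)+
  moreover have "p \<in> N" using N(2) p U(1) by blast
  ultimately show "\<exists>N. openin (mtop X) N \<and> p \<in> N \<and> smooth_map_on X Y (S \<inter> N) h"
    using N(1) by blast
qed

lemma smooth_triv:
  assumes "trivialization B E U F \<Phi>" "manifold X" "smooth_map_on X (tot E) S f" "\<And>x. x \<in> S \<Longrightarrow> prj E (f x) \<in> U"
  shows "smooth_map_on X euclid_mfd S (\<lambda>x. \<Phi> (f x))"
  by (rule smooth_compose[OF assms(2) total_manifold trivializationD(6)[OF assms(1)] assms(3)])
    (use smooth_map_on_in[OF assms(3)] assms(4) in auto)

lemma smooth_triv_inv:
  assumes "trivialization B E U F \<Phi>" "manifold X" "smooth_map_on X B S b" "\<And>x. x \<in> S \<Longrightarrow> b x \<in> U"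
    and "smooth_map_on X euclid_mfd S v" "\<And>x. x \<in> S \<Longrightarrow> v x \<in> F"
  shows "smooth_map_on X (tot E) S (\<lambda>x. inv_into (fibre E (b x)) \<Phi> (v x))"
  by (rule smooth_compose2[OF assms(2) base_manifold manifold_euclid trivializationD(7)[OF assms(1)] assms(3,5)])
    (use assms(4,6) in auto)

lemma triv_inv:
  assumes "trivialization B E U F \<Phi>" "x \<in> U"
  shows "p \<in> fibre E x \<Longrightarrow> inv_into (fibre E x) \<Phi> (\<Phi> p) = p"
    and "p \<in> fibre E x \<Longrightarrow> \<Phi> p \<in> F"
    and "v \<in> F \<Longrightarrow> inv_into (fibre E x) \<Phi> v \<in> fibre E x"
    and "v \<in> F \<Longrightarrow> \<Phi> (inv_into (fibre E x) \<Phi> v) = v"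
  using trivializationD(3)[OF assms]
  by (auto simp: bij_betw_def inv_into_into f_inv_into_f)

text \<open>Smoothness of the fibre operations is not an axiom of \<open>vector_bundle\<close>. In a
  trivialization the sum is addition in the subspace \<open>F\<close>, and the inverse
  trivialization is jointly smooth in base point and vector.\<close>

lemma smooth_vadd:
  assumes X: "manifold X" and f: "smooth_map_on X (tot E) S f" and g: "smooth_map_on X (tot E) S g"
    and eq: "\<And>x. x \<in> S \<Longrightarrow> prj E (g x) = prj E (f x)"
  shows "smooth_map_on X (tot E) S (\<lambda>x. vadd E (f x) (g x))"
proof (rule smooth_local_triv[OF X prj_smooth_comp[OF X f]])
  fix U F \<Phi> T
  assume t: "trivialization B E U F \<Phi>" and T: "T \<subseteq> S" "\<And>x. x \<in> T \<Longrightarrow> prj E (f x) \<in> U"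
  note f' = smooth_map_on_subset[OF f T(1)] and g' = smooth_map_on_subset[OF g T(1)]
  note tD = trivializationD[OF t] and tI = triv_inv[OF t]
  have fib: "f x \<in> fibre E (prj E (f x))" "g x \<in> fibre E (prj E (f x))" if "x \<in> T" for x
    using smooth_map_on_in[OF f' that] smooth_map_on_in[OF g' that] eq that T(1)
    by (auto simp: fibre_def)
  have inF: "\<Phi> (f x) \<in> F" "\<Phi> (g x) \<in> F" if "x \<in> T" for x
    using tI(2)[OF T(2)[OF that]] fib[OF that] by auto
  have "smooth_map_on X (tot E) T (\<lambda>x. inv_into (fibre E (prj E (f x))) \<Phi> (\<Phi> (f x) + \<Phi> (g x)))"
    by (rule smooth_triv_inv[OF t X prj_smooth_comp[OF X f'] _
        smooth_euclid_add[OF smooth_triv[OF t X f'] smooth_triv[OF t X g']]])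
      (use T eq inF subspace_add[OF tD(2)] in \<open>auto simp: subset_iff\<close>)
  then show "smooth_map_on X (tot E) T (\<lambda>x. vadd E (f x) (g x))"
    by (rule smooth_map_on_cong[rotated, OF _ manifold_charted[OF X]])
      (use T(2) fib tD(4) tI(1) vadd_in in metis)
qed

lemma smooth_vscl:
  assumes X: "manifold X" and f: "smooth_map_on X (tot E) S f"
  shows "smooth_map_on X (tot E) S (\<lambda>x. vscl E a (f x))"
proof (rule smooth_local_triv[OF X prj_smooth_comp[OF X f]])
  fix U F \<Phi> T
  assume t: "trivialization B E U F \<Phi>" and T: "T \<subseteq> S" "\<And>x. x \<in> T \<Longrightarrow> prj E (f x) \<in> U"
  note f' = smooth_map_on_subset[OF f T(1)]
  note tD = trivializationD[OF t] and tI = triv_inv[OF t]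
  have fib: "f x \<in> fibre E (prj E (f x))" if "x \<in> T" for x
    using smooth_map_on_in[OF f' that] by (auto simp: fibre_def)
  have inF: "\<Phi> (f x) \<in> F" if "x \<in> T" for x
    using tI(2)[OF T(2)[OF that]] fib[OF that] by auto
  have "smooth_map_on X (tot E) T (\<lambda>x. inv_into (fibre E (prj E (f x))) \<Phi> (a *\<^sub>R \<Phi> (f x)))"
    by (rule smooth_triv_inv[OF t X prj_smooth_comp[OF X f'] _
        smooth_euclid_scaleR[OF smooth_triv[OF t X f']]])
      (use T inF subspace_scale[OF tD(2)] in \<open>auto simp: subset_iff\<close>)
  then show "smooth_map_on X (tot E) T (\<lambda>x. vscl E a (f x))"
    by (rule smooth_map_on_cong[rotated, OF _ manifold_charted[OF X]])
      (use T(2) fib tD(5) tI(1) vscl_in in metis)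
qed

lemma smooth_vsub:
  assumes X: "manifold X" and f: "smooth_map_on X (tot E) S f" and g: "smooth_map_on X (tot E) S g"
    and eq: "\<And>x. x \<in> S \<Longrightarrow> prj E (g x) = prj E (f x)"
  shows "smooth_map_on X (tot E) S (\<lambda>x. vsub E (f x) (g x))"
  unfolding vsub_def
proof (rule smooth_vadd[OF X f smooth_vscl[OF X g]])
  fix x assume x: "x \<in> S"
  then have "vscl E (- 1) (g x) \<in> fibre E (prj E (g x))"
    using smooth_map_on_in[OF g x] by (intro vscl_in fibreI)
  then show "prj E (vscl E (- 1) (g x)) = prj E (f x)"
    using eq[OF x] by (simp add: fibre_def)
qed

lemma smooth_vzero:
  assumes X: "manifold X" and b: "smooth_map_on X B S b"
  shows "smooth_map_on X (tot E) S (\<lambda>x. vzero E (b x))"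
proof (rule smooth_local_triv[OF X b])
  fix U F \<Phi> T
  assume t: "trivialization B E U F \<Phi>" and T: "T \<subseteq> S" "\<And>x. x \<in> T \<Longrightarrow> b x \<in> U"
  note b' = smooth_map_on_subset[OF b T(1)]
  note tD = trivializationD[OF t] and tI = triv_inv[OF t]
  have sm: "smooth_map_on X (tot E) T (\<lambda>x. inv_into (fibre E (b x)) \<Phi> 0)"
    by (rule smooth_triv_inv[OF t X b' T(2) smooth_const])
      (use smooth_map_onD(1)[OF b'] subspace_0[OF tD(2)] in auto)
  have eq: "inv_into (fibre E (b x)) \<Phi> 0 = vzero E (b x)" if "x \<in> T" for x
  proof -
    have z: "vzero E (b x) \<in> fibre E (b x)"
      using smooth_map_on_in[OF b' that] by (rule zero_closed)
    then have "\<Phi> (vzero E (b x)) = 0"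
      using tD(5)[OF T(2)[OF that] z, of 0] vscl_0[OF z] by simp
    then show ?thesis using tI(1)[OF T(2)[OF that] z] by simp
  qed
  show "smooth_map_on X (tot E) T (\<lambda>x. vzero E (b x))"
    by (rule smooth_map_on_cong[OF eq sm manifold_charted[OF X]])
qed

text \<open>Prepares \<open>kmul_scl\<close>, where a real scalar is varied inside a single
  fibre.\<close>

lemma continuous_scaling:
  assumes p: "p \<in> fibre E x"
  shows "continuous_map (euclidean :: real topology) (mtop (tot E)) (\<lambda>a. vscl E a p)"
proof -
  obtain U F \<Phi> where U: "x \<in> U" "trivialization B E U F \<Phi>"
    using locally_trivial fibreD(1)[OF p] by blast
  note tD = trivializationD[OF U(2)] and tI = triv_inv[OF U(2,1)]
  have "smooth_map_on (euclid_mfd :: (real, real) mfd) (tot E) UNIV (\<lambda>a. inv_into (fibre E x) \<Phi> (a *\<^sub>R \<Phi> p))"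
    by (rule smooth_triv_inv[OF U(2) manifold_euclid smooth_const])
      (use fibreD(1)[OF p] U(1) tI(2)[OF p] subspace_scale[OF tD(2)] in
        \<open>auto simp: smooth_map_on_euclid_euclid smooth_in_linear bounded_linear_scaleR_left\<close>)
  moreover have "inv_into (fibre E x) \<Phi> (a *\<^sub>R \<Phi> p) = vscl E a p" for a
    using tD(5)[OF U(1) p] tI(1)[OF vscl_in[OF p]] by metis
  ultimately show ?thesis
    using smooth_map_onD(2) by fastforce
qed

end

lemma fibre_linearD:
  assumes "fibre_linear E x E' x' f"
  shows "p \<in> fibre E x \<Longrightarrow> f p \<in> fibre E' x'"
    and "p \<in> fibre E x \<Longrightarrow> q \<in> fibre E x \<Longrightarrow> f (vadd E p q) = vadd E' (f p) (f q)"
    and "p \<in> fibre E x \<Longrightarrow> f (vscl E a p) = vscl E' a (f p)"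
  using assms unfolding fibre_linear_def by blast+

lemma fibre_linear_vsub:
  assumes "vector_bundle B E" "fibre_linear E x E' x' f" "p \<in> fibre E x" "q \<in> fibre E x"
  shows "f (vsub E p q) = vsub E' (f p) (f q)"
  using fibre_linearD[OF assms(2)] assms(3,4) vector_bundle.vscl_in[OF assms(1)]
  by (simp add: vsub_def)

text \<open>\<open>fibre_linear\<close> does not mention zero vectors, so zero is written as the
  scalar 0 times itself.\<close>

lemma fibre_linear_vzero:
  assumes "vector_bundle B E" "vector_bundle B' E'" "fibre_linear E x E' x' f" "x \<in> mcar B"
  shows "f (vzero E x) = vzero E' x'"
proof -
  have z: "vzero E x \<in> fibre E x" using assms(1,4) by (rule vector_bundle.zero_closed)
  have "f (vzero E x) = f (vscl E 0 (vzero E x))"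
    using vector_bundle.vscl_0[OF assms(1) z] by simp
  also have "\<dots> = vzero E' x'"
    using fibre_linearD(1,3)[OF assms(3) z] vector_bundle.vscl_0[OF assms(2)] by simp
  finally show ?thesis .
qed

section \<open>Additive maps along scalings\<close>

text \<open>Cauchy's functional equation: additivity gives the formula at rational arguments, and
  continuity of both sides extends it to the closure of the rationals.\<close>

lemma additive_continuous_linear:
  fixes f :: "real \<Rightarrow> 'a::real_normed_vector"
  assumes add: "\<And>a b. f (a + b) = f a + f b" and cont: "continuous_on UNIV f"
  shows "f a = a *\<^sub>R f 1"
proof -
  have f0: "f 0 = 0" using add[of 0 0] by simp
  have neg: "f (- a) = - f a" for a using add[of a "- a"] f0 by (simp add: eq_neg_iff_add_eq_0 add.commute)
  have nat: "f (real n * a) = real n *\<^sub>R f a" for n a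
    by (induction n) (simp_all add: f0 add algebra_simps)
  have int: "f (of_int k * a) = of_int k *\<^sub>R f a" for k a
    by (cases k rule: int_cases2) (simp_all add: nat neg)
  have rat: "f (of_rat r) = of_rat r *\<^sub>R f 1" for r
  proof (cases r)
    case (Fract m n)
    then have r: "of_rat r = (of_int m / of_int n :: real)"
      by (simp add: of_rat_rat)
    have "of_int n *\<^sub>R f (of_rat r) = of_int m *\<^sub>R f 1"
      using int[of n "of_rat r"] int[of m 1] Fract(2) by (simp add: r)
    then have "(1 / of_int n) *\<^sub>R (of_int n *\<^sub>R f (of_rat r)) = (1 / of_int n) *\<^sub>R (of_int m *\<^sub>R f 1)"
      by simp
    then show ?thesis using Fract(2) by (simp add: r)
  qed
  have "closed {a. f a = a *\<^sub>R f 1}"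
    by (rule closed_Collect_eq) (auto intro!: continuous_intros cont)
  moreover have "\<rat> \<subseteq> {a. f a = a *\<^sub>R f 1}"
    using rat by (auto simp: Rats_def)
  ultimately have "closure \<rat> \<subseteq> {a. f a = a *\<^sub>R f 1}"
    by (rule closure_minimal[rotated])
  then show ?thesis by (auto simp: Rats_closure_real)
qed

section \<open>Lie groupoids\<close>

lemma submersion_smooth: "submersion X Y f \<Longrightarrow> smooth_map X Y f"
  by (simp add: submersion_def)

context lie_groupoid
begin

lemmas src_smooth = submersion_smooth[OF src_submersion]
lemmas tgt_smooth = submersion_smooth[OF tgt_submersion]

lemma
  shows src_in: "g \<in> Arr G \<Longrightarrow> src G g \<in> Obj G"
    and tgt_in: "g \<in> Arr G \<Longrightarrow> tgt G g \<in> Obj G"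
    and unt_in: "x \<in> Obj G \<Longrightarrow> unt G x \<in> Arr G"
    and inv_in: "g \<in> Arr G \<Longrightarrow> ginv G g \<in> Arr G"
    and mul_in: "(g\<^sub>1, g\<^sub>2) \<in> composable G \<Longrightarrow> mul G g\<^sub>1 g\<^sub>2 \<in> Arr G"
  using smooth_map_on_in[OF src_smooth] smooth_map_on_in[OF tgt_smooth] smooth_map_on_in[OF unt_smooth]
    smooth_map_on_in[OF inv_smooth] smooth_map_on_in[OF mul_smooth] by auto

lemma composableI: "g\<^sub>1 \<in> Arr G \<Longrightarrow> g\<^sub>2 \<in> Arr G \<Longrightarrow> src G g\<^sub>1 = tgt G g\<^sub>2 \<Longrightarrow> (g\<^sub>1, g\<^sub>2) \<in> composable G"
  by (simp add: composable_def)

lemma composableD: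
  "(g\<^sub>1, g\<^sub>2) \<in> composable G \<Longrightarrow> g\<^sub>1 \<in> Arr G"
  "(g\<^sub>1, g\<^sub>2) \<in> composable G \<Longrightarrow> g\<^sub>2 \<in> Arr G"
  "(g\<^sub>1, g\<^sub>2) \<in> composable G \<Longrightarrow> src G g\<^sub>1 = tgt G g\<^sub>2"
  by (simp_all add: composable_def)

text \<open>Multiply \<open>g g = g\<close> by the inverse of \<open>g\<close> on the left. Applied
  to the total groupoid, this recognizes the zero vectors over units as unit arrows.\<close>

lemma idempotent_unt:
  assumes "(g, g) \<in> composable G" "mul G g g = g"
  shows "g = unt G (src G g)"
proof -
  have g: "g \<in> Arr G" and st: "src G g = tgt G g" using assms(1) by (auto simp: composable_def)
  have c: "(ginv G g, g) \<in> composable G"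
    using g by (intro composableI inv_in) (simp_all add: src_inv)
  have "mul G (mul G (ginv G g) g) g = mul G (ginv G g) g"
    using mul_assoc[OF c assms(1)] assms(2) by simp
  then show ?thesis
    using inv_left[OF g] mul_unt_left[OF g] st by simp
qed

end

section \<open>The algebra of VB-groupoids with horizontal lifts\<close>

lemma total_lgpd_simps [simp]:
  "arr (total_lgpd E \<Gamma>) = tot \<Gamma>" "obj (total_lgpd E \<Gamma>) = tot E" "src (total_lgpd E \<Gamma>) = tsrc \<Gamma>"
  "tgt (total_lgpd E \<Gamma>) = ttgt \<Gamma>" "mul (total_lgpd E \<Gamma>) = tmul \<Gamma>" "unt (total_lgpd E \<Gamma>) = tunt \<Gamma>"
  "ginv (total_lgpd E \<Gamma>) = tinv \<Gamma>"
  by (simp_all add: total_lgpd_def)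

text \<open>\<open>vb_groupoid_hl\<close> is a predicate; the locale around it makes the two
  groupoids and the three vector bundles available under the prefixes \<open>G\<close>,
  \<open>K\<close>, \<open>EB\<close>, \<open>CB\<close> and \<open>GB\<close>.\<close>

locale lifted_vb_groupoid =
  fixes G :: "('g, 'gv::euclidean_space, 'm, 'mv::euclidean_space) lgpd"
    and E :: "('e, 'ev::euclidean_space, 'm) vb"
    and C :: "('c, 'cv::euclidean_space, 'm) vb"
    and \<Gamma> :: "('k, 'kv::euclidean_space, 'g, 'e, 'c) vbgh"
  assumes hl: "vb_groupoid_hl G E C \<Gamma>"
begin

lemma vbg: "vb_groupoid G E \<Gamma>" and core_id: "core_identification G E C \<Gamma> (cemb \<Gamma>)"
  and lift: "horizontal_lift G E \<Gamma> (hlift \<Gamma>)"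
  using hl by (simp_all add: vb_groupoid_hl_def)

sublocale VB: vb_groupoid G E \<Gamma> by (rule vbg)
sublocale G: lie_groupoid G by (rule VB.base_groupoid)
sublocale K: lie_groupoid "total_lgpd E \<Gamma>" by (rule VB.total_groupoid)
sublocale EB: vector_bundle "obj G" E by (rule VB.side_bundle)
sublocale CB: vector_bundle "obj G" C using hl by (simp add: vb_groupoid_hl_def)
sublocale GB: vector_bundle "arr G" \<Gamma> by (rule VB.total_bundle)

abbreviation "\<kappa> \<equiv> cemb \<Gamma>"
abbreviation "h \<equiv> hlift \<Gamma>"
abbreviation "z \<equiv> vzero \<Gamma>"
abbreviation kmul (infixl "\<cdot>" 72) where "kmul \<equiv> tmul \<Gamma>"
abbreviation kadd (infixl "\<oplus>" 67) where "kadd \<equiv> vadd \<Gamma>"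
abbreviation ksub (infixl "\<ominus>" 67) where "ksub \<equiv> vsub \<Gamma>"

lemma src_linear: "g \<in> Arr G \<Longrightarrow> fibre_linear \<Gamma> g E (src G g) (tsrc \<Gamma>)"
  and tgt_linear: "g \<in> Arr G \<Longrightarrow> fibre_linear \<Gamma> g E (tgt G g) (ttgt \<Gamma>)"
  using VB.src_morphism VB.tgt_morphism by (simp_all add: vb_morphism_def)

lemma arr_of: "\<gamma> \<in> fibre \<Gamma> g \<Longrightarrow> g \<in> Arr G"
  by (rule GB.fibreD)

lemma
  assumes "\<gamma> \<in> fibre \<Gamma> g"
  shows tsrc_in: "tsrc \<Gamma> \<gamma> \<in> fibre E (src G g)" and ttgt_in: "ttgt \<Gamma> \<gamma> \<in> fibre E (tgt G g)"
  using fibre_linearD(1)[OF src_linear assms] fibre_linearD(1)[OF tgt_linear assms] arr_of[OF assms] by auto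

lemma
  assumes "\<gamma> \<in> fibre \<Gamma> g" "\<gamma>' \<in> fibre \<Gamma> g"
  shows tsrc_add: "tsrc \<Gamma> (\<gamma> \<oplus> \<gamma>') = vadd E (tsrc \<Gamma> \<gamma>) (tsrc \<Gamma> \<gamma>')"
    and ttgt_add: "ttgt \<Gamma> (\<gamma> \<oplus> \<gamma>') = vadd E (ttgt \<Gamma> \<gamma>) (ttgt \<Gamma> \<gamma>')"
    and tsrc_sub: "tsrc \<Gamma> (\<gamma> \<ominus> \<gamma>') = vsub E (tsrc \<Gamma> \<gamma>) (tsrc \<Gamma> \<gamma>')"
    and ttgt_sub: "ttgt \<Gamma> (\<gamma> \<ominus> \<gamma>') = vsub E (ttgt \<Gamma> \<gamma>) (ttgt \<Gamma> \<gamma>')"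
    and tsrc_scl: "tsrc \<Gamma> (vscl \<Gamma> a \<gamma>) = vscl E a (tsrc \<Gamma> \<gamma>)"
    and ttgt_scl: "ttgt \<Gamma> (vscl \<Gamma> a \<gamma>) = vscl E a (ttgt \<Gamma> \<gamma>)"
  using src_linear[OF arr_of[OF assms(1)]] tgt_linear[OF arr_of[OF assms(1)]] assms
  by (simp_all add: fibre_linearD fibre_linear_vsub[OF GB.vector_bundle_axioms])

lemma
  assumes "g \<in> Arr G"
  shows z_in: "z g \<in> fibre \<Gamma> g"
    and tsrc_z: "tsrc \<Gamma> (z g) = vzero E (src G g)" and ttgt_z: "ttgt \<Gamma> (z g) = vzero E (tgt G g)"
  using GB.zero_closed fibre_linear_vzero[OF GB.vector_bundle_axioms EB.vector_bundle_axioms]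
    src_linear tgt_linear assms by auto

lemma
  assumes "\<gamma>\<^sub>1 \<in> fibre \<Gamma> g\<^sub>1" "\<gamma>\<^sub>2 \<in> fibre \<Gamma> g\<^sub>2" "tsrc \<Gamma> \<gamma>\<^sub>1 = ttgt \<Gamma> \<gamma>\<^sub>2"
  shows comp_K: "(\<gamma>\<^sub>1, \<gamma>\<^sub>2) \<in> composable (total_lgpd E \<Gamma>)"
    and mul_fibre: "\<gamma>\<^sub>1 \<cdot> \<gamma>\<^sub>2 \<in> fibre \<Gamma> (mul G g\<^sub>1 g\<^sub>2)"
    and tsrc_mul: "tsrc \<Gamma> (\<gamma>\<^sub>1 \<cdot> \<gamma>\<^sub>2) = tsrc \<Gamma> \<gamma>\<^sub>2"
    and ttgt_mul: "ttgt \<Gamma> (\<gamma>\<^sub>1 \<cdot> \<gamma>\<^sub>2) = ttgt \<Gamma> \<gamma>\<^sub>1"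
proof -
  show K: "(\<gamma>\<^sub>1, \<gamma>\<^sub>2) \<in> composable (total_lgpd E \<Gamma>)"
    using assms GB.fibreD(2) by (auto simp: composable_def)
  have "\<gamma>\<^sub>1 \<cdot> \<gamma>\<^sub>2 \<in> mcar (tot \<Gamma>)" using K.mul_in[OF K] by simp
  moreover have "prj \<Gamma> (\<gamma>\<^sub>1 \<cdot> \<gamma>\<^sub>2) = mul G (prj \<Gamma> \<gamma>\<^sub>1) (prj \<Gamma> \<gamma>\<^sub>2)"
    using VB.prj_morphism K unfolding lgpd_morphism_def by fastforce
  ultimately show "\<gamma>\<^sub>1 \<cdot> \<gamma>\<^sub>2 \<in> fibre \<Gamma> (mul G g\<^sub>1 g\<^sub>2)"
    using GB.fibreD(3)[OF assms(1)] GB.fibreD(3)[OF assms(2)] by (simp add: fibre_def)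
  show "tsrc \<Gamma> (\<gamma>\<^sub>1 \<cdot> \<gamma>\<^sub>2) = tsrc \<Gamma> \<gamma>\<^sub>2" "ttgt \<Gamma> (\<gamma>\<^sub>1 \<cdot> \<gamma>\<^sub>2) = ttgt \<Gamma> \<gamma>\<^sub>1"
    using K.src_mul[OF K] K.tgt_mul[OF K] by simp_all
qed

lemma kmul_assoc:
  assumes "\<gamma>\<^sub>1 \<in> fibre \<Gamma> g\<^sub>1" "\<gamma>\<^sub>2 \<in> fibre \<Gamma> g\<^sub>2" "\<gamma>\<^sub>3 \<in> fibre \<Gamma> g\<^sub>3"
    "tsrc \<Gamma> \<gamma>\<^sub>1 = ttgt \<Gamma> \<gamma>\<^sub>2" "tsrc \<Gamma> \<gamma>\<^sub>2 = ttgt \<Gamma> \<gamma>\<^sub>3"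
  shows "\<gamma>\<^sub>1 \<cdot> \<gamma>\<^sub>2 \<cdot> \<gamma>\<^sub>3 = \<gamma>\<^sub>1 \<cdot> (\<gamma>\<^sub>2 \<cdot> \<gamma>\<^sub>3)"
  using K.mul_assoc[OF comp_K[OF assms(1,2,4)] comp_K[OF assms(2,3,5)]] by simp

lemma kmul_add:
  assumes "\<gamma>\<^sub>1 \<in> fibre \<Gamma> g\<^sub>1" "\<gamma>\<^sub>2 \<in> fibre \<Gamma> g\<^sub>2" "\<gamma>\<^sub>3 \<in> fibre \<Gamma> g\<^sub>1" "\<gamma>\<^sub>4 \<in> fibre \<Gamma> g\<^sub>2"
    "tsrc \<Gamma> \<gamma>\<^sub>1 = ttgt \<Gamma> \<gamma>\<^sub>2" "tsrc \<Gamma> \<gamma>\<^sub>3 = ttgt \<Gamma> \<gamma>\<^sub>4"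
  shows "(\<gamma>\<^sub>1 \<oplus> \<gamma>\<^sub>3) \<cdot> (\<gamma>\<^sub>2 \<oplus> \<gamma>\<^sub>4) = \<gamma>\<^sub>1 \<cdot> \<gamma>\<^sub>2 \<oplus> \<gamma>\<^sub>3 \<cdot> \<gamma>\<^sub>4"
  using VB.interchange[OF comp_K[OF assms(1,2,5)] comp_K[OF assms(3,4,6)]] assms GB.fibreD(3) by metis

text \<open>Compatibility of the multiplication with scalars is not an axiom: it follows from additivity
  and continuity.\<close>

lemma kmul_scl:
  assumes "\<gamma>\<^sub>1 \<in> fibre \<Gamma> g\<^sub>1" "\<gamma>\<^sub>2 \<in> fibre \<Gamma> g\<^sub>2" "tsrc \<Gamma> \<gamma>\<^sub>1 = ttgt \<Gamma> \<gamma>\<^sub>2"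
  shows "vscl \<Gamma> a \<gamma>\<^sub>1 \<cdot> vscl \<Gamma> a \<gamma>\<^sub>2 = vscl \<Gamma> a (\<gamma>\<^sub>1 \<cdot> \<gamma>\<^sub>2)"
proof -
  define g where "g = mul G g\<^sub>1 g\<^sub>2"
  have sg: "vscl \<Gamma> b \<gamma>\<^sub>1 \<in> fibre \<Gamma> g\<^sub>1" "vscl \<Gamma> b \<gamma>\<^sub>2 \<in> fibre \<Gamma> g\<^sub>2"
    "tsrc \<Gamma> (vscl \<Gamma> b \<gamma>\<^sub>1) = ttgt \<Gamma> (vscl \<Gamma> b \<gamma>\<^sub>2)" for b
    using assms GB.vscl_in tsrc_scl[OF assms(1,1)] ttgt_scl[OF assms(2,2)] by auto
  note m = mul_fibre[OF sg, folded g_def]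
  \<comment> \<open>A trivialization of \<open>\<Gamma>\<close> around \<open>g\<close> turns the
    product of the two scaled arrows into a vector-valued function \<open>f\<close> of the scalar,
    additive by the interchange law.\<close>
  obtain U F \<Phi> where U: "g \<in> U" "trivialization (arr G) \<Gamma> U F \<Phi>"
    using GB.locally_trivial[OF arr_of[OF m]] by blast
  note t = trivializationD[OF U(2)]
  define f where "f = (\<lambda>b. \<Phi> (vscl \<Gamma> b \<gamma>\<^sub>1 \<cdot> vscl \<Gamma> b \<gamma>\<^sub>2))"
  have "f (b + b') = f b + f b'" for b b'
  proof -
    have "vscl \<Gamma> (b + b') \<gamma>\<^sub>1 \<cdot> vscl \<Gamma> (b + b') \<gamma>\<^sub>2 =
        vscl \<Gamma> b \<gamma>\<^sub>1 \<cdot> vscl \<Gamma> b \<gamma>\<^sub>2 \<oplus> vscl \<Gamma> b' \<gamma>\<^sub>1 \<cdot> vscl \<Gamma> b' \<gamma>\<^sub>2"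
      using GB.scale_add_left[OF arr_of[OF assms(1)] assms(1)] GB.scale_add_left[OF arr_of[OF assms(2)] assms(2)]
        kmul_add[OF sg(1,2) sg(1,2) sg(3) sg(3)] by simp
    then show ?thesis
      using t(4)[OF U(1) m m] by (simp add: f_def)
  qed
  moreover have "continuous_on UNIV f"
  proof -
    \<comment> \<open>The multiplication is continuous only as a map on composable pairs, so the two
      scalings are regarded as a curve in that subspace.\<close>
    let ?K = "subtopology (prod_topology (mtop (tot \<Gamma>)) (mtop (tot \<Gamma>))) (composable (total_lgpd E \<Gamma>))"
    have "continuous_map euclidean ?K (\<lambda>b. (vscl \<Gamma> b \<gamma>\<^sub>1, vscl \<Gamma> b \<gamma>\<^sub>2))"
      using GB.continuous_scaling[OF assms(1)] GB.continuous_scaling[OF assms(2)] comp_K[OF sg]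
      by (auto simp: continuous_map_in_subtopology intro: continuous_map_pairedI)
    moreover have "continuous_map ?K (mtop (tot \<Gamma>)) (\<lambda>(p, q). p \<cdot> q)"
      using smooth_map_onD(2)[OF K.mul_smooth] by simp
    ultimately have "continuous_map euclidean (mtop (tot \<Gamma>)) ((\<lambda>(p, q). p \<cdot> q) \<circ> (\<lambda>b. (vscl \<Gamma> b \<gamma>\<^sub>1, vscl \<Gamma> b \<gamma>\<^sub>2)))"
      by (rule continuous_map_compose)
    then have "continuous_map euclidean (subtopology (mtop (tot \<Gamma>)) {p \<in> mcar (tot \<Gamma>). prj \<Gamma> p \<in> U})
        (\<lambda>b. vscl \<Gamma> b \<gamma>\<^sub>1 \<cdot> vscl \<Gamma> b \<gamma>\<^sub>2)"
      using GB.fibreD(2,3)[OF m] U(1) by (auto simp: continuous_map_in_subtopology o_def)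
    from continuous_map_compose[OF this smooth_map_onD(2)[OF t(6)]] show ?thesis
      by (simp add: f_def o_def)
  qed
  ultimately have "f a = a *\<^sub>R f 1"
    by (rule additive_continuous_linear)
  moreover have "vscl \<Gamma> 1 \<gamma>\<^sub>1 \<cdot> vscl \<Gamma> 1 \<gamma>\<^sub>2 = \<gamma>\<^sub>1 \<cdot> \<gamma>\<^sub>2"
    using GB.scale_one[OF arr_of[OF assms(1)] assms(1)] GB.scale_one[OF arr_of[OF assms(2)] assms(2)] by simp
  moreover have g: "\<gamma>\<^sub>1 \<cdot> \<gamma>\<^sub>2 \<in> fibre \<Gamma> g" unfolding g_def by (rule mul_fibre[OF assms])
  ultimately have "\<Phi> (vscl \<Gamma> a \<gamma>\<^sub>1 \<cdot> vscl \<Gamma> a \<gamma>\<^sub>2) = \<Phi> (vscl \<Gamma> a (\<gamma>\<^sub>1 \<cdot> \<gamma>\<^sub>2))"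
    using t(5)[OF U(1) g] by (simp add: f_def)
  then show ?thesis
    using bij_betw_imp_inj_on[OF t(3)[OF U(1)]] m[of a] GB.vscl_in[OF g] by (auto dest: inj_onD)
qed

text \<open>By the interchange law the product equals its own double, and a vector equal to its
  double is zero.\<close>

lemma z_mul:
  assumes "(g\<^sub>1, g\<^sub>2) \<in> composable G"
  shows "z g\<^sub>1 \<cdot> z g\<^sub>2 = z (mul G g\<^sub>1 g\<^sub>2)"
proof (rule GB.vzero_unique)
  note g = G.composableD[OF assms]
  have e: "tsrc \<Gamma> (z g\<^sub>1) = ttgt \<Gamma> (z g\<^sub>2)" using g by (simp add: tsrc_z ttgt_z)
  note zz = z_in[OF g(1)] z_in[OF g(2)]
  show "z g\<^sub>1 \<cdot> z g\<^sub>2 \<in> fibre \<Gamma> (mul G g\<^sub>1 g\<^sub>2)" by (rule mul_fibre[OF zz e])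
  show "z g\<^sub>1 \<cdot> z g\<^sub>2 \<oplus> z g\<^sub>1 \<cdot> z g\<^sub>2 = z g\<^sub>1 \<cdot> z g\<^sub>2"
    using kmul_add[OF zz zz e e] GB.vadd_vzero_left zz by simp
qed

text \<open>By \<open>z_mul\<close> the zero vector over a unit is idempotent for the
  multiplication, hence a unit arrow of the total groupoid, namely the one at its source.\<close>

lemma z_unt:
  assumes "x \<in> Obj G"
  shows "tunt \<Gamma> (vzero E x) = z (unt G x)"
proof -
  have u: "unt G x \<in> Arr G" "src G (unt G x) = x" "tgt G (unt G x) = x"
    using assms by (simp_all add: G.unt_in G.src_unt G.tgt_unt)
  have "mul G (unt G x) (unt G x) = unt G x" using G.mul_unt_left[OF u(1)] u by simp
  then have "z (unt G x) \<cdot> z (unt G x) = z (unt G x)"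
    using z_mul[of "unt G x" "unt G x"] u by (simp add: composable_def)
  moreover have "(z (unt G x), z (unt G x)) \<in> composable (total_lgpd E \<Gamma>)"
    by (rule comp_K[OF z_in z_in]) (use u in \<open>simp_all add: tsrc_z ttgt_z\<close>)
  ultimately show ?thesis
    using K.idempotent_unt[of "z (unt G x)"] u by (simp add: tsrc_z)
qed

lemma kmul_unt_right: "\<gamma> \<in> fibre \<Gamma> g \<Longrightarrow> \<gamma> \<cdot> tunt \<Gamma> (tsrc \<Gamma> \<gamma>) = \<gamma>"
  and kmul_unt_left: "\<gamma> \<in> fibre \<Gamma> g \<Longrightarrow> tunt \<Gamma> (ttgt \<Gamma> \<gamma>) \<cdot> \<gamma> = \<gamma>"
  using K.mul_unt_right K.mul_unt_left GB.fibreD(2) by auto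

lemma kmul_z_right:
  assumes "\<gamma> \<in> fibre \<Gamma> g" "tsrc \<Gamma> \<gamma> = vzero E (src G g)"
  shows "\<gamma> \<cdot> z (unt G (src G g)) = \<gamma>"
  using kmul_unt_right[OF assms(1)] assms(2) z_unt[OF G.src_in[OF arr_of[OF assms(1)]]] by simp

lemma
  assumes "x \<in> Obj G"
  shows \<kappa>_linear: "fibre_linear C x \<Gamma> (unt G x) \<kappa>"
    and \<kappa>_bij: "bij_betw \<kappa> (fibre C x) (core_fibre G E \<Gamma> x)"
  using core_id assms by (simp_all add: core_identification_def vb_morphism_def)

lemma
  assumes "c \<in> fibre C x"
  shows \<kappa>_in: "\<kappa> c \<in> fibre \<Gamma> (unt G x)" and tsrc_\<kappa>: "tsrc \<Gamma> (\<kappa> c) = vzero E x"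
  using bij_betwE[OF \<kappa>_bij[OF CB.fibreD(1)[OF assms]]] assms by (auto simp: core_fibre_def)

text \<open>The core identification is bijective on each fibre. Different fibres of \<open>C\<close>
  go to different fibres of \<open>\<Gamma>\<close>, because \<open>unt\<close> has the left inverse
  \<open>src\<close>.\<close>

lemma \<kappa>_inj: "inj_on \<kappa> (mcar (tot C))"
proof (rule inj_onI)
  fix c c' assume c: "c \<in> mcar (tot C)" "c' \<in> mcar (tot C)" "\<kappa> c = \<kappa> c'"
  note f = CB.fibreI[OF c(1)] CB.fibreI[OF c(2)]
  have "unt G (prj C c) = unt G (prj C c')"
    using GB.fibreD(3)[OF \<kappa>_in[OF f(1)]] GB.fibreD(3)[OF \<kappa>_in[OF f(2)]] c(3) by simp
  then have "prj C c = prj C c'"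
    using G.src_unt CB.fibreD(1)[OF f(1)] CB.fibreD(1)[OF f(2)] by metis
  then show "c = c'"
    using bij_betw_imp_inj_on[OF \<kappa>_bij[OF CB.fibreD(1)[OF f(1)]]] f c(3) by (auto dest: inj_onD)
qed

abbreviation "unk \<equiv> inv_into (mcar (tot C)) \<kappa>"

lemma unk_\<kappa>: "c \<in> fibre C x \<Longrightarrow> unk (\<kappa> c) = c"
  using \<kappa>_inj CB.fibreD(2) by simp

lemma
  assumes "\<gamma> \<in> fibre \<Gamma> (unt G x)" "tsrc \<Gamma> \<gamma> = vzero E x" "x \<in> Obj G"
  shows unk_in: "unk \<gamma> \<in> fibre C x" and \<kappa>_unk: "\<kappa> (unk \<gamma>) = \<gamma>"
proof -
  obtain c where c: "c \<in> fibre C x" "\<gamma> = \<kappa> c"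
    using \<kappa>_bij[OF assms(3)] assms(1,2) by (auto simp: bij_betw_def core_fibre_def image_iff)
  then show "unk \<gamma> \<in> fibre C x" "\<kappa> (unk \<gamma>) = \<gamma>"
    using unk_\<kappa> by simp_all
qed

text \<open>Right translation of core elements by zero vectors. For fixed \<open>g\<close> it is a
  linear isomorphism from the fibre of \<open>C\<close> over \<open>tgt G g\<close> onto the kernel
  of \<open>tsrc\<close> over \<open>g\<close>; equations in \<open>C\<close> are proved by applying
  it to both sides.\<close>

definition kz :: "'c \<Rightarrow> 'g \<Rightarrow> 'k" where "kz c g = \<kappa> c \<cdot> z g"

text \<open>The inverse of \<open>kz\<close> on that kernel, with \<open>unk\<close> leading from
  the core back to the fixed bundle \<open>C\<close>. The components \<open>dC\<close> and
  \<open>Om\<close> of \<open>to_rep2\<close> are values of it.\<close>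

definition cpart :: "'g \<Rightarrow> 'k \<Rightarrow> 'c" where "cpart g \<gamma> = unk (\<gamma> \<cdot> z (ginv G g))"

context
  fixes g assumes g: "g \<in> Arr G"
begin

lemma
  assumes c: "c \<in> fibre C (tgt G g)"
  shows kz_comp: "tsrc \<Gamma> (\<kappa> c) = ttgt \<Gamma> (z g)"
    and kz_in: "kz c g \<in> fibre \<Gamma> g"
    and tsrc_kz: "tsrc \<Gamma> (kz c g) = vzero E (src G g)"
    and ttgt_kz: "ttgt \<Gamma> (kz c g) = ttgt \<Gamma> (\<kappa> c)"
proof -
  note k = \<kappa>_in[OF c] z_in[OF g]
  show e: "tsrc \<Gamma> (\<kappa> c) = ttgt \<Gamma> (z g)" using tsrc_\<kappa>[OF c] ttgt_z[OF g] by simp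
  show "kz c g \<in> fibre \<Gamma> g"
    using mul_fibre[OF k e] G.mul_unt_left[OF g] by (simp add: kz_def)
  show "tsrc \<Gamma> (kz c g) = vzero E (src G g)" "ttgt \<Gamma> (kz c g) = ttgt \<Gamma> (\<kappa> c)"
    using tsrc_mul[OF k e] ttgt_mul[OF k e] tsrc_z[OF g] by (simp_all add: kz_def)
qed

lemma kz_add:
  assumes c: "c \<in> fibre C (tgt G g)" "c' \<in> fibre C (tgt G g)"
  shows "kz (vadd C c c') g = kz c g \<oplus> kz c' g"
  using kmul_add[OF \<kappa>_in[OF c(1)] z_in[OF g] \<kappa>_in[OF c(2)] z_in[OF g] kz_comp[OF c(1)] kz_comp[OF c(2)]]
    fibre_linearD(2)[OF \<kappa>_linear[OF G.tgt_in[OF g]] c] GB.vadd_vzero_left[OF z_in[OF g]]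
  by (simp add: kz_def)

lemma kz_scl:
  assumes c: "c \<in> fibre C (tgt G g)"
  shows "kz (vscl C a c) g = vscl \<Gamma> a (kz c g)"
  using kmul_scl[OF \<kappa>_in[OF c] z_in[OF g] kz_comp[OF c], of a]
    fibre_linearD(3)[OF \<kappa>_linear[OF G.tgt_in[OF g]] c] GB.vscl_vzero[OF g]
  by (simp add: kz_def)

lemma kz_linear: "fibre_linear C (tgt G g) \<Gamma> g (\<lambda>c. kz c g)"
  by (simp add: fibre_linear_def kz_in kz_add kz_scl)

lemmas kz_sub = fibre_linear_vsub[OF CB.vector_bundle_axioms kz_linear]
lemmas kz_vzero = fibre_linear_vzero[OF CB.vector_bundle_axioms GB.vector_bundle_axioms kz_linear G.tgt_in[OF g]]

lemma cpart_kz: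
  assumes c: "c \<in> fibre C (tgt G g)"
  shows "cpart g (kz c g) = c"
proof -
  have i: "ginv G g \<in> Arr G" "tgt G (ginv G g) = src G g"
    using g by (simp_all add: G.inv_in G.tgt_inv)
  have ci: "(g, ginv G g) \<in> composable G" using g i by (simp add: composable_def)
  have "kz c g \<cdot> z (ginv G g) = \<kappa> c \<cdot> (z g \<cdot> z (ginv G g))"
    unfolding kz_def
    by (rule kmul_assoc[OF \<kappa>_in[OF c] z_in[OF g] z_in[OF i(1)] kz_comp[OF c]])
      (use g i in \<open>simp add: tsrc_z ttgt_z\<close>)
  \<comment> \<open>The unit takes this roundabout form to fit \<open>kmul_z_right\<close> at the
    arrow \<open>unt G (tgt G g)\<close>.\<close>
  also have "\<dots> = \<kappa> c \<cdot> z (unt G (src G (unt G (tgt G g))))"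
    using z_mul[OF ci] G.inv_right[OF g] G.src_unt[OF G.tgt_in[OF g]] by simp
  also have "\<dots> = \<kappa> c"
    by (rule kmul_z_right[OF \<kappa>_in[OF c]]) (simp add: tsrc_\<kappa>[OF c] G.src_unt[OF G.tgt_in[OF g]])
  finally show ?thesis
    using unk_\<kappa>[OF c] by (simp add: cpart_def)
qed

text \<open>An arrow with zero source can be multiplied by the zero vector over the inverse of
  \<open>g\<close>, and multiplying by \<open>z g\<close> undoes this. The third claim is kept for
  smoothness: the inverse of \<open>\<kappa>\<close> is known to be smooth exactly on the
  core.\<close>

lemma
  assumes \<gamma>: "\<gamma> \<in> fibre \<Gamma> g" "tsrc \<Gamma> \<gamma> = vzero E (src G g)"
  shows cpart_in: "cpart g \<gamma> \<in> fibre C (tgt G g)" and kz_cpart: "kz (cpart g \<gamma>) g = \<gamma>"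
    and cpart_core: "\<gamma> \<cdot> z (ginv G g) \<in> core_fibre G E \<Gamma> (tgt G g)"
proof -
  have i: "ginv G g \<in> Arr G" "tgt G (ginv G g) = src G g" "src G (ginv G g) = tgt G g"
    using g by (simp_all add: G.inv_in G.tgt_inv G.src_inv)
  have ci: "(ginv G g, g) \<in> composable G" using g i by (simp add: composable_def)
  have e: "tsrc \<Gamma> \<gamma> = ttgt \<Gamma> (z (ginv G g))" using \<gamma>(2) i by (simp add: ttgt_z)
  have m: "\<gamma> \<cdot> z (ginv G g) \<in> fibre \<Gamma> (unt G (tgt G g))"
    using mul_fibre[OF \<gamma>(1) z_in[OF i(1)] e] G.inv_right[OF g] by simp
  have s: "tsrc \<Gamma> (\<gamma> \<cdot> z (ginv G g)) = vzero E (tgt G g)"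
    using tsrc_mul[OF \<gamma>(1) z_in[OF i(1)] e] i by (simp add: tsrc_z)
  show "\<gamma> \<cdot> z (ginv G g) \<in> core_fibre G E \<Gamma> (tgt G g)"
    using m s by (simp add: core_fibre_def)
  show "cpart g \<gamma> \<in> fibre C (tgt G g)"
    unfolding cpart_def by (rule unk_in[OF m s G.tgt_in[OF g]])
  have "kz (cpart g \<gamma>) g = \<gamma> \<cdot> z (ginv G g) \<cdot> z g"
    by (simp add: kz_def cpart_def \<kappa>_unk[OF m s G.tgt_in[OF g]])
  also have "\<dots> = \<gamma> \<cdot> (z (ginv G g) \<cdot> z g)"
    by (rule kmul_assoc[OF \<gamma>(1) z_in[OF i(1)] z_in[OF g] e]) (use g i in \<open>simp add: tsrc_z ttgt_z\<close>)
  also have "\<dots> = \<gamma>"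
    using z_mul[OF ci] G.inv_left[OF g] kmul_z_right[OF \<gamma>] by simp
  finally show "kz (cpart g \<gamma>) g = \<gamma>" .
qed

lemma kz_inj: "c \<in> fibre C (tgt G g) \<Longrightarrow> c' \<in> fibre C (tgt G g) \<Longrightarrow> kz c g = kz c' g \<Longrightarrow> c = c'"
  using cpart_kz by metis

end

lemma
  assumes "g \<in> Arr G"
  shows h_linear: "fibre_linear E (src G g) \<Gamma> g (h g)"
    and tsrc_h: "e \<in> fibre E (src G g) \<Longrightarrow> tsrc \<Gamma> (h g e) = e"
  using lift assms by (simp_all add: horizontal_lift_def)

lemma h_unt: "e \<in> fibre E x \<Longrightarrow> h (unt G x) e = tunt \<Gamma> e"
  using lift EB.fibreD(1) by (simp add: horizontal_lift_def)

lemmas h_in = fibre_linearD(1)[OF h_linear]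
lemmas h_add = fibre_linearD(2)[OF h_linear]
lemmas h_scl = fibre_linearD(3)[OF h_linear]
lemmas h_vzero = fibre_linear_vzero[OF EB.vector_bundle_axioms GB.vector_bundle_axioms h_linear]

end

lemma smooth_compose_map:
  assumes "manifold X" "manifold Y" "smooth_map Y Z g" "smooth_map_on X Y S f"
  shows "smooth_map_on X Z S (\<lambda>x. g (f x))"
  by (rule smooth_compose[OF assms]) (use smooth_map_on_in[OF assms(4)] in auto)

lemma (in lie_groupoid) smooth_mul:
  assumes "manifold X" "smooth_map_on X (arr G) S f" "smooth_map_on X (arr G) S g"
    and "\<And>x. x \<in> S \<Longrightarrow> src G (f x) = tgt G (g x)"
  shows "smooth_map_on X (arr G) S (\<lambda>x. mul G (f x) (g x))"
  by (rule smooth_compose2[OF assms(1) arr_manifold arr_manifold mul_smooth assms(2,3)])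
    (use assms(4) smooth_map_on_in[OF assms(2)] smooth_map_on_in[OF assms(3)] in \<open>simp add: composable_def\<close>)

section \<open>The 4-tuple of a horizontal lift: values and linearity\<close>

context lifted_vb_groupoid
begin

abbreviation "R \<equiv> to_rep2 G E C \<Gamma>"

lemma bd_eq: "c \<in> fibre C x \<Longrightarrow> bd R c = ttgt \<Gamma> (\<kappa> c)"
  using CB.fibreD(2) by (simp add: to_rep2_def Let_def)

lemma dE_eq: "g \<in> Arr G \<Longrightarrow> e \<in> fibre E (src G g) \<Longrightarrow> dE R g e = ttgt \<Gamma> (h g e)"
  by (simp add: to_rep2_def Let_def)

lemma bd_in: "c \<in> fibre C x \<Longrightarrow> bd R c \<in> fibre E x"
  using ttgt_in[OF \<kappa>_in] G.tgt_unt[OF CB.fibreD(1)] by (simp add: bd_eq)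

lemma dE_in: "g \<in> Arr G \<Longrightarrow> e \<in> fibre E (src G g) \<Longrightarrow> dE R g e \<in> fibre E (tgt G g)"
  using ttgt_in[OF h_in] by (simp add: dE_eq)

lemma dC_eq: "g \<in> Arr G \<Longrightarrow> c \<in> fibre C (src G g) \<Longrightarrow> dC R g c = cpart g (h g (bd R c) \<cdot> \<kappa> c)"
  using bd_eq[of c] by (simp add: to_rep2_def Let_def cpart_def)

lemma Om_eq: "(g\<^sub>1, g\<^sub>2) \<in> composable G \<Longrightarrow> e \<in> fibre E (src G g\<^sub>2) \<Longrightarrow>
    Om R g\<^sub>1 g\<^sub>2 e = cpart (mul G g\<^sub>1 g\<^sub>2) (h (mul G g\<^sub>1 g\<^sub>2) e \<ominus> h g\<^sub>1 (dE R g\<^sub>2 e) \<cdot> h g\<^sub>2 e)"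
  using dE_eq[of g\<^sub>2 e] G.composableD(2) by (simp add: to_rep2_def Let_def cpart_def)

text \<open>The lift at \<open>bd R c\<close> is the one that can be multiplied with
  \<open>\<kappa> c\<close>. The product keeps the source of \<open>\<kappa> c\<close>, which is
  zero, and is therefore a translated core element.\<close>

lemma
  assumes g: "g \<in> Arr G" and c: "c \<in> fibre C (src G g)"
  shows h\<kappa>_comp: "tsrc \<Gamma> (h g (bd R c)) = ttgt \<Gamma> (\<kappa> c)"
    and h\<kappa>_in: "h g (bd R c) \<cdot> \<kappa> c \<in> fibre \<Gamma> g"
    and tsrc_h\<kappa>: "tsrc \<Gamma> (h g (bd R c) \<cdot> \<kappa> c) = vzero E (src G g)"
    and ttgt_h\<kappa>: "ttgt \<Gamma> (h g (bd R c) \<cdot> \<kappa> c) = dE R g (bd R c)"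
proof -
  note b = bd_in[OF c]
  show e: "tsrc \<Gamma> (h g (bd R c)) = ttgt \<Gamma> (\<kappa> c)"
    using tsrc_h[OF g b] bd_eq[OF c] by simp
  note k = h_in[OF g b] \<kappa>_in[OF c] e
  show "h g (bd R c) \<cdot> \<kappa> c \<in> fibre \<Gamma> g"
    using mul_fibre[OF k] G.mul_unt_right[OF g] by simp
  show "tsrc \<Gamma> (h g (bd R c) \<cdot> \<kappa> c) = vzero E (src G g)" "ttgt \<Gamma> (h g (bd R c) \<cdot> \<kappa> c) = dE R g (bd R c)"
    using tsrc_mul[OF k] ttgt_mul[OF k] tsrc_\<kappa>[OF c] dE_eq[OF g b] by simp_all
qed

lemma
  assumes g: "g \<in> Arr G" and c: "c \<in> fibre C (src G g)"
  shows dC_in: "dC R g c \<in> fibre C (tgt G g)"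
    and kz_dC: "kz (dC R g c) g = h g (bd R c) \<cdot> \<kappa> c"
  using cpart_in[OF g h\<kappa>_in[OF g c] tsrc_h\<kappa>[OF g c]] kz_cpart[OF g h\<kappa>_in[OF g c] tsrc_h\<kappa>[OF g c]]
  by (simp_all add: dC_eq[OF g c])

text \<open>The lift of the product and the product of the lifts both have source \<open>e\<close>,
  so their difference is in the kernel of \<open>tsrc\<close> and equals \<open>kz\<close> of a core
  element, which is \<open>Om\<close>. Taking targets gives the last claim, the equation for
  \<open>\<Delta>\<^sup>E\<close> in rearranged form.\<close>

lemma
  assumes gg: "(g\<^sub>1, g\<^sub>2) \<in> composable G" and e: "e \<in> fibre E (src G g\<^sub>2)"
  shows hh_comp: "tsrc \<Gamma> (h g\<^sub>1 (dE R g\<^sub>2 e)) = ttgt \<Gamma> (h g\<^sub>2 e)"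
    and h1_in: "h g\<^sub>1 (dE R g\<^sub>2 e) \<in> fibre \<Gamma> g\<^sub>1" and h2_in: "h g\<^sub>2 e \<in> fibre \<Gamma> g\<^sub>2"
    and h12_in: "h (mul G g\<^sub>1 g\<^sub>2) e \<in> fibre \<Gamma> (mul G g\<^sub>1 g\<^sub>2)"
    and hh_in: "h g\<^sub>1 (dE R g\<^sub>2 e) \<cdot> h g\<^sub>2 e \<in> fibre \<Gamma> (mul G g\<^sub>1 g\<^sub>2)"
    and Om_in: "Om R g\<^sub>1 g\<^sub>2 e \<in> fibre C (tgt G g\<^sub>1)"
    and kz_Om: "kz (Om R g\<^sub>1 g\<^sub>2 e) (mul G g\<^sub>1 g\<^sub>2) = h (mul G g\<^sub>1 g\<^sub>2) e \<ominus> h g\<^sub>1 (dE R g\<^sub>2 e) \<cdot> h g\<^sub>2 e"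
    and bd_Om: "bd R (Om R g\<^sub>1 g\<^sub>2 e) = vsub E (dE R (mul G g\<^sub>1 g\<^sub>2) e) (dE R g\<^sub>1 (dE R g\<^sub>2 e))"
proof -
  note g = G.composableD[OF gg] and g12 = G.mul_in[OF gg]
  have d: "dE R g\<^sub>2 e \<in> fibre E (src G g\<^sub>1)" using dE_in[OF g(2) e] g(3) by simp
  have e12: "e \<in> fibre E (src G (mul G g\<^sub>1 g\<^sub>2))" using e G.src_mul[OF gg] by simp
  show c: "tsrc \<Gamma> (h g\<^sub>1 (dE R g\<^sub>2 e)) = ttgt \<Gamma> (h g\<^sub>2 e)"
    using tsrc_h[OF g(1) d] dE_eq[OF g(2) e] by simp
  show 1: "h g\<^sub>1 (dE R g\<^sub>2 e) \<in> fibre \<Gamma> g\<^sub>1" and 2: "h g\<^sub>2 e \<in> fibre \<Gamma> g\<^sub>2"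
    and 12: "h (mul G g\<^sub>1 g\<^sub>2) e \<in> fibre \<Gamma> (mul G g\<^sub>1 g\<^sub>2)"
    using h_in[OF g(1) d] h_in[OF g(2) e] h_in[OF g12 e12] by simp_all
  show m: "h g\<^sub>1 (dE R g\<^sub>2 e) \<cdot> h g\<^sub>2 e \<in> fibre \<Gamma> (mul G g\<^sub>1 g\<^sub>2)"
    by (rule mul_fibre[OF 1 2 c])
  let ?d = "h (mul G g\<^sub>1 g\<^sub>2) e \<ominus> h g\<^sub>1 (dE R g\<^sub>2 e) \<cdot> h g\<^sub>2 e"
  have din: "?d \<in> fibre \<Gamma> (mul G g\<^sub>1 g\<^sub>2)" using 12 m by (rule GB.vsub_in)
  have ds: "tsrc \<Gamma> ?d = vzero E (src G (mul G g\<^sub>1 g\<^sub>2))"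
    using tsrc_sub[OF 12 m] tsrc_mul[OF 1 2 c] tsrc_h[OF g(2) e] tsrc_h[OF g12 e12] EB.vsub_eq_vzero[OF e12 e12]
    by simp
  show O: "Om R g\<^sub>1 g\<^sub>2 e \<in> fibre C (tgt G g\<^sub>1)"
    and kO: "kz (Om R g\<^sub>1 g\<^sub>2 e) (mul G g\<^sub>1 g\<^sub>2) = ?d"
    using cpart_in[OF g12 din ds] kz_cpart[OF g12 din ds] G.tgt_mul[OF gg] by (simp_all add: Om_eq[OF gg e])
  have "bd R (Om R g\<^sub>1 g\<^sub>2 e) = ttgt \<Gamma> ?d"
    using ttgt_kz[OF g12, of "Om R g\<^sub>1 g\<^sub>2 e"] O G.tgt_mul[OF gg] kO by (simp add: bd_eq)
  also have "\<dots> = vsub E (dE R (mul G g\<^sub>1 g\<^sub>2) e) (dE R g\<^sub>1 (dE R g\<^sub>2 e))"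
    using ttgt_sub[OF 12 m] ttgt_mul[OF 1 2 c] dE_eq[OF g(1) d] dE_eq[OF g12 e12] by simp
  finally show "bd R (Om R g\<^sub>1 g\<^sub>2 e) = vsub E (dE R (mul G g\<^sub>1 g\<^sub>2) e) (dE R g\<^sub>1 (dE R g\<^sub>2 e))" .
qed

lemma bd_linear:
  assumes x: "x \<in> Obj G"
  shows "fibre_linear C x E x (bd R)"
  using bd_in[of _ x] CB.vadd_in[of _ x] CB.vscl_in[of _ x] ttgt_add[OF \<kappa>_in[of _ x] \<kappa>_in[of _ x]]
    ttgt_scl[OF \<kappa>_in[of _ x] \<kappa>_in[of _ x]] fibre_linearD[OF \<kappa>_linear[OF x]]
  by (simp add: fibre_linear_def bd_eq[where x = x])

lemma dE_linear:
  assumes g: "g \<in> Arr G"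
  shows "fibre_linear E (src G g) E (tgt G g) (dE R g)"
  using dE_in[OF g] EB.vadd_in[of _ "src G g"] EB.vscl_in[of _ "src G g"]
    ttgt_add[OF h_in[OF g] h_in[OF g]] ttgt_scl[OF h_in[OF g] h_in[OF g]]
  by (simp add: fibre_linear_def dE_eq[OF g] h_add[OF g] h_scl[OF g])

text \<open>Tested after \<open>kz\<close>, where the claim becomes linearity in \<open>c\<close> of
  the product of \<open>h g (bd R c)\<close> and \<open>\<kappa> c\<close>: the interchange law
  handles sums and \<open>kmul_scl\<close> handles scalars.\<close>

lemma dC_linear:
  assumes g: "g \<in> Arr G"
  shows "fibre_linear C (src G g) C (tgt G g) (dC R g)"
  unfolding fibre_linear_def
proof (intro conjI ballI allI)
  note b = fibre_linearD[OF bd_linear[OF G.src_in[OF g]]] and k = fibre_linearD[OF \<kappa>_linear[OF G.src_in[OF g]]]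
  fix c assume c: "c \<in> fibre C (src G g)"
  show "dC R g c \<in> fibre C (tgt G g)" by (rule dC_in[OF g c])
  show "dC R g (vscl C a c) = vscl C a (dC R g c)" for a
  proof (rule kz_inj[OF g])
    show "dC R g (vscl C a c) \<in> fibre C (tgt G g)" "vscl C a (dC R g c) \<in> fibre C (tgt G g)"
      using dC_in[OF g] CB.vscl_in c by simp_all
    have "h g (bd R (vscl C a c)) \<cdot> \<kappa> (vscl C a c) = vscl \<Gamma> a (h g (bd R c) \<cdot> \<kappa> c)"
      using kmul_scl[OF h_in[OF g bd_in[OF c]] \<kappa>_in[OF c] h\<kappa>_comp[OF g c]]
      by (simp add: b(3)[OF c] k(3)[OF c] h_scl[OF g bd_in[OF c]])
    then show "kz (dC R g (vscl C a c)) g = kz (vscl C a (dC R g c)) g"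
      using CB.vscl_in[OF c] by (simp add: kz_dC[OF g] kz_scl[OF g dC_in[OF g c]] c)
  qed
  fix c' assume c': "c' \<in> fibre C (src G g)"
  show "dC R g (vadd C c c') = vadd C (dC R g c) (dC R g c')"
  proof (rule kz_inj[OF g])
    show "dC R g (vadd C c c') \<in> fibre C (tgt G g)" "vadd C (dC R g c) (dC R g c') \<in> fibre C (tgt G g)"
      using dC_in[OF g] CB.vadd_in c c' by simp_all
    have "h g (bd R (vadd C c c')) \<cdot> \<kappa> (vadd C c c') = h g (bd R c) \<cdot> \<kappa> c \<oplus> h g (bd R c') \<cdot> \<kappa> c'"
      using kmul_add[OF h_in[OF g bd_in[OF c]] \<kappa>_in[OF c] h_in[OF g bd_in[OF c']] \<kappa>_in[OF c']
          h\<kappa>_comp[OF g c] h\<kappa>_comp[OF g c']]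
      by (simp add: b(2)[OF c c'] k(2)[OF c c'] h_add[OF g bd_in[OF c] bd_in[OF c']])
    then show "kz (dC R g (vadd C c c')) g = kz (vadd C (dC R g c) (dC R g c')) g"
      using CB.vadd_in[OF c c'] by (simp add: kz_dC[OF g] kz_add[OF g dC_in[OF g c] dC_in[OF g c']] c c')
  qed
qed

lemma Om_linear:
  assumes gg: "(g\<^sub>1, g\<^sub>2) \<in> composable G"
  shows "fibre_linear E (src G g\<^sub>2) C (tgt G g\<^sub>1) (Om R g\<^sub>1 g\<^sub>2)"
  unfolding fibre_linear_def
proof (intro conjI ballI allI)
  note g = G.composableD[OF gg] and g12 = G.mul_in[OF gg]
  note t = G.tgt_mul[OF gg] and s = G.src_mul[OF gg]
  note d = fibre_linearD[OF dE_linear[OF g(2)]]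
  note inj = kz_inj[OF g12, unfolded t]
  fix e assume e: "e \<in> fibre E (src G g\<^sub>2)"
  have de: "dE R g\<^sub>2 e \<in> fibre E (src G g\<^sub>1)" using d(1)[OF e] g(3) by simp
  show "Om R g\<^sub>1 g\<^sub>2 e \<in> fibre C (tgt G g\<^sub>1)" by (rule Om_in[OF gg e])
  show "Om R g\<^sub>1 g\<^sub>2 (vscl E a e) = vscl C a (Om R g\<^sub>1 g\<^sub>2 e)" for a
  proof (rule inj)
    show "Om R g\<^sub>1 g\<^sub>2 (vscl E a e) \<in> fibre C (tgt G g\<^sub>1)" "vscl C a (Om R g\<^sub>1 g\<^sub>2 e) \<in> fibre C (tgt G g\<^sub>1)"
      using Om_in[OF gg] EB.vscl_in CB.vscl_in e by simp_all
    have "h g\<^sub>1 (dE R g\<^sub>2 (vscl E a e)) \<cdot> h g\<^sub>2 (vscl E a e) = vscl \<Gamma> a (h g\<^sub>1 (dE R g\<^sub>2 e) \<cdot> h g\<^sub>2 e)"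
      using kmul_scl[OF h1_in[OF gg e] h2_in[OF gg e] hh_comp[OF gg e]]
      by (simp add: d(3)[OF e] h_scl[OF g(1) de] h_scl[OF g(2) e])
    moreover have "h (mul G g\<^sub>1 g\<^sub>2) (vscl E a e) = vscl \<Gamma> a (h (mul G g\<^sub>1 g\<^sub>2) e)"
      using h_scl[OF g12] s e by simp
    moreover have "vscl \<Gamma> a p \<ominus> vscl \<Gamma> a q = vscl \<Gamma> a (p \<ominus> q)"
      if "p \<in> fibre \<Gamma> (mul G g\<^sub>1 g\<^sub>2)" "q \<in> fibre \<Gamma> (mul G g\<^sub>1 g\<^sub>2)" for p q
      using that by (intro GB.crd_inj[of _ "mul G g\<^sub>1 g\<^sub>2"]) (simp_all add: GB.vsub_in GB.vscl_in scaleR_diff_right)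
    ultimately show "kz (Om R g\<^sub>1 g\<^sub>2 (vscl E a e)) (mul G g\<^sub>1 g\<^sub>2) = kz (vscl C a (Om R g\<^sub>1 g\<^sub>2 e)) (mul G g\<^sub>1 g\<^sub>2)"
      using kz_scl[OF g12, unfolded t, OF Om_in[OF gg e]]
      by (simp add: kz_Om[OF gg] EB.vscl_in e h12_in[OF gg] hh_in[OF gg])
  qed
  fix e' assume e': "e' \<in> fibre E (src G g\<^sub>2)"
  have de': "dE R g\<^sub>2 e' \<in> fibre E (src G g\<^sub>1)" using d(1)[OF e'] g(3) by simp
  show "Om R g\<^sub>1 g\<^sub>2 (vadd E e e') = vadd C (Om R g\<^sub>1 g\<^sub>2 e) (Om R g\<^sub>1 g\<^sub>2 e')"
  proof (rule inj)
    show "Om R g\<^sub>1 g\<^sub>2 (vadd E e e') \<in> fibre C (tgt G g\<^sub>1)"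
      "vadd C (Om R g\<^sub>1 g\<^sub>2 e) (Om R g\<^sub>1 g\<^sub>2 e') \<in> fibre C (tgt G g\<^sub>1)"
      using Om_in[OF gg] EB.vadd_in CB.vadd_in e e' by simp_all
    have "h g\<^sub>1 (dE R g\<^sub>2 (vadd E e e')) \<cdot> h g\<^sub>2 (vadd E e e') =
        h g\<^sub>1 (dE R g\<^sub>2 e) \<cdot> h g\<^sub>2 e \<oplus> h g\<^sub>1 (dE R g\<^sub>2 e') \<cdot> h g\<^sub>2 e'"
      using kmul_add[OF h1_in[OF gg e] h2_in[OF gg e] h1_in[OF gg e'] h2_in[OF gg e']
          hh_comp[OF gg e] hh_comp[OF gg e']]
      by (simp add: d(2)[OF e e'] h_add[OF g(1) de de'] h_add[OF g(2) e e'])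
    moreover have "h (mul G g\<^sub>1 g\<^sub>2) (vadd E e e') = h (mul G g\<^sub>1 g\<^sub>2) e \<oplus> h (mul G g\<^sub>1 g\<^sub>2) e'"
      using h_add[OF g12] s e e' by simp
    moreover have "(p \<oplus> p') \<ominus> (q \<oplus> q') = (p \<ominus> q) \<oplus> (p' \<ominus> q')"
      if "p \<in> fibre \<Gamma> (mul G g\<^sub>1 g\<^sub>2)" "q \<in> fibre \<Gamma> (mul G g\<^sub>1 g\<^sub>2)"
        "p' \<in> fibre \<Gamma> (mul G g\<^sub>1 g\<^sub>2)" "q' \<in> fibre \<Gamma> (mul G g\<^sub>1 g\<^sub>2)" for p q p' q'
      using that by (intro GB.crd_inj[of _ "mul G g\<^sub>1 g\<^sub>2"]) (simp_all add: GB.vsub_in GB.vadd_in)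
    ultimately show "kz (Om R g\<^sub>1 g\<^sub>2 (vadd E e e')) (mul G g\<^sub>1 g\<^sub>2) =
        kz (vadd C (Om R g\<^sub>1 g\<^sub>2 e) (Om R g\<^sub>1 g\<^sub>2 e')) (mul G g\<^sub>1 g\<^sub>2)"
      using kz_add[OF g12, unfolded t, OF Om_in[OF gg e] Om_in[OF gg e']]
      by (simp add: kz_Om[OF gg] EB.vadd_in e e' h12_in[OF gg] hh_in[OF gg])
  qed
qed

section \<open>The multiplication in terms of the decomposition\<close>

definition dcp :: "'c \<Rightarrow> 'g \<Rightarrow> 'e \<Rightarrow> 'k" where "dcp c g e = kz c g \<oplus> h g e"

lemma decomposition_eq: "decomposition \<Gamma> (c, g, e) = dcp c g e"
  by (simp add: decomposition_def dcp_def kz_def)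

lemma
  assumes g: "g \<in> Arr G" and c: "c \<in> fibre C (tgt G g)" and e: "e \<in> fibre E (src G g)"
  shows dcp_in: "dcp c g e \<in> fibre \<Gamma> g"
    and tsrc_dcp: "tsrc \<Gamma> (dcp c g e) = e"
    and ttgt_dcp: "ttgt \<Gamma> (dcp c g e) = vadd E (bd R c) (dE R g e)"
    and cpart_dcp: "cpart g (dcp c g e \<ominus> h g e) = c"
proof -
  note i = kz_in[OF g c] h_in[OF g e]
  show "dcp c g e \<in> fibre \<Gamma> g" unfolding dcp_def by (rule GB.vadd_in[OF i])
  show "tsrc \<Gamma> (dcp c g e) = e"
    using tsrc_add[OF i] tsrc_kz[OF g c] tsrc_h[OF g e] EB.vadd_vzero_left[OF e] by (simp add: dcp_def)
  show "ttgt \<Gamma> (dcp c g e) = vadd E (bd R c) (dE R g e)"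
    using ttgt_add[OF i] ttgt_kz[OF g c] bd_eq[OF c] dE_eq[OF g e] by (simp add: dcp_def)
  have "dcp c g e \<ominus> h g e = kz c g"
    by (rule GB.crd_inj[of _ g]) (simp_all add: dcp_def i GB.vadd_in GB.vsub_in)
  then show "cpart g (dcp c g e \<ominus> h g e) = c" using cpart_kz[OF g c] by simp
qed

text \<open>Subtracting the lift of its source puts an arbitrary arrow into the kernel of
  \<open>tsrc\<close>, where \<open>cpart\<close> applies. This inverts the decomposition.\<close>

lemma
  assumes \<gamma>: "\<gamma> \<in> fibre \<Gamma> g"
  defines "e \<equiv> tsrc \<Gamma> \<gamma>"
  shows diff_in: "\<gamma> \<ominus> h g e \<in> fibre \<Gamma> g" and tsrc_diff: "tsrc \<Gamma> (\<gamma> \<ominus> h g e) = vzero E (src G g)"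
    and cpart_diff_in: "cpart g (\<gamma> \<ominus> h g e) \<in> fibre C (tgt G g)"
    and dcp_cpart: "dcp (cpart g (\<gamma> \<ominus> h g e)) g e = \<gamma>"
proof -
  note g = arr_of[OF \<gamma>]
  have e: "e \<in> fibre E (src G g)" unfolding e_def by (rule tsrc_in[OF \<gamma>])
  show d: "\<gamma> \<ominus> h g e \<in> fibre \<Gamma> g" using \<gamma> h_in[OF g e] by (rule GB.vsub_in)
  show s: "tsrc \<Gamma> (\<gamma> \<ominus> h g e) = vzero E (src G g)"
    using tsrc_sub[OF \<gamma> h_in[OF g e]] tsrc_h[OF g e] EB.vsub_eq_vzero[OF e e] by (simp add: e_def)
  show "cpart g (\<gamma> \<ominus> h g e) \<in> fibre C (tgt G g)" by (rule cpart_in[OF g d s])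
  show "dcp (cpart g (\<gamma> \<ominus> h g e)) g e = \<gamma>"
    using kz_cpart[OF g d s] GB.vsub_vadd_cancel[OF \<gamma> h_in[OF g e]] by (simp add: dcp_def)
qed

lemma kz_mul_z:
  assumes gg: "(g\<^sub>1, g\<^sub>2) \<in> composable G" and c: "c \<in> fibre C (tgt G g\<^sub>1)"
  shows "kz c g\<^sub>1 \<cdot> z g\<^sub>2 = kz c (mul G g\<^sub>1 g\<^sub>2)"
proof -
  note g = G.composableD[OF gg]
  have "kz c g\<^sub>1 \<cdot> z g\<^sub>2 = \<kappa> c \<cdot> (z g\<^sub>1 \<cdot> z g\<^sub>2)"
    unfolding kz_def
    by (rule kmul_assoc[OF \<kappa>_in[OF c] z_in[OF g(1)] z_in[OF g(2)] kz_comp[OF g(1) c]])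
      (use g in \<open>simp add: tsrc_z ttgt_z\<close>)
  then show ?thesis by (simp add: z_mul[OF gg] kz_def)
qed

text \<open>The hypothesis on \<open>e\<^sub>1\<close> is composability. It splits the lift of
  \<open>e\<^sub>1\<close> into the lifts of \<open>bd R c\<^sub>2\<close> and of
  \<open>dE R g\<^sub>2 e\<^sub>2\<close>. By the interchange law the second is multiplied with
  \<open>h g\<^sub>2 e\<^sub>2\<close>, which produces \<open>Om\<close>, and the remainder
  \<open>P\<close> with \<open>kz c\<^sub>2 g\<^sub>2\<close>, which produces
  \<open>dC\<close>.\<close>

lemma dcp_mul:
  assumes gg: "(g\<^sub>1, g\<^sub>2) \<in> composable G" and c1: "c\<^sub>1 \<in> fibre C (tgt G g\<^sub>1)" and c2: "c\<^sub>2 \<in> fibre C (tgt G g\<^sub>2)"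
    and e2: "e\<^sub>2 \<in> fibre E (src G g\<^sub>2)" and e1: "e\<^sub>1 = vadd E (bd R c\<^sub>2) (dE R g\<^sub>2 e\<^sub>2)"
  shows "dcp c\<^sub>1 g\<^sub>1 e\<^sub>1 \<cdot> dcp c\<^sub>2 g\<^sub>2 e\<^sub>2 =
    dcp (vsub C (vadd C c\<^sub>1 (dC R g\<^sub>1 c\<^sub>2)) (Om R g\<^sub>1 g\<^sub>2 e\<^sub>2)) (mul G g\<^sub>1 g\<^sub>2) e\<^sub>2"
proof -
  note g = G.composableD[OF gg] and g12 = G.mul_in[OF gg] and t = G.tgt_mul[OF gg]
  have c2': "c\<^sub>2 \<in> fibre C (src G g\<^sub>1)" using c2 g(3) by simp
  have b: "bd R c\<^sub>2 \<in> fibre E (src G g\<^sub>1)" using bd_in[OF c2'] .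
  have d: "dE R g\<^sub>2 e\<^sub>2 \<in> fibre E (src G g\<^sub>1)" using dE_in[OF g(2) e2] g(3) by simp
  note k1 = kz_in[OF g(1) c1] and k2 = kz_in[OF g(2) c2] and hb = h_in[OF g(1) b] and hd = h_in[OF g(1) d]
    and h2 = h_in[OF g(2) e2]
  define P where "P = kz c\<^sub>1 g\<^sub>1 \<oplus> h g\<^sub>1 (bd R c\<^sub>2)"
  have P: "P \<in> fibre \<Gamma> g\<^sub>1" unfolding P_def by (rule GB.vadd_in[OF k1 hb])
  have sh: "tsrc \<Gamma> (h g\<^sub>1 (bd R c\<^sub>2)) = ttgt \<Gamma> (kz c\<^sub>2 g\<^sub>2)"
    using tsrc_h[OF g(1) b] ttgt_kz[OF g(2) c2] bd_eq[OF c2] by simp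
  have sP: "tsrc \<Gamma> P = ttgt \<Gamma> (kz c\<^sub>2 g\<^sub>2)"
    using tsrc_add[OF k1 hb] tsrc_kz[OF g(1) c1] sh EB.vadd_vzero_left[OF b] tsrc_h[OF g(1) b] by (simp add: P_def)
  have sk: "tsrc \<Gamma> (kz c\<^sub>1 g\<^sub>1) = ttgt \<Gamma> (z g\<^sub>2)"
    using tsrc_kz[OF g(1) c1] ttgt_z[OF g(2)] g(3) by simp
  have 1: "dcp c\<^sub>1 g\<^sub>1 e\<^sub>1 = P \<oplus> h g\<^sub>1 (dE R g\<^sub>2 e\<^sub>2)"
    using GB.add_assoc[OF g(1) k1 hb hd] by (simp add: dcp_def P_def e1 h_add[OF g(1) b d])
  \<comment> \<open>The zero vector inserted here is the partner of
    \<open>kz c\<^sub>1 g\<^sub>1\<close> in the interchange law, as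
    \<open>kz c\<^sub>1 g\<^sub>1\<close> has zero source; the lift is left for
    \<open>kz c\<^sub>2 g\<^sub>2\<close>.\<close>
  have "P \<cdot> kz c\<^sub>2 g\<^sub>2 = P \<cdot> (z g\<^sub>2 \<oplus> kz c\<^sub>2 g\<^sub>2)"
    using GB.vadd_vzero_left[OF k2] by simp
  also have "\<dots> = kz c\<^sub>1 g\<^sub>1 \<cdot> z g\<^sub>2 \<oplus> h g\<^sub>1 (bd R c\<^sub>2) \<cdot> kz c\<^sub>2 g\<^sub>2"
    unfolding P_def by (rule kmul_add[OF k1 z_in[OF g(2)] hb k2 sk sh])
  also have "h g\<^sub>1 (bd R c\<^sub>2) \<cdot> kz c\<^sub>2 g\<^sub>2 = h g\<^sub>1 (bd R c\<^sub>2) \<cdot> \<kappa> c\<^sub>2 \<cdot> z g\<^sub>2"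
    unfolding kz_def
    by (rule kmul_assoc[symmetric, OF hb \<kappa>_in[OF c2] z_in[OF g(2)] h\<kappa>_comp[OF g(1) c2'] kz_comp[OF g(2) c2]])
  also have "h g\<^sub>1 (bd R c\<^sub>2) \<cdot> \<kappa> c\<^sub>2 = kz (dC R g\<^sub>1 c\<^sub>2) g\<^sub>1"
    using kz_dC[OF g(1) c2'] by simp
  finally have 2: "P \<cdot> kz c\<^sub>2 g\<^sub>2 = kz c\<^sub>1 (mul G g\<^sub>1 g\<^sub>2) \<oplus> kz (dC R g\<^sub>1 c\<^sub>2) (mul G g\<^sub>1 g\<^sub>2)"
    using kz_mul_z[OF gg c1] kz_mul_z[OF gg dC_in[OF g(1) c2']] by simp
  have 3: "dcp c\<^sub>1 g\<^sub>1 e\<^sub>1 \<cdot> dcp c\<^sub>2 g\<^sub>2 e\<^sub>2 = P \<cdot> kz c\<^sub>2 g\<^sub>2 \<oplus> h g\<^sub>1 (dE R g\<^sub>2 e\<^sub>2) \<cdot> h g\<^sub>2 e\<^sub>2"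
    using kmul_add[OF P k2 hd h2 sP hh_comp[OF gg e2]] unfolding 1 dcp_def[of c\<^sub>2] .
  have i: "c\<^sub>1 \<in> fibre C (tgt G (mul G g\<^sub>1 g\<^sub>2))" "dC R g\<^sub>1 c\<^sub>2 \<in> fibre C (tgt G (mul G g\<^sub>1 g\<^sub>2))"
    "Om R g\<^sub>1 g\<^sub>2 e\<^sub>2 \<in> fibre C (tgt G (mul G g\<^sub>1 g\<^sub>2))"
    using c1 dC_in[OF g(1) c2'] Om_in[OF gg e2] t by simp_all
  note ki = kz_in[OF g12 i(1)] kz_in[OF g12 i(2)] h12_in[OF gg e2] hh_in[OF gg e2]
  show ?thesis
    unfolding 3 2 unfolding dcp_def
      kz_sub[OF g12 CB.vadd_in[OF i(1,2)] i(3)] kz_add[OF g12 i(1,2)] kz_Om[OF gg e2]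
    by (rule GB.crd_inj[of _ "mul G g\<^sub>1 g\<^sub>2"]) (simp_all add: ki GB.vadd_in GB.vsub_in)
qed

text \<open>Associativity of three decomposed arrows, compared in the core component. The first core
  component is taken to be 0, as it would be the same summand on both sides. With
  \<open>c\<^sub>2\<close> and \<open>c\<^sub>3\<close> zero this is the cocycle equation for
  \<open>Om\<close>; with \<open>c\<^sub>2\<close> zero and a core element as third arrow it is the
  equation for \<open>dC\<close>.\<close>

lemma assoc_core:
  assumes gg: "(g\<^sub>1, g\<^sub>2) \<in> composable G" "(g\<^sub>2, g\<^sub>3) \<in> composable G"
    and c2: "c\<^sub>2 \<in> fibre C (tgt G g\<^sub>2)" and c3: "c\<^sub>3 \<in> fibre C (tgt G g\<^sub>3)" and e3: "e\<^sub>3 \<in> fibre E (src G g\<^sub>3)"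
    and e2: "e\<^sub>2 = vadd E (bd R c\<^sub>3) (dE R g\<^sub>3 e\<^sub>3)"
  shows "vsub C (vadd C (vsub C (dC R g\<^sub>1 c\<^sub>2) (Om R g\<^sub>1 g\<^sub>2 e\<^sub>2)) (dC R (mul G g\<^sub>1 g\<^sub>2) c\<^sub>3)) (Om R (mul G g\<^sub>1 g\<^sub>2) g\<^sub>3 e\<^sub>3)
    = vsub C (dC R g\<^sub>1 (vsub C (vadd C c\<^sub>2 (dC R g\<^sub>2 c\<^sub>3)) (Om R g\<^sub>2 g\<^sub>3 e\<^sub>3))) (Om R g\<^sub>1 (mul G g\<^sub>2 g\<^sub>3) e\<^sub>3)"
    (is "?l = ?r")
proof -
  note g = G.composableD[OF gg(1)] and g' = G.composableD[OF gg(2)]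
  note m = G.mul_in[OF gg(1)] G.mul_in[OF gg(2)]
    G.tgt_mul[OF gg(1)] G.tgt_mul[OF gg(2)] G.src_mul[OF gg(1)] G.src_mul[OF gg(2)]
  have gg': "(mul G g\<^sub>1 g\<^sub>2, g\<^sub>3) \<in> composable G" "(g\<^sub>1, mul G g\<^sub>2 g\<^sub>3) \<in> composable G"
    using g g' m by (simp_all add: composable_def)
  have ga: "mul G (mul G g\<^sub>1 g\<^sub>2) g\<^sub>3 = mul G g\<^sub>1 (mul G g\<^sub>2 g\<^sub>3)" by (rule G.mul_assoc[OF gg])
  define c1 where "c1 = vzero C (tgt G g\<^sub>1)"
  have c1: "c1 \<in> fibre C (tgt G g\<^sub>1)" unfolding c1_def by (rule CB.zero_closed[OF G.tgt_in[OF g(1)]])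
  have c2': "c\<^sub>2 \<in> fibre C (src G g\<^sub>1)" and c3': "c\<^sub>3 \<in> fibre C (src G g\<^sub>2)" using c2 c3 g(3) g'(3) by simp_all
  have e2': "e\<^sub>2 \<in> fibre E (src G g\<^sub>2)"
    unfolding e2 using bd_in[OF c3'] dE_in[OF g'(2) e3] g'(3) by (simp add: EB.vadd_in)
  define e1 where "e1 = vadd E (bd R c\<^sub>2) (dE R g\<^sub>2 e\<^sub>2)"
  have e1': "e1 \<in> fibre E (src G g\<^sub>1)"
    unfolding e1_def using bd_in[OF c2'] dE_in[OF g(2) e2'] g(3) by (simp add: EB.vadd_in)
  note dc2 = dC_in[OF g(1) c2'] and om12 = Om_in[OF gg(1) e2']
  have dc23: "dC R g\<^sub>2 c\<^sub>3 \<in> fibre C (tgt G g\<^sub>2)" by (rule dC_in[OF g(2) c3'])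
  have om23: "Om R g\<^sub>2 g\<^sub>3 e\<^sub>3 \<in> fibre C (tgt G g\<^sub>2)" by (rule Om_in[OF gg(2) e3])
  define c12 where "c12 = vsub C (vadd C c1 (dC R g\<^sub>1 c\<^sub>2)) (Om R g\<^sub>1 g\<^sub>2 e\<^sub>2)"
  define c23 where "c23 = vsub C (vadd C c\<^sub>2 (dC R g\<^sub>2 c\<^sub>3)) (Om R g\<^sub>2 g\<^sub>3 e\<^sub>3)"
  have c12: "c12 \<in> fibre C (tgt G g\<^sub>1)" unfolding c12_def by (intro CB.vsub_in CB.vadd_in c1 dc2 om12)
  have c23: "c23 \<in> fibre C (tgt G g\<^sub>2)" unfolding c23_def by (intro CB.vsub_in CB.vadd_in c2 dc23 om23)
  have c23': "c23 \<in> fibre C (src G g\<^sub>1)" using c23 g(3) by simp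
  have c3'': "c\<^sub>3 \<in> fibre C (src G (mul G g\<^sub>1 g\<^sub>2))" using c3' m by simp
  have e3': "e\<^sub>3 \<in> fibre E (src G (mul G g\<^sub>2 g\<^sub>3))" using e3 m by simp
  note x1 = dcp_in[OF g(1) c1 e1'] and x2 = dcp_in[OF g(2) c2 e2'] and x3 = dcp_in[OF g'(2) c3 e3]
  have s12: "tsrc \<Gamma> (dcp c1 g\<^sub>1 e1) = ttgt \<Gamma> (dcp c\<^sub>2 g\<^sub>2 e\<^sub>2)"
    using tsrc_dcp[OF g(1) c1 e1'] ttgt_dcp[OF g(2) c2 e2'] by (simp add: e1_def)
  have s23: "tsrc \<Gamma> (dcp c\<^sub>2 g\<^sub>2 e\<^sub>2) = ttgt \<Gamma> (dcp c\<^sub>3 g\<^sub>3 e\<^sub>3)"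
    using tsrc_dcp[OF g(2) c2 e2'] ttgt_dcp[OF g'(2) c3 e3] by (simp add: e2)
  note m12 = dcp_mul[OF gg(1) c1 c2 e2' e1_def, folded c12_def]
  note m23 = dcp_mul[OF gg(2) c2 c3 e3 e2, folded c23_def]
  \<comment> \<open>The first arrow is also composable with the product of the other two. This gives
    a second expression for \<open>e1\<close>, the one \<open>dcp_mul\<close> requires for the
    right-hand bracketing.\<close>
  have "e1 = ttgt \<Gamma> (dcp c23 (mul G g\<^sub>2 g\<^sub>3) e\<^sub>3)"
    using s12 ttgt_mul[OF x2 x3 s23] tsrc_dcp[OF g(1) c1 e1'] by (simp add: m23)
  also have "\<dots> = vadd E (bd R c23) (dE R (mul G g\<^sub>2 g\<^sub>3) e\<^sub>3)"
    using ttgt_dcp[OF m(2) _ e3'] c23 m by simp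
  finally have e1_eq: "e1 = vadd E (bd R c23) (dE R (mul G g\<^sub>2 g\<^sub>3) e\<^sub>3)" .
  have c12m: "c12 \<in> fibre C (tgt G (mul G g\<^sub>1 g\<^sub>2))" and c23m: "c23 \<in> fibre C (tgt G (mul G g\<^sub>2 g\<^sub>3))"
    using c12 c23 m by simp_all
  define cl where "cl = vsub C (vadd C c12 (dC R (mul G g\<^sub>1 g\<^sub>2) c\<^sub>3)) (Om R (mul G g\<^sub>1 g\<^sub>2) g\<^sub>3 e\<^sub>3)"
  define cr where "cr = vsub C (vadd C c1 (dC R g\<^sub>1 c23)) (Om R g\<^sub>1 (mul G g\<^sub>2 g\<^sub>3) e\<^sub>3)"
  have eq: "dcp cl (mul G g\<^sub>1 (mul G g\<^sub>2 g\<^sub>3)) e\<^sub>3 = dcp cr (mul G g\<^sub>1 (mul G g\<^sub>2 g\<^sub>3)) e\<^sub>3"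
    using kmul_assoc[OF x1 x2 x3 s12 s23] dcp_mul[OF gg'(1) c12m c3 e3 e2] dcp_mul[OF gg'(2) c1 c23m e3' e1_eq]
    by (simp add: m12 m23 cl_def cr_def ga)
  have mm: "mul G g\<^sub>1 (mul G g\<^sub>2 g\<^sub>3) \<in> Arr G" "tgt G (mul G g\<^sub>1 (mul G g\<^sub>2 g\<^sub>3)) = tgt G g\<^sub>1"
    "src G (mul G g\<^sub>1 (mul G g\<^sub>2 g\<^sub>3)) = src G g\<^sub>3"
    using G.mul_in[OF gg'(2)] G.tgt_mul[OF gg'(2)] G.src_mul[OF gg'(2)] m by simp_all
  have d3: "dC R (mul G g\<^sub>1 g\<^sub>2) c\<^sub>3 \<in> fibre C (tgt G g\<^sub>1)" using dC_in[OF m(1) c3''] m by simp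
  have o3: "Om R (mul G g\<^sub>1 g\<^sub>2) g\<^sub>3 e\<^sub>3 \<in> fibre C (tgt G g\<^sub>1)" using Om_in[OF gg'(1) e3] m by simp
  have d1: "dC R g\<^sub>1 c23 \<in> fibre C (tgt G g\<^sub>1)" by (rule dC_in[OF g(1) c23'])
  have o1: "Om R g\<^sub>1 (mul G g\<^sub>2 g\<^sub>3) e\<^sub>3 \<in> fibre C (tgt G g\<^sub>1)" by (rule Om_in[OF gg'(2) e3'])
  have cl: "cl \<in> fibre C (tgt G g\<^sub>1)" unfolding cl_def by (intro CB.vsub_in CB.vadd_in c12 d3 o3)
  have cr: "cr \<in> fibre C (tgt G g\<^sub>1)" unfolding cr_def by (intro CB.vsub_in CB.vadd_in c1 d1 o1)
  \<comment> \<open>The core component is recovered by \<open>cpart\<close> after the lift has been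
    subtracted, so equal arrows have equal core components.\<close>
  have "cpart (mul G g\<^sub>1 (mul G g\<^sub>2 g\<^sub>3)) (dcp c (mul G g\<^sub>1 (mul G g\<^sub>2 g\<^sub>3)) e\<^sub>3 \<ominus> h (mul G g\<^sub>1 (mul G g\<^sub>2 g\<^sub>3)) e\<^sub>3) = c"
    if "c \<in> fibre C (tgt G g\<^sub>1)" for c
    by (rule cpart_dcp[OF mm(1)]) (simp_all only: mm that e3)
  from this[OF cl] this[OF cr] have "cl = cr"
    unfolding eq by (rule trans[OF sym])
  moreover have "c12 = vsub C (dC R g\<^sub>1 c\<^sub>2) (Om R g\<^sub>1 g\<^sub>2 e\<^sub>2)"
    unfolding c12_def c1_def by (simp add: CB.vadd_vzero_left[OF dc2])
  moreover have "vadd C c1 (dC R g\<^sub>1 c23) = dC R g\<^sub>1 c23"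
    unfolding c1_def by (rule CB.vadd_vzero_left[OF d1])
  ultimately show ?thesis
    by (simp add: cl_def cr_def c23_def)
qed

section \<open>Smoothness of the 4-tuple\<close>

lemma smooth_h:
  assumes "manifold X" "smooth_map_on X (arr G) S a" "smooth_map_on X (tot E) S e"
    and "\<And>x. x \<in> S \<Longrightarrow> e x \<in> fibre E (src G (a x))"
  shows "smooth_map_on X (tot \<Gamma>) S (\<lambda>x. h (a x) (e x))"
proof -
  have "smooth_map_on (prod_mfd (arr G) (tot E)) (tot \<Gamma>) {(g, e). g \<in> Arr G \<and> e \<in> fibre E (src G g)} (\<lambda>(g, e). h g e)"
    using lift by (simp add: horizontal_lift_def)
  from smooth_compose2[OF assms(1) G.arr_manifold EB.total_manifold this assms(2,3)]
  show ?thesis using assms(4) smooth_map_on_in[OF assms(2)] by simp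
qed

lemma smooth_tsrc: "smooth_map (tot \<Gamma>) (tot E) (tsrc \<Gamma>)" and smooth_ttgt: "smooth_map (tot \<Gamma>) (tot E) (ttgt \<Gamma>)"
  and smooth_\<kappa>: "smooth_map (tot C) (tot \<Gamma>) \<kappa>"
  using K.src_smooth K.tgt_smooth core_id by (simp_all add: core_identification_def vb_morphism_def)

lemma smooth_kmul:
  assumes "manifold X" "smooth_map_on X (tot \<Gamma>) S f" "smooth_map_on X (tot \<Gamma>) S g"
    and "\<And>x. x \<in> S \<Longrightarrow> tsrc \<Gamma> (f x) = ttgt \<Gamma> (g x)"
  shows "smooth_map_on X (tot \<Gamma>) S (\<lambda>x. f x \<cdot> g x)"
  using K.smooth_mul[of X S f g] assms by simp

lemma smooth_kz:
  assumes X: "manifold X" and a: "smooth_map_on X (arr G) S a" and c: "smooth_map_on X (tot C) S c"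
    and in_f: "\<And>x. x \<in> S \<Longrightarrow> c x \<in> fibre C (tgt G (a x))"
  shows "smooth_map_on X (tot \<Gamma>) S (\<lambda>x. kz (c x) (a x))"
  unfolding kz_def
  by (rule smooth_kmul[OF X smooth_compose_map[OF X CB.total_manifold smooth_\<kappa> c] GB.smooth_vzero[OF X a]])
    (rule kz_comp[OF smooth_map_on_in[OF a] in_f])

text \<open>\<open>core_identification\<close> provides a smooth inverse of \<open>\<kappa>\<close>
  on the core only, so the translated arrow has to be shown to land there.\<close>

lemma smooth_cpart:
  assumes X: "manifold X" and a: "smooth_map_on X (arr G) S a" and f: "smooth_map_on X (tot \<Gamma>) S f"
    and in_f: "\<And>x. x \<in> S \<Longrightarrow> f x \<in> fibre \<Gamma> (a x)" "\<And>x. x \<in> S \<Longrightarrow> tsrc \<Gamma> (f x) = vzero E (src G (a x))"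
  shows "smooth_map_on X (tot C) S (\<lambda>x. cpart (a x) (f x))"
proof -
  note aA = smooth_map_on_in[OF a]
  have i: "smooth_map_on X (arr G) S (\<lambda>x. ginv G (a x))"
    by (rule smooth_compose_map[OF X G.arr_manifold G.inv_smooth a])
  have "smooth_map_on X (tot \<Gamma>) S (\<lambda>x. f x \<cdot> z (ginv G (a x)))"
    by (rule smooth_kmul[OF X f GB.smooth_vzero[OF X i]])
      (use in_f(2) aA in \<open>simp add: ttgt_z G.inv_in G.tgt_inv\<close>)
  moreover have "smooth_map_on (tot \<Gamma>) (tot C) (\<Union>x\<in>Obj G. core_fibre G E \<Gamma> x) unk"
    using core_id by (simp add: core_identification_def)
  moreover have "(\<lambda>x. f x \<cdot> z (ginv G (a x))) ` S \<subseteq> (\<Union>x\<in>Obj G. core_fibre G E \<Gamma> x)"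
    using cpart_core[OF aA in_f] G.tgt_in[OF aA] by blast
  ultimately show ?thesis
    unfolding cpart_def using smooth_compose[OF X GB.total_manifold] by blast
qed

lemma bd_smooth: "smooth_map (tot C) (tot E) (bd R)"
  by (rule smooth_map_on_cong[OF _ smooth_compose_map[OF CB.total_manifold GB.total_manifold smooth_ttgt smooth_\<kappa>]
        manifold_charted[OF CB.total_manifold]]) (use bd_eq CB.fibreI in metis)

lemma dE_smooth_comp:
  assumes X: "manifold X" and a: "smooth_map_on X (arr G) S a" and e: "smooth_map_on X (tot E) S e"
    and in_f: "\<And>x. x \<in> S \<Longrightarrow> e x \<in> fibre E (src G (a x))"
  shows "smooth_map_on X (tot E) S (\<lambda>x. dE R (a x) (e x))"
  by (rule smooth_map_on_cong[OF _ smooth_compose_map[OF X GB.total_manifold smooth_ttgt smooth_h[OF X a e in_f]]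
        manifold_charted[OF X]]) (simp_all add: dE_eq smooth_map_on_in[OF a] in_f)

lemma dC_smooth_comp:
  assumes X: "manifold X" and a: "smooth_map_on X (arr G) S a" and c: "smooth_map_on X (tot C) S c"
    and in_f: "\<And>x. x \<in> S \<Longrightarrow> c x \<in> fibre C (src G (a x))"
  shows "smooth_map_on X (tot C) S (\<lambda>x. dC R (a x) (c x))"
proof -
  note aA = smooth_map_on_in[OF a]
  have b: "smooth_map_on X (tot E) S (\<lambda>x. bd R (c x))"
    by (rule smooth_compose_map[OF X CB.total_manifold bd_smooth c])
  have "smooth_map_on X (tot \<Gamma>) S (\<lambda>x. h (a x) (bd R (c x)) \<cdot> \<kappa> (c x))"
    by (rule smooth_kmul[OF X smooth_h[OF X a b bd_in[OF in_f]] smooth_compose_map[OF X CB.total_manifold smooth_\<kappa> c]])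
      (use h\<kappa>_comp[OF aA in_f] in auto)
  from smooth_cpart[OF X a this h\<kappa>_in[OF aA in_f] tsrc_h\<kappa>[OF aA in_f]]
  have "smooth_map_on X (tot C) S (\<lambda>x. cpart (a x) (h (a x) (bd R (c x)) \<cdot> \<kappa> (c x)))"
    by simp
  then show ?thesis
    by (rule smooth_map_on_cong[rotated, OF _ manifold_charted[OF X]]) (simp add: dC_eq aA in_f)
qed

lemma Om_smooth_comp:
  assumes X: "manifold X" and a: "smooth_map_on X (arr G) S a" and b: "smooth_map_on X (arr G) S b"
    and e: "smooth_map_on X (tot E) S e"
    and ab: "\<And>x. x \<in> S \<Longrightarrow> (a x, b x) \<in> composable G" and in_f: "\<And>x. x \<in> S \<Longrightarrow> e x \<in> fibre E (src G (b x))"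
  shows "smooth_map_on X (tot C) S (\<lambda>x. Om R (a x) (b x) (e x))"
proof -
  note g = G.composableD[OF ab]
  have m: "smooth_map_on X (arr G) S (\<lambda>x. mul G (a x) (b x))"
    by (rule G.smooth_mul[OF X a b g(3)])
  have d: "smooth_map_on X (tot E) S (\<lambda>x. dE R (b x) (e x))"
    by (rule dE_smooth_comp[OF X b e in_f])
  have h1: "smooth_map_on X (tot \<Gamma>) S (\<lambda>x. h (a x) (dE R (b x) (e x)))"
    by (rule smooth_h[OF X a d]) (simp add: dE_in g in_f)
  have hh: "smooth_map_on X (tot \<Gamma>) S (\<lambda>x. h (a x) (dE R (b x) (e x)) \<cdot> h (b x) (e x))"
    by (rule smooth_kmul[OF X h1 smooth_h[OF X b e in_f] hh_comp[OF ab in_f]])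
  have h12: "smooth_map_on X (tot \<Gamma>) S (\<lambda>x. h (mul G (a x) (b x)) (e x))"
    by (rule smooth_h[OF X m e]) (simp add: G.src_mul ab in_f)
  have dd: "smooth_map_on X (tot \<Gamma>) S (\<lambda>x. h (mul G (a x) (b x)) (e x) \<ominus> h (a x) (dE R (b x) (e x)) \<cdot> h (b x) (e x))"
    by (rule GB.smooth_vsub[OF X h12 hh]) (simp add: GB.fibreD(3)[OF hh_in[OF ab in_f]] GB.fibreD(3)[OF h12_in[OF ab in_f]])
  \<comment> \<open>The difference is \<open>kz\<close> of \<open>Om\<close>, so its source is
    already known to be zero.\<close>
  have tk: "tsrc \<Gamma> (h (mul G (a x) (b x)) (e x) \<ominus> h (a x) (dE R (b x) (e x)) \<cdot> h (b x) (e x)) = vzero E (src G (mul G (a x) (b x)))"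
    if "x \<in> S" for x
    using tsrc_kz[OF G.mul_in[OF ab[OF that]], of "Om R (a x) (b x) (e x)"] Om_in[OF ab[OF that] in_f[OF that]]
      kz_Om[OF ab[OF that] in_f[OF that]] G.tgt_mul[OF ab[OF that]] by simp
  have "smooth_map_on X (tot C) S (\<lambda>x. cpart (mul G (a x) (b x))
      (h (mul G (a x) (b x)) (e x) \<ominus> h (a x) (dE R (b x) (e x)) \<cdot> h (b x) (e x)))"
    by (rule smooth_cpart[OF X m dd GB.vsub_in[OF h12_in[OF ab in_f] hh_in[OF ab in_f]] tk])
  then show ?thesis
    by (rule smooth_map_on_cong[rotated, OF _ manifold_charted[OF X]]) (simp add: Om_eq ab in_f)
qed

end

section \<open>The equations of the 4-tuple\<close>

context lifted_vb_groupoid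
begin

text \<open>Over a unit the lift is a unit arrow, so the product defining \<open>dC\<close>
  collapses to \<open>\<kappa> c\<close>.\<close>

lemma dC_unt:
  assumes c: "c \<in> fibre C x"
  shows "dC R (unt G x) c = c"
proof -
  have x: "x \<in> Obj G" by (rule CB.fibreD(1)[OF c])
  have u: "unt G x \<in> Arr G" "src G (unt G x) = x" "tgt G (unt G x) = x"
    using x by (simp_all add: G.unt_in G.src_unt G.tgt_unt)
  have c': "c \<in> fibre C (src G (unt G x))" "c \<in> fibre C (tgt G (unt G x))" using c u by simp_all
  have "kz (dC R (unt G x) c) (unt G x) = tunt \<Gamma> (ttgt \<Gamma> (\<kappa> c)) \<cdot> \<kappa> c"
    using kz_dC[OF u(1) c'(1)] h_unt[OF bd_in[OF c]] bd_eq[OF c] by simp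
  also have "\<dots> = \<kappa> c" by (rule kmul_unt_left[OF \<kappa>_in[OF c]])
  also have "\<dots> = kz c (unt G x)"
    using kmul_z_right[OF \<kappa>_in[OF c]] tsrc_\<kappa>[OF c] u by (simp add: kz_def)
  finally show ?thesis
    by (rule kz_inj[OF u(1) dC_in[OF u(1) c'(1)] c'(2)])
qed

lemma dE_unt: "e \<in> fibre E x \<Longrightarrow> dE R (unt G x) e = e"
  using dE_eq[of "unt G x" e] h_unt[of e x] K.tgt_unt[of e] EB.fibreD[of e x] G.unt_in[of x] G.src_unt[of x]
  by simp

text \<open>If one of the two arrows is a unit, its lift is a unit arrow, and the product of the
  lifts is the lift of the product. The difference measured by \<open>Om\<close> is then
  zero.\<close>

lemma Om_unt:
  assumes gg: "(g\<^sub>1, g\<^sub>2) \<in> composable G" and u: "g\<^sub>1 \<in> unt G ` Obj G \<or> g\<^sub>2 \<in> unt G ` Obj G"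
    and e: "e \<in> fibre E (src G g\<^sub>2)"
  shows "Om R g\<^sub>1 g\<^sub>2 e = vzero C (tgt G g\<^sub>1)"
proof -
  note g = G.composableD[OF gg] and g12 = G.mul_in[OF gg] and t = G.tgt_mul[OF gg]
  have "h g\<^sub>1 (dE R g\<^sub>2 e) \<cdot> h g\<^sub>2 e = h (mul G g\<^sub>1 g\<^sub>2) e"
    using u
  proof
    assume "g\<^sub>1 \<in> unt G ` Obj G"
    then have 1: "g\<^sub>1 = unt G (tgt G g\<^sub>2)" using G.src_unt g(3) by auto
    have "h g\<^sub>1 (dE R g\<^sub>2 e) = tunt \<Gamma> (ttgt \<Gamma> (h g\<^sub>2 e))"
      unfolding 1 using h_unt[OF dE_in[OF g(2) e]] dE_eq[OF g(2) e] by simp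
    then show ?thesis
      using kmul_unt_left[OF h_in[OF g(2) e]] G.mul_unt_left[OF g(2)] 1 by simp
  next
    assume "g\<^sub>2 \<in> unt G ` Obj G"
    then have 2: "g\<^sub>2 = unt G (src G g\<^sub>1)" using G.tgt_unt g(3) by auto
    have e1: "e \<in> fibre E (src G g\<^sub>1)" using e 2 G.src_unt G.src_in[OF g(1)] by simp
    have "h g\<^sub>2 e = tunt \<Gamma> (tsrc \<Gamma> (h g\<^sub>1 e))" "dE R g\<^sub>2 e = e"
      unfolding 2 using h_unt[OF e1] tsrc_h[OF g(1) e1] dE_unt[OF e1] by simp_all
    then show ?thesis
      using kmul_unt_right[OF h_in[OF g(1) e1]] G.mul_unt_right[OF g(1)] 2 by simp
  qed
  then have "kz (Om R g\<^sub>1 g\<^sub>2 e) (mul G g\<^sub>1 g\<^sub>2) = kz (vzero C (tgt G (mul G g\<^sub>1 g\<^sub>2))) (mul G g\<^sub>1 g\<^sub>2)"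
    using kz_Om[OF gg e] GB.vsub_eq_vzero[OF h12_in[OF gg e] h12_in[OF gg e]] kz_vzero[OF g12] by simp
  then have "Om R g\<^sub>1 g\<^sub>2 e = vzero C (tgt G (mul G g\<^sub>1 g\<^sub>2))"
    by (rule kz_inj[OF g12, rotated 2]) (use Om_in[OF gg e] CB.zero_closed[OF G.tgt_in[OF g(1)]] t in simp_all)
  then show ?thesis using t by simp
qed

theorem to_rep2_rep_up_to_homotopy: "rep_up_to_homotopy G E C R"
proof (rule rep_up_to_homotopy.intro)
  show "lie_groupoid G" "vector_bundle (obj G) E" "vector_bundle (obj G) C" by unfold_locales
  show "vb_morphism (obj G) C (obj G) E (bd R) id"
    using manifold.smooth_ident[OF G.obj_manifold order_refl] bd_smooth bd_linear by (simp add: vb_morphism_def id_def)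
  have P: "manifold (prod_mfd (arr G) (tot C))" "manifold (prod_mfd (arr G) (tot E))"
    "manifold (prod_mfd (arr G) (arr G))" "manifold (prod_mfd (prod_mfd (arr G) (arr G)) (tot E))"
    by (intro manifold_prod G.arr_manifold CB.total_manifold EB.total_manifold)+
  have "smooth_map_on (prod_mfd (arr G) (tot C)) (tot C) {p. fst p \<in> Arr G \<and> snd p \<in> fibre C (src G (fst p))}
      (\<lambda>p. dC R (fst p) (snd p))"
    by (rule dC_smooth_comp[OF P(1) smooth_fst[OF G.arr_manifold CB.total_manifold] smooth_snd[OF G.arr_manifold CB.total_manifold]])
      (auto dest: CB.fibreD(2))
  then show "quasi_action G C (dC R)"
    using dC_linear by (simp add: quasi_action_def case_prod_unfold)
  have "smooth_map_on (prod_mfd (arr G) (tot E)) (tot E) {p. fst p \<in> Arr G \<and> snd p \<in> fibre E (src G (fst p))}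
      (\<lambda>p. dE R (fst p) (snd p))"
    by (rule dE_smooth_comp[OF P(2) smooth_fst[OF G.arr_manifold EB.total_manifold] smooth_snd[OF G.arr_manifold EB.total_manifold]])
      (auto dest: EB.fibreD(2))
  then show "quasi_action G E (dE R)"
    using dE_linear by (simp add: quasi_action_def case_prod_unfold)
  show "unital G C (dC R)" "unital G E (dE R)"
    using dC_unt dE_unt by (simp_all add: unital_def)
  show "fibre_linear E (src G g\<^sub>2) C (tgt G g\<^sub>1) (Om R g\<^sub>1 g\<^sub>2)" if "(g\<^sub>1, g\<^sub>2) \<in> composable G" for g\<^sub>1 g\<^sub>2
    by (rule Om_linear[OF that])
  define S where "S = {p. fst p \<in> composable G \<and> snd p \<in> fibre E (src G (snd (fst p)))}"
  have S: "S \<subseteq> (Arr G \<times> Arr G) \<times> mcar (tot E)"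
    using EB.fibreD(2) by (auto simp: S_def composable_def)
  have f: "smooth_map_on (prod_mfd (prod_mfd (arr G) (arr G)) (tot E)) (prod_mfd (arr G) (arr G)) S fst"
    by (rule smooth_fst[OF P(3) EB.total_manifold]) (use S in simp)
  have "smooth_map_on (prod_mfd (prod_mfd (arr G) (arr G)) (tot E)) (tot C) S (\<lambda>p. Om R (fst (fst p)) (snd (fst p)) (snd p))"
    by (rule Om_smooth_comp[OF P(4) smooth_fst_comp[OF P(4) G.arr_manifold G.arr_manifold f]
          smooth_snd_comp[OF P(4) G.arr_manifold G.arr_manifold f] smooth_snd[OF P(3) EB.total_manifold]])
      (use S in \<open>auto simp: S_def\<close>)
  then show "smooth_map_on (prod_mfd (prod_mfd (arr G) (arr G)) (tot E)) (tot C)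
      {((g\<^sub>1, g\<^sub>2), e). (g\<^sub>1, g\<^sub>2) \<in> composable G \<and> e \<in> fibre E (src G g\<^sub>2)} (\<lambda>((g\<^sub>1, g\<^sub>2), e). Om R g\<^sub>1 g\<^sub>2 e)"
    by (simp add: S_def case_prod_unfold)
  show "Om R g\<^sub>1 g\<^sub>2 e = vzero C (tgt G g\<^sub>1)"
    if "(g\<^sub>1, g\<^sub>2) \<in> composable G" "g\<^sub>1 \<in> unt G ` Obj G \<or> g\<^sub>2 \<in> unt G ` Obj G" "e \<in> fibre E (src G g\<^sub>2)" for g\<^sub>1 g\<^sub>2 e
    by (rule Om_unt[OF that])
  \<comment> \<open>Both sides are the target of \<open>kz (dC R g c) g\<close>: right translation
    does not change the target of the core element, and \<open>kz_dC\<close> presents the same arrow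
    as a product beginning with a lift.\<close>
  show "dE R g (bd R c) = bd R (dC R g c)" if g: "g \<in> Arr G" and c: "c \<in> fibre C (src G g)" for g c
    using ttgt_kz[OF g dC_in[OF g c]] kz_dC[OF g c] ttgt_h\<kappa>[OF g c] bd_eq[OF dC_in[OF g c]] by simp
  show "vadd E (vsub E (dE R g\<^sub>1 (dE R g\<^sub>2 e)) (dE R (mul G g\<^sub>1 g\<^sub>2) e)) (bd R (Om R g\<^sub>1 g\<^sub>2 e)) = vzero E (tgt G g\<^sub>1)"
    if gg: "(g\<^sub>1, g\<^sub>2) \<in> composable G" and e: "e \<in> fibre E (src G g\<^sub>2)" for g\<^sub>1 g\<^sub>2 e
  proof -
    note g = G.composableD[OF gg]
    have i: "dE R g\<^sub>1 (dE R g\<^sub>2 e) \<in> fibre E (tgt G g\<^sub>1)" "dE R (mul G g\<^sub>1 g\<^sub>2) e \<in> fibre E (tgt G g\<^sub>1)"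
      using dE_in[OF g(1)] dE_in[OF g(2) e] dE_in[OF G.mul_in[OF gg], of e] g(3) e G.tgt_mul[OF gg] G.src_mul[OF gg]
      by simp_all
    show ?thesis
      unfolding bd_Om[OF gg e]
      by (rule EB.crd_inj[of _ "tgt G g\<^sub>1"])
        (simp_all add: i EB.vadd_in EB.vsub_in EB.zero_closed G.tgt_in g)
  qed
  note dC0 = fibre_linear_vzero[OF CB.vector_bundle_axioms CB.vector_bundle_axioms dC_linear]
  note dE0 = fibre_linear_vzero[OF EB.vector_bundle_axioms EB.vector_bundle_axioms dE_linear]
  note Om0 = fibre_linear_vzero[OF EB.vector_bundle_axioms CB.vector_bundle_axioms Om_linear]
  note bd0 = fibre_linear_vzero[OF CB.vector_bundle_axioms EB.vector_bundle_axioms bd_linear]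
  show "vadd C (vsub C (dC R g\<^sub>1 (dC R g\<^sub>2 c)) (dC R (mul G g\<^sub>1 g\<^sub>2) c)) (Om R g\<^sub>1 g\<^sub>2 (bd R c)) = vzero C (tgt G g\<^sub>1)"
    if gg: "(g\<^sub>1, g\<^sub>2) \<in> composable G" and c: "c \<in> fibre C (src G g\<^sub>2)" for g\<^sub>1 g\<^sub>2 c
  proof -
    note g = G.composableD[OF gg] and s2 = G.src_in[OF G.composableD(2)[OF gg]]
    \<comment> \<open>The third arrow for \<open>assoc_core\<close> lies over the unit
      \<open>u\<close> and has core component \<open>c\<close> and source 0, so it is the core
      element \<open>c\<close> itself. The values of \<open>Om\<close> at the zero vector vanish,
      which leaves the claim.\<close>
    define u where "u = unt G (src G g\<^sub>2)"
    have u: "u \<in> Arr G" "src G u = src G g\<^sub>2" "tgt G u = src G g\<^sub>2"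
      using s2 by (simp_all add: u_def G.unt_in G.src_unt G.tgt_unt)
    have g2u: "(g\<^sub>2, u) \<in> composable G" using g u by (simp add: composable_def)
    have m: "mul G g\<^sub>2 u = g\<^sub>2" unfolding u_def by (rule G.mul_unt_right[OF g(2)])
    have g12u: "(mul G g\<^sub>1 g\<^sub>2, u) \<in> composable G"
      using G.mul_in[OF gg] G.src_mul[OF gg] u by (simp add: composable_def)
    have zC: "vzero C (tgt G g\<^sub>2) \<in> fibre C (tgt G g\<^sub>2)" by (rule CB.zero_closed[OF G.tgt_in[OF g(2)]])
    have zE: "vzero E (src G g\<^sub>2) \<in> fibre E (src G g\<^sub>2)" by (rule EB.zero_closed[OF s2])
    have b: "bd R c \<in> fibre E (src G g\<^sub>2)" by (rule bd_in[OF c])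
    have e2: "bd R c = vadd E (bd R c) (dE R u (vzero E (src G u)))"
      using dE0[OF u(1)] s2 u EB.vadd_vzero_right[OF b] by simp
    have d: "dC R g\<^sub>2 c \<in> fibre C (tgt G g\<^sub>2)" "dC R g\<^sub>2 c \<in> fibre C (src G g\<^sub>1)"
      using dC_in[OF g(2) c] g(3) by simp_all
    have i: "dC R g\<^sub>1 (dC R g\<^sub>2 c) \<in> fibre C (tgt G g\<^sub>1)" "dC R (mul G g\<^sub>1 g\<^sub>2) c \<in> fibre C (tgt G g\<^sub>1)"
      "Om R g\<^sub>1 g\<^sub>2 (bd R c) \<in> fibre C (tgt G g\<^sub>1)" "vzero C (tgt G g\<^sub>1) \<in> fibre C (tgt G g\<^sub>1)"
      using dC_in[OF g(1) d(2)] dC_in[OF G.mul_in[OF gg], of c] c Om_in[OF gg b] G.tgt_mul[OF gg] G.src_mul[OF gg]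
        CB.zero_closed[OF G.tgt_in[OF g(1)]] by simp_all
    have o: "Om R g\<^sub>2 u (vzero E (src G u)) = vzero C (tgt G g\<^sub>2)"
      "Om R (mul G g\<^sub>1 g\<^sub>2) u (vzero E (src G u)) = vzero C (tgt G g\<^sub>1)"
      "Om R g\<^sub>1 (mul G g\<^sub>2 u) (vzero E (src G u)) = vzero C (tgt G g\<^sub>1)"
      "dC R g\<^sub>1 (vzero C (tgt G g\<^sub>2)) = vzero C (tgt G g\<^sub>1)"
      using Om0[OF g2u] Om0[OF g12u] Om0[OF gg] dC0[OF g(1)] s2 u m G.tgt_mul[OF gg] g(3) G.tgt_in[OF g(2)] by simp_all
    have v: "vsub C (vadd C (vzero C (tgt G g\<^sub>2)) (dC R g\<^sub>2 c)) (vzero C (tgt G g\<^sub>2)) = dC R g\<^sub>2 c"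
      by (rule CB.crd_inj[of _ "tgt G g\<^sub>2"])
        (simp_all add: d zC CB.vadd_in CB.vsub_in G.tgt_in g)
    have "vsub C (vadd C (vsub C (vzero C (tgt G g\<^sub>1)) (Om R g\<^sub>1 g\<^sub>2 (bd R c))) (dC R (mul G g\<^sub>1 g\<^sub>2) c)) (vzero C (tgt G g\<^sub>1))
        = vsub C (dC R g\<^sub>1 (dC R g\<^sub>2 c)) (vzero C (tgt G g\<^sub>1))"
      using assoc_core[OF gg g2u zC _ _ e2] c zE u by (simp add: o[unfolded u(2) m] v m)
    from arg_cong[OF this, of "crd C (tgt G g\<^sub>1)"]
    show ?thesis
      by (intro CB.crd_inj[of _ "tgt G g\<^sub>1"])
        (simp_all add: i CB.vadd_in CB.vsub_in G.tgt_in g algebra_simps)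
  qed
  show "vsub C (vadd C (vsub C (dC R g\<^sub>1 (Om R g\<^sub>2 g\<^sub>3 e)) (Om R (mul G g\<^sub>1 g\<^sub>2) g\<^sub>3 e)) (Om R g\<^sub>1 (mul G g\<^sub>2 g\<^sub>3) e))
      (Om R g\<^sub>1 g\<^sub>2 (dE R g\<^sub>3 e)) = vzero C (tgt G g\<^sub>1)"
    if gg: "(g\<^sub>1, g\<^sub>2) \<in> composable G" "(g\<^sub>2, g\<^sub>3) \<in> composable G" and e: "e \<in> fibre E (src G g\<^sub>3)" for g\<^sub>1 g\<^sub>2 g\<^sub>3 e
  proof -
    note g = G.composableD[OF gg(1)] and g' = G.composableD[OF gg(2)]
    note m = G.mul_in[OF gg(1)] G.mul_in[OF gg(2)]
      G.tgt_mul[OF gg(1)] G.tgt_mul[OF gg(2)] G.src_mul[OF gg(1)] G.src_mul[OF gg(2)]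
    have gg': "(mul G g\<^sub>1 g\<^sub>2, g\<^sub>3) \<in> composable G" "(g\<^sub>1, mul G g\<^sub>2 g\<^sub>3) \<in> composable G"
      using g g' m by (simp_all add: composable_def)
    have z: "vzero C (tgt G g\<^sub>2) \<in> fibre C (tgt G g\<^sub>2)" "vzero C (tgt G g\<^sub>3) \<in> fibre C (tgt G g\<^sub>3)"
      "vzero C (tgt G g\<^sub>1) \<in> fibre C (tgt G g\<^sub>1)"
      using CB.zero_closed G.tgt_in g g' by simp_all
    have d: "dE R g\<^sub>3 e \<in> fibre E (src G g\<^sub>2)" using dE_in[OF g'(2) e] g'(3) by simp
    \<comment> \<open>With zero core components the second and third arrows are lifts, and
      \<open>e\<^sub>2\<close> in \<open>assoc_core\<close> is the target
      \<open>dE R g\<^sub>3 e\<close> of the third.\<close>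
    have e2: "dE R g\<^sub>3 e = vadd E (bd R (vzero C (tgt G g\<^sub>3))) (dE R g\<^sub>3 e)"
      using bd0[OF G.tgt_in[OF g'(2)]] EB.vadd_vzero_left[OF d] G.tgt_in[OF g'(2)] g'(3) by simp
    have O: "Om R g\<^sub>2 g\<^sub>3 e \<in> fibre C (tgt G g\<^sub>2)" "Om R g\<^sub>2 g\<^sub>3 e \<in> fibre C (src G g\<^sub>1)"
      using Om_in[OF gg(2) e] g(3) by simp_all
    have o: "dC R g\<^sub>1 (vzero C (tgt G g\<^sub>2)) = vzero C (tgt G g\<^sub>1)" "dC R g\<^sub>2 (vzero C (tgt G g\<^sub>3)) = vzero C (tgt G g\<^sub>2)"
      "dC R (mul G g\<^sub>1 g\<^sub>2) (vzero C (tgt G g\<^sub>3)) = vzero C (tgt G g\<^sub>1)"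
      using dC0[OF g(1)] dC0[OF g(2)] dC0[OF m(1)] g(3) g'(3) m G.tgt_in g g' by simp_all
    have i: "dC R g\<^sub>1 (Om R g\<^sub>2 g\<^sub>3 e) \<in> fibre C (tgt G g\<^sub>1)" "Om R (mul G g\<^sub>1 g\<^sub>2) g\<^sub>3 e \<in> fibre C (tgt G g\<^sub>1)"
      "Om R g\<^sub>1 (mul G g\<^sub>2 g\<^sub>3) e \<in> fibre C (tgt G g\<^sub>1)" "Om R g\<^sub>1 g\<^sub>2 (dE R g\<^sub>3 e) \<in> fibre C (tgt G g\<^sub>1)"
      using dC_in[OF g(1) O(2)] Om_in[OF gg'(1) e] Om_in[OF gg'(2), of e] Om_in[OF gg(1) d] e m by simp_all
    have "vsub C (vadd C (vzero C (tgt G g\<^sub>2)) (vzero C (tgt G g\<^sub>2))) (Om R g\<^sub>2 g\<^sub>3 e) = vsub C (vzero C (tgt G g\<^sub>2)) (Om R g\<^sub>2 g\<^sub>3 e)"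
      by (simp add: CB.vadd_vzero_left[OF z(1)])
    then have v: "dC R g\<^sub>1 (vsub C (vadd C (vzero C (tgt G g\<^sub>2)) (vzero C (tgt G g\<^sub>2))) (Om R g\<^sub>2 g\<^sub>3 e)) =
        vsub C (vzero C (tgt G g\<^sub>1)) (dC R g\<^sub>1 (Om R g\<^sub>2 g\<^sub>3 e))"
      using fibre_linear_vsub[OF CB.vector_bundle_axioms dC_linear[OF g(1)]] z(1) O(1) g(3) o(1) by simp
    have "vsub C (vadd C (vsub C (vzero C (tgt G g\<^sub>1)) (Om R g\<^sub>1 g\<^sub>2 (dE R g\<^sub>3 e))) (vzero C (tgt G g\<^sub>1))) (Om R (mul G g\<^sub>1 g\<^sub>2) g\<^sub>3 e)
        = vsub C (vsub C (vzero C (tgt G g\<^sub>1)) (dC R g\<^sub>1 (Om R g\<^sub>2 g\<^sub>3 e))) (Om R g\<^sub>1 (mul G g\<^sub>2 g\<^sub>3) e)"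
      using assoc_core[OF gg z(1) z(2) e e2] by (simp add: o v)
    from arg_cong[OF this, of "crd C (tgt G g\<^sub>1)"]
    show ?thesis
      by (intro CB.crd_inj[of _ "tgt G g\<^sub>1"])
        (simp_all add: i z CB.vadd_in CB.vsub_in CB.zero_closed G.tgt_in g algebra_simps)
  qed
\<comment> \<open>The values off the domains are left; they are \<open>undefined\<close> by the
  conditionals in \<open>to_rep2\<close>.\<close>
qed (auto simp: to_rep2_def Let_def)

end

section \<open>The bundle \<open>t\<^sup>*C \<oplus> s\<^sup>*E\<close>\<close>

text \<open>Gathers the constructions determined by the two bundles over \<open>G\<close>. It is
  instantiated by \<open>rep_up_to_homotopy\<close> and, through that locale, by
  \<open>lifted_vb_groupoid\<close>.\<close>

locale bundle_pair =
  G: lie_groupoid G + EB: vector_bundle "obj G" E + CB: vector_bundle "obj G" C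
  for G :: "('g, 'gv::euclidean_space, 'm, 'mv::euclidean_space) lgpd"
    and E :: "('e, 'ev::euclidean_space, 'm) vb"
    and C :: "('c, 'cv::euclidean_space, 'm) vb"
begin

abbreviation "CGE \<equiv> prod_mfd (tot C) (prod_mfd (arr G) (tot E))"

definition SD :: "('c \<times> 'g \<times> 'e) set" where
  "SD = {(c, g, e). g \<in> Arr G \<and> c \<in> fibre C (tgt G g) \<and> e \<in> fibre E (src G g)}"

lemma manifold_GE: "manifold (prod_mfd (arr G) (tot E))" and manifold_CGE: "manifold CGE"
  by (intro manifold_prod G.arr_manifold CB.total_manifold EB.total_manifold)+

lemma SD_sub: "SD \<subseteq> mcar CGE"
  using EB.fibreD(2) CB.fibreD(2) by (auto simp: SD_def)

lemma
  assumes X: "manifold X" and f: "smooth_map_on X CGE S f"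
  shows smooth_CGE_1: "smooth_map_on X (tot C) S (\<lambda>x. fst (f x))"
    and smooth_CGE_2: "smooth_map_on X (arr G) S (\<lambda>x. fst (snd (f x)))"
    and smooth_CGE_3: "smooth_map_on X (tot E) S (\<lambda>x. snd (snd (f x)))"
proof -
  show "smooth_map_on X (tot C) S (\<lambda>x. fst (f x))"
    by (rule smooth_fst_comp[OF X CB.total_manifold manifold_GE f])
  have s: "smooth_map_on X (prod_mfd (arr G) (tot E)) S (\<lambda>x. snd (f x))"
    by (rule smooth_snd_comp[OF X CB.total_manifold manifold_GE f])
  show "smooth_map_on X (arr G) S (\<lambda>x. fst (snd (f x)))" "smooth_map_on X (tot E) S (\<lambda>x. snd (snd (f x)))"
    by (rule smooth_fst_comp[OF X G.arr_manifold EB.total_manifold s]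
        smooth_snd_comp[OF X G.arr_manifold EB.total_manifold s])+
qed

text \<open>A chart of \<open>G\<close> together with trivializations of \<open>C\<close> around the
  target and of \<open>E\<close> around the source straightens \<open>SD\<close> near
  \<open>p\<close>. The image \<open>Q\<close> is relatively open in a product of linear subspaces,
  and the inverse \<open>\<rho>\<close> is smooth into the ambient product, as the induced atlas
  demands.\<close>

lemma SD_chart:
  assumes p: "p \<in> SD"
  shows "\<exists>W \<theta>. p \<in> W \<and> (W, \<theta>) \<in> matlas (sub_mfd CGE SD)"
proof -
  obtain c0 g0 e0 where p0: "p = (c0, g0, e0)" "g0 \<in> Arr G" "c0 \<in> fibre C (tgt G g0)" "e0 \<in> fibre E (src G g0)"
    using p by (auto simp: SD_def)
  obtain U \<phi> where U: "(U, \<phi>) \<in> matlas (arr G)" "g0 \<in> U"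
    using manifold.chart_at[OF G.arr_manifold p0(2)] by blast
  obtain UC FC \<Phi>C where C: "tgt G g0 \<in> UC" "trivialization (obj G) C UC FC \<Phi>C"
    using CB.locally_trivial[OF G.tgt_in[OF p0(2)]] by blast
  obtain UE FE \<Phi>E where E: "src G g0 \<in> UE" "trivialization (obj G) E UE FE \<Phi>E"
    using EB.locally_trivial[OF G.src_in[OF p0(2)]] by blast
  note tC = trivializationD[OF C(2)] and tE = trivializationD[OF E(2)]
  note iC = CB.triv_inv[OF C(2)] and iE = EB.triv_inv[OF E(2)]
  note cU = is_chartD[OF manifold.charts[OF G.arr_manifold U(1)]]
  obtain L where L: "subspace L" "openin (top_of_set L) (\<phi> ` U)"
    using manifold.charts[OF G.arr_manifold U(1)] by (auto simp: is_chart_def models_def)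
  define N where "N = {g \<in> U. tgt G g \<in> UC \<and> src G g \<in> UE}"
  have "openin (mtop (arr G)) {g \<in> Arr G. tgt G g \<in> UC}" "openin (mtop (arr G)) {g \<in> Arr G. src G g \<in> UE}"
    using smooth_map_onD(2)[OF G.tgt_smooth] smooth_map_onD(2)[OF G.src_smooth] tC(1) tE(1)
    by (auto simp: subtopology_topspace intro: openin_continuous_map_preimage)
  moreover have "N = U \<inter> ({g \<in> Arr G. tgt G g \<in> UC} \<inter> {g \<in> Arr G. src G g \<in> UE})"
    using cU(2) by (auto simp: N_def)
  ultimately have N: "openin (mtop (arr G)) N" using cU(1) by (simp add: openin_Int)
  have NU: "N \<subseteq> U" and NA: "N \<subseteq> Arr G" using cU(2) by (auto simp: N_def)
  define W where "W = {q \<in> SD. fst (snd q) \<in> N}"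
  define \<theta> where "\<theta> = (\<lambda>q. (\<Phi>C (fst q), \<phi> (fst (snd q)), \<Phi>E (snd (snd q))))"
  define Q where "Q = FC \<times> \<phi> ` N \<times> FE"
  \<comment> \<open>The base arrow is recovered before the other components, because the fibres in
    which these are inverted lie over its target and its source.\<close>
  define iu where "iu = (\<lambda>q :: 'cv \<times> 'gv \<times> 'ev. inv_into U \<phi> (fst (snd q)))"
  define \<rho> where "\<rho> = (\<lambda>q. (inv_into (fibre C (tgt G (iu q))) \<Phi>C (fst q), iu q, inv_into (fibre E (src G (iu q))) \<Phi>E (snd (snd q))))"
  have iuN: "iu q \<in> N" "\<phi> (iu q) = fst (snd q)" if "q \<in> Q" for q
    using that cU(3) NU by (auto simp: Q_def iu_def)
  have iuUC: "tgt G (iu q) \<in> UC" "src G (iu q) \<in> UE" if "q \<in> Q" for q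
    using iuN(1)[OF that] by (auto simp: N_def)
  have \<theta>Q: "\<theta> q \<in> Q" and \<rho>\<theta>: "\<rho> (\<theta> q) = q" if "q \<in> W" for q
  proof -
    obtain c g e where q: "q = (c, g, e)" "c \<in> fibre C (tgt G g)" "e \<in> fibre E (src G g)" "g \<in> N"
      using \<open>q \<in> W\<close> by (auto simp: W_def SD_def)
    then have u: "tgt G g \<in> UC" "src G g \<in> UE" "g \<in> U" by (auto simp: N_def)
    show "\<theta> q \<in> Q" using iC(2)[OF u(1) q(2)] iE(2)[OF u(2) q(3)] q(4) by (simp add: \<theta>_def Q_def q(1))
    have "iu (\<theta> q) = g" using u(3) cU(3) by (simp add: iu_def \<theta>_def q(1))
    then show "\<rho> (\<theta> q) = q"
      using iC(1)[OF u(1) q(2)] iE(1)[OF u(2) q(3)] by (simp add: \<rho>_def) (simp add: \<theta>_def q(1))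
  qed
  have \<rho>W: "\<rho> q \<in> W" and \<theta>\<rho>: "\<theta> (\<rho> q) = q" if "q \<in> Q" for q
  proof -
    have F: "fst q \<in> FC" "snd (snd q) \<in> FE" using that by (auto simp: Q_def)
    show "\<rho> q \<in> W"
      using iuN(1)[OF that] NA iC(3)[OF iuUC(1)[OF that] F(1)] iE(3)[OF iuUC(2)[OF that] F(2)]
      by (auto simp: \<rho>_def W_def SD_def)
    show "\<theta> (\<rho> q) = q"
      using iuN(2)[OF that] iC(4)[OF iuUC(1)[OF that] F(1)] iE(4)[OF iuUC(2)[OF that] F(2)]
      by (simp add: \<rho>_def \<theta>_def)
  qed
  have im: "\<theta> ` W = Q" using \<theta>Q \<rho>W \<theta>\<rho> by (metis image_eqI image_subsetI subsetI subset_antisym)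
  have inj: "inj_on \<theta> W" using \<rho>\<theta> by (rule inj_on_inverseI)
  have W_sub: "W \<subseteq> SD" "W \<subseteq> mcar CGE" using SD_sub by (auto simp: W_def)
  note id = manifold.smooth_ident[OF manifold_CGE W_sub(2)]
  have \<theta>: "smooth_map_on CGE euclid_mfd W \<theta>"
    unfolding \<theta>_def prod_euclid_mfd[symmetric]
  proof (intro smooth_Pair)
    show "smooth_map_on CGE euclid_mfd W (\<lambda>q. \<Phi>C (fst q))"
      by (rule CB.smooth_triv[OF C(2) manifold_CGE smooth_CGE_1[OF manifold_CGE id]])
        (auto simp: W_def SD_def N_def CB.fibreD(3))
    show "smooth_map_on CGE euclid_mfd W (\<lambda>q. \<Phi>E (snd (snd q)))"
      by (rule EB.smooth_triv[OF E(2) manifold_CGE smooth_CGE_3[OF manifold_CGE id]])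
        (auto simp: W_def SD_def N_def EB.fibreD(3))
    show "smooth_map_on CGE euclid_mfd W (\<lambda>q. \<phi> (fst (snd q)))"
      by (rule smooth_compose[OF manifold_CGE G.arr_manifold manifold.chart_smooth[OF G.arr_manifold U(1)]
            smooth_CGE_2[OF manifold_CGE id]])
        (use NU in \<open>auto simp: W_def\<close>)
  qed
  have \<rho>: "smooth_map_on euclid_mfd CGE Q \<rho>"
  proof -
    have iu: "smooth_map_on euclid_mfd (arr G) Q iu"
      unfolding iu_def
      by (rule smooth_compose[OF manifold_euclid manifold_euclid manifold.chart_inv_smooth[OF G.arr_manifold U(1)]])
        (use NU in \<open>auto simp: Q_def smooth_map_on_euclid_euclid bounded_linear_fst bounded_linear_snd
          intro!: smooth_in_linear bounded_linear_compose[of fst snd, unfolded o_def]\<close>)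
    have f: "smooth_map_on (euclid_mfd :: ('cv \<times> 'gv \<times> 'ev, _) mfd) euclid_mfd Q fst"
      by (simp add: smooth_map_on_euclid_euclid smooth_in_fst)
    have s: "smooth_map_on (euclid_mfd :: ('cv \<times> 'gv \<times> 'ev, _) mfd) euclid_mfd Q (\<lambda>q. snd (snd q))"
      by (auto simp: smooth_map_on_euclid_euclid bounded_linear_snd
          intro!: smooth_in_linear bounded_linear_compose[of snd snd, unfolded o_def])
    show ?thesis
      unfolding \<rho>_def
    proof (intro smooth_Pair iu)
      show "smooth_map_on euclid_mfd (tot C) Q (\<lambda>q. inv_into (fibre C (tgt G (iu q))) \<Phi>C (fst q))"
        by (rule CB.smooth_triv_inv[OF C(2) manifold_euclid
              smooth_compose_map[OF manifold_euclid G.arr_manifold G.tgt_smooth iu] iuUC(1) f])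
          (auto simp: Q_def)
      show "smooth_map_on euclid_mfd (tot E) Q (\<lambda>q. inv_into (fibre E (src G (iu q))) \<Phi>E (snd (snd q)))"
        by (rule EB.smooth_triv_inv[OF E(2) manifold_euclid
              smooth_compose_map[OF manifold_euclid G.arr_manifold G.src_smooth iu] iuUC(2) s])
          (auto simp: Q_def)
    qed
  qed
  have inv: "smooth_map_on euclid_mfd CGE (\<theta> ` W) (inv_into W \<theta>)"
  proof (rule smooth_map_on_cong[OF _ _ manifold_charted[OF manifold_euclid]])
    show "smooth_map_on euclid_mfd CGE (\<theta> ` W) \<rho>" using \<rho> im by simp
    fix q assume "q \<in> \<theta> ` W"
    then show "\<rho> q = inv_into W \<theta> q"
      using inv_into_f_eq[OF inj \<rho>W \<theta>\<rho>] im by simp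
  qed
  have chart: "is_chart (subtopology (mtop CGE) SD) W \<theta>"
    unfolding is_chart_def
  proof (intro conjI exI)
    have "openin (mtop CGE) {q \<in> topspace (mtop CGE). fst (snd q) \<in> N}"
      using smooth_map_onD(2)[OF smooth_CGE_2[OF manifold_CGE manifold.smooth_ident[OF manifold_CGE order_refl]]] N
      unfolding subtopology_topspace by (rule openin_continuous_map_preimage)
    moreover have "W = {q \<in> topspace (mtop CGE). fst (snd q) \<in> N} \<inter> SD"
      using SD_sub unfolding W_def by blast
    ultimately show "openin (subtopology (mtop CGE) SD) W"
      unfolding openin_subtopology by blast
    have "openin (top_of_set (\<phi> ` U)) (\<phi> ` N)"
      using cU(6)[OF N] NU by (simp add: Int_absorb1)
    then have "openin (top_of_set L) (\<phi> ` N)" using L(2) by (rule openin_trans)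
    then show "models (FC \<times> L \<times> FE) W \<theta>"
      using L(1) tC(2) tE(2) by (auto simp: models_def im Q_def subspace_Times intro!: openin_Times)
    have "homeomorphic_maps (subtopology (subtopology (mtop CGE) SD) W) (top_of_set (\<theta> ` W)) \<theta> \<rho>"
      unfolding homeomorphic_maps_def
    proof (intro conjI)
      have eq: "subtopology (subtopology (mtop CGE) SD) W = subtopology (mtop CGE) W"
        using W_sub(1) by (simp add: subtopology_subtopology Int_absorb1)
      show "continuous_map (subtopology (subtopology (mtop CGE) SD) W) (top_of_set (\<theta> ` W)) \<theta>"
        using smooth_map_onD(2)[OF \<theta>] unfolding eq by (auto simp: continuous_map_in_subtopology)
      show "continuous_map (top_of_set (\<theta> ` W)) (subtopology (subtopology (mtop CGE) SD) W) \<rho>"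
        using smooth_map_onD(2)[OF \<rho>] \<rho>W unfolding eq im by (auto simp: continuous_map_in_subtopology)
    qed (use \<rho>\<theta> \<theta>\<rho> im in auto)
    then show "homeomorphic_map (subtopology (subtopology (mtop CGE) SD) W) (top_of_set (\<theta> ` W)) \<theta>"
      by (auto simp: homeomorphic_map_maps)
  qed
  have "p \<in> W" using p p0 U(2) C(1) E(1) by (simp add: W_def N_def)
  with chart \<theta> inv show ?thesis
    by (auto simp: matlas_sub_mfd)
qed

lemma manifold_SD: "manifold (sub_mfd CGE SD)"
  by (rule manifold_sub_mfd[OF manifold_CGE SD_sub SD_chart])

lemma mcar_SD: "mcar (sub_mfd CGE SD) = SD"
  using SD_sub by auto

text \<open>This rule and the three coordinate rules that follow replace the charts of
  \<open>SD\<close>: smoothness into \<open>SD\<close> is smoothness of the three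
  components.\<close>

lemma smooth_into_SD:
  assumes X: "manifold X" and c: "smooth_map_on X (tot C) S c" and g: "smooth_map_on X (arr G) S g"
    and e: "smooth_map_on X (tot E) S e"
    and f: "\<And>x. x \<in> S \<Longrightarrow> c x \<in> fibre C (tgt G (g x))" "\<And>x. x \<in> S \<Longrightarrow> e x \<in> fibre E (src G (g x))"
  shows "smooth_map_on X (sub_mfd CGE SD) S (\<lambda>x. (c x, g x, e x))"
  by (rule smooth_into_sub_mfd[OF X manifold_CGE smooth_Pair[OF c smooth_Pair[OF g e]]])
    (use f smooth_map_on_in[OF g] in \<open>auto simp: SD_def\<close>)

lemma
  assumes X: "manifold X" and f: "smooth_map_on X (sub_mfd CGE SD) S f"
  shows smooth_SD_1: "smooth_map_on X (tot C) S (\<lambda>x. fst (f x))"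
    and smooth_SD_2: "smooth_map_on X (arr G) S (\<lambda>x. fst (snd (f x)))"
    and smooth_SD_3: "smooth_map_on X (tot E) S (\<lambda>x. snd (snd (f x)))"
proof -
  have "smooth_map_on X CGE S (\<lambda>x. f x)"
    by (rule smooth_compose[OF X manifold_SD smooth_sub_incl[OF manifold_CGE order_refl SD_sub] f])
      (use smooth_map_on_in[OF f] in auto)
  from smooth_CGE_1[OF X this] smooth_CGE_2[OF X this] smooth_CGE_3[OF X this]
  show "smooth_map_on X (tot C) S (\<lambda>x. fst (f x))" "smooth_map_on X (arr G) S (\<lambda>x. fst (snd (f x)))"
    "smooth_map_on X (tot E) S (\<lambda>x. snd (snd (f x)))" .
qed

end

lemma vb_morphism_smooth: "vb_morphism B E B' E' f f\<^sub>0 \<Longrightarrow> smooth_map (tot E) (tot E') f"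
  by (simp add: vb_morphism_def)

section \<open>The vector bundle structure of the semidirect product\<close>

context bundle_pair
begin

lemma semidirect_simps [simp]:
  "tot (semidirect G E C R) = sub_mfd CGE SD"
  "prj (semidirect G E C R) (c, g, e) = g"
  "vadd (semidirect G E C R) (c, g, e) (c', g', e') = (vadd C c c', g, vadd E e e')"
  "vscl (semidirect G E C R) a (c, g, e) = (vscl C a c, g, vscl E a e)"
  "vzero (semidirect G E C R) g = (vzero C (tgt G g), g, vzero E (src G g))"
  "tsrc (semidirect G E C R) (c, g, e) = e"
  "ttgt (semidirect G E C R) (c, g, e) = vadd E (bd R c) (dE R g e)"
  "tmul (semidirect G E C R) (c, g, e) (c', g', e') =
    (vsub C (vadd C c (dC R g c')) (Om R g g' e'), mul G g g', e')"
  "tunt (semidirect G E C R) e = (vzero C (prj E e), unt G (prj E e), e)"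
  "tinv (semidirect G E C R) (c, g, e) = (vadd C (vscl C (- 1) (dC R (ginv G g) c)) (Om R (ginv G g) g e),
     ginv G g, vadd E (bd R c) (dE R g e))"
  "cemb (semidirect G E C R) c = (c, unt G (prj C c), vzero E (prj C c))"
  "hlift (semidirect G E C R) g e = (vzero C (tgt G g), g, e)"
  by (simp_all add: semidirect_def SD_def)

lemma vsub_semidirect [simp]: "vsub (semidirect G E C R) (c, g, e) (c', g', e') = (vsub C c c', g, vsub E e e')"
  by (simp add: vsub_def)

lemma prj_semidirect: "prj (semidirect G E C R) = (\<lambda>p. fst (snd p))"
  and tsrc_semidirect: "tsrc (semidirect G E C R) = (\<lambda>p. snd (snd p))"
  and ttgt_semidirect: "ttgt (semidirect G E C R) = (\<lambda>p. vadd E (bd R (fst p)) (dE R (fst (snd p)) (snd (snd p))))"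
  by (auto simp: fun_eq_iff)

lemma SD_iff [simp]: "(c, g, e) \<in> SD \<longleftrightarrow> g \<in> Arr G \<and> c \<in> fibre C (tgt G g) \<and> e \<in> fibre E (src G g)"
  by (simp add: SD_def)

lemma fibre_semidirect_iff [simp]: "(c, g, e) \<in> fibre (semidirect G E C R) g' \<longleftrightarrow>
    g = g' \<and> g \<in> Arr G \<and> c \<in> fibre C (tgt G g) \<and> e \<in> fibre E (src G g)"
  using SD_sub by (auto simp: fibre_def)

lemma fibre_semidirectE:
  assumes "p \<in> fibre (semidirect G E C R) g"
  obtains c e where "p = (c, g, e)" "g \<in> Arr G" "c \<in> fibre C (tgt G g)" "e \<in> fibre E (src G g)"
  using assms by (cases p) auto

lemma mcar_semidirect: "mcar (tot (semidirect G E C R)) = SD"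
  using mcar_SD by simp

lemma smooth_SD_ident: "S \<subseteq> SD \<Longrightarrow> smooth_map_on (sub_mfd CGE SD) (sub_mfd CGE SD) S (\<lambda>p. p)"
  by (rule manifold.smooth_ident[OF manifold_SD]) (simp only: mcar_SD)

lemmas SD_coord1 = smooth_SD_1[OF manifold_SD smooth_SD_ident]
lemmas SD_coord2 = smooth_SD_2[OF manifold_SD smooth_SD_ident]
lemmas SD_coord3 = smooth_SD_3[OF manifold_SD smooth_SD_ident]

text \<open>A trivialization has its values in the model type of the total space, here a product
  with three factors. The factor belonging to \<open>G\<close> is a base direction and contributes
  nothing to the fibre, whence the 0 in the middle.\<close>

lemma semidirect_trivial:
  assumes C: "trivialization (obj G) C UC FC \<Phi>C" and E: "trivialization (obj G) E UE FE \<Phi>E"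
  shows "trivialization (arr G) (semidirect G E C R) {g \<in> Arr G. tgt G g \<in> UC \<and> src G g \<in> UE}
    (FC \<times> {0} \<times> FE) (\<lambda>(c, g, e). (\<Phi>C c, 0, \<Phi>E e))"
    (is "trivialization _ _ ?U ?F ?\<Phi>")
proof -
  note tC = trivializationD[OF C] and tE = trivializationD[OF E]
  note iC = CB.triv_inv[OF C] and iE = EB.triv_inv[OF E]
  have "openin (mtop (arr G)) {g \<in> Arr G. tgt G g \<in> UC}" "openin (mtop (arr G)) {g \<in> Arr G. src G g \<in> UE}"
    using smooth_map_onD(2)[OF G.tgt_smooth] smooth_map_onD(2)[OF G.src_smooth] tC(1) tE(1)
    by (auto simp: subtopology_topspace intro: openin_continuous_map_preimage)
  moreover have "?U = {g \<in> Arr G. tgt G g \<in> UC} \<inter> {g \<in> Arr G. src G g \<in> UE}" by auto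
  ultimately have 1: "openin (mtop (arr G)) ?U" by (simp add: openin_Int)
  have bij: "bij_betw ?\<Phi> (fibre (semidirect G E C R) g) ?F" if g: "g \<in> ?U" for g
  proof (rule bij_betw_byWitness)
    let ?inv = "\<lambda>(v, _ :: 'gv, w). (inv_into (fibre C (tgt G g)) \<Phi>C v, g, inv_into (fibre E (src G g)) \<Phi>E w)"
    have u: "tgt G g \<in> UC" "src G g \<in> UE" "g \<in> Arr G" using g by auto
    show "\<forall>p\<in>fibre (semidirect G E C R) g. ?inv (?\<Phi> p) = p"
      using iC(1)[OF u(1)] iE(1)[OF u(2)] by auto
    show "\<forall>q\<in>?F. ?\<Phi> (?inv q) = q"
      using iC(4)[OF u(1)] iE(4)[OF u(2)] by auto
    show "?\<Phi> ` fibre (semidirect G E C R) g \<subseteq> ?F"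
      using iC(2)[OF u(1)] iE(2)[OF u(2)] by auto
    show "?inv ` ?F \<subseteq> fibre (semidirect G E C R) g"
      using iC(3)[OF u(1)] iE(3)[OF u(2)] u(3) by auto
  qed
  have inv: "inv_into (fibre (semidirect G E C R) g) ?\<Phi> q =
      (inv_into (fibre C (tgt G g)) \<Phi>C (fst q), g, inv_into (fibre E (src G g)) \<Phi>E (snd (snd q)))"
    if g: "g \<in> ?U" and q: "q \<in> ?F" for g q
  proof (rule inv_into_f_eq[OF bij_betw_imp_inj_on[OF bij[OF g]]])
    have u: "tgt G g \<in> UC" "src G g \<in> UE" "g \<in> Arr G" using g by auto
    have v: "fst q \<in> FC" "snd (snd q) \<in> FE" using q by auto
    show "(inv_into (fibre C (tgt G g)) \<Phi>C (fst q), g, inv_into (fibre E (src G g)) \<Phi>E (snd (snd q)))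
        \<in> fibre (semidirect G E C R) g"
      using iC(3)[OF u(1) v(1)] iE(3)[OF u(2) v(2)] u(3) by simp
    show "?\<Phi> (inv_into (fibre C (tgt G g)) \<Phi>C (fst q), g, inv_into (fibre E (src G g)) \<Phi>E (snd (snd q))) = q"
      using iC(4)[OF u(1) v(1)] iE(4)[OF u(2) v(2)] q by auto
  qed
  have sm: "smooth_map_on (sub_mfd CGE SD) euclid_mfd {p \<in> SD. fst (snd p) \<in> ?U} (\<lambda>p. (\<Phi>C (fst p), 0, \<Phi>E (snd (snd p))))"
    unfolding prod_euclid_mfd[symmetric]
  proof (intro smooth_Pair)
    show "smooth_map_on (sub_mfd CGE SD) euclid_mfd {p \<in> SD. fst (snd p) \<in> ?U} (\<lambda>p. \<Phi>C (fst p))"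
      by (rule CB.smooth_triv[OF C manifold_SD SD_coord1]) (auto simp: CB.fibreD(3))
    show "smooth_map_on (sub_mfd CGE SD) euclid_mfd {p \<in> SD. fst (snd p) \<in> ?U} (\<lambda>p. \<Phi>E (snd (snd p)))"
      by (rule EB.smooth_triv[OF E manifold_SD SD_coord3]) (auto simp: EB.fibreD(3))
    show "smooth_map_on (sub_mfd CGE SD) euclid_mfd {p \<in> SD. fst (snd p) \<in> ?U} (\<lambda>p. 0)"
      by (rule smooth_const) (use mcar_SD in auto)
  qed
  let ?X = "prod_mfd (arr G) (euclid_mfd :: ('cv \<times> 'gv \<times> 'ev, _) mfd)"
  have X: "manifold ?X" by (intro manifold_prod G.arr_manifold manifold_euclid)
  have f: "smooth_map_on ?X (arr G) (?U \<times> ?F) fst" and s: "smooth_map_on ?X euclid_mfd (?U \<times> ?F) snd"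
    by (rule smooth_fst[OF G.arr_manifold manifold_euclid] smooth_snd[OF G.arr_manifold manifold_euclid]; auto)+
  have s0: "smooth_map_on ?X (prod_mfd euclid_mfd (prod_mfd euclid_mfd euclid_mfd)) (?U \<times> ?F) snd"
    using s by (simp add: prod_euclid_mfd)
  note s1 = smooth_fst_comp[OF X manifold_euclid manifold_prod[OF manifold_euclid manifold_euclid] s0]
  note s2 = smooth_snd_comp[OF X manifold_euclid manifold_euclid
      smooth_snd_comp[OF X manifold_euclid manifold_prod[OF manifold_euclid manifold_euclid] s0]]
  have "smooth_map_on ?X (sub_mfd CGE SD) (?U \<times> ?F) (\<lambda>x. (inv_into (fibre C (tgt G (fst x))) \<Phi>C (fst (snd x)), fst x,
      inv_into (fibre E (src G (fst x))) \<Phi>E (snd (snd (snd x)))))"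
  proof (rule smooth_into_SD[OF X _ f])
    show "smooth_map_on ?X (tot C) (?U \<times> ?F) (\<lambda>x. inv_into (fibre C (tgt G (fst x))) \<Phi>C (fst (snd x)))"
      by (rule CB.smooth_triv_inv[OF C X smooth_compose_map[OF X G.arr_manifold G.tgt_smooth f] _ s1]) auto
    show "smooth_map_on ?X (tot E) (?U \<times> ?F) (\<lambda>x. inv_into (fibre E (src G (fst x))) \<Phi>E (snd (snd (snd x))))"
      by (rule EB.smooth_triv_inv[OF E X smooth_compose_map[OF X G.arr_manifold G.src_smooth f] _ s2]) auto
  qed (use iC(3) iE(3) in auto)
  then have sinv: "smooth_map_on ?X (sub_mfd CGE SD) (?U \<times> ?F) (\<lambda>(g, v). inv_into (fibre (semidirect G E C R) g) ?\<Phi> v)"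
    by (rule smooth_map_on_cong[rotated, OF _ manifold_charted[OF X]]) (auto simp: inv)
  have dom: "{p \<in> mcar (tot (semidirect G E C R)). prj (semidirect G E C R) p \<in> ?U} = {p \<in> SD. fst (snd p) \<in> ?U}"
    unfolding mcar_semidirect prj_semidirect ..
  have ph: "?\<Phi> = (\<lambda>p. (\<Phi>C (fst p), 0, \<Phi>E (snd (snd p))))" by (auto simp: fun_eq_iff)
  have add: "?\<Phi> (vadd (semidirect G E C R) p q) = ?\<Phi> p + ?\<Phi> q"
    if "g \<in> ?U" "p \<in> fibre (semidirect G E C R) g" "q \<in> fibre (semidirect G E C R) g" for g p q
    using that tC(4)[of "tgt G g"] tE(4)[of "src G g"] by (auto elim!: fibre_semidirectE)
  have scl: "?\<Phi> (vscl (semidirect G E C R) a p) = a *\<^sub>R ?\<Phi> p"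
    if "g \<in> ?U" "p \<in> fibre (semidirect G E C R) g" for g p a
    using that tC(5)[of "tgt G g"] tE(5)[of "src G g"] by (auto elim!: fibre_semidirectE)
  show ?thesis
    unfolding trivialization_def dom
    using 1 tC(2) tE(2) bij add scl sm sinv
    by (simp add: ph subspace_Times)
qed

theorem semidirect_vector_bundle: "vector_bundle (arr G) (semidirect G E C R)"
proof (rule vector_bundle.intro)
  show "manifold (arr G)" by (rule G.arr_manifold)
  show "manifold (tot (semidirect G E C R))" using manifold_SD by simp
  show "smooth_map (tot (semidirect G E C R)) (arr G) (prj (semidirect G E C R))"
    using SD_coord2[OF order_refl] mcar_SD by (simp add: prj_semidirect)
  show "\<exists>U F \<Phi>. g \<in> U \<and> trivialization (arr G) (semidirect G E C R) U F \<Phi>" if g: "g \<in> Arr G" for g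
  proof -
    obtain UC FC \<Phi>C where C: "tgt G g \<in> UC" "trivialization (obj G) C UC FC \<Phi>C"
      using CB.locally_trivial[OF G.tgt_in[OF g]] by blast
    obtain UE FE \<Phi>E where E: "src G g \<in> UE" "trivialization (obj G) E UE FE \<Phi>E"
      using EB.locally_trivial[OF G.src_in[OF g]] by blast
    show ?thesis
      by (rule exI, rule exI, rule exI, rule conjI[rotated], rule semidirect_trivial[OF C(2) E(2)])
        (use C(1) E(1) g in simp)
  qed
  fix g p q r a b
  assume g: "g \<in> Arr G"
  note t = G.tgt_in[OF g] and s = G.src_in[OF g]
  show "vzero (semidirect G E C R) g \<in> fibre (semidirect G E C R) g"
    using g CB.zero_closed[OF t] EB.zero_closed[OF s] by simp
  assume "p \<in> fibre (semidirect G E C R) g"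
  then obtain c e where p: "p = (c, g, e)" "c \<in> fibre C (tgt G g)" "e \<in> fibre E (src G g)"
    by (rule fibre_semidirectE)
  show "vscl (semidirect G E C R) a p \<in> fibre (semidirect G E C R) g"
    "vadd (semidirect G E C R) p (vzero (semidirect G E C R) g) = p"
    "vsub (semidirect G E C R) p p = vzero (semidirect G E C R) g"
    "vscl (semidirect G E C R) (a + b) p = vadd (semidirect G E C R) (vscl (semidirect G E C R) a p) (vscl (semidirect G E C R) b p)"
    "vscl (semidirect G E C R) a (vscl (semidirect G E C R) b p) = vscl (semidirect G E C R) (a * b) p"
    "vscl (semidirect G E C R) 1 p = p"
    using p g CB.vscl_in EB.vscl_in CB.add_zero[OF t] EB.add_zero[OF s] CB.add_neg[OF t] EB.add_neg[OF s]
      CB.scale_add_left[OF t] EB.scale_add_left[OF s] CB.scale_scale[OF t] EB.scale_scale[OF s]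
      CB.scale_one[OF t] EB.scale_one[OF s]
    by simp_all
  assume "q \<in> fibre (semidirect G E C R) g"
  then obtain c' e' where q: "q = (c', g, e')" "c' \<in> fibre C (tgt G g)" "e' \<in> fibre E (src G g)"
    by (rule fibre_semidirectE)
  show "vadd (semidirect G E C R) p q \<in> fibre (semidirect G E C R) g"
    "vscl (semidirect G E C R) a (vadd (semidirect G E C R) p q) =
      vadd (semidirect G E C R) (vscl (semidirect G E C R) a p) (vscl (semidirect G E C R) a q)"
    using p q g CB.vadd_in EB.vadd_in CB.scale_add_right[OF t] EB.scale_add_right[OF s]
    by simp_all
  show "vadd (semidirect G E C R) p q = vadd (semidirect G E C R) q p"
    using p q CB.add_commute[OF t p(2) q(2)] EB.add_commute[OF s p(3) q(3)] by simp
  assume "r \<in> fibre (semidirect G E C R) g"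
  then obtain c'' e'' where r: "r = (c'', g, e'')" "c'' \<in> fibre C (tgt G g)" "e'' \<in> fibre E (src G g)"
    by (rule fibre_semidirectE)
  show "vadd (semidirect G E C R) (vadd (semidirect G E C R) p q) r = vadd (semidirect G E C R) p (vadd (semidirect G E C R) q r)"
    using p q r CB.add_assoc[OF t p(2) q(2) r(2)] EB.add_assoc[OF s p(3) q(3) r(3)] by simp
qed

text \<open>A curve in \<open>E\<close> is lifted along the source by lifting its base curve to \<open>G\<close> to first order
  and keeping the fibre coordinates fixed.\<close>

lemma tsrc_submersion: "submersion (sub_mfd CGE SD) (tot E) (\<lambda>p. snd (snd p))"
proof (rule submersionI[OF manifold_SD EB.total_manifold])
  show "smooth_map (sub_mfd CGE SD) (tot E) (\<lambda>p. snd (snd p))"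
    using SD_coord3[OF order_refl] mcar_SD by simp
  fix p \<gamma> assume "p \<in> mcar (sub_mfd CGE SD)" and \<gamma>: "tangent (tot E) \<gamma> \<gamma>" "\<gamma> 0 = snd (snd p)"
  then obtain c0 g0 e0 where p: "p = (c0, g0, e0)" "g0 \<in> Arr G" "c0 \<in> fibre C (tgt G g0)" "e0 \<in> fibre E (src G g0)"
    using mcar_SD by (cases p) auto
  have \<gamma>0: "\<gamma> 0 = e0" using \<gamma>(2) p(1) by simp
  have e0: "e0 \<in> mcar (tot E)" "prj E e0 = src G g0" using EB.fibreD[OF p(4)] by auto
  have \<gamma>E: "eventually (\<lambda>t. \<gamma> t \<in> mcar (tot E)) (at 0)"
    using tangent_eventually[OF EB.total_manifold \<gamma>(1), of "mcar (tot E)"] \<gamma>0 e0 by simp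
  have q\<gamma>: "tangent (obj G) (\<lambda>t. prj E (\<gamma> t)) (\<lambda>t. prj E (\<gamma> t))"
    by (rule tangent_image[OF EB.total_manifold G.obj_manifold EB.prj_smooth \<gamma>(1) _ \<gamma>E \<gamma>E]) (simp add: \<gamma>0 e0)
  obtain \<delta> where \<delta>: "\<delta> 0 = g0" "tangent (arr G) \<delta> \<delta>" "tangent (obj G) (\<lambda>t. src G (\<delta> t)) (\<lambda>t. prj E (\<gamma> t))"
    using submersion_lift[OF G.arr_manifold G.obj_manifold G.src_submersion p(2) q\<gamma>] \<gamma>0 e0(2) by auto
  obtain UC FC \<Phi>C where C: "tgt G g0 \<in> UC" "trivialization (obj G) C UC FC \<Phi>C"
    using CB.locally_trivial[OF G.tgt_in[OF p(2)]] by blast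
  obtain UE FE \<Phi>E where E: "src G g0 \<in> UE" "trivialization (obj G) E UE FE \<Phi>E"
    using EB.locally_trivial[OF G.src_in[OF p(2)]] by blast
  note iC = CB.triv_inv[OF C(2)] and iE = EB.triv_inv[OF E(2)]
  define T where "T = {x. fst x \<in> Arr G \<and> tgt G (fst x) \<in> UC \<and> src G (fst x) \<in> UE \<and>
    snd x \<in> mcar (tot E) \<and> prj E (snd x) \<in> UE}"
  \<comment> \<open>The source of \<open>\<delta> t\<close> and the base point of
    \<open>\<gamma> t\<close> agree only to first order. Hence \<open>\<gamma> t\<close> is moved,
    with unchanged coordinates, into the fibre over the former, while the first component keeps the
    coordinates of \<open>c0\<close>.\<close>
  define F where "F = (\<lambda>x. (inv_into (fibre C (tgt G (fst x))) \<Phi>C (\<Phi>C c0), fst x,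
    inv_into (fibre E (src G (fst x))) \<Phi>E (\<Phi>E (snd x))))"
  let ?X = "prod_mfd (arr G) (tot E)"
  note X = manifold_GE
  have f: "smooth_map_on ?X (arr G) T fst" and s: "smooth_map_on ?X (tot E) T snd"
    by (rule smooth_fst[OF G.arr_manifold EB.total_manifold] smooth_snd[OF G.arr_manifold EB.total_manifold];
        auto simp: T_def)+
  have \<Phi>c0: "\<Phi>C c0 \<in> FC" by (rule iC(2)[OF C(1) p(3)])
  have \<Phi>e: "\<Phi>E e \<in> FE" if "e \<in> mcar (tot E)" "prj E e \<in> UE" for e
    using iE(2)[OF that(2) EB.fibreI[OF that(1)]] .
  have F: "smooth_map_on ?X (sub_mfd CGE SD) T F"
    unfolding F_def
  proof (rule smooth_into_SD[OF X _ f])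
    have T: "T \<subseteq> mcar ?X" by (auto simp: T_def)
    show "smooth_map_on ?X (tot C) T (\<lambda>x. inv_into (fibre C (tgt G (fst x))) \<Phi>C (\<Phi>C c0))"
      by (rule CB.smooth_triv_inv[OF C(2) X smooth_compose_map[OF X G.arr_manifold G.tgt_smooth f] _ smooth_const[OF T]])
        (auto simp: T_def \<Phi>c0)
    show "smooth_map_on ?X (tot E) T (\<lambda>x. inv_into (fibre E (src G (fst x))) \<Phi>E (\<Phi>E (snd x)))"
      by (rule EB.smooth_triv_inv[OF E(2) X smooth_compose_map[OF X G.arr_manifold G.src_smooth f] _
            EB.smooth_triv[OF E(2) X s]])
        (auto simp: T_def \<Phi>e)
  qed (use iC(3) iE(3) \<Phi>c0 \<Phi>e in \<open>auto simp: T_def\<close>)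
  have o1: "openin (mtop (arr G)) {g \<in> Arr G. tgt G g \<in> UC}" and o2: "openin (mtop (arr G)) {g \<in> Arr G. src G g \<in> UE}"
    and o3: "openin (mtop (tot E)) {e \<in> mcar (tot E). prj E e \<in> UE}"
    using smooth_map_onD(2)[OF G.tgt_smooth] smooth_map_onD(2)[OF G.src_smooth] smooth_map_onD(2)[OF EB.prj_smooth]
      trivializationD(1)[OF C(2)] trivializationD(1)[OF E(2)]
    by (auto simp: subtopology_topspace intro: openin_continuous_map_preimage)
  have ev: "eventually (\<lambda>t. tgt G (\<delta> t) \<in> UC \<and> \<delta> t \<in> Arr G) (at 0)" "eventually (\<lambda>t. src G (\<delta> t) \<in> UE) (at 0)"
    "eventually (\<lambda>t. prj E (\<gamma> t) \<in> UE) (at 0)"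
    using tangent_eventually[OF G.arr_manifold \<delta>(2) o1] tangent_eventually[OF G.arr_manifold \<delta>(2) o2]
      tangent_eventually[OF EB.total_manifold \<gamma>(1) o3] \<delta>(1) p C(1) E(1) \<gamma>0 e0
    by (auto elim: eventually_mono)
  have evT: "eventually (\<lambda>t. (\<delta> t, \<gamma> t) \<in> T) (at 0)"
    using ev \<gamma>E by eventually_elim (simp add: T_def)
  have T0: "(\<delta> 0, \<gamma> 0) \<in> T" using \<delta>(1) \<gamma>0 e0 p C(1) E(1) by (simp add: T_def)
  have tF: "tangent (sub_mfd CGE SD) (\<lambda>t. F (\<delta> t, \<gamma> t)) (\<lambda>t. F (\<delta> t, \<gamma> t))"
    by (rule tangent_image[OF X manifold_SD F tangent_Pair[OF \<delta>(2) \<gamma>(1)] T0 evT evT])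
  have \<Phi>\<gamma>: "tangent euclid_mfd (\<lambda>t. \<Phi>E (\<gamma> t)) (\<lambda>t. \<Phi>E (\<gamma> t))"
  proof (rule tangent_image[OF EB.total_manifold manifold_euclid trivializationD(6)[OF E(2)] \<gamma>(1)])
    show "eventually (\<lambda>t. \<gamma> t \<in> {p \<in> mcar (tot E). prj E p \<in> UE}) (at 0)"
      using ev(3) \<gamma>E by eventually_elim simp
    then show "eventually (\<lambda>t. \<gamma> t \<in> {p \<in> mcar (tot E). prj E p \<in> UE}) (at 0)" .
  qed (use e0 \<gamma>0 E(1) in auto)
  have ev\<Phi>: "eventually (\<lambda>t. (src G (\<delta> t), \<Phi>E (\<gamma> t)) \<in> UE \<times> FE) (at 0)"
    "eventually (\<lambda>t. (prj E (\<gamma> t), \<Phi>E (\<gamma> t)) \<in> UE \<times> FE) (at 0)"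
    using ev(2,3) \<gamma>E by (eventually_elim, simp add: \<Phi>e)+
  \<comment> \<open>The two base curves are tangent and the fibre coordinates are the same, so the
    inverse trivialization gives tangent curves. One is the last component of the lift, the other is
    \<open>\<gamma>\<close> near 0.\<close>
  have "tangent (tot E) (\<lambda>t. (\<lambda>(x, v). inv_into (fibre E x) \<Phi>E v) (src G (\<delta> t), \<Phi>E (\<gamma> t)))
      (\<lambda>t. (\<lambda>(x, v). inv_into (fibre E x) \<Phi>E v) (prj E (\<gamma> t), \<Phi>E (\<gamma> t)))"
    by (rule tangent_image[OF manifold_prod[OF G.obj_manifold manifold_euclid] EB.total_manifold
          trivializationD(7)[OF E(2)] tangent_Pair[OF \<delta>(3) \<Phi>\<gamma>] _ ev\<Phi>])
      (use \<delta>(1) \<gamma>0 E(1) e0 \<Phi>e in simp)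
  then have "tangent (tot E) (\<lambda>t. snd (snd (F (\<delta> t, \<gamma> t)))) (\<lambda>t. inv_into (fibre E (prj E (\<gamma> t))) \<Phi>E (\<Phi>E (\<gamma> t)))"
    by (simp add: F_def)
  then have "tangent (tot E) (\<lambda>t. snd (snd (F (\<delta> t, \<gamma> t)))) \<gamma>"
  proof (rule tangent_cong)
    show "eventually (\<lambda>t. inv_into (fibre E (prj E (\<gamma> t))) \<Phi>E (\<Phi>E (\<gamma> t)) = \<gamma> t) (at 0)"
      using ev(3) \<gamma>E by eventually_elim (simp add: iE(1) EB.fibreI)
    show "inv_into (fibre E (prj E (\<gamma> 0))) \<Phi>E (\<Phi>E (\<gamma> 0)) = \<gamma> 0"
      using iE(1)[OF E(1) p(4)] \<gamma>0 e0 by simp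
  qed
  moreover have "F (\<delta> 0, \<gamma> 0) = p"
    using iC(1)[OF C(1) p(3)] iE(1)[OF E(1) p(4)] \<delta>(1) \<gamma>0 p(1) by (simp add: F_def)
  ultimately show "\<exists>\<epsilon>. \<epsilon> 0 = p \<and> tangent (sub_mfd CGE SD) \<epsilon> \<epsilon> \<and> tangent (tot E) (\<lambda>t. snd (snd (\<epsilon> t))) \<gamma>"
    using tF by (intro exI[of _ "\<lambda>t. F (\<delta> t, \<gamma> t)"]) simp
qed

end

section \<open>The semidirect product\<close>

lemma (in lie_groupoid) inv_inv:
  assumes g: "g \<in> Arr G"
  shows "ginv G (ginv G g) = g"
proof -
  note i = inv_in[OF g] inv_in[OF inv_in[OF g]]
  have c: "(ginv G (ginv G g), ginv G g) \<in> composable G" "(ginv G g, g) \<in> composable G"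
    using g i by (simp_all add: composable_def src_inv)
  have "src G (ginv G (ginv G g)) = src G g" using g i by (simp add: src_inv tgt_inv)
  then show ?thesis
    using mul_assoc[OF c] inv_left[OF g] inv_left[OF i(1)] mul_unt_left[OF g] mul_unt_right[OF i(2)] g
    by (simp add: src_inv)
qed

context rep_up_to_homotopy
begin

sublocale bundle_pair G E C
  using base_groupoid E_bundle C_bundle by (rule bundle_pair.intro)

abbreviation "S \<equiv> semidirect G E C R"
abbreviation "K \<equiv> total_lgpd E S"

lemma bd_lin: "x \<in> Obj G \<Longrightarrow> fibre_linear C x E x (bd R)"
  and dC_lin: "g \<in> Arr G \<Longrightarrow> fibre_linear C (src G g) C (tgt G g) (dC R g)"
  and dE_lin: "g \<in> Arr G \<Longrightarrow> fibre_linear E (src G g) E (tgt G g) (dE R g)"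
  using bd_morphism dC_quasi_action dE_quasi_action by (simp_all add: vb_morphism_def quasi_action_def)

lemma bd_in: "c \<in> fibre C x \<Longrightarrow> bd R c \<in> fibre E x"
  by (rule fibre_linearD(1)[OF bd_lin[OF CB.fibreD(1)]])

lemmas dC_in = fibre_linearD(1)[OF dC_lin]
lemmas dE_in = fibre_linearD(1)[OF dE_lin]
lemmas Om_in = fibre_linearD(1)[OF Om_linear]

lemmas bd_zero = fibre_linear_vzero[OF CB.vector_bundle_axioms EB.vector_bundle_axioms bd_lin]
lemmas dC_zero = fibre_linear_vzero[OF CB.vector_bundle_axioms CB.vector_bundle_axioms dC_lin]

lemma dC_unt: "c \<in> fibre C x \<Longrightarrow> dC R (unt G x) c = c"
  and dE_unt: "e \<in> fibre E x \<Longrightarrow> dE R (unt G x) e = e"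
  using dC_unital dE_unital CB.fibreD(1) EB.fibreD(1) by (auto simp: unital_def)

lemma Om_unt_left: "g \<in> Arr G \<Longrightarrow> e \<in> fibre E (src G g) \<Longrightarrow> Om R (unt G (tgt G g)) g e = vzero C (tgt G g)"
  and Om_unt_right: "g \<in> Arr G \<Longrightarrow> e \<in> fibre E (src G g) \<Longrightarrow> Om R g (unt G (src G g)) e = vzero C (tgt G g)"
  using Om_normalized[of "unt G (tgt G g)" g e] Om_normalized[of g "unt G (src G g)" e] G.tgt_in[of g] G.src_in[of g]
  by (simp_all add: composable_def G.unt_in G.src_unt G.tgt_unt)

lemma bd_smooth_comp:
  assumes "manifold X" "smooth_map_on X (tot C) T c"
  shows "smooth_map_on X (tot E) T (\<lambda>x. bd R (c x))"
  by (rule smooth_compose_map[OF assms(1) CB.total_manifold vb_morphism_smooth[OF bd_morphism] assms(2)])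

lemma dC_smooth_comp:
  assumes "manifold X" "smooth_map_on X (arr G) T a" "smooth_map_on X (tot C) T c"
    "\<And>x. x \<in> T \<Longrightarrow> c x \<in> fibre C (src G (a x))"
  shows "smooth_map_on X (tot C) T (\<lambda>x. dC R (a x) (c x))"
  using dC_quasi_action smooth_map_on_in[OF assms(2)]
  by (intro smooth_compose2[OF assms(1) G.arr_manifold CB.total_manifold _ assms(2,3)])
    (auto simp: quasi_action_def assms(4))

lemma dE_smooth_comp:
  assumes "manifold X" "smooth_map_on X (arr G) T a" "smooth_map_on X (tot E) T c"
    "\<And>x. x \<in> T \<Longrightarrow> c x \<in> fibre E (src G (a x))"
  shows "smooth_map_on X (tot E) T (\<lambda>x. dE R (a x) (c x))"
  using dE_quasi_action smooth_map_on_in[OF assms(2)]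
  by (intro smooth_compose2[OF assms(1) G.arr_manifold EB.total_manifold _ assms(2,3)])
    (auto simp: quasi_action_def assms(4))

lemma Om_smooth_comp:
  assumes "manifold X" "smooth_map_on X (arr G) T a" "smooth_map_on X (arr G) T b" "smooth_map_on X (tot E) T e"
    "\<And>x. x \<in> T \<Longrightarrow> (a x, b x) \<in> composable G" "\<And>x. x \<in> T \<Longrightarrow> e x \<in> fibre E (src G (b x))"
  shows "smooth_map_on X (tot C) T (\<lambda>x. Om R (a x) (b x) (e x))"
  using smooth_compose2[OF assms(1) manifold_prod[OF G.arr_manifold G.arr_manifold] EB.total_manifold Om_smooth
      smooth_Pair[OF assms(2,3)] assms(4)] assms(5,6)
  by simp

lemma ttgt_in: "g \<in> Arr G \<Longrightarrow> c \<in> fibre C (tgt G g) \<Longrightarrow> e \<in> fibre E (src G g) \<Longrightarrow>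
    vadd E (bd R c) (dE R g e) \<in> fibre E (tgt G g)"
  by (intro EB.vadd_in bd_in dE_in)

lemma ttgt_smooth: "smooth_map (sub_mfd CGE SD) (tot E) (ttgt S)"
proof -
  have "smooth_map_on (sub_mfd CGE SD) (tot E) SD (\<lambda>p. vadd E (bd R (fst p)) (dE R (fst (snd p)) (snd (snd p))))"
  proof (rule EB.smooth_vadd[OF manifold_SD bd_smooth_comp[OF manifold_SD SD_coord1[OF order_refl]]
        dE_smooth_comp[OF manifold_SD SD_coord2[OF order_refl] SD_coord3[OF order_refl]]])
    show "prj E (dE R (fst (snd p)) (snd (snd p))) = prj E (bd R (fst p))" if "p \<in> SD" for p
      using that EB.fibreD(3)[OF bd_in] EB.fibreD(3)[OF dE_in] by (cases p) auto
  qed (auto simp: SD_def)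
  then show ?thesis by (simp only: ttgt_semidirect mcar_SD)
qed

lemma tinv_in: "p \<in> SD \<Longrightarrow> tinv S p \<in> SD"
proof -
  assume "p \<in> SD"
  then obtain c g e where p: "p = (c, g, e)" "g \<in> Arr G" "c \<in> fibre C (tgt G g)" "e \<in> fibre E (src G g)"
    by (cases p) auto
  have i: "ginv G g \<in> Arr G" "src G (ginv G g) = tgt G g" "tgt G (ginv G g) = src G g"
    using p(2) by (simp_all add: G.inv_in G.src_inv G.tgt_inv)
  have "(ginv G g, g) \<in> composable G" using p(2) i by (simp add: composable_def)
  then show "tinv S p \<in> SD"
    using p i dC_in[OF i(1)] Om_in[of "ginv G g" g e] ttgt_in[OF p(2-4)]
    by (simp add: CB.vadd_in CB.vscl_in)
qed

lemma tinv_smooth: "smooth_map (sub_mfd CGE SD) (sub_mfd CGE SD) (tinv S)"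
proof -
  note c1 = SD_coord1[OF order_refl] and c2 = SD_coord2[OF order_refl] and c3 = SD_coord3[OF order_refl]
  note M = manifold_SD
  have i: "smooth_map_on (sub_mfd CGE SD) (arr G) SD (\<lambda>p. ginv G (fst (snd p)))"
    by (rule smooth_compose_map[OF M G.arr_manifold G.inv_smooth c2])
  have t: "smooth_map_on (sub_mfd CGE SD) (tot E) SD (\<lambda>p. vadd E (bd R (fst p)) (dE R (fst (snd p)) (snd (snd p))))"
    using ttgt_smooth by (simp only: ttgt_semidirect mcar_SD)
  have inv: "ginv G g \<in> Arr G" "src G (ginv G g) = tgt G g" "tgt G (ginv G g) = src G g" "(ginv G g, g) \<in> composable G"
    if "g \<in> Arr G" for g
    using that by (simp_all add: G.inv_in G.src_inv G.tgt_inv composable_def)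
  have d: "smooth_map_on (sub_mfd CGE SD) (tot C) SD (\<lambda>p. dC R (ginv G (fst (snd p))) (fst p))"
    by (rule dC_smooth_comp[OF M i c1]) (auto simp: inv SD_def)
  have o: "smooth_map_on (sub_mfd CGE SD) (tot C) SD (\<lambda>p. Om R (ginv G (fst (snd p))) (fst (snd p)) (snd (snd p)))"
    by (rule Om_smooth_comp[OF M i c2 c3]) (auto simp: inv SD_def)
  have din: "vscl C a (dC R (ginv G g) c) \<in> fibre C (src G g)" if "g \<in> Arr G" "c \<in> fibre C (tgt G g)" for a g c
    using dC_in[OF inv(1)[OF that(1)], of c] that inv[OF that(1)] by (simp add: CB.vscl_in)
  have oin: "Om R (ginv G g) g e \<in> fibre C (src G g)" if "g \<in> Arr G" "e \<in> fibre E (src G g)" for g e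
    using Om_in[OF inv(4)[OF that(1)], of e] that inv[OF that(1)] by simp
  have "smooth_map_on (sub_mfd CGE SD) (sub_mfd CGE SD) SD
      (\<lambda>p. (vadd C (vscl C (- 1) (dC R (ginv G (fst (snd p))) (fst p))) (Om R (ginv G (fst (snd p))) (fst (snd p)) (snd (snd p))),
        ginv G (fst (snd p)), vadd E (bd R (fst p)) (dE R (fst (snd p)) (snd (snd p)))))"
  proof (rule smooth_into_SD[OF M CB.smooth_vadd[OF M CB.smooth_vscl[OF M d] o] i t])
    fix p assume "p \<in> SD"
    then obtain c g e where p: "p = (c, g, e)" "g \<in> Arr G" "c \<in> fibre C (tgt G g)" "e \<in> fibre E (src G g)"
      by (cases p) auto
    note a = din[OF p(2,3), of "- 1"] and b = oin[OF p(2,4)]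
    show "prj C (Om R (ginv G (fst (snd p))) (fst (snd p)) (snd (snd p))) =
        prj C (vscl C (- 1) (dC R (ginv G (fst (snd p))) (fst p)))"
      using CB.fibreD(3)[OF a] CB.fibreD(3)[OF b] by (simp add: p(1))
    show "vadd C (vscl C (- 1) (dC R (ginv G (fst (snd p))) (fst p))) (Om R (ginv G (fst (snd p))) (fst (snd p)) (snd (snd p)))
        \<in> fibre C (tgt G (ginv G (fst (snd p))))"
      using CB.vadd_in[OF a b] inv[OF p(2)] by (simp add: p(1))
    show "vadd E (bd R (fst p)) (dE R (fst (snd p)) (snd (snd p))) \<in> fibre E (src G (ginv G (fst (snd p))))"
      using ttgt_in[OF p(2-4)] inv[OF p(2)] by (simp add: p(1))
  qed
  then have "smooth_map_on (sub_mfd CGE SD) (sub_mfd CGE SD) SD (tinv S)"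
    by (rule smooth_map_on_cong[rotated, OF _ manifold_charted[OF M]]) auto
  then show ?thesis by (simp only: mcar_SD)
qed

text \<open>In this and the next two lemmas the equations of the 4-tuple are oriented as rewrite
  rules for coordinates: iterated operators are replaced by single ones, after which the groupoid
  axioms are linear arithmetic.\<close>

lemma crd_dC_dC:
  assumes gg: "(g\<^sub>1, g\<^sub>2) \<in> composable G" and c: "c \<in> fibre C (src G g\<^sub>2)"
  shows "crd C (tgt G g\<^sub>1) (dC R g\<^sub>1 (dC R g\<^sub>2 c)) =
    crd C (tgt G g\<^sub>1) (dC R (mul G g\<^sub>1 g\<^sub>2) c) - crd C (tgt G g\<^sub>1) (Om R g\<^sub>1 g\<^sub>2 (bd R c))"
proof -
  note g = G.composableD[OF gg]
  have i: "dC R g\<^sub>1 (dC R g\<^sub>2 c) \<in> fibre C (tgt G g\<^sub>1)" "dC R (mul G g\<^sub>1 g\<^sub>2) c \<in> fibre C (tgt G g\<^sub>1)"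
    "Om R g\<^sub>1 g\<^sub>2 (bd R c) \<in> fibre C (tgt G g\<^sub>1)"
    using dC_in[OF g(1), of "dC R g\<^sub>2 c"] dC_in[OF g(2) c] dC_in[OF G.mul_in[OF gg], of c] Om_in[OF gg bd_in[OF c]]
      c g G.src_mul[OF gg] G.tgt_mul[OF gg] by simp_all
  from arg_cong[OF dC_dC[OF gg c], of "crd C (tgt G g\<^sub>1)"] show ?thesis
    by (simp add: i CB.vsub_in G.tgt_in g algebra_simps)
qed

lemma crd_dE_dE:
  assumes gg: "(g\<^sub>1, g\<^sub>2) \<in> composable G" and e: "e \<in> fibre E (src G g\<^sub>2)"
  shows "crd E (tgt G g\<^sub>1) (dE R g\<^sub>1 (dE R g\<^sub>2 e)) =
    crd E (tgt G g\<^sub>1) (dE R (mul G g\<^sub>1 g\<^sub>2) e) - crd E (tgt G g\<^sub>1) (bd R (Om R g\<^sub>1 g\<^sub>2 e))"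
proof -
  note g = G.composableD[OF gg]
  have i: "dE R g\<^sub>1 (dE R g\<^sub>2 e) \<in> fibre E (tgt G g\<^sub>1)" "dE R (mul G g\<^sub>1 g\<^sub>2) e \<in> fibre E (tgt G g\<^sub>1)"
    "bd R (Om R g\<^sub>1 g\<^sub>2 e) \<in> fibre E (tgt G g\<^sub>1)"
    using dE_in[OF g(1), of "dE R g\<^sub>2 e"] dE_in[OF g(2) e] dE_in[OF G.mul_in[OF gg], of e] bd_in[OF Om_in[OF gg e]]
      e g G.src_mul[OF gg] G.tgt_mul[OF gg] by simp_all
  from arg_cong[OF dE_dE[OF gg e], of "crd E (tgt G g\<^sub>1)"] show ?thesis
    by (simp add: i EB.vsub_in G.tgt_in g algebra_simps)
qed

lemma crd_dC_Om:
  assumes gg: "(g\<^sub>1, g\<^sub>2) \<in> composable G" "(g\<^sub>2, g\<^sub>3) \<in> composable G" and e: "e \<in> fibre E (src G g\<^sub>3)"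
  shows "crd C (tgt G g\<^sub>1) (dC R g\<^sub>1 (Om R g\<^sub>2 g\<^sub>3 e)) = crd C (tgt G g\<^sub>1) (Om R (mul G g\<^sub>1 g\<^sub>2) g\<^sub>3 e) -
    crd C (tgt G g\<^sub>1) (Om R g\<^sub>1 (mul G g\<^sub>2 g\<^sub>3) e) + crd C (tgt G g\<^sub>1) (Om R g\<^sub>1 g\<^sub>2 (dE R g\<^sub>3 e))"
proof -
  note g = G.composableD[OF gg(1)] and g' = G.composableD[OF gg(2)]
  note m = G.mul_in[OF gg(1)] G.mul_in[OF gg(2)]
    G.tgt_mul[OF gg(1)] G.tgt_mul[OF gg(2)] G.src_mul[OF gg(1)] G.src_mul[OF gg(2)]
  have gg': "(mul G g\<^sub>1 g\<^sub>2, g\<^sub>3) \<in> composable G" "(g\<^sub>1, mul G g\<^sub>2 g\<^sub>3) \<in> composable G"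
    using g g' m by (simp_all add: composable_def)
  have i: "dC R g\<^sub>1 (Om R g\<^sub>2 g\<^sub>3 e) \<in> fibre C (tgt G g\<^sub>1)" "Om R (mul G g\<^sub>1 g\<^sub>2) g\<^sub>3 e \<in> fibre C (tgt G g\<^sub>1)"
    "Om R g\<^sub>1 (mul G g\<^sub>2 g\<^sub>3) e \<in> fibre C (tgt G g\<^sub>1)" "Om R g\<^sub>1 g\<^sub>2 (dE R g\<^sub>3 e) \<in> fibre C (tgt G g\<^sub>1)"
    using dC_in[OF g(1), of "Om R g\<^sub>2 g\<^sub>3 e"] Om_in[OF gg(2) e] Om_in[OF gg'(1) e] Om_in[OF gg'(2), of e]
      Om_in[OF gg(1), of "dE R g\<^sub>3 e"] dE_in[OF g'(2) e] e m g g' by simp_all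
  from arg_cong[OF Om_cocycle[OF gg e], of "crd C (tgt G g\<^sub>1)"] show ?thesis
    by (simp add: i CB.vsub_in CB.vadd_in G.tgt_in g algebra_simps)
qed

text \<open>Composability in the total groupoid is an equation between elements of \<open>E\<close>.
  That the base arrows are composable follows, since the two sides lie in the fibres over
  \<open>src G g\<^sub>1\<close> and \<open>tgt G g\<^sub>2\<close>.\<close>

lemma comp_SDE:
  assumes "(p\<^sub>1, p\<^sub>2) \<in> composable K"
  obtains c\<^sub>1 g\<^sub>1 e\<^sub>1 c\<^sub>2 g\<^sub>2 e\<^sub>2 where "p\<^sub>1 = (c\<^sub>1, g\<^sub>1, e\<^sub>1)" "p\<^sub>2 = (c\<^sub>2, g\<^sub>2, e\<^sub>2)" "(g\<^sub>1, g\<^sub>2) \<in> composable G"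
    "c\<^sub>1 \<in> fibre C (tgt G g\<^sub>1)" "c\<^sub>2 \<in> fibre C (tgt G g\<^sub>2)" "e\<^sub>1 \<in> fibre E (src G g\<^sub>1)" "e\<^sub>2 \<in> fibre E (src G g\<^sub>2)"
    "e\<^sub>1 = vadd E (bd R c\<^sub>2) (dE R g\<^sub>2 e\<^sub>2)"
proof -
  obtain c1 g1 e1 c2 g2 e2 where p: "p\<^sub>1 = (c1, g1, e1)" "p\<^sub>2 = (c2, g2, e2)"
    by (cases p\<^sub>1, cases p\<^sub>2)
  have i: "(c1, g1, e1) \<in> SD" "(c2, g2, e2) \<in> SD" "e1 = vadd E (bd R c2) (dE R g2 e2)"
    using assms p mcar_SD by (auto simp: composable_def)
  then have f: "g1 \<in> Arr G" "c1 \<in> fibre C (tgt G g1)" "e1 \<in> fibre E (src G g1)"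
    "g2 \<in> Arr G" "c2 \<in> fibre C (tgt G g2)" "e2 \<in> fibre E (src G g2)" by simp_all
  have "src G g1 = tgt G g2"
    using EB.fibreD(3)[OF f(3)] EB.fibreD(3)[OF ttgt_in[OF f(4-6)]] i(3) by simp
  then have "(g1, g2) \<in> composable G" using f by (simp add: composable_def)
  with that[OF p] f i(3) show thesis by blast
qed

lemma mul_C_in:
  assumes "(g\<^sub>1, g\<^sub>2) \<in> composable G" "c\<^sub>1 \<in> fibre C (tgt G g\<^sub>1)" "c\<^sub>2 \<in> fibre C (tgt G g\<^sub>2)" "e\<^sub>2 \<in> fibre E (src G g\<^sub>2)"
  shows "dC R g\<^sub>1 c\<^sub>2 \<in> fibre C (tgt G g\<^sub>1)" "Om R g\<^sub>1 g\<^sub>2 e\<^sub>2 \<in> fibre C (tgt G g\<^sub>1)"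
    "vsub C (vadd C c\<^sub>1 (dC R g\<^sub>1 c\<^sub>2)) (Om R g\<^sub>1 g\<^sub>2 e\<^sub>2) \<in> fibre C (tgt G g\<^sub>1)"
proof -
  show 1: "dC R g\<^sub>1 c\<^sub>2 \<in> fibre C (tgt G g\<^sub>1)" "Om R g\<^sub>1 g\<^sub>2 e\<^sub>2 \<in> fibre C (tgt G g\<^sub>1)"
    using dC_in[OF G.composableD(1)[OF assms(1)]] G.composableD(3)[OF assms(1)] assms(3) Om_in[OF assms(1,4)]
    by simp_all
  show "vsub C (vadd C c\<^sub>1 (dC R g\<^sub>1 c\<^sub>2)) (Om R g\<^sub>1 g\<^sub>2 e\<^sub>2) \<in> fibre C (tgt G g\<^sub>1)"
    by (intro CB.vsub_in CB.vadd_in 1 assms)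
qed

lemma tmul_smooth: "smooth_map_on (prod_mfd (sub_mfd CGE SD) (sub_mfd CGE SD)) (sub_mfd CGE SD) (composable K)
    (\<lambda>(p, q). tmul S p q)"
proof -
  let ?X = "prod_mfd (sub_mfd CGE SD) (sub_mfd CGE SD)" and ?T = "composable K"
  note M = manifold_SD
  have X: "manifold ?X" by (rule manifold_prod[OF M M])
  have T: "?T \<subseteq> mcar (sub_mfd CGE SD) \<times> mcar (sub_mfd CGE SD)" by (auto simp: composable_def)
  note f = smooth_fst[OF M M T] and s = smooth_snd[OF M M T]
  note c1 = smooth_SD_1[OF X f] and g1 = smooth_SD_2[OF X f] and e1 = smooth_SD_3[OF X f]
    and c2 = smooth_SD_1[OF X s] and g2 = smooth_SD_2[OF X s] and e2 = smooth_SD_3[OF X s]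
  have comp: "(fst (snd (fst x)), fst (snd (snd x))) \<in> composable G"
    "fst (fst x) \<in> fibre C (tgt G (fst (snd (fst x))))" "fst (snd x) \<in> fibre C (tgt G (fst (snd (snd x))))"
    "snd (snd (snd x)) \<in> fibre E (src G (fst (snd (snd x))))"
    if "x \<in> ?T" for x
  proof -
    have "(fst x, snd x) \<in> composable K" using that by simp
    then show "(fst (snd (fst x)), fst (snd (snd x))) \<in> composable G"
      "fst (fst x) \<in> fibre C (tgt G (fst (snd (fst x))))" "fst (snd x) \<in> fibre C (tgt G (fst (snd (snd x))))"
      "snd (snd (snd x)) \<in> fibre E (src G (fst (snd (snd x))))"
      by (rule comp_SDE, simp)+
  qed
  note i = mul_C_in[OF comp]
  have d: "smooth_map_on ?X (tot C) ?T (\<lambda>x. dC R (fst (snd (fst x))) (fst (snd x)))"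
    by (rule dC_smooth_comp[OF X g1 c2]) (use comp(1,3) G.composableD(3) in fastforce)
  have o: "smooth_map_on ?X (tot C) ?T (\<lambda>x. Om R (fst (snd (fst x))) (fst (snd (snd x))) (snd (snd (snd x))))"
    by (rule Om_smooth_comp[OF X g1 g2 e2 comp(1,4)])
  have a: "smooth_map_on ?X (tot C) ?T (\<lambda>x. vadd C (fst (fst x)) (dC R (fst (snd (fst x))) (fst (snd x))))"
    by (rule CB.smooth_vadd[OF X c1 d]) (simp add: CB.fibreD(3)[OF i(1)] CB.fibreD(3)[OF comp(2)])
  have v: "smooth_map_on ?X (tot C) ?T (\<lambda>x. vsub C (vadd C (fst (fst x)) (dC R (fst (snd (fst x))) (fst (snd x))))
      (Om R (fst (snd (fst x))) (fst (snd (snd x))) (snd (snd (snd x)))))"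
    by (rule CB.smooth_vsub[OF X a o]) (simp add: CB.fibreD(3)[OF i(2)] CB.fibreD(3)[OF CB.vadd_in[OF comp(2) i(1)]])
  have m: "smooth_map_on ?X (arr G) ?T (\<lambda>x. mul G (fst (snd (fst x))) (fst (snd (snd x))))"
    by (rule G.smooth_mul[OF X g1 g2]) (rule G.composableD(3)[OF comp(1)])
  have "smooth_map_on ?X (sub_mfd CGE SD) ?T (\<lambda>x. (vsub C (vadd C (fst (fst x)) (dC R (fst (snd (fst x))) (fst (snd x))))
      (Om R (fst (snd (fst x))) (fst (snd (snd x))) (snd (snd (snd x)))), mul G (fst (snd (fst x))) (fst (snd (snd x))),
      snd (snd (snd x))))"
    by (rule smooth_into_SD[OF X v m e2]) (simp_all add: G.tgt_mul[OF comp(1)] G.src_mul[OF comp(1)] i(3) comp(4))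
  then show ?thesis
    by (rule smooth_map_on_cong[rotated, OF _ manifold_charted[OF X]]) auto
qed

theorem semidirect_lie_groupoid: "lie_groupoid K"
proof (rule lie_groupoid.intro)
  note M = manifold_SD
  show "manifold (arr K)" "manifold (obj K)" using M EB.total_manifold by simp_all
  show "submersion (arr K) (obj K) (src K)"
    using tsrc_submersion by (simp add: tsrc_semidirect)
  have comp_inv: "(ginv G g, g) \<in> composable G" "(g, ginv G g) \<in> composable G" "ginv G g \<in> Arr G"
    "src G (ginv G g) = tgt G g" "tgt G (ginv G g) = src G g" if "g \<in> Arr G" for g
    using that by (simp_all add: composable_def G.inv_in G.src_inv G.tgt_inv)
  \<comment> \<open>The identities for the inversion come before the claim that the target is a
    submersion, because that claim is transferred from the source by the inversion.\<close>
  have ttgt_tinv: "ttgt S (tinv S (c, g, e)) = e"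
    and tmul_inv_left: "tmul S (tinv S (c, g, e)) (c, g, e) = tunt S e"
    and tmul_inv_right: "tmul S (c, g, e) (tinv S (c, g, e)) = tunt S (ttgt S (c, g, e))"
    and tinv_tinv: "tinv S (tinv S (c, g, e)) = (c, g, e)"
    if g: "g \<in> Arr G" and c: "c \<in> fibre C (tgt G g)" and e: "e \<in> fibre E (src G g)" for c g e
  proof -
    note i = comp_inv[OF g] and t = G.tgt_in[OF g] and s = G.src_in[OF g]
    have b: "bd R c \<in> fibre E (tgt G g)" "dE R g e \<in> fibre E (tgt G g)" using bd_in[OF c] dE_in[OF g e] .
    have d: "dC R (ginv G g) c \<in> fibre C (src G g)" using dC_in[OF i(3), of c] c i by simp
    have o: "Om R (ginv G g) g e \<in> fibre C (src G g)" using Om_in[OF i(1) e] i by simp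
    have c': "c \<in> fibre C (src G (ginv G g))" using c i by simp
    have x: "vscl C (- 1) (dC R (ginv G g) c) \<in> fibre C (src G g)" by (rule CB.vscl_in[OF d])
    note bl = fibre_linearD[OF bd_lin[OF s]] and dl = fibre_linearD[OF dE_lin[OF i(3)], unfolded i]
    \<comment> \<open>In the target of the inverse the terms in \<open>c\<close> cancel by
      \<open>dE_bd\<close>. The equation for \<open>dE\<close> at \<open>ginv G g\<close> and
      \<open>g\<close> leaves \<open>e\<close>, because \<open>dE\<close> is the identity over
      units.\<close>
    have "crd E (src G g) (dE R (ginv G g) (bd R c)) = crd E (src G g) (bd R (dC R (ginv G g) c))"
      using dE_bd[OF i(3) c'] by simp
    moreover have "crd E (src G g) (dE R (ginv G g) (dE R g e)) = crd E (src G g) e - crd E (src G g) (bd R (Om R (ginv G g) g e))"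
      using crd_dE_dE[OF i(1) e] i G.inv_left[OF g] dE_unt[OF e] by simp
    moreover have "bd R (dC R (ginv G g) c) \<in> fibre E (src G g)" "bd R (Om R (ginv G g) g e) \<in> fibre E (src G g)"
      "dE R (ginv G g) (bd R c) \<in> fibre E (src G g)" "dE R (ginv G g) (dE R g e) \<in> fibre E (src G g)"
      using bl(1)[OF d] bl(1)[OF o] dl(1)[OF b(1)] dl(1)[OF b(2)] by simp_all
    ultimately show tt: "ttgt S (tinv S (c, g, e)) = e"
      by (intro EB.crd_inj[of _ "src G g"]) (simp_all add: bl d o x dl b e EB.vadd_in EB.vscl_in)
    have "vsub C (vadd C (vadd C (vscl C (- 1) (dC R (ginv G g) c)) (Om R (ginv G g) g e)) (dC R (ginv G g) c))
        (Om R (ginv G g) g e) = vzero C (src G g)"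
      by (rule CB.crd_inj[of _ "src G g"]) (simp_all add: x o d s CB.vadd_in CB.vsub_in CB.zero_closed)
    then show "tmul S (tinv S (c, g, e)) (c, g, e) = tunt S e"
      using G.inv_left[OF g] EB.fibreD(3)[OF e] by simp
    note cl = fibre_linearD[OF dC_lin[OF g]] and ol = fibre_linearD[OF Om_linear[OF i(2)], unfolded i]
    have "crd C (tgt G g) (dC R g (dC R (ginv G g) c)) = crd C (tgt G g) c - crd C (tgt G g) (Om R g (ginv G g) (bd R c))"
      using crd_dC_dC[OF i(2) c'] G.inv_right[OF g] dC_unt[OF c] by simp
    \<comment> \<open>The cocycle equation for \<open>g\<close>, its inverse and \<open>g\<close>:
      two of the four terms have a unit among their arrows and vanish by normalization.\<close>
    moreover have "crd C (tgt G g) (dC R g (Om R (ginv G g) g e)) = crd C (tgt G g) (Om R g (ginv G g) (dE R g e))"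
      using crd_dC_Om[OF i(2,1) e] G.inv_right[OF g] G.inv_left[OF g] Om_unt_left[OF g e] Om_unt_right[OF g e] by simp
    ultimately have eq: "vsub C (vadd C c (dC R g (vadd C (vscl C (- 1) (dC R (ginv G g) c)) (Om R (ginv G g) g e))))
        (Om R g (ginv G g) (vadd E (bd R c) (dE R g e))) = vzero C (tgt G g)"
      by (intro CB.crd_inj[of _ "tgt G g"])
        (simp_all add: cl x d o ol b c t CB.vadd_in CB.vsub_in CB.vscl_in CB.zero_closed)
    then show "tmul S (c, g, e) (tinv S (c, g, e)) = tunt S (ttgt S (c, g, e))"
      using G.inv_right[OF g] EB.fibreD(3)[OF EB.vadd_in[OF b]] by simp
    have y: "dC R g (vadd C (vscl C (- 1) (dC R (ginv G g) c)) (Om R (ginv G g) g e)) \<in> fibre C (tgt G g)"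
      "Om R g (ginv G g) (vadd E (bd R c) (dE R g e)) \<in> fibre C (tgt G g)"
      using cl(1)[OF CB.vadd_in[OF x o]] ol(1)[OF EB.vadd_in[OF b]] .
    \<comment> \<open>This is \<open>eq\<close> solved for \<open>c\<close>.\<close>
    have "vadd C (vscl C (- 1) (dC R g (vadd C (vscl C (- 1) (dC R (ginv G g) c)) (Om R (ginv G g) g e))))
        (Om R g (ginv G g) (vadd E (bd R c) (dE R g e))) = c"
      using arg_cong[OF eq, of "crd C (tgt G g)"]
      by (intro CB.crd_inj[of _ "tgt G g"]) (simp_all add: y c t CB.vadd_in CB.vsub_in CB.vscl_in algebra_simps)
    then show "tinv S (tinv S (c, g, e)) = (c, g, e)"
      using G.inv_inv[OF g] tt by simp
  qed
  show "submersion (arr K) (obj K) (tgt K)"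
    unfolding total_lgpd_simps semidirect_simps(1)
  proof (rule submersionI[OF M EB.total_manifold ttgt_smooth])
    fix p \<gamma> assume "p \<in> mcar (sub_mfd CGE SD)" and \<gamma>: "tangent (tot E) \<gamma> \<gamma>" "\<gamma> 0 = ttgt S p"
    then obtain c g e where p: "p = (c, g, e)" "g \<in> Arr G" "c \<in> fibre C (tgt G g)" "e \<in> fibre E (src G g)"
      using mcar_SD by (cases p) auto
    have q: "tinv S p \<in> mcar (sub_mfd CGE SD)" unfolding mcar_SD by (rule tinv_in) (simp add: p)
    \<comment> \<open>The target of an arrow is the source of its inverse, so the curve is lifted
      along the source at \<open>tinv S p\<close>, and the lift is then inverted.\<close>
    obtain \<delta> where \<delta>: "\<delta> 0 = tinv S p" "tangent (sub_mfd CGE SD) \<delta> \<delta>" "tangent (tot E) (\<lambda>t. snd (snd (\<delta> t))) \<gamma>"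
      by (rule submersion_lift[OF M EB.total_manifold tsrc_submersion q \<gamma>(1)]) (simp_all add: \<gamma>(2) p(1))
    have ev: "eventually (\<lambda>t. \<delta> t \<in> mcar (sub_mfd CGE SD)) (at 0)"
      by (rule tangent_eventually[OF M \<delta>(2) openin_topspace]) (use \<delta>(1) q in simp)
    have ts: "ttgt S (tinv S d) = snd (snd d)" if "d \<in> SD" for d
      using that ttgt_tinv by (cases d) simp
    have ev': "eventually (\<lambda>t. snd (snd (\<delta> t)) = ttgt S (tinv S (\<delta> t))) (at 0)"
      using ev unfolding mcar_SD by eventually_elim (rule ts[symmetric])
    have "tangent (sub_mfd CGE SD) (\<lambda>t. tinv S (\<delta> t)) (\<lambda>t. tinv S (\<delta> t))"
      by (rule tangent_image[OF M M tinv_smooth \<delta>(2) _ ev ev]) (use \<delta>(1) q in simp)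
    moreover have "tangent (tot E) (\<lambda>t. ttgt S (tinv S (\<delta> t))) \<gamma>"
      by (rule tangent_sym, rule tangent_cong[OF tangent_sym[OF \<delta>(3)] ev'])
        (use \<delta>(1) q ts[of "\<delta> 0"] in \<open>simp only: mcar_SD\<close>)
    moreover have "tinv S (\<delta> 0) = p" unfolding \<delta>(1) p(1) by (rule tinv_tinv[OF p(2-4)])
    ultimately show "\<exists>\<epsilon>. \<epsilon> 0 = p \<and> tangent (sub_mfd CGE SD) \<epsilon> \<epsilon> \<and> tangent (tot E) (\<lambda>t. ttgt S (\<epsilon> t)) \<gamma>"
      by (intro exI[of _ "\<lambda>t. tinv S (\<delta> t)"]) simp
  qed
  show "smooth_map_on (prod_mfd (arr K) (arr K)) (arr K) (composable K) (\<lambda>(g\<^sub>1, g\<^sub>2). mul K g\<^sub>1 g\<^sub>2)"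
    using tmul_smooth by simp
  show "smooth_map (obj K) (arr K) (unt K)"
  proof -
    note id = manifold.smooth_ident[OF EB.total_manifold order_refl]
    have "smooth_map_on (tot E) (sub_mfd CGE SD) (mcar (tot E)) (\<lambda>e. (vzero C (prj E e), unt G (prj E e), e))"
    proof (rule smooth_into_SD[OF EB.total_manifold CB.smooth_vzero[OF EB.total_manifold EB.prj_smooth]
          smooth_compose_map[OF EB.total_manifold G.obj_manifold G.unt_smooth EB.prj_smooth] id])
      fix e assume e: "e \<in> mcar (tot E)"
      note x = EB.fibreD(1)[OF EB.fibreI[OF e]]
      show "vzero C (prj E e) \<in> fibre C (tgt G (unt G (prj E e)))" "e \<in> fibre E (src G (unt G (prj E e)))"
        using CB.zero_closed[OF x] EB.fibreI[OF e] G.src_unt[OF x] G.tgt_unt[OF x] by simp_all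
    qed
    moreover have "tunt S = (\<lambda>e. (vzero C (prj E e), unt G (prj E e), e))" by (simp add: fun_eq_iff)
    ultimately show ?thesis by simp
  qed
  show "smooth_map (arr K) (arr K) (ginv K)" using tinv_smooth by simp
  show "src K (mul K p q) = src K q" "tgt K (mul K p q) = tgt K p" if comp: "(p, q) \<in> composable K" for p q
  proof -
    obtain c1 g1 e1 c2 g2 e2
      where pq: "p = (c1, g1, e1)" "q = (c2, g2, e2)" and gg: "(g1, g2) \<in> composable G"
        and c: "c1 \<in> fibre C (tgt G g1)" "c2 \<in> fibre C (tgt G g2)"
        and e: "e1 \<in> fibre E (src G g1)" "e2 \<in> fibre E (src G g2)" "e1 = vadd E (bd R c2) (dE R g2 e2)"
      using comp by (rule comp_SDE)
    show "src K (mul K p q) = src K q" by (simp add: pq)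
    note g = G.composableD[OF gg] and i = mul_C_in[OF gg c e(2)]
    note bl = fibre_linearD[OF bd_lin[OF G.tgt_in[OF g(1)]]] and dl = fibre_linearD[OF dE_lin[OF g(1)]]
    have b: "bd R c2 \<in> fibre E (src G g1)" "dE R g2 e2 \<in> fibre E (src G g1)"
      using bd_in[OF c(2)] dE_in[OF g(2) e(2)] g(3) by simp_all
    have m: "dE R (mul G g1 g2) e2 \<in> fibre E (tgt G g1)"
      using dE_in[OF G.mul_in[OF gg], of e2] e(2) G.src_mul[OF gg] G.tgt_mul[OF gg] by simp
    \<comment> \<open>Invariance of the target uses two of the equations: \<open>dE_bd\<close> for
      the terms in \<open>c2\<close>, and \<open>dE_dE\<close> for those in
      \<open>e2\<close>.\<close>
    have "bd R (dC R g1 c2) = dE R g1 (bd R c2)" using dE_bd[OF g(1), of c2] c(2) g(3) by simp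
    moreover note crd_dE_dE[OF gg e(2)]
    moreover have "bd R (vsub C (vadd C c1 (dC R g1 c2)) (Om R g1 g2 e2)) =
        vsub E (vadd E (bd R c1) (bd R (dC R g1 c2))) (bd R (Om R g1 g2 e2))"
      using fibre_linear_vsub[OF CB.vector_bundle_axioms bd_lin[OF G.tgt_in[OF g(1)]] CB.vadd_in[OF c(1) i(1)] i(2)]
        bl(2)[OF c(1) i(1)] by simp
    ultimately show "tgt K (mul K p q) = tgt K p"
      by (intro EB.crd_inj[of _ "tgt G g1"])
        (simp_all add: pq e(3) dl b bl(1) c i m EB.vadd_in EB.vsub_in)
  qed
  show "mul K (mul K p q) r = mul K p (mul K q r)" if comp: "(p, q) \<in> composable K" "(q, r) \<in> composable K" for p q r
    using comp(1)
  proof (rule comp_SDE)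
    fix c1 g1 e1 c2 g2 e2
    assume pq: "p = (c1, g1, e1)" "q = (c2, g2, e2)" and gg: "(g1, g2) \<in> composable G"
      and c: "c1 \<in> fibre C (tgt G g1)" "c2 \<in> fibre C (tgt G g2)"
      and e: "e1 \<in> fibre E (src G g1)" "e2 \<in> fibre E (src G g2)" "e1 = vadd E (bd R c2) (dE R g2 e2)"
    obtain c3 g3 e3 where r: "r = (c3, g3, e3)" and gg': "(g2, g3) \<in> composable G"
      and c3: "c3 \<in> fibre C (tgt G g3)" and e3: "e3 \<in> fibre E (src G g3)" and e2: "e2 = vadd E (bd R c3) (dE R g3 e3)"
      using comp(2) by (rule comp_SDE) (simp add: pq)
    note g = G.composableD[OF gg] and g' = G.composableD[OF gg']
    note m = G.mul_in[OF gg] G.mul_in[OF gg'] G.tgt_mul[OF gg] G.tgt_mul[OF gg'] G.src_mul[OF gg] G.src_mul[OF gg']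
    have gg2: "(mul G g1 g2, g3) \<in> composable G" "(g1, mul G g2 g3) \<in> composable G"
      using g g' m by (simp_all add: composable_def)
    note i12 = mul_C_in[OF gg c e(2)] and i23 = mul_C_in[OF gg' c(2) c3 e3]
    have i3: "dC R (mul G g1 g2) c3 \<in> fibre C (tgt G g1)" "Om R (mul G g1 g2) g3 e3 \<in> fibre C (tgt G g1)"
      "Om R g1 (mul G g2 g3) e3 \<in> fibre C (tgt G g1)"
      using dC_in[OF m(1), of c3] Om_in[OF gg2(1) e3] Om_in[OF gg2(2), of e3] c3 e3 m g'(3) by simp_all
    note dl = fibre_linearD[OF dC_lin[OF g(1)], unfolded g(3)] and ol = fibre_linearD[OF Om_linear[OF gg]]
    have b3: "bd R c3 \<in> fibre E (src G g2)" "dE R g3 e3 \<in> fibre E (src G g2)" "c3 \<in> fibre C (src G g2)"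
      using bd_in[OF c3] dE_in[OF g'(2) e3] g'(3) c3 by simp_all
    have d: "dC R g1 (vsub C (vadd C c2 (dC R g2 c3)) (Om R g2 g3 e3)) =
        vsub C (vadd C (dC R g1 c2) (dC R g1 (dC R g2 c3))) (dC R g1 (Om R g2 g3 e3))"
      using fibre_linear_vsub[OF CB.vector_bundle_axioms dC_lin[OF g(1), unfolded g(3)] CB.vadd_in[OF c(2) i23(1)] i23(2)]
        dl(2)[OF c(2) i23(1)] by simp
    \<comment> \<open>After \<open>e2\<close> is substituted, the terms in \<open>c3\<close> agree
      by the equation for \<open>dC\<close> and the terms in \<open>e3\<close> by the cocycle
      equation.\<close>
    have "vsub C (vadd C (vsub C (vadd C c1 (dC R g1 c2)) (Om R g1 g2 e2)) (dC R (mul G g1 g2) c3)) (Om R (mul G g1 g2) g3 e3) =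
        vsub C (vadd C c1 (vsub C (vadd C (dC R g1 c2) (dC R g1 (dC R g2 c3))) (dC R g1 (Om R g2 g3 e3)))) (Om R g1 (mul G g2 g3) e3)"
      unfolding e2
      by (rule CB.crd_inj[of _ "tgt G g1"])
        (simp_all add: c i12 i23 i3 b3 ol dl(1) CB.vadd_in CB.vsub_in crd_dC_dC[OF gg] crd_dC_Om[OF gg gg' e3])
    then show ?thesis
      using G.mul_assoc[OF gg gg'] by (simp add: pq r d)
  qed
  show "src K (unt K e) = e" "tgt K (unt K e) = e" if "e \<in> Obj K" for e
  proof -
    have e: "e \<in> fibre E (prj E e)" using that by (simp add: EB.fibreI)
    note x = EB.fibreD(1)[OF e]
    show "src K (unt K e) = e" by simp
    show "tgt K (unt K e) = e"
      using bd_zero[OF x x] dE_unt[OF e] EB.vadd_vzero_left[OF e] by simp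
  qed
  fix p assume "p \<in> Arr K"
  then have "p \<in> SD" using mcar_SD by simp
  then obtain c g e where p: "p = (c, g, e)" "g \<in> Arr G" "c \<in> fibre C (tgt G g)" "e \<in> fibre E (src G g)"
    by (cases p) auto
  note t = G.tgt_in[OF p(2)] and s = G.src_in[OF p(2)] and tt = EB.fibreD(3)[OF ttgt_in[OF p(2-4)]]
  have "vsub C (vadd C (vzero C (tgt G g)) c) (vzero C (tgt G g)) = c" "vsub C (vadd C c (vzero C (tgt G g))) (vzero C (tgt G g)) = c"
    by (rule CB.crd_inj[of _ "tgt G g"]; simp add: p t CB.vadd_in CB.vsub_in CB.zero_closed)+
  then show "mul K (unt K (tgt K p)) p = p" "mul K p (unt K (src K p)) = p"
    using p tt EB.fibreD(3)[OF p(4)] G.mul_unt_left[OF p(2)] G.mul_unt_right[OF p(2)] dC_unt[OF p(3)] dC_zero[OF p(2) s]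
      Om_unt_left[OF p(2,4)] Om_unt_right[OF p(2,4)] by simp_all
  show "src K (ginv K p) = tgt K p" by (simp add: p(1))
  show "tgt K (ginv K p) = src K p" "mul K (ginv K p) p = unt K (src K p)" "mul K p (ginv K p) = unt K (tgt K p)"
    using ttgt_tinv[OF p(2-4)] tmul_inv_left[OF p(2-4)] tmul_inv_right[OF p(2-4)]
    by (simp_all only: p(1) total_lgpd_simps semidirect_simps(6))
qed

end

section \<open>VB-groupoid structure, core and lift of the semidirect product\<close>

context rep_up_to_homotopy
begin

text \<open>Over fixed base arrows the core component of a product is additive in all its arguments,
  so the law is a rearrangement of sums in one fibre of \<open>C\<close>.\<close>

lemma semidirect_interchange:
  assumes "(p\<^sub>1, p\<^sub>2) \<in> composable K" "(p\<^sub>3, p\<^sub>4) \<in> composable K" "prj S p\<^sub>1 = prj S p\<^sub>3" "prj S p\<^sub>2 = prj S p\<^sub>4"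
  shows "tmul S (vadd S p\<^sub>1 p\<^sub>3) (vadd S p\<^sub>2 p\<^sub>4) = vadd S (tmul S p\<^sub>1 p\<^sub>2) (tmul S p\<^sub>3 p\<^sub>4)"
  using assms(1)
proof (rule comp_SDE)
  fix c1 g1 e1 c2 g2 e2
  assume p: "p\<^sub>1 = (c1, g1, e1)" "p\<^sub>2 = (c2, g2, e2)" and gg: "(g1, g2) \<in> composable G"
    and c: "c1 \<in> fibre C (tgt G g1)" "c2 \<in> fibre C (tgt G g2)" and e: "e2 \<in> fibre E (src G g2)"
  obtain c3 e3 c4 e4 where p': "p\<^sub>3 = (c3, g1, e3)" "p\<^sub>4 = (c4, g2, e4)"
      and c': "c3 \<in> fibre C (tgt G g1)" "c4 \<in> fibre C (tgt G g2)" and e': "e4 \<in> fibre E (src G g2)"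
    using assms(2) by (rule comp_SDE) (use assms(3,4) p in simp)
  note g = G.composableD[OF gg] and i = mul_C_in[OF gg c e] and i' = mul_C_in[OF gg c' e']
  note dl = fibre_linearD[OF dC_lin[OF g(1)], unfolded g(3)] and ol = fibre_linearD[OF Om_linear[OF gg]]
  have "vsub C (vadd C (vadd C c1 c3) (dC R g1 (vadd C c2 c4))) (Om R g1 g2 (vadd E e2 e4)) =
      vadd C (vsub C (vadd C c1 (dC R g1 c2)) (Om R g1 g2 e2)) (vsub C (vadd C c3 (dC R g1 c4)) (Om R g1 g2 e4))"
    by (rule CB.crd_inj[of _ "tgt G g1"])
      (simp_all add: dl(2) ol(2) c c' e e' i(1,2) i'(1,2) CB.vadd_in CB.vsub_in)
  then show ?thesis by (simp add: p p')
qed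

lemma semidirect_vb_groupoid: "vb_groupoid G E S"
proof (rule vb_groupoid.intro)
  show "lie_groupoid G" "lie_groupoid K" "vector_bundle (obj G) E" "vector_bundle (arr G) S"
    by (rule base_groupoid semidirect_lie_groupoid E_bundle semidirect_vector_bundle)+
  have "fibre_linear S g E (src G g) (tsrc S)" for g
    by (auto simp: fibre_linear_def elim!: fibre_semidirectE)
  then show "vb_morphism (arr G) S (obj G) E (tsrc S) (src G)"
    using submersion_smooth[OF tsrc_submersion] G.src_smooth by (simp add: vb_morphism_def tsrc_semidirect)
  have "fibre_linear S g E (tgt G g) (ttgt S)" if g: "g \<in> Arr G" for g
    unfolding fibre_linear_def
  proof (intro conjI ballI allI)
    note bl = fibre_linearD[OF bd_lin[OF G.tgt_in[OF g]]] and dl = fibre_linearD[OF dE_lin[OF g]]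
    fix p assume "p \<in> fibre S g"
    then obtain c e where p: "p = (c, g, e)" "c \<in> fibre C (tgt G g)" "e \<in> fibre E (src G g)"
      by (rule fibre_semidirectE)
    show "ttgt S p \<in> fibre E (tgt G g)" using ttgt_in[OF g p(2,3)] by (simp add: p(1))
    show "ttgt S (vscl S a p) = vscl E a (ttgt S p)" for a
      using EB.scale_add_right[OF G.tgt_in[OF g] bl(1)[OF p(2)] dl(1)[OF p(3)]] p by (simp add: bl(3) dl(3))
    fix q assume "q \<in> fibre S g"
    then obtain c' e' where q: "q = (c', g, e')" "c' \<in> fibre C (tgt G g)" "e' \<in> fibre E (src G g)"
      by (rule fibre_semidirectE)
    have "vadd E (vadd E (bd R c) (bd R c')) (vadd E (dE R g e) (dE R g e')) =
        vadd E (vadd E (bd R c) (dE R g e)) (vadd E (bd R c') (dE R g e'))"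
      by (rule EB.crd_inj[of _ "tgt G g"]) (simp_all add: bl(1) dl(1) p q EB.vadd_in)
    then show "ttgt S (vadd S p q) = vadd E (ttgt S p) (ttgt S q)"
      using p q by (simp add: bl(2) dl(2))
  qed
  then show "vb_morphism (arr G) S (obj G) E (ttgt S) (tgt G)"
    using ttgt_smooth G.tgt_smooth by (simp add: vb_morphism_def)
  show "lgpd_morphism K G (prj S) (prj E)"
    unfolding lgpd_morphism_def
  proof (intro conjI ballI)
    show "smooth_map (arr K) (arr G) (prj S)"
      using SD_coord2[OF order_refl] mcar_SD by (simp add: prj_semidirect)
    show "smooth_map (obj K) (obj G) (prj E)" using EB.prj_smooth by simp
    show "src G (prj S p) = prj E (src K p)" "tgt G (prj S p) = prj E (tgt K p)" if "p \<in> Arr K" for p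
    proof -
      have "p \<in> SD" using that mcar_SD by simp
      then obtain c g e where p: "p = (c, g, e)" "g \<in> Arr G" "c \<in> fibre C (tgt G g)" "e \<in> fibre E (src G g)"
        by (cases p) auto
      show "src G (prj S p) = prj E (src K p)" "tgt G (prj S p) = prj E (tgt K p)"
        using EB.fibreD(3)[OF p(4)] EB.fibreD(3)[OF ttgt_in[OF p(2-4)]] by (simp_all add: p(1))
    qed
    show "prj S (unt K e) = unt G (prj E e)" for e by simp
    show "case x of (p, q) \<Rightarrow> prj S (mul K p q) = mul G (prj S p) (prj S q)" if "x \<in> composable K" for x
      by (cases x, cases "fst x", cases "snd x") simp
  qed
qed (rule semidirect_interchange)

lemma cemb_smooth: "smooth_map (tot C) (sub_mfd CGE SD) (cemb S)"
proof -
  note id = manifold.smooth_ident[OF CB.total_manifold order_refl] and M = CB.total_manifold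
  have "smooth_map (tot C) (sub_mfd CGE SD) (\<lambda>c. (c, unt G (prj C c), vzero E (prj C c)))"
  proof (rule smooth_into_SD[OF M id smooth_compose_map[OF M G.obj_manifold G.unt_smooth CB.prj_smooth]
        EB.smooth_vzero[OF M CB.prj_smooth]])
    fix c assume c: "c \<in> mcar (tot C)"
    note x = CB.fibreD(1)[OF CB.fibreI[OF c]]
    show "c \<in> fibre C (tgt G (unt G (prj C c)))" "vzero E (prj C c) \<in> fibre E (src G (unt G (prj C c)))"
      using CB.fibreI[OF c] EB.zero_closed[OF x] G.src_unt[OF x] G.tgt_unt[OF x] by simp_all
  qed
  moreover have "cemb S = (\<lambda>c. (c, unt G (prj C c), vzero E (prj C c)))" by (simp add: fun_eq_iff)
  ultimately show ?thesis by simp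
qed

text \<open>The core consists of the triples \<open>(c, unt G x, vzero E x)\<close>. The embedding
  of \<open>C\<close> is therefore inverted by the first projection, which is smooth on
  \<open>SD\<close>.\<close>

lemma semidirect_core: "core_identification G E C S (cemb S)"
  unfolding core_identification_def
proof (intro conjI ballI)
  have lin: "fibre_linear C x S (unt G x) (cemb S)" if x: "x \<in> Obj G" for x
    using CB.vadd_in[of _ x] CB.vscl_in[of _ x] CB.fibreD(3)[of _ x] CB.fibreD(3)[OF CB.vadd_in[of _ x]]
      CB.fibreD(3)[OF CB.vscl_in[of _ x]] EB.zero_closed[OF x] G.unt_in[OF x] G.src_unt[OF x] G.tgt_unt[OF x]
      EB.vadd_vzero_left[OF EB.zero_closed[OF x]] EB.vscl_vzero[OF x]
    by (auto simp: fibre_linear_def)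
  then show "vb_morphism (obj G) C (arr G) S (cemb S) (unt G)"
    using G.unt_smooth cemb_smooth by (simp add: vb_morphism_def)
  show "bij_betw (cemb S) (fibre C x) (core_fibre G E S x)" if x: "x \<in> Obj G" for x
  proof (rule bij_betw_byWitness[where f' = fst])
    show "cemb S ` fibre C x \<subseteq> core_fibre G E S x"
      using fibre_linearD(1)[OF lin[OF x]] CB.fibreD(3) by (auto simp: core_fibre_def)
    show "fst ` core_fibre G E S x \<subseteq> fibre C x"
      using G.tgt_unt[OF x] by (auto simp: core_fibre_def elim!: fibre_semidirectE)
    show "\<forall>p\<in>core_fibre G E S x. cemb S (fst p) = p"
      using G.tgt_unt[OF x] CB.fibreD(3) by (auto simp: core_fibre_def elim!: fibre_semidirectE)
  qed simp
  have sub: "(\<Union>x\<in>Obj G. core_fibre G E S x) \<subseteq> SD"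
    by (auto simp: core_fibre_def elim!: fibre_semidirectE)
  have inv: "fst p = inv_into (mcar (tot C)) (cemb S) p" if p: "p \<in> (\<Union>x\<in>Obj G. core_fibre G E S x)" for p
  proof (rule inv_into_f_eq[symmetric])
    show "inj_on (cemb S) (mcar (tot C))" by (rule inj_onI) simp
    obtain x where x: "x \<in> Obj G" "p \<in> core_fibre G E S x" using p by blast
    then obtain c where c: "p = (c, unt G x, vzero E x)" "c \<in> fibre C x"
      using G.tgt_unt[OF x(1)] by (auto simp: core_fibre_def elim!: fibre_semidirectE)
    show "fst p \<in> mcar (tot C)" "cemb S (fst p) = p"
      using CB.fibreD(2,3)[OF c(2)] by (simp_all add: c(1))
  qed
  show "smooth_map_on (tot S) (tot C) (\<Union>x\<in>Obj G. core_fibre G E S x) (inv_into (mcar (tot C)) (cemb S))"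
    using smooth_map_on_cong[OF inv SD_coord1[OF sub] manifold_charted[OF manifold_SD]] by simp
qed

lemma semidirect_lift: "horizontal_lift G E S (hlift S)"
  unfolding horizontal_lift_def
proof (intro conjI ballI)
  let ?X = "prod_mfd (arr G) (tot E)" and ?T = "{p. fst p \<in> Arr G \<and> snd p \<in> fibre E (src G (fst p))}"
  have T: "?T \<subseteq> Arr G \<times> mcar (tot E)" using EB.fibreD(2) by auto
  note f = smooth_fst[OF G.arr_manifold EB.total_manifold T] and s = smooth_snd[OF G.arr_manifold EB.total_manifold T]
  have "smooth_map_on ?X (sub_mfd CGE SD) ?T (\<lambda>p. (vzero C (tgt G (fst p)), fst p, snd p))"
    by (rule smooth_into_SD[OF manifold_GE CB.smooth_vzero[OF manifold_GE smooth_compose_map[OF manifold_GE G.arr_manifold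
              G.tgt_smooth f]] f s])
      (auto intro: CB.zero_closed G.tgt_in)
  then show "smooth_map_on ?X (tot S) {(g, e). g \<in> Arr G \<and> e \<in> fibre E (src G g)} (\<lambda>(g, e). hlift S g e)"
    by (simp add: case_prod_unfold)
  show "fibre_linear E (src G g) S g (hlift S g)" if g: "g \<in> Arr G" for g
    using g EB.vadd_in EB.vscl_in CB.zero_closed[OF G.tgt_in[OF g]] CB.vadd_vzero_left[OF CB.zero_closed[OF G.tgt_in[OF g]]]
      CB.vscl_vzero[OF G.tgt_in[OF g]]
    by (auto simp: fibre_linear_def)
  show "tsrc S (hlift S g e) = e" for g e by simp
  show "hlift S (unt G x) e = tunt S e" if "x \<in> Obj G" "e \<in> fibre E x" for x e
    using EB.fibreD(3)[OF that(2)] G.tgt_unt[OF that(1)] by simp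
qed

theorem semidirect_vb_groupoid_hl: "vb_groupoid_hl G E C S"
  using semidirect_vb_groupoid C_bundle semidirect_core semidirect_lift by (simp add: vb_groupoid_hl_def)

text \<open>The fields are total functions. Off their domains both tuples take the value
  \<open>undefined\<close>, so agreement on the domains is equality.\<close>

lemma rep2_eqI:
  assumes "rep_up_to_homotopy G E C R'"
    and "\<And>c x. c \<in> fibre C x \<Longrightarrow> bd R' c = bd R c"
    and "\<And>g c. g \<in> Arr G \<Longrightarrow> c \<in> fibre C (src G g) \<Longrightarrow> dC R' g c = dC R g c"
    and "\<And>g e. g \<in> Arr G \<Longrightarrow> e \<in> fibre E (src G g) \<Longrightarrow> dE R' g e = dE R g e"
    and "\<And>g\<^sub>1 g\<^sub>2 e. (g\<^sub>1, g\<^sub>2) \<in> composable G \<Longrightarrow> e \<in> fibre E (src G g\<^sub>2) \<Longrightarrow> Om R' g\<^sub>1 g\<^sub>2 e = Om R g\<^sub>1 g\<^sub>2 e"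
  shows "R' = R"
proof (rule rep2.equality)
  note off = rep_up_to_homotopy.off_domain[OF assms(1)]
  have "bd R' c = bd R c" for c
    using assms(2)[OF CB.fibreI] off(1) off_domain(1) by (cases "c \<in> mcar (tot C)") simp_all
  moreover have "dC R' g c = dC R g c" for g c
    using assms(3) off(2) off_domain(2) by (cases "g \<in> Arr G \<and> c \<in> fibre C (src G g)") simp_all
  moreover have "dE R' g e = dE R g e" for g e
    using assms(4) off(3) off_domain(3) by (cases "g \<in> Arr G \<and> e \<in> fibre E (src G g)") simp_all
  moreover have "Om R' g1 g2 e = Om R g1 g2 e" for g1 g2 e
    using assms(5) off(4) off_domain(4) by (cases "(g1, g2) \<in> composable G \<and> e \<in> fibre E (src G g2)") simp_all
  ultimately show "bd R' = bd R" "dC R' = dC R" "dE R' = dE R" "Om R' = Om R" by blast+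
qed simp

theorem to_rep2_semidirect: "to_rep2 G E C S = R"
proof -
  interpret L: lifted_vb_groupoid G E C S
    by (rule lifted_vb_groupoid.intro[OF semidirect_vb_groupoid_hl])
  \<comment> \<open>In the semidirect product the translated core element is a triple with first
    component \<open>c\<close>, so comparing after \<open>kz\<close> amounts to comparing first
    components.\<close>
  have kz: "L.kz c g = (c, g, vzero E (src G g))" if g: "g \<in> Arr G" and c: "c \<in> fibre C (tgt G g)" for c g
  proof -
    note t = G.tgt_in[OF g] and s = G.src_in[OF g]
    have "vsub C (vadd C c (vzero C (tgt G g))) (vzero C (tgt G g)) = c"
      by (rule CB.crd_inj[of _ "tgt G g"]) (simp_all add: c t CB.vadd_in CB.vsub_in CB.zero_closed)
    then show ?thesis
      using CB.fibreD(3)[OF c] G.mul_unt_left[OF g] dC_unt[OF CB.zero_closed[OF t]]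
        Om_unt_left[OF g EB.zero_closed[OF s]] by (simp add: L.kz_def)
  qed
  have bd: "bd (to_rep2 G E C S) c = bd R c" if c: "c \<in> fibre C x" for c x
    using L.bd_eq[OF c] CB.fibreD(1,3)[OF c] dE_unt[OF EB.zero_closed] EB.vadd_vzero_right[OF bd_in[OF c]] by simp
  have dE: "dE (to_rep2 G E C S) g e = dE R g e" if g: "g \<in> Arr G" and e: "e \<in> fibre E (src G g)" for g e
    using L.dE_eq[OF g e] bd_zero[OF G.tgt_in[OF g]] EB.vadd_vzero_left[OF dE_in[OF g e]] G.tgt_in[OF g] by simp
  have dC: "dC (to_rep2 G E C S) g c = dC R g c" if g: "g \<in> Arr G" and c: "c \<in> fibre C (src G g)" for g c
  proof (rule L.kz_inj[OF g L.dC_in[OF g c] dC_in[OF g c]])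
    note d = dC_in[OF g c] and z = CB.zero_closed[OF G.tgt_in[OF g]]
    have "vsub C (vadd C (vzero C (tgt G g)) (dC R g c)) (vzero C (tgt G g)) = dC R g c"
      by (rule CB.crd_inj[of _ "tgt G g"]) (simp_all add: d z CB.vadd_in CB.vsub_in G.tgt_in g)
    then have "tmul S (hlift S g (bd R c)) (cemb S c) = (dC R g c, g, vzero E (src G g))"
      using CB.fibreD(3)[OF c] G.mul_unt_right[OF g] Om_unt_right[OF g EB.zero_closed[OF G.src_in[OF g]]] by simp
    then show "L.kz (dC (to_rep2 G E C S) g c) g = L.kz (dC R g c) g"
      unfolding L.kz_dC[OF g c] kz[OF g d] bd[OF c] .
  qed
  have Om: "Om (to_rep2 G E C S) g1 g2 e = Om R g1 g2 e"
    if gg: "(g1, g2) \<in> composable G" and e: "e \<in> fibre E (src G g2)" for g1 g2 e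
  proof (rule L.kz_inj[OF G.mul_in[OF gg], unfolded G.tgt_mul[OF gg], OF L.Om_in[OF gg e] Om_in[OF gg e]])
    note g = G.composableD[OF gg] and o = Om_in[OF gg e] and z = CB.zero_closed[OF G.tgt_in[OF G.composableD(1)[OF gg]]]
    have z0: "dC R g1 (vzero C (tgt G g2)) = vzero C (tgt G g1)"
      using dC_zero[OF g(1)] g(3) G.src_in[OF g(1)] by simp
    \<comment> \<open>The minus sign in front of \<open>Om\<close> in the multiplication is undone
      here, since the product of the lifts is subtracted from the lift.\<close>
    have "vsub C (vzero C (tgt G g1)) (vsub C (vadd C (vzero C (tgt G g1)) (vzero C (tgt G g1))) (Om R g1 g2 e)) = Om R g1 g2 e"
      by (rule CB.crd_inj[of _ "tgt G g1"]) (simp_all add: o z CB.vadd_in CB.vsub_in G.tgt_in g)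
    moreover have "vsub E e e = vzero E (src G g2)" using EB.vsub_eq_vzero[OF e e] by simp
    ultimately have "vsub S (hlift S (mul G g1 g2) e) (tmul S (hlift S g1 (dE R g2 e)) (hlift S g2 e)) =
        (Om R g1 g2 e, mul G g1 g2, vzero E (src G (mul G g1 g2)))"
      using G.tgt_mul[OF gg] G.src_mul[OF gg] by (simp add: z0)
    then show "L.kz (Om (to_rep2 G E C S) g1 g2 e) (mul G g1 g2) = L.kz (Om R g1 g2 e) (mul G g1 g2)"
      using L.kz_Om[OF gg e] kz[OF G.mul_in[OF gg], unfolded G.tgt_mul[OF gg], OF o] dE[OF g(2) e] by simp
  qed
  show ?thesis
    by (rule rep2_eqI[OF L.to_rep2_rep_up_to_homotopy bd dC dE Om])
qed

end

section \<open>Isomorphisms\<close>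

lemma diffeomorphism_inv:
  assumes X: "manifold X" and f: "diffeomorphism X Y f"
  shows "diffeomorphism Y X (inv_into (mcar X) f)"
proof -
  have bij: "bij_betw f (mcar X) (mcar Y)" and sm: "smooth_map X Y f" and sm': "smooth_map Y X (inv_into (mcar X) f)"
    using f by (auto simp: diffeomorphism_def)
  have bij': "bij_betw (inv_into (mcar X) f) (mcar Y) (mcar X)" by (rule bij_betw_inv_into[OF bij])
  have "f p = inv_into (mcar Y) (inv_into (mcar X) f) p" if "p \<in> mcar X" for p
    using inv_into_inv_into_eq[OF bij that] by simp
  from smooth_map_on_cong[OF this sm manifold_charted[OF X]] show ?thesis
    using bij' sm' by (simp add: diffeomorphism_def)
qed

lemma diffeomorphism_compose:
  assumes X: "manifold X" and Y: "manifold Y" and Z: "manifold Z"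
    and f: "diffeomorphism X Y f" and g: "diffeomorphism Y Z g"
  shows "diffeomorphism X Z (\<lambda>x. g (f x))"
proof -
  have bf: "bij_betw f (mcar X) (mcar Y)" and bg: "bij_betw g (mcar Y) (mcar Z)"
    using f g by (auto simp: diffeomorphism_def)
  have b: "bij_betw (\<lambda>x. g (f x)) (mcar X) (mcar Z)"
    using bij_betw_trans[OF bf bg] by (simp add: o_def)
  have s: "smooth_map X Z (\<lambda>x. g (f x))"
    by (rule smooth_compose_map[OF X Y]) (use f g in \<open>auto simp: diffeomorphism_def\<close>)
  have s': "smooth_map Z X (\<lambda>z. inv_into (mcar X) f (inv_into (mcar Y) g z))"
    by (rule smooth_compose_map[OF Z Y]) (use f g in \<open>auto simp: diffeomorphism_def\<close>)
  have "inv_into (mcar X) f (inv_into (mcar Y) g z) = inv_into (mcar X) (\<lambda>x. g (f x)) z" if z: "z \<in> mcar Z" for z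
  proof (rule inv_into_f_eq[OF bij_betw_imp_inj_on[OF b], symmetric])
    have y: "inv_into (mcar Y) g z \<in> mcar Y" using bij_betwE[OF bij_betw_inv_into[OF bg]] z by blast
    show "inv_into (mcar X) f (inv_into (mcar Y) g z) \<in> mcar X"
      using bij_betwE[OF bij_betw_inv_into[OF bf]] y by blast
    show "g (f (inv_into (mcar X) f (inv_into (mcar Y) g z))) = z"
      using bij_betw_inv_into_right[OF bf y] bij_betw_inv_into_right[OF bg z] by simp
  qed
  from smooth_map_on_cong[OF this s' manifold_charted[OF Z]] show ?thesis
    using b s by (simp add: diffeomorphism_def)
qed

lemma vbgh_isoD:
  assumes "vbgh_iso G E C \<Gamma> \<Gamma>' f"
  shows "diffeomorphism (tot \<Gamma>) (tot \<Gamma>') f"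
    and "g \<in> Arr G \<Longrightarrow> fibre_linear \<Gamma> g \<Gamma>' g f"
    and "\<gamma> \<in> mcar (tot \<Gamma>) \<Longrightarrow> tsrc \<Gamma>' (f \<gamma>) = tsrc \<Gamma> \<gamma>"
    and "\<gamma> \<in> mcar (tot \<Gamma>) \<Longrightarrow> ttgt \<Gamma>' (f \<gamma>) = ttgt \<Gamma> \<gamma>"
    and "(\<gamma>\<^sub>1, \<gamma>\<^sub>2) \<in> composable (total_lgpd E \<Gamma>) \<Longrightarrow> f (tmul \<Gamma> \<gamma>\<^sub>1 \<gamma>\<^sub>2) = tmul \<Gamma>' (f \<gamma>\<^sub>1) (f \<gamma>\<^sub>2)"
    and "e \<in> mcar (tot E) \<Longrightarrow> f (tunt \<Gamma> e) = tunt \<Gamma>' e"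
    and "c \<in> mcar (tot C) \<Longrightarrow> f (cemb \<Gamma> c) = cemb \<Gamma>' c"
    and "g \<in> Arr G \<Longrightarrow> e \<in> fibre E (src G g) \<Longrightarrow> f (hlift \<Gamma> g e) = hlift \<Gamma>' g e"
  using assms by (auto simp: vbgh_iso_def vb_morphism_def lgpd_morphism_def)

lemma vbgh_isoI:
  assumes "manifold (arr G)" "manifold (tot E)"
    and "diffeomorphism (tot \<Gamma>) (tot \<Gamma>') f"
    and "\<And>g. g \<in> Arr G \<Longrightarrow> fibre_linear \<Gamma> g \<Gamma>' g f"
    and "\<And>\<gamma>. \<gamma> \<in> mcar (tot \<Gamma>) \<Longrightarrow> tsrc \<Gamma>' (f \<gamma>) = tsrc \<Gamma> \<gamma>"
    and "\<And>\<gamma>. \<gamma> \<in> mcar (tot \<Gamma>) \<Longrightarrow> ttgt \<Gamma>' (f \<gamma>) = ttgt \<Gamma> \<gamma>"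
    and "\<And>\<gamma>\<^sub>1 \<gamma>\<^sub>2. (\<gamma>\<^sub>1, \<gamma>\<^sub>2) \<in> composable (total_lgpd E \<Gamma>) \<Longrightarrow> f (tmul \<Gamma> \<gamma>\<^sub>1 \<gamma>\<^sub>2) = tmul \<Gamma>' (f \<gamma>\<^sub>1) (f \<gamma>\<^sub>2)"
    and "\<And>e. e \<in> mcar (tot E) \<Longrightarrow> f (tunt \<Gamma> e) = tunt \<Gamma>' e"
    and "\<And>c. c \<in> mcar (tot C) \<Longrightarrow> f (cemb \<Gamma> c) = cemb \<Gamma>' c"
    and "\<And>g e. g \<in> Arr G \<Longrightarrow> e \<in> fibre E (src G g) \<Longrightarrow> f (hlift \<Gamma> g e) = hlift \<Gamma>' g e"
  shows "vbgh_iso G E C \<Gamma> \<Gamma>' f"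
  using assms manifold.smooth_ident[OF assms(1) order_refl] manifold.smooth_ident[OF assms(2) order_refl]
  unfolding vbgh_iso_def vb_morphism_def lgpd_morphism_def diffeomorphism_def
  by (auto simp: id_def)

lemma vbgh_iso_compose:
  assumes L: "lifted_vb_groupoid G E C \<Gamma>" and L': "lifted_vb_groupoid G E C \<Gamma>'" and L'': "lifted_vb_groupoid G E C \<Gamma>''"
    and f: "vbgh_iso G E C \<Gamma> \<Gamma>' f" and f': "vbgh_iso G E C \<Gamma>' \<Gamma>'' f'"
  shows "vbgh_iso G E C \<Gamma> \<Gamma>'' (\<lambda>\<gamma>. f' (f \<gamma>))"
proof -
  interpret L: lifted_vb_groupoid G E C \<Gamma> by fact
  interpret L': lifted_vb_groupoid G E C \<Gamma>' by fact
  interpret L'': lifted_vb_groupoid G E C \<Gamma>'' by fact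
  note i = vbgh_isoD[OF f] and i' = vbgh_isoD[OF f']
  have car: "f \<gamma> \<in> mcar (tot \<Gamma>')" if "\<gamma> \<in> mcar (tot \<Gamma>)" for \<gamma>
    using i(1) that bij_betwE by (auto simp: diffeomorphism_def)
  show ?thesis
  proof (rule vbgh_isoI[OF L.G.arr_manifold L.EB.total_manifold])
    show "diffeomorphism (tot \<Gamma>) (tot \<Gamma>'') (\<lambda>\<gamma>. f' (f \<gamma>))"
      by (rule diffeomorphism_compose[OF L.GB.total_manifold L'.GB.total_manifold L''.GB.total_manifold i(1) i'(1)])
    show "fibre_linear \<Gamma> g \<Gamma>'' g (\<lambda>\<gamma>. f' (f \<gamma>))" if g: "g \<in> Arr G" for g
      using fibre_linearD[OF i(2)[OF g]] fibre_linearD[OF i'(2)[OF g]] by (simp add: fibre_linear_def)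
    show "f' (f (tmul \<Gamma> p q)) = tmul \<Gamma>'' (f' (f p)) (f' (f q))" if pq: "(p, q) \<in> composable (total_lgpd E \<Gamma>)" for p q
    proof -
      have "(f p, f q) \<in> composable (total_lgpd E \<Gamma>')"
        using pq car i(3,4) by (auto simp: composable_def)
      then show ?thesis using i(5)[OF pq] i'(5) by simp
    qed
  qed (use i i' car in simp_all)
qed

lemma vbgh_iso_inv:
  assumes L: "lifted_vb_groupoid G E C \<Gamma>" and L': "lifted_vb_groupoid G E C \<Gamma>'"
    and f: "vbgh_iso G E C \<Gamma> \<Gamma>' f"
  shows "vbgh_iso G E C \<Gamma>' \<Gamma> (inv_into (mcar (tot \<Gamma>)) f)"
proof -
  interpret L: lifted_vb_groupoid G E C \<Gamma> by fact
  interpret L': lifted_vb_groupoid G E C \<Gamma>' by fact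
  note i = vbgh_isoD[OF f]
  define k where "k = inv_into (mcar (tot \<Gamma>)) f"
  have bij: "bij_betw f (mcar (tot \<Gamma>)) (mcar (tot \<Gamma>'))" using i(1) by (simp add: diffeomorphism_def)
  have k: "k \<gamma> \<in> mcar (tot \<Gamma>)" "f (k \<gamma>) = \<gamma>" if "\<gamma> \<in> mcar (tot \<Gamma>')" for \<gamma>
    using bij_betwE[OF bij_betw_inv_into[OF bij]] bij_betw_inv_into_right[OF bij that] that by (auto simp: k_def)
  have kf: "k (f \<gamma>) = \<gamma>" if "\<gamma> \<in> mcar (tot \<Gamma>)" for \<gamma>
    using bij_betw_inv_into_left[OF bij that] by (simp add: k_def)
  \<comment> \<open>Preservation of fibres passes to the inverse: \<open>f\<close> leaves the base
    arrow of \<open>k \<gamma>\<close> unchanged and sends \<open>k \<gamma>\<close> to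
    \<open>\<gamma>\<close>.\<close>
  have inF: "k \<gamma> \<in> fibre \<Gamma> g" if "\<gamma> \<in> fibre \<Gamma>' g" for g \<gamma>
  proof -
    have c: "k \<gamma> \<in> mcar (tot \<Gamma>)" "f (k \<gamma>) = \<gamma>" using k L'.GB.fibreD(2)[OF that] by auto
    have "f (k \<gamma>) \<in> fibre \<Gamma>' (prj \<Gamma> (k \<gamma>))"
      using fibre_linearD(1)[OF i(2)[OF L.GB.fibreD(1)[OF L.GB.fibreI[OF c(1)]]] L.GB.fibreI[OF c(1)]] .
    then have "prj \<Gamma> (k \<gamma>) = g" using L'.GB.fibreD(3) that c(2) by metis
    then show ?thesis using L.GB.fibreI[OF c(1)] by simp
  qed
  have "vbgh_iso G E C \<Gamma>' \<Gamma> k"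
  proof (rule vbgh_isoI[OF L.G.arr_manifold L.EB.total_manifold])
    show "diffeomorphism (tot \<Gamma>') (tot \<Gamma>) k"
      unfolding k_def by (rule diffeomorphism_inv[OF L.GB.total_manifold i(1)])
    show "fibre_linear \<Gamma>' g \<Gamma> g k" if g: "g \<in> Arr G" for g
      unfolding fibre_linear_def
    proof (intro conjI ballI allI)
      note lin = fibre_linearD[OF i(2)[OF g]]
      fix p assume p: "p \<in> fibre \<Gamma>' g"
      note kp = inF[OF p] and fp = k(2)[OF L'.GB.fibreD(2)[OF p]]
      show "k p \<in> fibre \<Gamma> g" by (rule kp)
      show "k (vscl \<Gamma>' a p) = vscl \<Gamma> a (k p)" for a
        using kf[OF L.GB.fibreD(2)[OF L.GB.vscl_in[OF kp]]] lin(3)[OF kp] fp by simp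
      fix q assume q: "q \<in> fibre \<Gamma>' g"
      note kq = inF[OF q] and fq = k(2)[OF L'.GB.fibreD(2)[OF q]]
      show "k (vadd \<Gamma>' p q) = vadd \<Gamma> (k p) (k q)"
        using kf[OF L.GB.fibreD(2)[OF L.GB.vadd_in[OF kp kq]]] lin(2)[OF kp kq] fp fq by simp
    qed
    show "tsrc \<Gamma> (k \<gamma>) = tsrc \<Gamma>' \<gamma>" "ttgt \<Gamma> (k \<gamma>) = ttgt \<Gamma>' \<gamma>" if "\<gamma> \<in> mcar (tot \<Gamma>')" for \<gamma>
      using i(3,4)[OF k(1)[OF that]] k(2)[OF that] by simp_all
    show "k (tmul \<Gamma>' p q) = tmul \<Gamma> (k p) (k q)" if pq: "(p, q) \<in> composable (total_lgpd E \<Gamma>')" for p q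
    proof -
      have pq': "p \<in> mcar (tot \<Gamma>')" "q \<in> mcar (tot \<Gamma>')" "tsrc \<Gamma>' p = ttgt \<Gamma>' q"
        using pq by (simp_all add: composable_def)
      have c: "(k p, k q) \<in> composable (total_lgpd E \<Gamma>)"
        using pq' k i(3)[OF k(1)[OF pq'(1)]] i(4)[OF k(1)[OF pq'(2)]] by (simp add: composable_def)
      have "tmul \<Gamma> (k p) (k q) \<in> mcar (tot \<Gamma>)" using L.K.mul_in[OF c] by simp
      from kf[OF this] show ?thesis using i(5)[OF c] k(2) pq' by simp
    qed
    show "k (tunt \<Gamma>' e) = tunt \<Gamma> e" if "e \<in> mcar (tot E)" for e
      using kf[of "tunt \<Gamma> e"] i(6)[OF that] L.K.unt_in[of e] that by simp
    show "k (cemb \<Gamma>' c) = cemb \<Gamma> c" if "c \<in> mcar (tot C)" for c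
      using kf[OF L.GB.fibreD(2)[OF L.\<kappa>_in[OF L.CB.fibreI[OF that]]]] i(7)[OF that] by simp
    show "k (hlift \<Gamma>' g e) = hlift \<Gamma> g e" if "g \<in> Arr G" "e \<in> fibre E (src G g)" for g e
      using kf[OF L.GB.fibreD(2)[OF L.h_in[OF that]]] i(8)[OF that] by simp
  qed
  then show ?thesis by (simp add: k_def)
qed

text \<open>An isomorphism sends \<open>L.kz c g\<close> to \<open>L'.kz c g\<close> and the
  products that define the 4-tuple of \<open>\<Gamma>\<close> to those of \<open>\<Gamma>'\<close>.
  Comparison under the injective \<open>L'.kz\<close> avoids handling the inverses of the two core
  embeddings.\<close>

lemma vbgh_iso_to_rep2_eq:
  assumes L: "lifted_vb_groupoid G E C \<Gamma>" and L': "lifted_vb_groupoid G E C \<Gamma>'"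
    and f: "vbgh_iso G E C \<Gamma> \<Gamma>' f"
  shows "to_rep2 G E C \<Gamma> = to_rep2 G E C \<Gamma>'"
proof -
  interpret L: lifted_vb_groupoid G E C \<Gamma> by fact
  interpret L': lifted_vb_groupoid G E C \<Gamma>' by fact
  note i = vbgh_isoD[OF f]
  have kz: "f (L.kz c g) = L'.kz c g" if g: "g \<in> Arr G" and c: "c \<in> fibre C (tgt G g)" for c g
    using i(5)[OF L.comp_K[OF L.\<kappa>_in[OF c] L.z_in[OF g] L.kz_comp[OF g c]]] i(7)[OF L.CB.fibreD(2)[OF c]]
      fibre_linear_vzero[OF L.GB.vector_bundle_axioms L'.GB.vector_bundle_axioms i(2)[OF g] g]
    by (simp add: L.kz_def L'.kz_def)
  have bd: "bd L.R c = bd L'.R c" if c: "c \<in> fibre C x" for c x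
    using L.bd_eq[OF c] L'.bd_eq[OF c] i(4)[OF L.GB.fibreD(2)[OF L.\<kappa>_in[OF c]]] i(7)[OF L.CB.fibreD(2)[OF c]] by simp
  have dE: "dE L.R g e = dE L'.R g e" if g: "g \<in> Arr G" and e: "e \<in> fibre E (src G g)" for g e
    using L.dE_eq[OF g e] L'.dE_eq[OF g e] i(4)[OF L.GB.fibreD(2)[OF L.h_in[OF g e]]] i(8)[OF g e] by simp
  have dC: "dC L.R g c = dC L'.R g c" if g: "g \<in> Arr G" and c: "c \<in> fibre C (src G g)" for g c
  proof (rule L'.kz_inj[OF g L.dC_in[OF g c] L'.dC_in[OF g c]])
    have "L'.kz (dC L.R g c) g = f (tmul \<Gamma> (hlift \<Gamma> g (bd L.R c)) (cemb \<Gamma> c))"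
      using kz[OF g L.dC_in[OF g c]] L.kz_dC[OF g c] by simp
    also have "\<dots> = tmul \<Gamma>' (hlift \<Gamma>' g (bd L'.R c)) (cemb \<Gamma>' c)"
      using i(5)[OF L.comp_K[OF L.h_in[OF g L.bd_in[OF c]] L.\<kappa>_in[OF c] L.h\<kappa>_comp[OF g c]]]
        i(8)[OF g L.bd_in[OF c]] i(7)[OF L.CB.fibreD(2)[OF c]] bd[OF c] by simp
    finally show "L'.kz (dC L.R g c) g = L'.kz (dC L'.R g c) g"
      using L'.kz_dC[OF g c] by simp
  qed
  have Om: "Om L.R g1 g2 e = Om L'.R g1 g2 e"
    if gg: "(g1, g2) \<in> composable G" and e: "e \<in> fibre E (src G g2)" for g1 g2 e
  proof (rule L'.kz_inj[OF L.G.mul_in[OF gg], unfolded L.G.tgt_mul[OF gg], OF L.Om_in[OF gg e] L'.Om_in[OF gg e]])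
    note g = L.G.composableD[OF gg] and g12 = L.G.mul_in[OF gg] and t = L.G.tgt_mul[OF gg]
    have d: "dE L.R g2 e \<in> fibre E (src G g1)" using L.dE_in[OF g(2) e] g(3) by simp
    have e12: "e \<in> fibre E (src G (mul G g1 g2))" using e L.G.src_mul[OF gg] by simp
    have "L'.kz (Om L.R g1 g2 e) (mul G g1 g2) =
        f (vsub \<Gamma> (hlift \<Gamma> (mul G g1 g2) e) (tmul \<Gamma> (hlift \<Gamma> g1 (dE L.R g2 e)) (hlift \<Gamma> g2 e)))"
      using kz[OF g12, unfolded t, OF L.Om_in[OF gg e]] L.kz_Om[OF gg e] by simp
    also have "\<dots> = vsub \<Gamma>' (hlift \<Gamma>' (mul G g1 g2) e) (tmul \<Gamma>' (hlift \<Gamma>' g1 (dE L'.R g2 e)) (hlift \<Gamma>' g2 e))"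
      using fibre_linear_vsub[OF L.GB.vector_bundle_axioms i(2)[OF g12] L.h12_in[OF gg e] L.hh_in[OF gg e]]
        i(5)[OF L.comp_K[OF L.h1_in[OF gg e] L.h2_in[OF gg e] L.hh_comp[OF gg e]]]
        i(8)[OF g(1) d] i(8)[OF g(2) e] i(8)[OF g12 e12] dE[OF g(2) e] by simp
    finally show "L'.kz (Om L.R g1 g2 e) (mul G g1 g2) = L'.kz (Om L'.R g1 g2 e) (mul G g1 g2)"
      using L'.kz_Om[OF gg e] by simp
  qed
  show ?thesis
    by (rule rep_up_to_homotopy.rep2_eqI[OF L'.to_rep2_rep_up_to_homotopy L.to_rep2_rep_up_to_homotopy bd dC dE Om])
qed

section \<open>The decomposition as an isomorphism\<close>

context lifted_vb_groupoid
begin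

sublocale Rep: rep_up_to_homotopy G E C R
  by (rule to_rep2_rep_up_to_homotopy)

text \<open>The inverse \<open>\<iota>\<close> records the core part left after the lift of the
  source is subtracted, the base arrow and the source. It is smooth because \<open>cpart\<close> is,
  and multiplicativity of the decomposition is \<open>dcp_mul\<close>, whose right-hand side
  contains the multiplication of the semidirect product.\<close>

theorem decomposition_iso: "vbgh_iso G E C (semidirect G E C R) \<Gamma> (decomposition \<Gamma>)"
proof (rule vbgh_isoI[OF G.arr_manifold EB.total_manifold])
  let ?S = "semidirect G E C R" and ?D = "decomposition \<Gamma>" and ?SD = "Rep.SD" and ?M = "sub_mfd Rep.CGE Rep.SD"
  note M = Rep.manifold_SD and car = Rep.mcar_semidirect
  note D = decomposition_eq
  define \<iota> where "\<iota> = (\<lambda>\<gamma>. (cpart (prj \<Gamma> \<gamma>) (\<gamma> \<ominus> h (prj \<Gamma> \<gamma>) (tsrc \<Gamma> \<gamma>)), prj \<Gamma> \<gamma>, tsrc \<Gamma> \<gamma>))"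
  have D_in: "?D p \<in> mcar (tot \<Gamma>)" and \<iota>D: "\<iota> (?D p) = p" if pSD: "p \<in> Rep.SD" for p
  proof -
    obtain c g e where p: "p = (c, g, e)" "g \<in> Arr G" "c \<in> fibre C (tgt G g)" "e \<in> fibre E (src G g)"
      using pSD by (cases p) auto
    show "?D p \<in> mcar (tot \<Gamma>)" using GB.fibreD(2)[OF dcp_in[OF p(2-4)]] by (simp add: D p(1))
    show "\<iota> (?D p) = p"
      using GB.fibreD(3)[OF dcp_in[OF p(2-4)]] tsrc_dcp[OF p(2-4)] cpart_dcp[OF p(2-4)] by (simp add: D p(1) \<iota>_def)
  qed
  have \<iota>_in: "\<iota> \<gamma> \<in> Rep.SD" and D\<iota>: "?D (\<iota> \<gamma>) = \<gamma>" if "\<gamma> \<in> mcar (tot \<Gamma>)" for \<gamma>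
  proof -
    note \<gamma> = GB.fibreI[OF that]
    show "\<iota> \<gamma> \<in> Rep.SD" using arr_of[OF \<gamma>] cpart_diff_in[OF \<gamma>] tsrc_in[OF \<gamma>] by (simp add: \<iota>_def)
    show "?D (\<iota> \<gamma>) = \<gamma>" using dcp_cpart[OF \<gamma>] by (simp add: D \<iota>_def)
  qed
  have bij: "bij_betw ?D (mcar (tot ?S)) (mcar (tot \<Gamma>))"
    unfolding car by (rule bij_betw_byWitness[where f' = \<iota>]) (use D_in \<iota>D \<iota>_in D\<iota> in auto)
  have smD: "smooth_map_on ?M (tot \<Gamma>) Rep.SD ?D"
  proof (rule smooth_map_on_cong[OF _ _ manifold_charted[OF M]])
    note c = Rep.SD_coord1[OF order_refl] and g = Rep.SD_coord2[OF order_refl] and e = Rep.SD_coord3[OF order_refl]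
    have k: "smooth_map_on ?M (tot \<Gamma>) Rep.SD (\<lambda>p. kz (fst p) (fst (snd p)))"
      by (rule smooth_kz[OF M g c]) auto
    have h: "smooth_map_on ?M (tot \<Gamma>) Rep.SD (\<lambda>p. h (fst (snd p)) (snd (snd p)))"
      by (rule smooth_h[OF M g e]) auto
    show "smooth_map_on ?M (tot \<Gamma>) Rep.SD (\<lambda>p. kz (fst p) (fst (snd p)) \<oplus> h (fst (snd p)) (snd (snd p)))"
      by (rule GB.smooth_vadd[OF M k h]) (use GB.fibreD(3)[OF kz_in] GB.fibreD(3)[OF h_in] in auto)
    show "kz (fst p) (fst (snd p)) \<oplus> h (fst (snd p)) (snd (snd p)) = ?D p" for p
      by (cases p) (simp add: D dcp_def)
  qed
  have sm\<iota>: "smooth_map (tot \<Gamma>) ?M \<iota>"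
    unfolding \<iota>_def
  proof (rule Rep.smooth_into_SD[OF GB.total_manifold _ GB.prj_smooth smooth_tsrc])
    note id = manifold.smooth_ident[OF GB.total_manifold order_refl]
    have h: "smooth_map (tot \<Gamma>) (tot \<Gamma>) (\<lambda>\<gamma>. h (prj \<Gamma> \<gamma>) (tsrc \<Gamma> \<gamma>))"
      by (rule smooth_h[OF GB.total_manifold GB.prj_smooth smooth_tsrc tsrc_in[OF GB.fibreI]])
    have "smooth_map (tot \<Gamma>) (tot \<Gamma>) (\<lambda>\<gamma>. \<gamma> \<ominus> h (prj \<Gamma> \<gamma>) (tsrc \<Gamma> \<gamma>))"
      by (rule GB.smooth_vsub[OF GB.total_manifold id h])
        (rule GB.fibreD(3)[OF h_in[OF arr_of[OF GB.fibreI] tsrc_in[OF GB.fibreI]]])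
    then show "smooth_map (tot \<Gamma>) (tot C) (\<lambda>\<gamma>. cpart (prj \<Gamma> \<gamma>) (\<gamma> \<ominus> h (prj \<Gamma> \<gamma>) (tsrc \<Gamma> \<gamma>)))"
      by (rule smooth_cpart[OF GB.total_manifold GB.prj_smooth _ diff_in[OF GB.fibreI] tsrc_diff[OF GB.fibreI]])
  qed (rule cpart_diff_in[OF GB.fibreI] tsrc_in[OF GB.fibreI]; assumption)+
  have "\<iota> \<gamma> = inv_into (mcar (tot ?S)) ?D \<gamma>" if "\<gamma> \<in> mcar (tot \<Gamma>)" for \<gamma>
    by (rule inv_into_f_eq[OF bij_betw_imp_inj_on[OF bij] _ D\<iota>[OF that], symmetric]) (use \<iota>_in[OF that] car in blast)
  from smooth_map_on_cong[OF this sm\<iota> manifold_charted[OF GB.total_manifold]]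
  show "diffeomorphism (tot ?S) (tot \<Gamma>) ?D"
    using bij smD unfolding diffeomorphism_def Rep.semidirect_simps(1) Rep.mcar_SD by simp
  show "fibre_linear ?S g \<Gamma> g ?D" if g: "g \<in> Arr G" for g
    unfolding fibre_linear_def
  proof (intro conjI ballI allI)
    fix p assume "p \<in> fibre ?S g"
    then obtain c e where p: "p = (c, g, e)" "c \<in> fibre C (tgt G g)" "e \<in> fibre E (src G g)"
      by (rule Rep.fibre_semidirectE)
    note k = kz_in[OF g p(2)] and hh = h_in[OF g p(3)]
    show "?D p \<in> fibre \<Gamma> g" using dcp_in[OF g p(2,3)] by (simp add: p(1) D)
    show "?D (vscl ?S a p) = vscl \<Gamma> a (?D p)" for a
      using GB.scale_add_right[OF g k hh] by (simp add: p(1) D dcp_def kz_scl[OF g p(2)] h_scl[OF g p(3)])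
    fix q assume "q \<in> fibre ?S g"
    then obtain c' e' where q: "q = (c', g, e')" "c' \<in> fibre C (tgt G g)" "e' \<in> fibre E (src G g)"
      by (rule Rep.fibre_semidirectE)
    note k' = kz_in[OF g q(2)] and hh' = h_in[OF g q(3)]
    have "(kz c g \<oplus> kz c' g) \<oplus> (h g e \<oplus> h g e') = (kz c g \<oplus> h g e) \<oplus> (kz c' g \<oplus> h g e')"
      by (rule GB.crd_inj[of _ g]) (simp_all add: k k' hh hh' GB.vadd_in)
    then show "?D (vadd ?S p q) = ?D p \<oplus> ?D q"
      by (simp add: p(1) q(1) D dcp_def kz_add[OF g p(2) q(2)] h_add[OF g p(3) q(3)])
  qed
  show "tsrc \<Gamma> (?D p) = tsrc ?S p" "ttgt \<Gamma> (?D p) = ttgt ?S p" if pS: "p \<in> mcar (tot ?S)" for p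
  proof -
    obtain c g e where p: "p = (c, g, e)" "g \<in> Arr G" "c \<in> fibre C (tgt G g)" "e \<in> fibre E (src G g)"
      using pS unfolding car by (cases p) auto
    show "tsrc \<Gamma> (?D p) = tsrc ?S p" "ttgt \<Gamma> (?D p) = ttgt ?S p"
      using tsrc_dcp[OF p(2-4)] ttgt_dcp[OF p(2-4)] by (simp_all add: p(1) D)
  qed
  show "?D (tmul ?S p q) = ?D p \<cdot> ?D q" if pq: "(p, q) \<in> composable (total_lgpd E ?S)" for p q
    using pq
  proof (rule Rep.comp_SDE)
    fix c1 g1 e1 c2 g2 e2
    assume p: "p = (c1, g1, e1)" "q = (c2, g2, e2)" and gg: "(g1, g2) \<in> composable G"
      and c: "c1 \<in> fibre C (tgt G g1)" "c2 \<in> fibre C (tgt G g2)"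
      and e: "e2 \<in> fibre E (src G g2)" "e1 = vadd E (bd R c2) (dE R g2 e2)"
    show ?thesis using dcp_mul[OF gg c e] by (simp only: p D Rep.semidirect_simps)
  qed
  show "?D (tunt ?S e) = tunt \<Gamma> e" if "e \<in> mcar (tot E)" for e
  proof -
    note e = EB.fibreI[OF that]
    note x = EB.fibreD(1)[OF e]
    have u: "unt G (prj E e) \<in> Arr G" "tgt G (unt G (prj E e)) = prj E e" "src G (unt G (prj E e)) = prj E e"
      using x by (simp_all add: G.unt_in G.tgt_unt G.src_unt)
    show ?thesis
      using kz_vzero[OF u(1)] h_unt[OF e] GB.vadd_vzero_left[OF h_in[OF u(1)], of e] e u by (simp add: D dcp_def)
  qed
  show "?D (cemb ?S c) = \<kappa> c" if "c \<in> mcar (tot C)" for c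
  proof -
    note c = CB.fibreI[OF that]
    note x = CB.fibreD(1)[OF c]
    have u: "unt G (prj C c) \<in> Arr G" "tgt G (unt G (prj C c)) = prj C c" "src G (unt G (prj C c)) = prj C c"
      using x by (simp_all add: G.unt_in G.tgt_unt G.src_unt)
    have "kz c (unt G (prj C c)) = \<kappa> c"
      using kmul_z_right[OF \<kappa>_in[OF c]] tsrc_\<kappa>[OF c] u by (simp add: kz_def)
    moreover have "h (unt G (prj C c)) (vzero E (prj C c)) = z (unt G (prj C c))"
      using h_vzero[OF u(1)] x u by simp
    ultimately show ?thesis
      using GB.vadd_vzero_right[OF \<kappa>_in[OF c]] by (simp add: D dcp_def)
  qed
  show "?D (hlift ?S g e) = h g e" if "g \<in> Arr G" "e \<in> fibre E (src G g)" for g e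
    using kz_vzero[OF that(1)] GB.vadd_vzero_left[OF h_in[OF that]] by (simp add: D dcp_def)
qed

end

section \<open>Isomorphism classes\<close>

lemma vbgh_iso_iff_to_rep2_eq:
  assumes hl: "vb_groupoid_hl G E C \<Gamma>" and hl': "vb_groupoid_hl G E C \<Gamma>'"
  shows "(\<exists>f. vbgh_iso G E C \<Gamma> \<Gamma>' f) \<longleftrightarrow> to_rep2 G E C \<Gamma> = to_rep2 G E C \<Gamma>'"
proof
  note L = lifted_vb_groupoid.intro[OF hl] and L' = lifted_vb_groupoid.intro[OF hl']
  interpret L: lifted_vb_groupoid G E C \<Gamma> by (rule L)
  interpret L': lifted_vb_groupoid G E C \<Gamma>' by (rule L')
  show "to_rep2 G E C \<Gamma> = to_rep2 G E C \<Gamma>'" if "\<exists>f. vbgh_iso G E C \<Gamma> \<Gamma>' f"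
    using that vbgh_iso_to_rep2_eq[OF L L'] by blast
  assume eq: "to_rep2 G E C \<Gamma> = to_rep2 G E C \<Gamma>'"
  let ?S = "semidirect G E C L.R"
  have LS: "lifted_vb_groupoid G E C ?S"
    by (rule lifted_vb_groupoid.intro[OF L.Rep.semidirect_vb_groupoid_hl])
  \<comment> \<open>Equal 4-tuples have the same semidirect product, and both
    \<open>\<Gamma>\<close> and \<open>\<Gamma>'\<close> are isomorphic to it by their
    decompositions. The carrier types of the two may differ.\<close>
  have "vbgh_iso G E C \<Gamma> ?S (inv_into (mcar (tot ?S)) (decomposition \<Gamma>))"
    by (rule vbgh_iso_inv[OF LS L L.decomposition_iso])
  from vbgh_iso_compose[OF L LS L' this L'.decomposition_iso[folded eq]]
  show "\<exists>f. vbgh_iso G E C \<Gamma> \<Gamma>' f" by blast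
qed

text \<open>The invariant \<open>F\<close> is complete and \<open>s\<close> is a section of it. A
  class of \<open>r\<close> is the full preimage of one value of \<open>F\<close>, so
  \<open>the_elem\<close> is applied to a singleton.\<close>

lemma quotient_by_invariant:
  assumes F: "\<And>x. x \<in> A \<Longrightarrow> F x \<in> B" and s: "\<And>b. b \<in> B \<Longrightarrow> s b \<in> A" "\<And>b. b \<in> B \<Longrightarrow> F (s b) = b"
    and r: "r = {(x, y). x \<in> A \<and> y \<in> A \<and> F x = F y}"
  shows "equiv A r" "bij_betw (\<lambda>X. the_elem (F ` X)) (A // r) B" "bij_betw (\<lambda>b. r `` {s b}) B (A // r)"
proof -
  show "equiv A r"
    by (rule equivI) (auto simp: r refl_on_def sym_def trans_def)
  have cls: "r `` {x} = {y \<in> A. F y = F x}" if "x \<in> A" for x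
    using that by (auto simp: r)
  have q: "X \<in> A // r \<longleftrightarrow> (\<exists>b\<in>B. X = {y \<in> A. F y = b})" for X
  proof
    assume "X \<in> A // r"
    then show "\<exists>b\<in>B. X = {y \<in> A. F y = b}" by (rule quotientE) (use cls F in blast)
  next
    assume "\<exists>b\<in>B. X = {y \<in> A. F y = b}"
    then obtain b where b: "b \<in> B" "X = {y \<in> A. F y = b}" by blast
    then have "X = r `` {s b}" using cls[OF s(1)] s(2) by simp
    then show "X \<in> A // r" using s(1)[OF b(1)] by (simp add: quotientI)
  qed
  have the: "the_elem (F ` {y \<in> A. F y = b}) = b" if "b \<in> B" for b
  proof -
    have "F ` {y \<in> A. F y = b} = {b}" using s[OF that] by force
    then show ?thesis by simp
  qed
  have cls': "r `` {s b} = {y \<in> A. F y = b}" if "b \<in> B" for b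
    using cls[OF s(1)[OF that]] s(2)[OF that] by simp
  have the_cls: "the_elem (F ` (r `` {s b})) = b" "r `` {s b} \<in> A // r" if "b \<in> B" for b
    using cls'[OF that] the[OF that] quotientI[OF s(1)[OF that], of r] by simp_all
  have cls_the: "the_elem (F ` X) \<in> B" "r `` {s (the_elem (F ` X))} = X" if X: "X \<in> A // r" for X
  proof -
    obtain b where b: "b \<in> B" "X = {y \<in> A. F y = b}"
      using X q by blast
    show "the_elem (F ` X) \<in> B" "r `` {s (the_elem (F ` X))} = X"
      unfolding b(2) the[OF b(1)] by (rule b(1) cls'[OF b(1)])+
  qed
  show "bij_betw (\<lambda>X. the_elem (F ` X)) (A // r) B"
    by (rule bij_betw_byWitness[where f' = "\<lambda>b. r `` {s b}"]) (use the_cls cls_the in blast)+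
  show "bij_betw (\<lambda>b. r `` {s b}) B (A // r)"
    by (rule bij_betw_byWitness[where f' = "\<lambda>X. the_elem (F ` X)"]) (use the_cls cls_the in blast)+
qed

text \<open>A quotient needs all its objects on one carrier type, and the last clause uses that of
  the semidirect product. The preceding clauses range over other carrier types and show that each
  isomorphism class is represented on this one, by the semidirect product of its 4-tuple.\<close>

theorem theorem6p1:
  fixes G :: "('g, 'gv::euclidean_space, 'm, 'mv::euclidean_space) lgpd"
    and E :: "('e, 'ev::euclidean_space, 'm) vb"
    and C :: "('c, 'cv::euclidean_space, 'm) vb"
  assumes "lie_groupoid G" and "vector_bundle (obj G) E" and "vector_bundle (obj G) C"
  shows
    "(\<forall>\<Gamma> :: ('k, 'kv::euclidean_space, 'g, 'e, 'c) vbgh.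
        vb_groupoid_hl G E C \<Gamma> \<longrightarrow> rep_up_to_homotopy G E C (to_rep2 G E C \<Gamma>)) \<and>
     (\<forall>(\<Gamma> :: ('k, 'kv, 'g, 'e, 'c) vbgh) (\<Gamma>' :: ('l, 'lv::euclidean_space, 'g, 'e, 'c) vbgh).
        vb_groupoid_hl G E C \<Gamma> \<and> vb_groupoid_hl G E C \<Gamma>' \<longrightarrow>
        (\<exists>f. vbgh_iso G E C \<Gamma> \<Gamma>' f) \<longleftrightarrow> to_rep2 G E C \<Gamma> = to_rep2 G E C \<Gamma>') \<and>
     (\<forall>R. rep_up_to_homotopy G E C R \<longrightarrow>
        vb_groupoid_hl G E C (semidirect G E C R) \<and> to_rep2 G E C (semidirect G E C R) = R) \<and>
     (\<forall>\<Gamma> :: ('k, 'kv, 'g, 'e, 'c) vbgh. vb_groupoid_hl G E C \<Gamma> \<longrightarrow>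
        vbgh_iso G E C (semidirect G E C (to_rep2 G E C \<Gamma>)) \<Gamma> (decomposition \<Gamma>)) \<and>
     (let VB = (VBGH G E C :: ('c \<times> 'g \<times> 'e, 'cv \<times> 'gv \<times> 'ev, 'g, 'e, 'c) vbgh set);
          iso = vbgh_iso_rel G E C
      in equiv VB iso \<and>
         bij_betw (\<lambda>X. the_elem (to_rep2 G E C ` X)) (VB // iso) (RUTH G E C) \<and>
         bij_betw (\<lambda>R. iso `` {semidirect G E C R}) (RUTH G E C) (VB // iso))"
proof -
  let ?VB = "VBGH G E C :: ('c \<times> 'g \<times> 'e, 'cv \<times> 'gv \<times> 'ev, 'g, 'e, 'c) vbgh set"
  note rep = lifted_vb_groupoid.to_rep2_rep_up_to_homotopy[OF lifted_vb_groupoid.intro]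
  note dec = lifted_vb_groupoid.decomposition_iso[OF lifted_vb_groupoid.intro]
  note sd = rep_up_to_homotopy.semidirect_vb_groupoid_hl rep_up_to_homotopy.to_rep2_semidirect
  \<comment> \<open>On the common carrier type, being isomorphic is the kernel of
    \<open>to_rep2\<close>, so reflexivity, symmetry and transitivity are inherited from equality of
    4-tuples.\<close>
  have r: "vbgh_iso_rel G E C = {(x, y). x \<in> ?VB \<and> y \<in> ?VB \<and> to_rep2 G E C x = to_rep2 G E C y}"
    using vbgh_iso_iff_to_rep2_eq by (fastforce simp: vbgh_iso_rel_def VBGH_def)
  have F: "to_rep2 G E C x \<in> RUTH G E C" if "x \<in> ?VB" for x
    using that rep by (simp add: VBGH_def RUTH_def)
  have s: "semidirect G E C R \<in> ?VB" "to_rep2 G E C (semidirect G E C R) = R" if "R \<in> RUTH G E C" for R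
    using that sd by (simp_all add: VBGH_def RUTH_def)
  have q: "equiv ?VB (vbgh_iso_rel G E C)"
    "bij_betw (\<lambda>X. the_elem (to_rep2 G E C ` X)) (?VB // vbgh_iso_rel G E C) (RUTH G E C)"
    "bij_betw (\<lambda>R. vbgh_iso_rel G E C `` {semidirect G E C R}) (RUTH G E C) (?VB // vbgh_iso_rel G E C)"
    by (rule quotient_by_invariant[OF F s r]; assumption)+
  show ?thesis
    unfolding Let_def
  proof (intro conjI allI impI)
    fix \<Gamma> :: "('k, 'kv, 'g, 'e, 'c) vbgh" and \<Gamma>' :: "('l, 'lv, 'g, 'e, 'c) vbgh"
    assume "vb_groupoid_hl G E C \<Gamma> \<and> vb_groupoid_hl G E C \<Gamma>'"
    then show "(\<exists>f. vbgh_iso G E C \<Gamma> \<Gamma>' f) \<longleftrightarrow> to_rep2 G E C \<Gamma> = to_rep2 G E C \<Gamma>'"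
      by (intro vbgh_iso_iff_to_rep2_eq) auto
  qed (fact q | erule rep dec sd)+
qed

end
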